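(* Let $M$ be a connected compact complex manifold of complex dimension $n$ with a Hermitian holomorphic line bundle $(L,h)$ whose Chern curvature $\Theta$ is such that $\omega=\frac{i}{2\pi}\Theta$ is a positive form, let $g(u,v)=\omega(u,Jv)$, and let $\Delta$ be the positive Laplacian of $g$ acting on complex-valued functions. Let $m>0$ be such that the Kodaira map of $L^m$ is an embedding, and let $T_m$, $T_m^*$, $\Delta_m$, $V_m$ be as defined in the context. If $\omega$ is $m$-balanced, then $$\Delta_m(A)=C\;T_m\circ\Delta\circ T_m^*(A)\qquad\text{for all }A\in V_m,$$ where $$C=\frac{m^{n-1}\left(\int_M\frac{\omega^n}{n!}\right)^2}{\left(\dim H^0(M,L^m)\right)^2}.$$
   Context: $C^\infty(M)$ denotes complex-valued smooth functions. $J$ is the complex structure of $M$. The positive Laplacian of a Riemannian metric is $d^*d$ (nonnegative Laplace-Beltrami operator), extended complex-linearly. Hermitian products are linear in the first slot. Let $H_m=H^0(M,L^m)$ with Hermitian product $b_m(s,t)=\int_M h^m(s,t)\frac{\omega^n}{n!}$, where $h^m$ is the metric induced by $h$ on $L^m$. Let $V_m=\mathrm{End}(H_m)$ with Hermitian product $\langle A,B\rangle=\mathrm{tr}(AB^* )$, $B^*$ being the $b_m$-adjoint of $B$. Let $\rho_m=\sum_\alpha|s_\alpha|^2_{h^m}$ for any $b_m$-orthonormal basis $\{s_\alpha\}$ of $H_m$. The form $\omega$ (or its metric) is called $m$-balanced if $\rho_m$ is constant on $M$. $T_m:C^\infty(M)\to V_m$ is defined by $T_m(f)s=P(fs)$,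 where $P:\Gamma(M,L^m)\to H_m$ is the orthogonal projection from smooth sections with respect to the $L^2$ product $\int_M h^m(s,t)\frac{\omega^n}{n!}$. $T_m^*:V_m\to C^\infty(M)$ is the adjoint of $T_m$ with respect to $\int_M f\bar g\,\frac{\omega^n}{n!}$ on $C^\infty(M)$ and $\mathrm{tr}(AB^* )$ on $V_m$. $\iota_m:M\to\mathbf P(H_m)$ (the space of lines in $H_m$) is the Kodaira map $M\to\mathbf P(H_m^* )$, $x\mapsto[s\mapsto s(x)]$, followed by the (conjugate-linear) identification $\mathbf P(H_m^* )\simeq\mathbf P(H_m)$ given by $b_m$; for a $b_m$-orthonormal basis $\{s_\alpha\}$ it is $x\mapsto[\sum_\alpha\overline{s_\alpha(x)}\,s_\alpha]$. The Fubini-Study form on $\mathbf P(H_m)$ is $\omega_{FS}=\frac{i}{2\pi}\partial\bar\partial\log|z|^2$, with $|\cdot|$ the norm of $b_m$, with Riemannian metric $g_{FS}(u,v)=\omega_{FS}(u,Jv)$. Put $g_m=\iota_m^*g_{FS}$, a Kähler metric on $M$ with Kähler form $\omega_m=m\omega+\frac{i}{2\pi}\partial\bar\partial\log\rho_m$. For $A\in V_m$ with $A=A^*$ let $\nu(A)$ be the real vector field on $\mathbf P(H_m)$ with flow $z\mapsto e^{2\pi tA}z$; extend $\nu$ complex-linearly to all $A\in V_m$, with values in complexified vector fields. Let $e_m(A)\in\Gamma(TM\otimes\mathbf C)$ be the $g_{FS}$-orthogonal projection (complex-linearly extended) to $TM\otimes\mathbf C$ of the restriction of $\nu(A)$ to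 $M$ as a section of $\iota_m^*T\mathbf P(H_m)\otimes\mathbf C$. Give $\Gamma(TM\otimes\mathbf C)$ the Hermitian product $(\eta,\xi)_m=\int_M g_m(\eta,\xi)\frac{\omega_m^n}{n!}$, where $g_m$ is extended to be complex-linear in the first and conjugate-linear in the second argument. Then $\Delta_m=e_m^*\circ e_m:V_m\to V_m$, i.e. $\Delta_m$ is determined by $\mathrm{tr}(\Delta_m(A)B^* )=(e_m(A),e_m(B))_m$ for all $A,B\in V_m$. *)

theory Defs
  imports "HOL-Analysis.Analysis" "HOL-Library.Function_Algebras"
begin

section \<open>Calculus on open subsets of \<open>\<complex>\<^sup>n\<close>\<close>

fun Ck_on :: "nat \<Rightarrow> 'v::real_normed_vector set \<Rightarrow> ('v \<Rightarrow> 'w::real_normed_vector) \<Rightarrow> bool" where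
  "Ck_on 0 S f \<longleftrightarrow> continuous_on S f"
| "Ck_on (Suc k) S f \<longleftrightarrow>
     (\<forall>x\<in>S. f differentiable (at x)) \<and> (\<forall>v. Ck_on k S (\<lambda>x. frechet_derivative f (at x) v))"

definition smooth_on :: "'v::real_normed_vector set \<Rightarrow> ('v \<Rightarrow> 'w::real_normed_vector) \<Rightarrow> bool" where
  "smooth_on S f \<longleftrightarrow> (\<forall>k. Ck_on k S f)"

definition hol_on :: "(complex^'n) set \<Rightarrow> (complex^'n \<Rightarrow> complex) \<Rightarrow> bool" where
  "hol_on S f \<longleftrightarrow>
     (\<forall>x\<in>S. \<exists>D. (f has_derivative D) (at x) \<and> (\<forall>c v. D (c *s v) = c * D v))"

text \<open>The derivatives \<open>\<partial>f/\<partial>w\<close> and \<open>\<partial>f/\<partial>\<close>(conjugate of \<open>w\<close>) at the origin of \<open>\<complex>\<close>.\<close>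

definition dw :: "(complex \<Rightarrow> complex) \<Rightarrow> complex" where
  "dw f = (vector_derivative (\<lambda>t::real. f (of_real t)) (at 0)
           - \<i> * vector_derivative (\<lambda>t::real. f (\<i> * of_real t)) (at 0)) / 2"

definition dwbar :: "(complex \<Rightarrow> complex) \<Rightarrow> complex" where
  "dwbar f = (vector_derivative (\<lambda>t::real. f (of_real t)) (at 0)
           + \<i> * vector_derivative (\<lambda>t::real. f (\<i> * of_real t)) (at 0)) / 2"


section \<open>Complex manifolds\<close>

text \<open>A chart is a pair (domain, coordinate map); the values of the coordinate map outside the
  domain play no role. The manifold is the whole type \<open>'a\<close>, its dimension is \<open>CARD('n)\<close>.\<close>

type_synonym ('a, 'n) chart = "'a set \<times> ('a \<Rightarrow> complex^'n)"

definition cinv :: "('a, 'n) chart \<Rightarrow> complex^'n \<Rightarrow> 'a" where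
  "cinv c = inv_into (fst c) (snd c)"

definition complex_manifold :: "('a::t2_space, 'n::finite) chart set \<Rightarrow> bool" where
  "complex_manifold \<A> \<longleftrightarrow>
     (\<Union>c\<in>\<A>. fst c) = UNIV \<and>
     (\<forall>c\<in>\<A>. open (fst c) \<and> open (snd c ` fst c) \<and>
        homeomorphism (fst c) (snd c ` fst c) (snd c) (cinv c)) \<and>
     (\<forall>c\<in>\<A>. \<forall>d\<in>\<A>. \<forall>k. hol_on (snd c ` (fst c \<inter> fst d)) (\<lambda>z. snd d (cinv c z) $ k))"

definition smooth_fun_on ::
    "('a, 'n::finite) chart set \<Rightarrow> 'a set \<Rightarrow> ('a \<Rightarrow> 'w::real_normed_vector) \<Rightarrow> bool" where
  "smooth_fun_on \<A> S f \<longleftrightarrow> (\<forall>c\<in>\<A>. smooth_on (snd c ` (fst c \<inter> S)) (f \<circ> cinv c))"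

definition hol_fun_on ::
    "('a, 'n::finite) chart set \<Rightarrow> 'a set \<Rightarrow> ('a \<Rightarrow> complex) \<Rightarrow> bool" where
  "hol_fun_on \<A> S f \<longleftrightarrow> (\<forall>c\<in>\<A>. hol_on (snd c ` (fst c \<inter> S)) (f \<circ> cinv c))"

text \<open>The tangent space at \<open>x\<close> is \<open>complex^'n\<close>, identified through a preferred chart around \<open>x\<close>;
  the complex structure \<open>J\<close> is multiplication by \<open>\<i>\<close>. Accordingly vector fields are functions
  \<open>'a \<Rightarrow> complex^'n\<close>, and a tensor field assigns to each point a multilinear map of tangent vectors.
  An element \<open>u + \<surd>-1 w\<close> of the complexified tangent space is the pair \<open>(u, w)\<close> of real tangent
  vectors; the scalar \<open>\<surd>-1\<close> is not \<open>J\<close>.\<close>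

definition chart_at :: "('a, 'n::finite) chart set \<Rightarrow> 'a \<Rightarrow> ('a, 'n) chart" where
  "chart_at \<A> x = (SOME c. c \<in> \<A> \<and> x \<in> fst c)"

definition J :: "complex^'n \<Rightarrow> complex^'n" where
  "J v = \<i> *s v"

definition mderiv ::
    "('a, 'n::finite) chart set \<Rightarrow> ('a \<Rightarrow> 'w::real_normed_vector) \<Rightarrow> 'a \<Rightarrow> complex^'n \<Rightarrow> 'w" where
  "mderiv \<A> f x v =
     frechet_derivative (f \<circ> cinv (chart_at \<A> x)) (at (snd (chart_at \<A> x) x)) v"

text \<open>The tangent vector at \<open>x\<close> whose components in the chart \<open>c\<close> are \<open>v\<close>.\<close>

definition tangent ::
    "('a, 'n::finite) chart set \<Rightarrow> ('a, 'n) chart \<Rightarrow> 'a \<Rightarrow> complex^'n \<Rightarrow> complex^'n" where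
  "tangent \<A> c x v = frechet_derivative (snd (chart_at \<A> x) \<circ> cinv c) (at (snd c x)) v"


section \<open>Integration and the Laplacian\<close>

text \<open>The real basis \<open>\<partial>/\<partial>x\<^sub>k\<close> (index \<open>(k, False)\<close>), \<open>\<partial>/\<partial>y\<^sub>k\<close> (index \<open>(k, True)\<close>) of \<open>\<complex>\<^sup>n\<close>. The
  orientation is that of \<open>x\<^sub>1, y\<^sub>1, \<dots>, x\<^sub>n, y\<^sub>n\<close>.\<close>

definition rbasis :: "'n \<times> bool \<Rightarrow> complex^'n" where
  "rbasis = (\<lambda>(k, y). axis k (if y then \<i> else 1))"

text \<open>The Borel measure on the manifold given in each chart \<open>c\<close> by the density \<open>\<delta> c\<close> with respect
  to Lebesgue measure of the coordinates.\<close>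

definition manifold_measure ::
    "('a::t2_space, 'n::finite) chart set \<Rightarrow> (('a, 'n) chart \<Rightarrow> 'a \<Rightarrow> real) \<Rightarrow> 'a measure" where
  "manifold_measure \<A> \<delta> = (THE \<mu>. sets \<mu> = sets borel \<and>
     (\<forall>c\<in>\<A>. \<forall>B\<in>sets borel. B \<subseteq> fst c \<longrightarrow>
        emeasure \<mu> B = (\<integral>\<^sup>+z\<in>snd c ` B. ennreal (\<delta> c (cinv c z)) \<partial>lborel)))"

text \<open>The coefficient of \<open>\<omega>\<^sup>n/n!\<close> in the chart \<open>c\<close>, i.e. its value on
  \<open>(\<partial>/\<partial>x\<^sub>1, \<partial>/\<partial>y\<^sub>1, \<dots>, \<partial>/\<partial>x\<^sub>n, \<partial>/\<partial>y\<^sub>n)\<close>, with the wedge product normalised so that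
  \<open>(\<alpha> \<and> \<beta>)(u, v) = \<alpha>(u) \<beta>(v) - \<alpha>(v) \<beta>(u)\<close> for 1-forms. Since 2-forms commute, the order chosen on
  the index type \<open>'n\<close> is immaterial.\<close>

definition top_power ::
    "('a, 'n::finite) chart set \<Rightarrow> ('a \<Rightarrow> complex^'n \<Rightarrow> complex^'n \<Rightarrow> real)
       \<Rightarrow> ('a, 'n) chart \<Rightarrow> 'a \<Rightarrow> real" where
  "top_power \<A> \<omega> c x =
     (\<Sum>p | p permutes (UNIV :: ('n \<times> bool) set). of_int (sign p) *
        (\<Prod>k\<in>UNIV. \<omega> x (tangent \<A> c x (rbasis (p (k, False))))
                         (tangent \<A> c x (rbasis (p (k, True)))))) / (2 ^ CARD('n) * fact CARD('n))"

definition form_measure ::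
    "('a::t2_space, 'n::finite) chart set \<Rightarrow> ('a \<Rightarrow> complex^'n \<Rightarrow> complex^'n \<Rightarrow> real) \<Rightarrow> 'a measure" where
  "form_measure \<A> \<omega> = manifold_measure \<A> (top_power \<A> \<omega>)"

definition riemannian_measure ::
    "('a::t2_space, 'n::finite) chart set \<Rightarrow> ('a \<Rightarrow> complex^'n \<Rightarrow> complex^'n \<Rightarrow> real) \<Rightarrow> 'a measure" where
  "riemannian_measure \<A> g = manifold_measure \<A>
     (\<lambda>c x. sqrt (det (\<chi> i j. g x (tangent \<A> c x (rbasis i)) (tangent \<A> c x (rbasis j)))))"

text \<open>The Hermitian extension of the dual metric to complex-valued covectors.\<close>

definition cotangent_inner ::
    "('a \<Rightarrow> complex^'n::finite \<Rightarrow> complex^'n \<Rightarrow> real) \<Rightarrow> 'a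
       \<Rightarrow> (complex^'n \<Rightarrow> complex) \<Rightarrow> (complex^'n \<Rightarrow> complex) \<Rightarrow> complex" where
  "cotangent_inner g x \<alpha> \<beta> =
     (\<Sum>i\<in>UNIV. \<Sum>j\<in>UNIV.
        of_real (matrix_inv (\<chi> i j. g x (rbasis i) (rbasis j)) $ i $ j)
        * \<alpha> (rbasis i) * cnj (\<beta> (rbasis j)))"

text \<open>\<open>d\<^sup>*\<close> is the formal adjoint of \<open>d\<close>.\<close>

definition codiff ::
    "('a::t2_space, 'n::finite) chart set \<Rightarrow> ('a \<Rightarrow> complex^'n \<Rightarrow> complex^'n \<Rightarrow> real)
       \<Rightarrow> ('a \<Rightarrow> complex^'n \<Rightarrow> complex) \<Rightarrow> 'a \<Rightarrow> complex" where
  "codiff \<A> g \<alpha> = (THE u. smooth_fun_on \<A> UNIV u \<and>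
     (\<forall>\<phi>. smooth_fun_on \<A> UNIV \<phi> \<longrightarrow>
        (LINT x|riemannian_measure \<A> g. u x * cnj (\<phi> x)) =
        (LINT x|riemannian_measure \<A> g. cotangent_inner g x (\<alpha> x) (mderiv \<A> \<phi> x))))"

definition laplacian ::
    "('a::t2_space, 'n::finite) chart set \<Rightarrow> ('a \<Rightarrow> complex^'n \<Rightarrow> complex^'n \<Rightarrow> real)
       \<Rightarrow> ('a \<Rightarrow> complex) \<Rightarrow> 'a \<Rightarrow> complex" where
  "laplacian \<A> g f = codiff \<A> g (mderiv \<A> f)"


section \<open>Hermitian holomorphic line bundles\<close>

text \<open>A line bundle is presented by a trivialising open cover with holomorphic frames \<open>e\<^sub>i\<close> on
  \<open>patch i\<close> and transition functions \<open>e\<^sub>j = trans i j \<cdot> e\<^sub>i\<close>; \<open>hmet i = h(e\<^sub>i, e\<^sub>i)\<close>. A section is the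
  family \<open>s\<close> of its components, \<open>s i\<close> being the component with respect to \<open>e\<^sub>i\<close>, set to \<open>0\<close> outside
  \<open>patch i\<close>.\<close>

record ('i, 'a) herm_bundle =
  patch :: "'i \<Rightarrow> 'a set"
  trans :: "'i \<Rightarrow> 'i \<Rightarrow> 'a \<Rightarrow> complex"
  hmet :: "'i \<Rightarrow> 'a \<Rightarrow> real"

type_synonym ('i, 'a) sect = "'i \<Rightarrow> 'a \<Rightarrow> complex"

definition hermitian_line_bundle ::
    "('a::t2_space, 'n::finite) chart set \<Rightarrow> ('i, 'a) herm_bundle \<Rightarrow> bool" where
  "hermitian_line_bundle \<A> L \<longleftrightarrow>
     (\<Union>i. patch L i) = UNIV \<and> (\<forall>i. open (patch L i)) \<and>
     (\<forall>i j. hol_fun_on \<A> (patch L i \<inter> patch L j) (trans L i j)) \<and>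
     (\<forall>i j. \<forall>x\<in>patch L i \<inter> patch L j. trans L i j x \<noteq> 0) \<and>
     (\<forall>i j k. \<forall>x\<in>patch L i \<inter> patch L j \<inter> patch L k.
        trans L i j x * trans L j k x = trans L i k x) \<and>
     (\<forall>i. smooth_fun_on \<A> (patch L i) (hmet L i)) \<and>
     (\<forall>i. \<forall>x\<in>patch L i. hmet L i x > 0) \<and>
     (\<forall>i j. \<forall>x\<in>patch L i \<inter> patch L j. hmet L j x = (cmod (trans L i j x))\<^sup>2 * hmet L i x)"

definition bundle_power :: "('i, 'a) herm_bundle \<Rightarrow> nat \<Rightarrow> ('i, 'a) herm_bundle" where
  "bundle_power L m =
     \<lparr>patch = patch L, trans = (\<lambda>i j x. trans L i j x ^ m), hmet = (\<lambda>i x. hmet L i x ^ m)\<rparr>"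

definition triv_at :: "('i, 'a) herm_bundle \<Rightarrow> 'a \<Rightarrow> 'i" where
  "triv_at L x = (SOME i. x \<in> patch L i)"

text \<open>The Chern connection is \<open>\<nabla>e\<^sub>i = \<theta> e\<^sub>i\<close> with \<open>\<theta> = \<partial>h\<^sub>i / h\<^sub>i\<close>, and its curvature is \<open>d\<theta>\<close>. Both are
  computed in a chart \<open>c\<close>; for \<open>d\<theta>\<close> the vectors \<open>u\<close>, \<open>v\<close> are extended as constant fields.\<close>

definition chern_form ::
    "('i, 'a) herm_bundle \<Rightarrow> 'i \<Rightarrow> ('a, 'n::finite) chart \<Rightarrow> complex^'n \<Rightarrow> complex^'n \<Rightarrow> complex" where
  "chern_form L i c z v =
     dw (\<lambda>w. of_real (hmet L i (cinv c (z + w *s v)))) / of_real (hmet L i (cinv c z))"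

definition chern_curvature ::
    "('a, 'n::finite) chart set \<Rightarrow> ('i, 'a) herm_bundle
       \<Rightarrow> 'a \<Rightarrow> complex^'n \<Rightarrow> complex^'n \<Rightarrow> complex" where
  "chern_curvature \<A> L x u v =
     (let c = chart_at \<A> x; i = triv_at L x; z = snd c x in
        frechet_derivative (\<lambda>z. chern_form L i c z v) (at z) u
        - frechet_derivative (\<lambda>z. chern_form L i c z u) (at z) v)"

text \<open>\<open>i\<Theta>/2\<pi>\<close> is a real form; \<open>Re\<close> only changes the type.\<close>

definition curvature_form ::
    "('a, 'n::finite) chart set \<Rightarrow> ('i, 'a) herm_bundle
       \<Rightarrow> 'a \<Rightarrow> complex^'n \<Rightarrow> complex^'n \<Rightarrow> real" where
  "curvature_form \<A> L x u v = Re (\<i> / (2 * of_real pi) * chern_curvature \<A> L x u v)"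

definition positive_form :: "('a \<Rightarrow> complex^'n::finite \<Rightarrow> complex^'n \<Rightarrow> real) \<Rightarrow> bool" where
  "positive_form \<omega> \<longleftrightarrow> (\<forall>x v. v \<noteq> 0 \<longrightarrow> \<omega> x v (J v) > 0)"

definition metric_of ::
    "('a \<Rightarrow> complex^'n::finite \<Rightarrow> complex^'n \<Rightarrow> real) \<Rightarrow> 'a \<Rightarrow> complex^'n \<Rightarrow> complex^'n \<Rightarrow> real" where
  "metric_of \<omega> x u v = \<omega> x u (J v)"

text \<open>Inverse to \<open>metric_of\<close> on \<open>J\<close>-invariant metrics: \<open>\<omega>(u, J v) = g(u, v)\<close> iff
  \<open>\<omega>(u, v) = g(J u, v)\<close>.\<close>

definition kaehler_form_of ::
    "('a \<Rightarrow> complex^'n::finite \<Rightarrow> complex^'n \<Rightarrow> real) \<Rightarrow> 'a \<Rightarrow> complex^'n \<Rightarrow> complex^'n \<Rightarrow> real" where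
  "kaehler_form_of g x u v = g x (J u) v"


section \<open>Holomorphic sections and endomorphisms\<close>

text \<open>Sections form a complex vector space for the pointwise addition of
  \<^theory>\<open>HOL-Library.Function_Algebras\<close> and the following scalar multiplication.\<close>

definition scl :: "complex \<Rightarrow> ('i, 'a) sect \<Rightarrow> ('i, 'a) sect" (infixr "\<cdot>s" 75) where
  "c \<cdot>s s = (\<lambda>i x. c * s i x)"

definition is_section :: "('i, 'a) herm_bundle \<Rightarrow> ('i, 'a) sect \<Rightarrow> bool" where
  "is_section L s \<longleftrightarrow>
     (\<forall>i. \<forall>x. x \<notin> patch L i \<longrightarrow> s i x = 0) \<and>
     (\<forall>i j. \<forall>x\<in>patch L i \<inter> patch L j. s i x = trans L i j x * s j x)"

definition herm :: "('i, 'a) herm_bundle \<Rightarrow> ('i, 'a) sect \<Rightarrow> ('i, 'a) sect \<Rightarrow> 'a \<Rightarrow> complex" where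
  "herm L s t x = (let i = triv_at L x in of_real (hmet L i x) * s i x * cnj (t i x))"

context
  fixes \<A> :: "('a::t2_space, 'n::finite) chart set"
    and L :: "('i, 'a) herm_bundle"
    and m :: nat
begin

definition hol_sections :: "('i, 'a) sect set" where
  "hol_sections = {s. is_section (bundle_power L m) s \<and> (\<forall>i. hol_fun_on \<A> (patch L i) (s i))}"

definition vol :: "'a measure" where
  "vol = form_measure \<A> (curvature_form \<A> L)"

definition l2 :: "('i, 'a) sect \<Rightarrow> ('i, 'a) sect \<Rightarrow> complex" where
  "l2 s t = (LINT x|vol. herm (bundle_power L m) s t x)"

definition is_onb :: "('i, 'a) sect set \<Rightarrow> bool" where
  "is_onb E \<longleftrightarrow> finite E \<and> E \<subseteq> hol_sections \<and>
     (\<forall>s\<in>E. \<forall>t\<in>E. l2 s t = (if s = t then 1 else 0)) \<and>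
     (\<forall>s\<in>hol_sections. s = (\<Sum>e\<in>E. l2 s e \<cdot>s e))"

definition onb :: "('i, 'a) sect set" where
  "onb = (SOME E. is_onb E)"

definition density :: "'a \<Rightarrow> real" where
  "density x = (\<Sum>s\<in>onb. Re (herm (bundle_power L m) s s x))"

definition balanced :: bool where
  "balanced \<longleftrightarrow> (\<exists>C. \<forall>x. density x = C)"

text \<open>Endomorphisms of \<open>H\<^sub>m\<close> are extensional functions, so that they are equal as functions iff they
  agree on \<open>H\<^sub>m\<close>.\<close>

definition Endo :: "(('i, 'a) sect \<Rightarrow> ('i, 'a) sect) set" where
  "Endo = {F \<in> hol_sections \<rightarrow>\<^sub>E hol_sections.
     (\<forall>s\<in>hol_sections. \<forall>t\<in>hol_sections. F (s + t) = F s + F t) \<and>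
     (\<forall>c. \<forall>s\<in>hol_sections. F (c \<cdot>s s) = c \<cdot>s F s)}"

definition escale ::
    "complex \<Rightarrow> (('i, 'a) sect \<Rightarrow> ('i, 'a) sect) \<Rightarrow> ('i, 'a) sect \<Rightarrow> ('i, 'a) sect" where
  "escale c F = (\<lambda>s\<in>hol_sections. c \<cdot>s F s)"

definition adj :: "(('i, 'a) sect \<Rightarrow> ('i, 'a) sect) \<Rightarrow> ('i, 'a) sect \<Rightarrow> ('i, 'a) sect" where
  "adj F = (THE G. G \<in> Endo \<and>
     (\<forall>s\<in>hol_sections. \<forall>t\<in>hol_sections. l2 (F s) t = l2 s (G t)))"

definition tr :: "(('i, 'a) sect \<Rightarrow> ('i, 'a) sect) \<Rightarrow> complex" where
  "tr F = (\<Sum>e\<in>onb. l2 (F e) e)"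


section \<open>Toeplitz quantisation\<close>

definition bergman_proj :: "('i, 'a) sect \<Rightarrow> ('i, 'a) sect" where
  "bergman_proj s = (THE p. p \<in> hol_sections \<and> (\<forall>t\<in>hol_sections. l2 (s - p) t = 0))"

definition toeplitz :: "('a \<Rightarrow> complex) \<Rightarrow> ('i, 'a) sect \<Rightarrow> ('i, 'a) sect" where
  "toeplitz f = (\<lambda>s\<in>hol_sections. bergman_proj (\<lambda>i x. f x * s i x))"

definition toeplitz_adj :: "(('i, 'a) sect \<Rightarrow> ('i, 'a) sect) \<Rightarrow> 'a \<Rightarrow> complex" where
  "toeplitz_adj F = (THE f. smooth_fun_on \<A> UNIV f \<and>
     (\<forall>\<phi>. smooth_fun_on \<A> UNIV \<phi> \<longrightarrow>
        tr (toeplitz \<phi> \<circ> adj F) = (LINT x|vol. \<phi> x * cnj (f x))))"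


section \<open>The Kodaira map and the projective space \<open>P(H\<^sub>m)\<close>\<close>

text \<open>A nonzero \<open>z \<in> H\<^sub>m\<close> represents the point \<open>[z]\<close> of \<open>P(H\<^sub>m)\<close>, and \<open>u \<in> H\<^sub>m\<close> represents the
  tangent vector \<open>d\<pi>\<^sub>z(u)\<close> at \<open>[z]\<close>, where \<open>\<pi> : H\<^sub>m - 0 \<rightarrow> P(H\<^sub>m)\<close>; thus \<open>u\<close> represents \<open>0\<close> iff
  \<open>u \<in> \<complex>z\<close>. Forms on \<open>P(H\<^sub>m)\<close> are given by their pullbacks under \<open>\<pi>\<close>.\<close>

definition line :: "('i, 'a) sect \<Rightarrow> ('i, 'a) sect set" where
  "line z = {c \<cdot>s z | c. True}"

text \<open>For \<open>x \<in> patch i\<close>, the element of \<open>H\<^sub>m\<close> corresponding under \<open>b\<^sub>m\<close> to the functional \<open>s \<mapsto> s(x)\<close>,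
  where \<open>L\<^sub>x\<^sup>m\<close> is identified with \<open>\<complex>\<close> by the frame of index \<open>i\<close>. As a function of \<open>x\<close> it is a
  local lift of the Kodaira map to \<open>H\<^sub>m - 0\<close>.\<close>

definition kodaira_lift :: "'i \<Rightarrow> 'a \<Rightarrow> ('i, 'a) sect" where
  "kodaira_lift i x = (THE k. k \<in> hol_sections \<and> (\<forall>s\<in>hol_sections. l2 s k = s i x))"

definition lift_at :: "'a \<Rightarrow> ('i, 'a) sect" where
  "lift_at x = kodaira_lift (triv_at L x) x"

definition kodaira_map :: "'a \<Rightarrow> ('i, 'a) sect set" where
  "kodaira_map x = line (lift_at x)"

text \<open>A representative in \<open>H\<^sub>m\<close> of the image of a tangent vector \<open>v\<close> at \<open>x\<close> under the differential of
  the Kodaira map.\<close>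

definition kodaira_deriv :: "'a \<Rightarrow> complex^'n \<Rightarrow> ('i, 'a) sect" where
  "kodaira_deriv x v = (\<lambda>j y. mderiv \<A> (\<lambda>x'. kodaira_lift (triv_at L x) x' j y) x v)"

text \<open>Well-defined (no base points), injective and immersive. As the manifold is compact, such a map
  is a homeomorphism onto its image.\<close>

definition kodaira_embedding :: bool where
  "kodaira_embedding \<longleftrightarrow>
     (\<forall>x. \<exists>s\<in>hol_sections. s (triv_at L x) x \<noteq> 0) \<and>
     inj kodaira_map \<and>
     (\<forall>x v. v \<noteq> 0 \<longrightarrow> kodaira_deriv x v \<notin> line (lift_at x))"

text \<open>\<open>\<partial>\<close>\<open>\<partial>\<close>-bar of \<open>log |z|\<^sup>2\<close> evaluated on the constant fields \<open>u\<close>, \<open>v\<close>: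
  \<open>\<partial>\<^sub>u\<close> applied to the \<open>(0,1)\<close>-derivative along \<open>v\<close>, antisymmetrised.\<close>

definition log_norm2 :: "('i, 'a) sect \<Rightarrow> complex" where
  "log_norm2 z = of_real (ln (Re (l2 z z)))"

definition fs_form :: "('i, 'a) sect \<Rightarrow> ('i, 'a) sect \<Rightarrow> ('i, 'a) sect \<Rightarrow> real" where
  "fs_form z u v = Re (\<i> / (2 * of_real pi) *
     (dw (\<lambda>w. dwbar (\<lambda>w'. log_norm2 (z + w \<cdot>s u + w' \<cdot>s v)))
      - dw (\<lambda>w. dwbar (\<lambda>w'. log_norm2 (z + w \<cdot>s v + w' \<cdot>s u)))))"

definition fs_metric :: "('i, 'a) sect \<Rightarrow> ('i, 'a) sect \<Rightarrow> ('i, 'a) sect \<Rightarrow> real" where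
  "fs_metric z u v = fs_form z u (\<i> \<cdot>s v)"

definition induced_metric :: "'a \<Rightarrow> complex^'n \<Rightarrow> complex^'n \<Rightarrow> real" where
  "induced_metric x u v = fs_metric (lift_at x) (kodaira_deriv x u) (kodaira_deriv x v)"


section \<open>The quantised Laplacian\<close>

text \<open>\<open>exp_flow F t z\<close> is \<open>e\<^bsup>2\<pi>tF\<^esup> z\<close>, and \<open>\<nu>\<close> its velocity at \<open>t = 0\<close>; both are computed pointwise,
  which is the topology of the finite-dimensional space \<open>H\<^sub>m\<close>.\<close>

definition exp_flow ::
    "(('i, 'a) sect \<Rightarrow> ('i, 'a) sect) \<Rightarrow> real \<Rightarrow> ('i, 'a) sect \<Rightarrow> ('i, 'a) sect" where
  "exp_flow F t z = (\<lambda>i x. \<Sum>k. of_real ((2 * pi * t) ^ k / fact k) * (F ^^ k) z i x)"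

definition nu :: "(('i, 'a) sect \<Rightarrow> ('i, 'a) sect) \<Rightarrow> ('i, 'a) sect \<Rightarrow> ('i, 'a) sect" where
  "nu F z = (\<lambda>i x. vector_derivative (\<lambda>t. exp_flow F t z i x) (at 0))"

text \<open>\<open>F = re_part F + \<i> im_part F\<close> with self-adjoint parts.\<close>

definition re_part :: "(('i, 'a) sect \<Rightarrow> ('i, 'a) sect) \<Rightarrow> ('i, 'a) sect \<Rightarrow> ('i, 'a) sect" where
  "re_part F = (\<lambda>s\<in>hol_sections. (1 / 2) \<cdot>s (F s + adj F s))"

definition im_part :: "(('i, 'a) sect \<Rightarrow> ('i, 'a) sect) \<Rightarrow> ('i, 'a) sect \<Rightarrow> ('i, 'a) sect" where
  "im_part F = (\<lambda>s\<in>hol_sections. (1 / (2 * \<i>)) \<cdot>s (F s - adj F s))"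

definition tangent_proj :: "'a \<Rightarrow> ('i, 'a) sect \<Rightarrow> complex^'n" where
  "tangent_proj x w = (THE \<eta>. \<forall>\<xi>.
     fs_metric (lift_at x) (kodaira_deriv x \<eta>) (kodaira_deriv x \<xi>) =
     fs_metric (lift_at x) w (kodaira_deriv x \<xi>))"

definition e_op ::
    "(('i, 'a) sect \<Rightarrow> ('i, 'a) sect) \<Rightarrow> 'a \<Rightarrow> (complex^'n) \<times> (complex^'n)" where
  "e_op F x = (tangent_proj x (nu (re_part F) (lift_at x)),
               tangent_proj x (nu (im_part F) (lift_at x)))"

definition herm_metric ::
    "'a \<Rightarrow> (complex^'n) \<times> (complex^'n) \<Rightarrow> (complex^'n) \<times> (complex^'n) \<Rightarrow> complex" where
  "herm_metric x \<eta> \<xi> = Complex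
     (induced_metric x (fst \<eta>) (fst \<xi>) + induced_metric x (snd \<eta>) (snd \<xi>))
     (induced_metric x (snd \<eta>) (fst \<xi>) - induced_metric x (fst \<eta>) (snd \<xi>))"

definition field_inner ::
    "('a \<Rightarrow> (complex^'n) \<times> (complex^'n)) \<Rightarrow> ('a \<Rightarrow> (complex^'n) \<times> (complex^'n)) \<Rightarrow> complex" where
  "field_inner \<eta> \<xi> =
     (LINT x|form_measure \<A> (kaehler_form_of induced_metric). herm_metric x (\<eta> x) (\<xi> x))"

definition quantised_laplacian ::
    "(('i, 'a) sect \<Rightarrow> ('i, 'a) sect) \<Rightarrow> ('i, 'a) sect \<Rightarrow> ('i, 'a) sect" where
  "quantised_laplacian F = (THE D. D \<in> Endo \<and>
     (\<forall>G\<in>Endo. tr (D \<circ> adj G) = field_inner (e_op F) (e_op G)))"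

end

end

theory Submission
  imports Defs "HOL-Complex_Analysis.Complex_Analysis"
begin

text \<open>Write \<open>\<mu>\<^sub>A = T\<^sub>m\<^sup>*(A) = \<Sum> h(A s\<^sub>\<alpha>, s\<^sub>\<alpha>)\<close> and \<open>\<rho>\<close> for the constant \<open>\<rho>\<^sub>m\<close>. If \<open>\<omega>\<close> is balanced, then in a
  trivialisation \<open>\<rho> = h\<^sup>m \<Sum> |s\<^sub>\<alpha>|\<^sup>2\<close>, hence \<open>g\<^sub>m = m g\<close>, and \<open>\<mu>\<^sub>A / \<rho>\<close> is the restriction to \<open>M\<close> of the function
  \<open>\<langle>A z, z\<rangle> / |z|\<^sup>2\<close>, whose gradient on the projective space is \<open>\<nu>(A)\<close>. So \<open>e\<^sub>m(A)\<close> is the \<open>g\<^sub>m\<close>-gradient of \<open>\<mu>\<^sub>A / \<rho>\<close>, and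
  integration by parts gives \<open>tr(\<Delta>\<^sub>m(A) B\<^sup>*) = m\<^sup>n\<^sup>-\<^sup>1 / \<rho>\<^sup>2 \<integral> \<Delta>\<mu>\<^sub>A cnj \<mu>\<^sub>B\<close>, which is
  \<open>m\<^sup>n\<^sup>-\<^sup>1 / \<rho>\<^sup>2 tr(T\<^sub>m(\<Delta>\<mu>\<^sub>A) B\<^sup>*)\<close>. Integrating \<open>\<rho>\<close> over \<open>M\<close> yields \<open>\<rho> vol = dim H\<^sub>m\<close>.\<close>

section \<open>Smooth functions on open sets\<close>

text \<open>Most operators of the statement (\<open>manifold_measure\<close>, \<open>codiff\<close>,
  \<open>adj\<close>, \<open>bergman_proj\<close>, \<open>toeplitz_adj\<close>,
  \<open>kodaira_lift\<close>, \<open>tangent_proj\<close>, \<open>quantised_laplacian\<close>) are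
  definite descriptions, so the bulk of the work is existence and uniqueness: a measure glued from
  charts, a divergence theorem behind the Laplacian, and the finite dimension of the space of
  sections, which rests on the Schwarz lemma and compactness. A second obstacle is that tangent
  vectors, curvature and section values are read in a chart and a frame chosen separately at every
  point; before anything is differentiated it is carried over to one fixed chart and frame. The
  power of m has two sources: the volume of m g is m^n times that of g, while the squared length of
  a gradient taken for m g is 1/m times the squared length of the differential for g. The factor 2
  pi in the flow of nu(A) fits the normalisation of the Fubini-Study metric, which is the real part
  of the mixed Hessian of log |z|^2 divided by pi; this is why nu(A) is the gradient with no further
  constant.\<close>

lemma frechet_derivative_cong_open:
  assumes "open S" "x \<in> S" "\<And>y. y \<in> S \<Longrightarrow> f y = g y"
  shows "frechet_derivative f (at x) = frechet_derivative g (at x)"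
proof -
  have "(f has_derivative D) (at x) \<longleftrightarrow> (g has_derivative D) (at x)" for D
    using has_derivative_transform_within_open[of f D x UNIV S g]
      has_derivative_transform_within_open[of g D x UNIV S f] assms by auto
  then show ?thesis unfolding frechet_derivative_def by simp
qed

lemma Ck_on_cong:
  assumes "open S" "\<And>x. x \<in> S \<Longrightarrow> g x = h x"
  shows "Ck_on k S g = Ck_on k S h"
  using assms(2)
proof (induction k arbitrary: g h)
  case 0
  then show ?case by (simp cong: continuous_on_cong)
next
  case (Suc k)
  have 1: "frechet_derivative g (at x) = frechet_derivative h (at x)" if "x \<in> S" for x
    using frechet_derivative_cong_open[OF \<open>open S\<close> that] Suc.prems by blast
  have 2: "g differentiable (at x) \<longleftrightarrow> h differentiable (at x)" if "x \<in> S" for x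
    using has_derivative_transform_within_open[of g _ x UNIV S h]
      has_derivative_transform_within_open[of h _ x UNIV S g] that \<open>open S\<close> Suc.prems
    unfolding differentiable_def by (metis (no_types))
  show ?case using 1 2 Suc.IH[of "\<lambda>x. frechet_derivative g (at x) v" "\<lambda>x. frechet_derivative h (at x) v" for v]
    by auto
qed

text \<open>Lets a derivative be given by a formula; the inductions on the order of
  differentiability then work with that formula instead of the choice made in
  \<open>frechet_derivative\<close>.\<close>

lemma Ck_on_SucI:
  assumes "\<And>x. x \<in> S \<Longrightarrow> (f has_derivative f' x) (at x)"
    and "\<And>v. Ck_on k S (\<lambda>x. f' x v)" and "open S"
  shows "Ck_on (Suc k) S f"
proof -
  have "frechet_derivative f (at x) = f' x" if "x \<in> S" for x
    using frechet_derivative_at assms(1) that by metis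
  then have "Ck_on k S (\<lambda>x. frechet_derivative f (at x) v)" for v
    using assms(2)[of v] Ck_on_cong[OF assms(3), of "\<lambda>x. frechet_derivative f (at x) v" "\<lambda>x. f' x v" k] by simp
  then show ?thesis using assms(1) by (auto simp: differentiable_def)
qed

text \<open>In the product and chain rules an undifferentiated factor stands next to a first
  derivative; lowering its order by one puts both within reach of the induction hypothesis.\<close>

lemma Ck_on_SucD: "Ck_on (Suc k) S f \<Longrightarrow> Ck_on k S f"
proof (induction k arbitrary: f)
  case 0
  then show ?case
    by (auto intro!: continuous_at_imp_continuous_on differentiable_imp_continuous_within)
next
  case (Suc k)
  then show ?case by simp
qed

lemma Ck_on_subset: "Ck_on k S f \<Longrightarrow> T \<subseteq> S \<Longrightarrow> Ck_on k T f"
  by (induction k arbitrary: f) (auto intro: continuous_on_subset)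

lemma Ck_on_local:
  assumes "\<And>x. x \<in> S \<Longrightarrow> \<exists>U. open U \<and> x \<in> U \<and> Ck_on k U f"
  shows "Ck_on k S f"
  using assms
proof (induction k arbitrary: f)
  case 0
  then show ?case
    by (auto intro!: continuous_at_imp_continuous_on simp: continuous_on_eq_continuous_at)
      (meson continuous_on_eq_continuous_at)
next
  case (Suc k)
  have "\<exists>U. open U \<and> x \<in> U \<and> Ck_on k U (\<lambda>x. frechet_derivative f (at x) v)" if "x \<in> S" for x v
    using Suc.prems[OF that] by auto
  then have "Ck_on k S (\<lambda>x. frechet_derivative f (at x) v)" for v
    using Suc.IH by blast
  moreover have "f differentiable at x" if "x \<in> S" for x
    using Suc.prems[OF that] by auto
  ultimately show ?case by simp
qed

lemma Ck_on_const: "Ck_on k S (\<lambda>x. c)"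
proof (induction k arbitrary: c)
  case (Suc k)
  have "frechet_derivative (\<lambda>x. c) (at x) = (\<lambda>v. 0)" for x
    using frechet_derivative_at[OF has_derivative_const[of c "at x"]] by simp
  then show ?case using Suc by simp
qed simp

lemma Ck_on_bounded_linear:
  assumes "bounded_linear h" "Ck_on k S f" "open S"
  shows "Ck_on k S (\<lambda>x. h (f x))"
  using assms(2)
proof (induction k arbitrary: f)
  case 0
  then show ?case using bounded_linear.continuous_on[OF assms(1)] by simp
next
  case (Suc k)
  show ?case
  proof (rule Ck_on_SucI[where f' = "\<lambda>x v. h (frechet_derivative f (at x) v)"])
    show "((\<lambda>x. h (f x)) has_derivative (\<lambda>v. h (frechet_derivative f (at x) v))) (at x)"
      if "x \<in> S" for x
      using Suc.prems that
      by (intro bounded_linear.has_derivative[OF assms(1)]) (simp add: frechet_derivative_works[symmetric])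
    show "Ck_on k S (\<lambda>x. h (frechet_derivative f (at x) v))" for v
      using Suc by auto
  qed (use assms in auto)
qed

lemma Ck_on_add:
  assumes "Ck_on k S f" "Ck_on k S g" "open S"
  shows "Ck_on k S (\<lambda>x. f x + g x)"
  using assms(1,2)
proof (induction k arbitrary: f g)
  case 0
  then show ?case by (auto intro: continuous_intros)
next
  case (Suc k)
  show ?case
  proof (rule Ck_on_SucI[where f' = "\<lambda>x v. frechet_derivative f (at x) v + frechet_derivative g (at x) v"])
    show "((\<lambda>x. f x + g x) has_derivative (\<lambda>v. frechet_derivative f (at x) v + frechet_derivative g (at x) v)) (at x)"
      if "x \<in> S" for x
      using Suc.prems that by (auto intro!: has_derivative_add simp: frechet_derivative_works)
  qed (use Suc assms in auto)
qed

text \<open>One Leibniz induction for an arbitrary bounded bilinear map serves products, scalar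
  multiples and inner products alike.\<close>

lemma Ck_on_bilinear:
  assumes "bounded_bilinear B" "Ck_on k S f" "Ck_on k S g" "open S"
  shows "Ck_on k S (\<lambda>x. B (f x) (g x))"
  using assms(2,3)
proof (induction k arbitrary: f g)
  case 0
  then show ?case using bounded_bilinear.continuous_on[OF assms(1)] by simp
next
  case (Suc k)
  show ?case
  proof (rule Ck_on_SucI[where f' = "\<lambda>x v. B (f x) (frechet_derivative g (at x) v) + B (frechet_derivative f (at x) v) (g x)"])
    show "((\<lambda>x. B (f x) (g x)) has_derivative (\<lambda>v. B (f x) (frechet_derivative g (at x) v) + B (frechet_derivative f (at x) v) (g x))) (at x)"
      if "x \<in> S" for x
      using Suc.prems that by (auto intro!: bounded_bilinear.FDERIV[OF assms(1)] simp: frechet_derivative_works)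
    show "Ck_on k S (\<lambda>x. B (f x) (frechet_derivative g (at x) v) + B (frechet_derivative f (at x) v) (g x))" for v
      using Suc.prems Ck_on_SucD[OF Suc.prems(1)] Ck_on_SucD[OF Suc.prems(2)] assms(4)
      by (intro Ck_on_add Suc.IH) simp_all
  qed (use assms in auto)
qed

lemma Ck_on_sum:
  assumes "\<And>i. i \<in> I \<Longrightarrow> Ck_on k S (f i)" "open S"
  shows "Ck_on k S (\<lambda>x. \<Sum>i\<in>I. f i x)"
  using assms(1)
  by (induction I rule: infinite_finite_induct) (auto simp: Ck_on_const intro: Ck_on_add assms)

lemma Ck_on_compose:
  fixes f :: "'b::euclidean_space \<Rightarrow> 'c::real_normed_vector"
  assumes "Ck_on k T f" "Ck_on k S g" "open S" "g ` S \<subseteq> T"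
  shows "Ck_on k S (\<lambda>x. f (g x))"
  using assms(1,2)
proof (induction k arbitrary: f)
  case 0
  then show ?case using assms continuous_on_compose2 by auto
next
  case (Suc k)
  show ?case
  proof (rule Ck_on_SucI[where f' = "\<lambda>x v. frechet_derivative f (at (g x)) (frechet_derivative g (at x) v)"])
    show "((\<lambda>x. f (g x)) has_derivative (\<lambda>v. frechet_derivative f (at (g x)) (frechet_derivative g (at x) v))) (at x)"
      if "x \<in> S" for x
    proof (rule has_derivative_compose[of g "frechet_derivative g (at x)" x UNIV f])
      show "(g has_derivative frechet_derivative g (at x)) (at x)"
        using Suc.prems(2) that by (simp add: frechet_derivative_works[symmetric])
      have "f differentiable at (g x)" using Suc.prems(1) that assms(4) by auto
      then show "(f has_derivative frechet_derivative f (at (g x))) (at (g x))"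
        by (simp add: frechet_derivative_works[symmetric])
    qed
    \<comment> \<open>\<open>Ck_on\<close> controls derivatives in a fixed direction only, whereas
      the direction here moves with \<open>x\<close>. Expanding it in the basis leaves fixed
      directions with differentiable coefficients.\<close>
    have "frechet_derivative f (at (g x)) (frechet_derivative g (at x) v) =
       (\<Sum>b\<in>Basis. (frechet_derivative g (at x) v \<bullet> b) *\<^sub>R frechet_derivative f (at (g x)) b)"
      if "x \<in> S" for x v
    proof -
      have "f differentiable at (g x)" using Suc.prems that assms(4) by auto
      then have l: "linear (frechet_derivative f (at (g x)))"
        using linear_frechet_derivative by blast
      have "frechet_derivative f (at (g x)) (\<Sum>b\<in>Basis. (frechet_derivative g (at x) v \<bullet> b) *\<^sub>R b) =
         (\<Sum>b\<in>Basis. (frechet_derivative g (at x) v \<bullet> b) *\<^sub>R frechet_derivative f (at (g x)) b)"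
        using l by (simp add: linear_sum linear_scale)
      then show ?thesis unfolding euclidean_representation .
    qed
    moreover have "Ck_on k S (\<lambda>x. \<Sum>b\<in>Basis. (frechet_derivative g (at x) v \<bullet> b) *\<^sub>R frechet_derivative f (at (g x)) b)" for v
      using Suc.prems Ck_on_SucD[OF Suc.prems(2)] assms(3)
      by (intro Ck_on_sum Ck_on_bilinear[OF bounded_bilinear_scaleR] Suc.IH
          Ck_on_bounded_linear[OF bounded_linear_inner_left]) auto
    ultimately show "Ck_on k S (\<lambda>x. frechet_derivative f (at (g x)) (frechet_derivative g (at x) v))" for v
      using Ck_on_cong[OF \<open>open S\<close>, of "\<lambda>x. frechet_derivative f (at (g x)) (frechet_derivative g (at x) v)"
          "\<lambda>x. \<Sum>b\<in>Basis. (frechet_derivative g (at x) v \<bullet> b) *\<^sub>R frechet_derivative f (at (g x)) b" k]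
      by simp
  qed (use assms in auto)
qed

section \<open>Closure properties of smooth functions\<close>

lemma smooth_on_cong: "open S \<Longrightarrow> (\<And>x. x \<in> S \<Longrightarrow> g x = h x) \<Longrightarrow> smooth_on S g = smooth_on S h"
  unfolding smooth_on_def using Ck_on_cong by blast

lemma smooth_on_subset: "smooth_on S f \<Longrightarrow> T \<subseteq> S \<Longrightarrow> smooth_on T f"
  unfolding smooth_on_def using Ck_on_subset by blast

lemma smooth_on_local:
  assumes "\<And>x. x \<in> S \<Longrightarrow> \<exists>U. open U \<and> x \<in> U \<and> smooth_on U f"
  shows "smooth_on S f"
  unfolding smooth_on_def
proof
  fix k show "Ck_on k S f"
    by (rule Ck_on_local) (use assms in \<open>auto simp: smooth_on_def\<close>)
qed

lemma smooth_on_const: "smooth_on S (\<lambda>x. c)"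
  by (simp add: smooth_on_def Ck_on_const)

lemma smooth_on_bounded_linear:
  "bounded_linear h \<Longrightarrow> smooth_on S f \<Longrightarrow> open S \<Longrightarrow> smooth_on S (\<lambda>x. h (f x))"
  unfolding smooth_on_def by (intro allI, rule Ck_on_bounded_linear[of h]) auto

lemma smooth_on_id: "open S \<Longrightarrow> smooth_on S (\<lambda>x. x)"
proof -
  assume "open S"
  have "Ck_on k S (\<lambda>x::'a. x)" for k
  proof (cases k)
    case (Suc j)
    then show ?thesis using \<open>open S\<close>
      by (auto intro!: Ck_on_SucI[where f' = "\<lambda>x v. v"] Ck_on_const)
  qed (auto simp: continuous_on_id)
  then show ?thesis by (simp add: smooth_on_def)
qed

lemma smooth_on_add: "smooth_on S f \<Longrightarrow> smooth_on S g \<Longrightarrow> open S \<Longrightarrow> smooth_on S (\<lambda>x. f x + g x)"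
  unfolding smooth_on_def by (intro allI, rule Ck_on_add) auto

lemma smooth_on_bilinear:
  "bounded_bilinear B \<Longrightarrow> smooth_on S f \<Longrightarrow> smooth_on S g \<Longrightarrow> open S \<Longrightarrow> smooth_on S (\<lambda>x. B (f x) (g x))"
  unfolding smooth_on_def by (intro allI, rule Ck_on_bilinear) auto

lemma smooth_on_sum:
  "(\<And>i. i \<in> I \<Longrightarrow> smooth_on S (f i)) \<Longrightarrow> open S \<Longrightarrow> smooth_on S (\<lambda>x. \<Sum>i\<in>I. f i x)"
  unfolding smooth_on_def by (intro allI, rule Ck_on_sum) auto

lemma smooth_on_compose:
  fixes f :: "'b::euclidean_space \<Rightarrow> 'c::real_normed_vector"
  shows "smooth_on T f \<Longrightarrow> smooth_on S g \<Longrightarrow> open S \<Longrightarrow> g ` S \<subseteq> T \<Longrightarrow> smooth_on S (\<lambda>x. f (g x))"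
  unfolding smooth_on_def by (intro allI, rule Ck_on_compose[of _ T f S g]) auto

lemma smooth_on_mult:
  fixes f g :: "'a::real_normed_vector \<Rightarrow> 'b::real_normed_algebra"
  shows "smooth_on S f \<Longrightarrow> smooth_on S g \<Longrightarrow> open S \<Longrightarrow> smooth_on S (\<lambda>x. f x * g x)"
  by (rule smooth_on_bilinear[OF bounded_bilinear_mult])

lemma smooth_on_prod:
  fixes f :: "'i \<Rightarrow> 'a::real_normed_vector \<Rightarrow> 'b::{real_normed_algebra, comm_ring_1}"
  assumes "\<And>i. i \<in> I \<Longrightarrow> smooth_on S (f i)" "open S"
  shows "smooth_on S (\<lambda>x. \<Prod>i\<in>I. f i x)"
  using assms(1)
  by (induction I rule: infinite_finite_induct) (auto simp: smooth_on_const intro: smooth_on_mult assms)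

lemma smooth_on_power:
  fixes f :: "'a::real_normed_vector \<Rightarrow> 'b::{real_normed_algebra, comm_ring_1}"
  assumes "smooth_on S f" "open S"
  shows "smooth_on S (\<lambda>x. f x ^ k)"
  using smooth_on_prod[of "{..<k}" S "\<lambda>_. f"] assms by simp

lemma smooth_on_uminus: "smooth_on S f \<Longrightarrow> open S \<Longrightarrow> smooth_on S (\<lambda>x. - f x)"
  using smooth_on_bounded_linear[OF bounded_linear_minus[OF bounded_linear_ident]] .

lemma smooth_on_diff: "smooth_on S f \<Longrightarrow> smooth_on S g \<Longrightarrow> open S \<Longrightarrow> smooth_on S (\<lambda>x. f x - g x)"
  using smooth_on_add[of S f "\<lambda>x. - g x"] smooth_on_uminus[of S g] by simp

lemma smooth_on_of_real:
  "smooth_on S f \<Longrightarrow> open S \<Longrightarrow> smooth_on S (\<lambda>x. complex_of_real (f x))"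
  by (rule smooth_on_bounded_linear[OF bounded_linear_of_real])

lemma smooth_on_cnj: "smooth_on S f \<Longrightarrow> open S \<Longrightarrow> smooth_on S (\<lambda>x. cnj (f x))"
  by (rule smooth_on_bounded_linear[OF bounded_linear_cnj])

lemma smooth_on_Re: "smooth_on S f \<Longrightarrow> open S \<Longrightarrow> smooth_on S (\<lambda>x. Re (f x))"
  by (rule smooth_on_bounded_linear[OF bounded_linear_Re])

lemma smooth_on_deriv: "smooth_on S f \<Longrightarrow> smooth_on S (\<lambda>x. frechet_derivative f (at x) v)"
  unfolding smooth_on_def
proof
  fix k
  assume "\<forall>k. Ck_on k S f"
  then have "Ck_on (Suc k) S f" by blast
  then show "Ck_on k S (\<lambda>x. frechet_derivative f (at x) v)" by simp
qed

lemma smooth_on_has_derivative: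
  "smooth_on S f \<Longrightarrow> x \<in> S \<Longrightarrow> (f has_derivative frechet_derivative f (at x)) (at x)"
  unfolding smooth_on_def by (auto simp: frechet_derivative_works[symmetric] dest: spec[of _ 1])

lemma smooth_on_continuous: "smooth_on S f \<Longrightarrow> continuous_on S f"
  unfolding smooth_on_def by (auto dest: spec[of _ 0])

text \<open>Bootstrapping for functions such as \<open>exp\<close> and \<open>inverse\<close>, whose
  derivative is an expression in the function itself: regularity of order k of the function gives it
  for the derivative, hence order k + 1.\<close>

lemma smooth_on_coinduct:
  assumes "open S"
    and "\<forall>x\<in>S. (f has_derivative f' x) (at x)"
    and "\<And>k v. Ck_on k S f \<Longrightarrow> Ck_on k S (\<lambda>x. f' x v)"
    and "continuous_on S f"
  shows "smooth_on S f"
proof -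
  have "Ck_on k S f" for k
  proof (induction k)
    case (Suc k)
    then show ?case by (intro Ck_on_SucI[where f'=f']) (use assms in auto)
  qed (use assms in auto)
  then show ?thesis by (simp add: smooth_on_def)
qed

lemma smooth_on_real_inverse: "smooth_on {0<..} (inverse :: real \<Rightarrow> real)"
proof (rule smooth_on_coinduct[where f' = "\<lambda>x v. - (inverse x * v * inverse x)"])
  show "Ck_on k {0<..} (\<lambda>x. - (inverse x * v * inverse x))" if "Ck_on k {0<..} (inverse :: real \<Rightarrow> real)" for k and v :: real
    by (intro Ck_on_bounded_linear[OF bounded_linear_minus[OF bounded_linear_ident]]
        Ck_on_bilinear[OF bounded_bilinear_mult] that Ck_on_const) auto
qed (auto intro!: continuous_intros has_derivative_inverse')

lemma smooth_on_real_exp: "smooth_on UNIV (exp :: real \<Rightarrow> real)"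
proof (rule smooth_on_coinduct[where f' = "\<lambda>x v. exp x * v"])
  show "Ck_on k UNIV (\<lambda>x. exp x * v)" if "Ck_on k UNIV (exp :: real \<Rightarrow> real)" for k and v :: real
    by (intro Ck_on_bilinear[OF bounded_bilinear_mult] that Ck_on_const) auto
  show "\<forall>x\<in>UNIV. (exp has_derivative (*) (exp x)) (at (x::real))"
    using DERIV_exp unfolding has_field_derivative_def by blast
qed (auto intro!: continuous_intros)

lemma smooth_on_real_ln: "smooth_on {0<..} (ln :: real \<Rightarrow> real)"
proof (rule smooth_on_coinduct[where f' = "\<lambda>x v. inverse x * v"])
  show "Ck_on k {0<..} (\<lambda>x. inverse x * v)" for k and v :: real
    using smooth_on_real_inverse
    by (intro Ck_on_bilinear[OF bounded_bilinear_mult] Ck_on_const) (auto simp: smooth_on_def)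
  show "\<forall>x\<in>{0<..}. (ln has_derivative (*) (inverse x)) (at (x::real))"
    using DERIV_ln unfolding has_field_derivative_def by auto
qed (auto intro!: continuous_intros)

lemma smooth_on_inverse:
  fixes f :: "'a::real_normed_vector \<Rightarrow> real"
  shows "smooth_on S f \<Longrightarrow> open S \<Longrightarrow> (\<And>x. x \<in> S \<Longrightarrow> f x > 0) \<Longrightarrow> smooth_on S (\<lambda>x. inverse (f x))"
  by (rule smooth_on_compose[OF smooth_on_real_inverse]) auto

lemma smooth_on_ln:
  fixes f :: "'a::real_normed_vector \<Rightarrow> real"
  shows "smooth_on S f \<Longrightarrow> open S \<Longrightarrow> (\<And>x. x \<in> S \<Longrightarrow> f x > 0) \<Longrightarrow> smooth_on S (\<lambda>x. ln (f x))"
  by (rule smooth_on_compose[OF smooth_on_real_ln]) auto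

lemma smooth_on_exp:
  fixes f :: "'a::real_normed_vector \<Rightarrow> real"
  shows "smooth_on S f \<Longrightarrow> open S \<Longrightarrow> smooth_on S (\<lambda>x. exp (f x))"
  by (rule smooth_on_compose[OF smooth_on_real_exp]) auto

lemma smooth_on_sqrt:
  fixes f :: "'a::real_normed_vector \<Rightarrow> real"
  assumes "smooth_on S f" "open S" "\<And>x. x \<in> S \<Longrightarrow> f x > 0"
  shows "smooth_on S (\<lambda>x. sqrt (f x))"
proof -
  have "smooth_on S (\<lambda>x. exp (ln (f x) * (1/2)))"
    using assms by (intro smooth_on_exp smooth_on_mult smooth_on_ln smooth_on_const) auto
  moreover have "exp (ln (f x) * (1/2)) = sqrt (f x)" if "x \<in> S" for x
    using assms(3)[OF that] by (simp add: powr_half_sqrt[symmetric] powr_def field_simps)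
  ultimately show ?thesis
    using smooth_on_cong[OF assms(2), of "\<lambda>x. exp (ln (f x) * (1/2))" "\<lambda>x. sqrt (f x)"] by simp
qed

lemma smooth_on_divide:
  fixes f g :: "'a::real_normed_vector \<Rightarrow> real"
  assumes "smooth_on S f" "smooth_on S g" "open S" "\<And>x. x \<in> S \<Longrightarrow> g x > 0"
  shows "smooth_on S (\<lambda>x. f x / g x)"
  using smooth_on_mult[OF assms(1) smooth_on_inverse[OF assms(2-4)] assms(3)] by (simp add: divide_inverse)

lemma smooth_on_vec:
  fixes f :: "'a::real_normed_vector \<Rightarrow> complex^'n"
  assumes "\<And>k. smooth_on S (\<lambda>x. f x $ k)" "open S"
  shows "smooth_on S f"
proof -
  have bl: "bounded_linear (axis k :: complex \<Rightarrow> complex^'n)" for k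
    unfolding axis_def
    by (rule linear_conv_bounded_linear[THEN iffD1]) (auto intro!: linearI simp: vec_eq_iff)
  have "smooth_on S (\<lambda>x. \<Sum>k\<in>UNIV. axis k (f x $ k))"
    using assms by (intro smooth_on_sum smooth_on_bounded_linear[OF bl]) auto
  moreover have "(\<Sum>k\<in>UNIV. axis k (f x $ k)) = f x" for x
    by (simp add: vec_eq_iff axis_def)
  ultimately show ?thesis by simp
qed

subsection \<open>Symmetry of second derivatives\<close>

lemma has_vector_derivative_line:
  assumes "(f has_derivative D) (at (y + q *\<^sub>R v))"
  shows "((\<lambda>q. f (y + q *\<^sub>R v)) has_vector_derivative D v) (at q)"
proof -
  have "((\<lambda>q. y + q *\<^sub>R v) has_derivative (\<lambda>h. h *\<^sub>R v)) (at q)"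
    by (auto intro!: derivative_eq_intros)
  then have "((\<lambda>q. f (y + q *\<^sub>R v)) has_derivative (\<lambda>h. D (h *\<^sub>R v))) (at q)"
    using assms by (rule has_derivative_compose)
  moreover have "(\<lambda>h. D (h *\<^sub>R v)) = (\<lambda>h. h *\<^sub>R D v)"
    using has_derivative_linear[OF assms] by (simp add: linear_scale)
  ultimately show ?thesis by (simp add: has_vector_derivative_def)
qed

text \<open>The mean value theorem is applied twice, to the v-increment as a function of the step
  along u, then to the u-derivative as a function of the step along v. The left-hand side is
  symmetric in u and v, the right-hand side is not visibly so.\<close>

lemma second_difference_mvt:
  fixes f :: "'a::real_normed_vector \<Rightarrow> real"
  assumes f: "smooth_on S f" and S: "ball x r \<subseteq> S" "open S" and t: "t > 0" "t * (norm u + norm v) < r"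
  shows "\<exists>p \<in> ball x r. f (x + t *\<^sub>R u + t *\<^sub>R v) - f (x + t *\<^sub>R u) - f (x + t *\<^sub>R v) + f x =
     t^2 * frechet_derivative (\<lambda>y. frechet_derivative f (at y) u) (at p) v \<and> dist x p \<le> t * (norm u + norm v)"
proof -
  let ?D = "\<lambda>y. frechet_derivative f (at y)"
  have inS: "x + s *\<^sub>R u + q *\<^sub>R v \<in> ball x r" "dist x (x + s *\<^sub>R u + q *\<^sub>R v) \<le> t * (norm u + norm v)"
    if "0 \<le> s" "s \<le> t" "0 \<le> q" "q \<le> t" for s q
  proof -
    have "norm (s *\<^sub>R u + q *\<^sub>R v) \<le> s * norm u + q * norm v"
      by (rule order_trans[OF norm_triangle_ineq]) (use that in simp)
    also have "\<dots> \<le> t * (norm u + norm v)"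
      using that by (simp add: distrib_left add_mono mult_right_mono)
    finally have "norm (s *\<^sub>R u + q *\<^sub>R v) \<le> t * (norm u + norm v)" .
    moreover have "dist x (x + s *\<^sub>R u + q *\<^sub>R v) = norm (s *\<^sub>R u + q *\<^sub>R v)"
      by (metis add.assoc add_diff_cancel_left' dist_commute dist_norm)
    ultimately show "dist x (x + s *\<^sub>R u + q *\<^sub>R v) \<le> t * (norm u + norm v)"
      "x + s *\<^sub>R u + q *\<^sub>R v \<in> ball x r" using t by auto
  qed
  define G where "G s = f (x + s *\<^sub>R u + t *\<^sub>R v) - f (x + s *\<^sub>R u)" for s
  have dG: "(G has_real_derivative ?D (x + s *\<^sub>R u + t *\<^sub>R v) u - ?D (x + s *\<^sub>R u) u) (at s)"
    if "0 \<le> s" "s \<le> t" for s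
  proof -
    have a: "x + s *\<^sub>R u + t *\<^sub>R v \<in> S" "x + s *\<^sub>R u \<in> S"
      using inS[of s t] inS[of s 0] that t S by auto
    have b: "((\<lambda>s. f ((x + t *\<^sub>R v) + s *\<^sub>R u)) has_vector_derivative ?D (x + s *\<^sub>R u + t *\<^sub>R v) u) (at s)"
      using smooth_on_has_derivative[OF f a(1)] by (intro has_vector_derivative_line) (simp add: add_ac)
    have c: "((\<lambda>s. f (x + s *\<^sub>R u)) has_vector_derivative ?D (x + s *\<^sub>R u) u) (at s)"
      using smooth_on_has_derivative[OF f a(2)] by (intro has_vector_derivative_line)
    show ?thesis
      using has_vector_derivative_diff[OF b c]
      unfolding G_def has_real_derivative_iff_has_vector_derivative by (simp add: add_ac)
  qed
  obtain s where s: "0 < s" "s < t"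
    "G t - G 0 = (t - 0) * (?D (x + s *\<^sub>R u + t *\<^sub>R v) u - ?D (x + s *\<^sub>R u) u)"
    using MVT2[OF t(1), of G "\<lambda>s. ?D (x + s *\<^sub>R u + t *\<^sub>R v) u - ?D (x + s *\<^sub>R u) u"] dG by auto
  define H where "H q = ?D (x + s *\<^sub>R u + q *\<^sub>R v) u" for q
  have f1: "smooth_on S (\<lambda>y. ?D y u)" by (rule smooth_on_deriv[OF f])
  have dH: "(H has_real_derivative frechet_derivative (\<lambda>y. ?D y u) (at (x + s *\<^sub>R u + q *\<^sub>R v)) v) (at q)"
    if "0 \<le> q" "q \<le> t" for q
  proof -
    have a: "x + s *\<^sub>R u + q *\<^sub>R v \<in> S" using inS[of s q] s that S by auto
    show ?thesis
      unfolding H_def has_real_derivative_iff_has_vector_derivative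
      using smooth_on_has_derivative[OF f1 a] by (intro has_vector_derivative_line)
  qed
  obtain q where q: "0 < q" "q < t"
    "H t - H 0 = (t - 0) * frechet_derivative (\<lambda>y. ?D y u) (at (x + s *\<^sub>R u + q *\<^sub>R v)) v"
    using MVT2[OF t(1), of H "\<lambda>q. frechet_derivative (\<lambda>y. ?D y u) (at (x + s *\<^sub>R u + q *\<^sub>R v)) v"] dH by auto
  have "f (x + t *\<^sub>R u + t *\<^sub>R v) - f (x + t *\<^sub>R u) - f (x + t *\<^sub>R v) + f x = G t - G 0"
    by (simp add: G_def)
  also have "\<dots> = t^2 * frechet_derivative (\<lambda>y. ?D y u) (at (x + s *\<^sub>R u + q *\<^sub>R v)) v"
    using s(3) q(3) by (simp add: H_def power2_eq_square)
  finally show ?thesis using inS[of s q] s q by (intro bexI[of _ "x + s *\<^sub>R u + q *\<^sub>R v"]) auto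
qed

text \<open>The second difference does not change when u and v are interchanged, so the two mixed
  derivatives agree at points arbitrarily close to \<open>x\<close>; continuity brings the equality
  to \<open>x\<close>.\<close>

lemma second_derivative_symmetric_real:
  fixes f :: "'a::real_normed_vector \<Rightarrow> real"
  assumes f: "smooth_on S f" and S: "x \<in> S" "open S"
  shows "frechet_derivative (\<lambda>y. frechet_derivative f (at y) u) (at x) v =
    frechet_derivative (\<lambda>y. frechet_derivative f (at y) v) (at x) u" (is "?a x = ?b x")
proof (rule ccontr)
  assume ne: "?a x \<noteq> ?b x"
  define e where "e = \<bar>?a x - ?b x\<bar> / 2"
  have e: "e > 0" using ne by (simp add: e_def)
  have "continuous_on S ?a" "continuous_on S ?b"
    by (intro smooth_on_continuous smooth_on_deriv f)+
  then have "isCont ?a x" "isCont ?b x" using S continuous_on_eq_continuous_at by blast+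
  then obtain d1 d2 where d: "d1 > 0" "\<And>y. dist y x < d1 \<Longrightarrow> dist (?a y) (?a x) < e"
    "d2 > 0" "\<And>y. dist y x < d2 \<Longrightarrow> dist (?b y) (?b x) < e"
    using e unfolding continuous_at_eps_delta dist_norm[symmetric] by blast
  obtain r where r: "r > 0" "ball x r \<subseteq> S" using S openE by blast
  define R where "R = Min {d1, d2, r}"
  have R: "R > 0" "R \<le> d1" "R \<le> d2" "ball x R \<subseteq> S"
    using d r by (auto simp: R_def)
  \<comment> \<open>The summand 1 keeps the divisor in \<open>t\<close> positive when both
    directions vanish.\<close>
  define N where "N = norm u + norm v + 1"
  have N: "N > 0" unfolding N_def by (intro add_nonneg_pos) auto
  define t where "t = R / (2 * N)"
  have t: "t > 0" using R N by (simp add: t_def)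
  have "t * (norm u + norm v) \<le> t * N" using t by (simp add: N_def)
  also have "\<dots> = R / 2" using N by (simp add: t_def)
  also have "\<dots> < R" using R by simp
  finally have t2: "t * (norm u + norm v) < R" .
  obtain p where p: "f (x + t *\<^sub>R u + t *\<^sub>R v) - f (x + t *\<^sub>R u) - f (x + t *\<^sub>R v) + f x = t^2 * ?a p"
    "dist x p \<le> t * (norm u + norm v)"
    using second_difference_mvt[OF f R(4) S(2) t t2] by blast
  obtain q where q: "f (x + t *\<^sub>R v + t *\<^sub>R u) - f (x + t *\<^sub>R v) - f (x + t *\<^sub>R u) + f x = t^2 * ?b q"
    "dist x q \<le> t * (norm v + norm u)"
    using second_difference_mvt[OF f R(4) S(2) t, of v u] t2 by (auto simp: add.commute)
  have "t^2 * ?a p = t^2 * ?b q" using p(1) q(1) by (simp add: algebra_simps)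
  then have "?a p = ?b q" using t by simp
  moreover have "dist (?a p) (?a x) < e" "dist (?b q) (?b x) < e"
    using d p(2) q(2) t2 R by (auto simp: add.commute dist_commute[of _ x])
  ultimately show False unfolding e_def dist_real_def by (auto simp: abs_if split: if_splits)
qed

lemma frechet_derivative_bounded_linear:
  assumes "bounded_linear h" "f differentiable at x"
  shows "frechet_derivative (\<lambda>y. h (f y)) (at x) v = h (frechet_derivative f (at x) v)"
  using frechet_derivative_at[OF bounded_linear.has_derivative[OF assms(1) assms(2)[unfolded frechet_derivative_works]]]
  by (rule fun_cong[OF sym])

lemma smooth_on_differentiable: "smooth_on S f \<Longrightarrow> x \<in> S \<Longrightarrow> f differentiable at x"
  using smooth_on_has_derivative unfolding differentiable_def by blast

lemma frechet_derivative2_bounded_linear: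
  assumes h: "bounded_linear h" and f: "smooth_on S f" and S: "x \<in> S" "open S"
  shows "frechet_derivative (\<lambda>y. frechet_derivative (\<lambda>y. h (f y)) (at y) u) (at x) v =
    h (frechet_derivative (\<lambda>y. frechet_derivative f (at y) u) (at x) v)"
proof -
  have "frechet_derivative (\<lambda>y. frechet_derivative (\<lambda>y. h (f y)) (at y) u) (at x) =
    frechet_derivative (\<lambda>y. h (frechet_derivative f (at y) u)) (at x)"
    by (rule frechet_derivative_cong_open[OF S(2,1)])
      (auto intro: frechet_derivative_bounded_linear[OF h] smooth_on_differentiable[OF f])
  then show ?thesis
    using frechet_derivative_bounded_linear[OF h smooth_on_differentiable[OF smooth_on_deriv[OF f] S(1)]]
    by simp
qed

lemma second_derivative_symmetric:
  fixes f :: "'a::real_normed_vector \<Rightarrow> 'b::euclidean_space"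
  assumes f: "smooth_on S f" and S: "x \<in> S" "open S"
  shows "frechet_derivative (\<lambda>y. frechet_derivative f (at y) u) (at x) v =
    frechet_derivative (\<lambda>y. frechet_derivative f (at y) v) (at x) u"
proof (rule euclidean_eqI)
  fix b :: 'b
  note h = bounded_linear_inner_left[of b]
  show "frechet_derivative (\<lambda>y. frechet_derivative f (at y) u) (at x) v \<bullet> b =
    frechet_derivative (\<lambda>y. frechet_derivative f (at y) v) (at x) u \<bullet> b"
    using second_derivative_symmetric_real[OF smooth_on_bounded_linear[OF h f S(2)] S, of u v]
    unfolding frechet_derivative2_bounded_linear[OF h f S] .
qed

section \<open>Holomorphic functions of several variables\<close>

lemma norm_vector_smult: "norm (c *s v) = cmod c * norm (v :: complex^'n)"
proof -
  have "(\<Sum>i\<in>UNIV. (norm ((c *s v) $ i))^2) = (cmod c)^2 * (\<Sum>i\<in>UNIV. (norm (v $ i))^2)"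
    by (simp add: norm_mult power_mult_distrib sum_distrib_left)
  then show ?thesis by (simp add: norm_vec_def L2_set_def real_sqrt_mult)
qed

lemma bounded_linear_smult_left: "bounded_linear (\<lambda>c. c *s (v :: complex^'n))"
  by (rule bounded_linear_intro[of _ "norm v"])
    (auto simp: vec_eq_iff norm_vector_smult algebra_simps complex_eq_iff)

lemma scaleR_smult: "r *\<^sub>R v = complex_of_real r *s (v :: complex^'n)"
  by (auto simp: vec_eq_iff complex_eq_iff)

lemma hol_on_has_derivative:
  assumes "hol_on S f" "x \<in> S"
  shows "(f has_derivative frechet_derivative f (at x)) (at x)"
    and "frechet_derivative f (at x) (c *s v) = c * frechet_derivative f (at x) v"
proof -
  obtain D where D: "(f has_derivative D) (at x)" "\<forall>c v. D (c *s v) = c * D v"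
    using assms unfolding hol_on_def by blast
  have "frechet_derivative f (at x) = D" using frechet_derivative_at[OF D(1)] by simp
  then show "(f has_derivative frechet_derivative f (at x)) (at x)"
    and "frechet_derivative f (at x) (c *s v) = c * frechet_derivative f (at x) v"
    using D by auto
qed

lemma hol_on_continuous: "hol_on S f \<Longrightarrow> continuous_on S f"
  by (intro continuous_at_imp_continuous_on ballI) (blast intro: has_derivative_continuous hol_on_has_derivative(1))

lemma hol_on_subset: "hol_on S f \<Longrightarrow> T \<subseteq> S \<Longrightarrow> hol_on T f"
  unfolding hol_on_def by blast

lemma hol_on_add: "hol_on S f \<Longrightarrow> hol_on S g \<Longrightarrow> hol_on S (\<lambda>x. f x + g x)"
  unfolding hol_on_def
proof
  fix x assume *: "\<forall>x\<in>S. \<exists>D. (f has_derivative D) (at x) \<and> (\<forall>c v. D (c *s v) = c * D v)"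
    "\<forall>x\<in>S. \<exists>D. (g has_derivative D) (at x) \<and> (\<forall>c v. D (c *s v) = c * D v)" "x \<in> S"
  then obtain D E where "(f has_derivative D) (at x) \<and> (\<forall>c v. D (c *s v) = c * D v)"
    "(g has_derivative E) (at x) \<and> (\<forall>c v. E (c *s v) = c * E v)" by blast
  then show "\<exists>D. ((\<lambda>x. f x + g x) has_derivative D) (at x) \<and> (\<forall>c v. D (c *s v) = c * D v)"
    by (intro exI[of _ "\<lambda>v. D v + E v"]) (auto intro!: has_derivative_add simp: algebra_simps)
qed

lemma hol_on_cmult: "hol_on S f \<Longrightarrow> hol_on S (\<lambda>x. a * f x)"
  unfolding hol_on_def
proof
  fix x assume *: "\<forall>x\<in>S. \<exists>D. (f has_derivative D) (at x) \<and> (\<forall>c v. D (c *s v) = c * D v)" "x \<in> S"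
  then obtain D where "(f has_derivative D) (at x) \<and> (\<forall>c v. D (c *s v) = c * D v)" by blast
  then show "\<exists>D. ((\<lambda>x. a * f x) has_derivative D) (at x) \<and> (\<forall>c v. D (c *s v) = c * D v)"
    by (intro exI[of _ "\<lambda>v. a * D v"]) (auto intro!: has_derivative_mult_right simp: algebra_simps)
qed

lemma hol_on_zero: "hol_on S (\<lambda>x. 0)"
  unfolding hol_on_def by (intro ballI exI[of _ "\<lambda>_. 0"]) auto

lemma hol_on_line:
  assumes "hol_on S f" "x + \<zeta> *s v \<in> S"
  shows "((\<lambda>\<zeta>. f (x + \<zeta> *s v)) has_field_derivative frechet_derivative f (at (x + \<zeta> *s v)) v) (at \<zeta>)"
proof -
  have "((\<lambda>\<zeta>. x + \<zeta> *s v) has_derivative (\<lambda>h. h *s v)) (at \<zeta>)"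
    using bounded_linear.has_derivative[OF bounded_linear_smult_left has_derivative_ident]
    by (auto intro!: derivative_eq_intros)
  then have "((\<lambda>\<zeta>. f (x + \<zeta> *s v)) has_derivative (\<lambda>h. frechet_derivative f (at (x + \<zeta> *s v)) (h *s v))) (at \<zeta>)"
    by (rule has_derivative_compose) (rule hol_on_has_derivative(1)[OF assms])
  moreover have "(\<lambda>h. frechet_derivative f (at (x + \<zeta> *s v)) (h *s v)) = (*) (frechet_derivative f (at (x + \<zeta> *s v)) v)"
    by (rule ext) (simp add: hol_on_has_derivative(2)[OF assms])
  ultimately show ?thesis unfolding has_field_derivative_def by simp
qed

abbreviation circ :: "real \<Rightarrow> real \<Rightarrow> complex" where
  "circ r t \<equiv> complex_of_real r * exp (2 * complex_of_real pi * \<i> * complex_of_real t)"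

lemma norm_circ: "r > 0 \<Longrightarrow> cmod (circ r t) = r"
  by (simp add: norm_mult)

text \<open>Cauchy's formula on the complex line through \<open>x\<close> in direction
  \<open>v\<close>. It writes a derivative as an integral of values of \<open>f\<close>, so
  properties of \<open>f\<close> pass to its derivatives.\<close>

lemma hol_on_Cauchy:
  assumes f: "hol_on S f" and r: "r > 0" and S: "\<And>\<zeta>. cmod \<zeta> \<le> r \<Longrightarrow> x + \<zeta> *s v \<in> S"
  shows "frechet_derivative f (at x) v = integral {0..1} (\<lambda>t. f (x + circ r t *s v) / circ r t)"
proof -
  define g where "g \<zeta> = f (x + \<zeta> *s v)" for \<zeta>
  have d: "(g has_field_derivative frechet_derivative f (at (x + \<zeta> *s v)) v) (at \<zeta>)" if "cmod \<zeta> \<le> r" for \<zeta>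
    unfolding g_def by (rule hol_on_line[OF f S[OF that]])
  have hol: "g holomorphic_on cball 0 r"
    using d by (intro holomorphic_onI) (auto simp: field_differentiable_def intro: field_differentiable_at_within has_field_derivative_at_within)
  have "(g has_field_derivative (1 / (2 * complex_of_real pi * \<i>) *
        contour_integral (circlepath 0 r) (\<lambda>u. g u / (u - 0)\<^sup>2))) (at 0)"
    using hol r by (intro Cauchy_derivative_integral_circlepath)
      (auto intro: holomorphic_on_imp_continuous_on holomorphic_on_subset)
  moreover have "(g has_field_derivative frechet_derivative f (at x) v) (at 0)"
    using d[of 0] r by simp
  ultimately have "frechet_derivative f (at x) v = 1 / (2 * complex_of_real pi * \<i>) *
        contour_integral (circlepath 0 r) (\<lambda>u. g u / (u - 0)\<^sup>2)"
    using DERIV_unique by blast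
  also have "\<dots> = integral {0..1} (\<lambda>t. 1 / (2 * complex_of_real pi * \<i>) * (g (circ r t) / (circ r t)\<^sup>2 *
      (2 * of_real pi * \<i> * circ r t)))"
    unfolding contour_integral_integral vector_derivative_circlepath integral_mult_right
    by (simp add: circlepath mult.assoc)
  also have "(\<lambda>t. 1 / (2 * complex_of_real pi * \<i>) * (g (circ r t) / (circ r t)\<^sup>2 *
      (2 * of_real pi * \<i> * circ r t))) = (\<lambda>t. f (x + circ r t *s v) / circ r t)"
    using r by (intro ext) (simp add: g_def power2_eq_square field_simps)
  finally show ?thesis .
qed

text \<open>A single radius serves all centres near \<open>x0\<close>; this permits treating the
  centre in Cauchy's formula as a parameter of the integral.\<close>

lemma circ_nbhd:
  fixes x0 v :: "complex^'n"
  assumes "open S" "x0 \<in> S"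
  obtains \<delta> r where "\<delta> > 0" "r > 0" "ball x0 \<delta> \<subseteq> S"
    "\<And>x \<zeta>. x \<in> ball x0 \<delta> \<Longrightarrow> cmod \<zeta> \<le> r \<Longrightarrow> x + \<zeta> *s v \<in> S"
proof -
  obtain e where e: "e > 0" "ball x0 e \<subseteq> S" using assms openE by blast
  \<comment> \<open>Half of \<open>e\<close> is reserved for moving the centre and half for the
    displacement along \<open>v\<close>; the added 1 covers a vanishing direction.\<close>
  define r where "r = e / (2 * (norm v + 1))"
  have n: "norm v + 1 > 0" by (simp add: add_nonneg_pos)
  have r: "r > 0" using e n by (simp add: r_def)
  have rv: "r * norm v \<le> e / 2"
  proof -
    have "r * norm v \<le> r * (norm v + 1)" using r by simp
    also have "r * (norm v + 1) = e * ((norm v + 1) / (2 * (norm v + 1)))" by (simp add: r_def)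
    also have "(norm v + 1) / (2 * (norm v + 1)) = 1 / 2" using n by simp
    finally show ?thesis by simp
  qed
  have "x + \<zeta> *s v \<in> S" if "x \<in> ball x0 (e/2)" "cmod \<zeta> \<le> r" for x \<zeta>
  proof -
    have "norm (\<zeta> *s v) \<le> r * norm v" using that by (simp add: norm_vector_smult mult_right_mono)
    then have "norm (\<zeta> *s v) \<le> e / 2" using rv by simp
    moreover have "dist x0 (x + \<zeta> *s v) \<le> dist x0 x + norm (\<zeta> *s v)"
      using dist_triangle[of x0 "x + \<zeta> *s v" x] by (simp add: dist_norm)
    ultimately have "dist x0 (x + \<zeta> *s v) < e" using that by simp
    then show ?thesis using e by auto
  qed
  moreover have "ball x0 (e/2) \<subseteq> S" using e by auto
  ultimately show ?thesis using that[of "e/2" r] e(1) r by simp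
qed

lemma hol_on_deriv_continuous:
  fixes f :: "complex^'n \<Rightarrow> complex"
  assumes "open S" "hol_on S f"
  shows "continuous_on S (\<lambda>x. frechet_derivative f (at x) v)"
proof (rule continuous_at_imp_continuous_on, rule ballI)
  fix x0 assume x0: "x0 \<in> S"
  obtain \<delta> r where d: "\<delta> > 0" "r > 0" "ball x0 \<delta> \<subseteq> S"
    "\<And>x \<zeta>. x \<in> ball x0 \<delta> \<Longrightarrow> cmod \<zeta> \<le> r \<Longrightarrow> x + \<zeta> *s v \<in> S"
    using circ_nbhd[OF assms(1) x0, of v] by blast
  have "continuous_on (ball x0 \<delta>) (\<lambda>x. integral (cbox 0 1) (\<lambda>t. f (x + circ r t *s v) / circ r t))"
  proof (rule integral_continuous_on_param)
    have "continuous_on (ball x0 \<delta> \<times> cbox 0 1) (\<lambda>z. f (fst z + circ r (snd z) *s v))"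
      by (rule continuous_on_compose2[OF hol_on_continuous[OF assms(2)]])
        (use d norm_circ in \<open>auto intro!: continuous_intros bounded_linear.continuous_on[OF bounded_linear_smult_left]\<close>)
    then show "continuous_on (ball x0 \<delta> \<times> cbox 0 1) (\<lambda>(x, t). f (x + circ r t *s v) / circ r t)"
      using d by (auto simp: case_prod_beta intro!: continuous_intros)
  qed
  then have "continuous_on (ball x0 \<delta>) (\<lambda>x. frechet_derivative f (at x) v)"
    by (rule continuous_on_eq) (use d hol_on_Cauchy[OF assms(2) d(2)] in auto)
  then show "isCont (\<lambda>x. frechet_derivative f (at x) v) x0"
    using d(1) by (auto simp: continuous_on_eq_continuous_at)
qed

text \<open>Differentiation of Cauchy's formula under the integral sign. The derivative is the
  integral of complex linear maps, hence complex linear, which is what \<open>hol_on\<close>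
  demands.\<close>

lemma hol_on_deriv:
  fixes f :: "complex^'n \<Rightarrow> complex"
  assumes "open S" "hol_on S f"
  shows "hol_on S (\<lambda>x. frechet_derivative f (at x) v)"
  unfolding hol_on_def
proof
  fix x0 assume x0: "x0 \<in> S"
  obtain \<delta> r where d: "\<delta> > 0" "r > 0" "ball x0 \<delta> \<subseteq> S"
    "\<And>x \<zeta>. x \<in> ball x0 \<delta> \<Longrightarrow> cmod \<zeta> \<le> r \<Longrightarrow> x + \<zeta> *s v \<in> S"
    using circ_nbhd[OF assms(1) x0, of v] by blast
  let ?U = "ball x0 \<delta>"
  let ?D = "\<lambda>x. frechet_derivative f (at x)"
  \<comment> \<open>The derivative of the integrand becomes a bounded linear map because the Leibniz
    rule needs joint continuity in operator norm; in finite dimension this may be checked on each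
    basis vector.\<close>
  define fx where "fx x t = Blinfun (\<lambda>h. ?D (x + circ r t *s v) h / circ r t)" for x t
  have inS: "x + circ r t *s v \<in> S" if "x \<in> ?U" for x t
    using d that norm_circ[OF d(2)] by simp
  have fx: "blinfun_apply (fx x t) = (\<lambda>h. ?D (x + circ r t *s v) h / circ r t)" if "x \<in> ?U" for x t
  proof -
    have "bounded_linear (?D (x + circ r t *s v))"
      using hol_on_has_derivative(1)[OF assms(2) inS[OF that]] has_derivative_bounded_linear by blast
    then have "bounded_linear (\<lambda>h. ?D (x + circ r t *s v) h / circ r t)"
      using bounded_linear_compose[OF bounded_linear_divide] by fast
    then show ?thesis unfolding fx_def by (rule bounded_linear_Blinfun_apply)
  qed
  have cont: "continuous_on (?U \<times> cbox 0 1) (\<lambda>(x, t). fx x t)"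
  proof (rule continuous_on_blinfun_componentwise)
    fix i :: "complex^'n"
    have "continuous_on (?U \<times> cbox 0 1) (\<lambda>z. ?D (fst z + circ r (snd z) *s v) i)"
      by (rule continuous_on_compose2[OF hol_on_deriv_continuous[OF assms]])
        (use inS in \<open>auto intro!: continuous_intros bounded_linear.continuous_on[OF bounded_linear_smult_left]\<close>)
    then have "continuous_on (?U \<times> cbox 0 1) (\<lambda>z. ?D (fst z + circ r (snd z) *s v) i / circ r (snd z))"
      using d by (auto intro!: continuous_intros)
    then show "continuous_on (?U \<times> cbox 0 1) (\<lambda>x. blinfun_apply (case x of (x, t) \<Rightarrow> fx x t) i)"
      by (rule continuous_on_eq) (auto simp: fx)
  qed
  have int: "fx x0 integrable_on cbox 0 1"
  proof (rule integrable_continuous)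
    have "continuous_on (cbox 0 1) (\<lambda>t. (\<lambda>(x, t). fx x t) (x0, t))"
      by (rule continuous_on_compose2[OF cont]) (use d in \<open>auto intro!: continuous_intros\<close>)
    then show "continuous_on (cbox 0 1) (fx x0)" by simp
  qed
  have "((\<lambda>x. integral (cbox 0 1) (\<lambda>t. f (x + circ r t *s v) / circ r t)) has_derivative
      blinfun_apply (integral (cbox 0 1) (fx x0))) (at x0 within ?U)"
  proof (rule leibniz_rule[OF _ _ cont])
    fix x t assume x: "x \<in> ?U" and "t \<in> cbox (0::real) 1"
    have "((\<lambda>x. f (x + circ r t *s v)) has_derivative (\<lambda>h. ?D (x + circ r t *s v) h)) (at x within ?U)"
      by (rule has_derivative_compose[of "\<lambda>x. x + circ r t *s v" "\<lambda>h. h"])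
        (use hol_on_has_derivative(1)[OF assms(2) inS[OF x]] in \<open>auto intro!: derivative_eq_intros\<close>)
    then have "((\<lambda>x. f (x + circ r t *s v) / circ r t) has_derivative (\<lambda>h. ?D (x + circ r t *s v) h / circ r t)) (at x within ?U)"
      by (rule bounded_linear.has_derivative[OF bounded_linear_divide])
    then show "((\<lambda>x. f (x + circ r t *s v) / circ r t) has_derivative blinfun_apply (fx x t)) (at x within ?U)"
      using fx[OF x] by simp
  next
    fix x assume x: "x \<in> ?U"
    have "continuous_on (cbox 0 1) (\<lambda>t. f (x + circ r t *s v))"
      by (rule continuous_on_compose2[OF hol_on_continuous[OF assms(2)]])
        (use inS[OF x] in \<open>auto intro!: continuous_intros bounded_linear.continuous_on[OF bounded_linear_smult_left]\<close>)
    then show "(\<lambda>t. f (x + circ r t *s v) / circ r t) integrable_on cbox 0 1"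
      using d by (intro integrable_continuous) (auto intro!: continuous_intros)
  qed (use d in auto)
  then have der: "((\<lambda>x. integral (cbox 0 1) (\<lambda>t. f (x + circ r t *s v) / circ r t)) has_derivative
      blinfun_apply (integral (cbox 0 1) (fx x0))) (at x0)"
    using d(1) by (simp add: at_within_open[of x0 ?U])
  have "((\<lambda>x. ?D x v) has_derivative blinfun_apply (integral (cbox 0 1) (fx x0))) (at x0)"
    by (rule has_derivative_transform_within_open[OF der, of ?U])
      (use d hol_on_Cauchy[OF assms(2) d(2)] in auto)
  moreover have "blinfun_apply (integral (cbox 0 1) (fx x0)) (c *s w) =
      c * blinfun_apply (integral (cbox 0 1) (fx x0)) w" for c w
  proof -
    have "blinfun_apply (fx x0 t) (c *s w) = c * blinfun_apply (fx x0 t) w" for t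
      using d fx[of x0 t] hol_on_has_derivative(2)[OF assms(2) inS[of x0 t]] by simp
    then show ?thesis using int by (simp add: blinfun_apply_integral)
  qed
  ultimately show "\<exists>D. ((\<lambda>x. ?D x v) has_derivative D) (at x0) \<and> (\<forall>c w. D (c *s w) = c * D w)"
    by blast
qed

lemma hol_on_smooth:
  fixes f :: "complex^'n \<Rightarrow> complex"
  assumes "open S" "hol_on S f"
  shows "smooth_on S f"
proof -
  have "Ck_on k S f" for k
    using assms(2)
  proof (induction k arbitrary: f)
    case 0
    then show ?case using hol_on_continuous by simp
  next
    case (Suc k)
    then show ?case using assms(1) hol_on_deriv hol_on_has_derivative(1)
      by (intro Ck_on_SucI[where f' = "\<lambda>x. frechet_derivative f (at x)"]) auto
  qed
  then show ?thesis by (simp add: smooth_on_def)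
qed

text \<open>On the complex line joining p and q, rescaled so that the ball of radius r becomes the
  unit disc, this is the Schwarz lemma of one variable.\<close>

lemma hol_on_Schwarz:
  fixes f :: "complex^'n \<Rightarrow> complex"
  assumes f: "hol_on S f" and S: "ball p r \<subseteq> S" and B: "\<And>z. z \<in> ball p r \<Longrightarrow> cmod (f z) \<le> B"
    and p: "f p = 0" and q: "q \<in> ball p r"
  shows "cmod (f q) \<le> B * (dist p q / r)"
proof (cases "q = p")
  case True
  then show ?thesis using p by simp
next
  case False
  define v where "v = q - p"
  have v: "norm v > 0" "norm v < r" using False q by (auto simp: v_def dist_norm norm_minus_commute)
  have r: "r > 0" using v by linarith
  have B0: "B \<ge> 0" using B[of p] r p by simp
  \<comment> \<open>The slack \<open>e\<close> makes the bound on the unit disc strict and the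
    divisor positive even for \<open>B = 0\<close>; it tends to 0 at the end.\<close>
  have key: "cmod (f q) \<le> (B + e) * (norm v / r)" if e: "e > 0" for e
  proof -
    define g where "g w = f (p + (of_real (r / norm v) * w) *s v) / of_real (B + e)" for w
    have inb: "p + (of_real (r / norm v) * w) *s v \<in> ball p r" if "cmod w < 1" for w
      using that v r by (simp add: dist_norm norm_vector_smult norm_mult norm_divide)
    have "g holomorphic_on ball 0 1"
    proof (rule holomorphic_onI)
      fix w :: complex assume "w \<in> ball 0 1"
      then have w: "p + (of_real (r / norm v) * w) *s v \<in> S" using inb S by auto
      have "((\<lambda>w. f (p + (of_real (r / norm v) * w) *s v)) has_field_derivative
         frechet_derivative f (at (p + (of_real (r / norm v) * w) *s v)) v * of_real (r / norm v)) (at w)"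
        by (rule DERIV_chain'[where f="\<lambda>w. of_real (r / norm v) * w" and g="\<lambda>\<zeta>. f (p + \<zeta> *s v)",
              OF DERIV_cmult_Id hol_on_line[OF f w]])
      from DERIV_cdivide[OF this, of "of_real (B + e)"]
      have "g field_differentiable at w" unfolding g_def field_differentiable_def by blast
      then show "g field_differentiable at w within ball 0 1"
        by (rule field_differentiable_at_within)
    qed
    moreover have "g 0 = 0" using p by (simp add: g_def)
    moreover have "cmod (g w) < 1" if "cmod w < 1" for w
    proof -
      have "cmod (f (p + (of_real (r / norm v) * w) *s v)) \<le> B" using B inb[OF that] by blast
      moreover have "cmod (complex_of_real (B + e)) = B + e" using B0 e by (simp only: norm_of_real)
      ultimately show ?thesis unfolding g_def norm_divide using e B0 by simp
    qed
    moreover have "cmod (complex_of_real (norm v / r)) < 1" using v r by (simp add: norm_divide)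
    ultimately have "cmod (g (of_real (norm v / r))) \<le> cmod (complex_of_real (norm v / r))"
      by (rule Schwarz_Lemma(1))
    moreover have "g (of_real (norm v / r)) = f q / of_real (B + e)"
      using v r by (simp add: g_def v_def)
    moreover have "cmod (complex_of_real (B + e)) = B + e" using B0 e by (simp only: norm_of_real)
    moreover have "cmod (complex_of_real (norm v / r)) = norm v / r" using r by (simp add: norm_divide)
    ultimately have "cmod (f q) / (B + e) \<le> norm v / r" by (simp only: norm_divide)
    then show ?thesis using B0 e by (simp add: pos_divide_le_eq mult.commute)
  qed
  have "cmod (f q) \<le> B * (norm v / r) + e" if "e > 0" for e
  proof -
    have "cmod (f q) \<le> (B + e) * (norm v / r)" by (rule key[OF that])
    also have "\<dots> = B * (norm v / r) + e * (norm v / r)" by (rule distrib_right)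
    also have "e * (norm v / r) \<le> e" using that v r mult_left_le[of "norm v / r" e] by simp
    finally show ?thesis by simp
  qed
  then have "cmod (f q) \<le> B * (norm v / r)" by (rule field_le_epsilon)
  then show ?thesis by (simp add: v_def dist_norm norm_minus_commute)
qed

subsection \<open>Holomorphic maps\<close>

lemma frechet_derivative_vec_nth:
  fixes f :: "complex^'n \<Rightarrow> complex^'m"
  assumes "f differentiable at z"
  shows "frechet_derivative (\<lambda>z. f z $ k) (at z) v = frechet_derivative f (at z) v $ k"
  by (rule frechet_derivative_bounded_linear[OF bounded_linear_vec_nth assms])

lemma hol_map_smooth:
  fixes \<tau> :: "complex^'n \<Rightarrow> complex^'n"
  assumes "open S" "\<And>k. hol_on S (\<lambda>z. \<tau> z $ k)"
  shows "smooth_on S \<tau>"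
  by (rule smooth_on_vec) (use assms hol_on_smooth in auto)

lemma hol_map_deriv_smult:
  fixes \<tau> :: "complex^'n \<Rightarrow> complex^'n"
  assumes "open S" "\<And>k. hol_on S (\<lambda>z. \<tau> z $ k)" "z \<in> S"
  shows "frechet_derivative \<tau> (at z) (c *s v) = c *s frechet_derivative \<tau> (at z) v"
  using frechet_derivative_vec_nth[OF smooth_on_differentiable[OF hol_map_smooth[OF assms(1,2)] assms(3)]]
    hol_on_has_derivative(2)[OF assms(2,3)]
  by (simp add: vec_eq_iff)

text \<open>Together with the symmetry of second derivatives this says that the second derivative of
  a holomorphic map changes sign when J is applied to both arguments, the reason why the Levi form
  transforms as a tensor.\<close>

lemma hol_map_deriv2_smult:
  fixes \<tau> :: "complex^'n \<Rightarrow> complex^'n"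
  assumes "open S" "\<And>k. hol_on S (\<lambda>z. \<tau> z $ k)" "z \<in> S"
  shows "frechet_derivative (\<lambda>z. frechet_derivative \<tau> (at z) u) (at z) (c *s v) =
    c *s frechet_derivative (\<lambda>z. frechet_derivative \<tau> (at z) u) (at z) v"
proof (rule hol_map_deriv_smult[OF assms(1) _ assms(3)])
  fix k
  have "hol_on S (\<lambda>z. frechet_derivative (\<lambda>z. \<tau> z $ k) (at z) u)"
    by (rule hol_on_deriv[OF assms(1,2)])
  moreover have "frechet_derivative (\<lambda>z. \<tau> z $ k) (at z) u = frechet_derivative \<tau> (at z) u $ k" if "z \<in> S" for z
    by (rule frechet_derivative_vec_nth[OF smooth_on_differentiable[OF hol_map_smooth[OF assms(1,2)] that]])
  ultimately show "hol_on S (\<lambda>z. frechet_derivative \<tau> (at z) u $ k)"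
    unfolding hol_on_def using assms(1)
    by (meson has_derivative_transform_within_open)
qed

section \<open>Hermitian forms and Pfaffians\<close>

definition orthonormal :: "('b \<Rightarrow> 'b \<Rightarrow> complex) \<Rightarrow> 'b set \<Rightarrow> bool" where
  "orthonormal h E \<longleftrightarrow> (\<forall>s\<in>E. \<forall>t\<in>E. h s t = (if s = t then 1 else 0))"

text \<open>An orthonormal set of maximal size reproduces every vector, since a nonzero remainder
  could be normalised and added. Finite dimension enters only as a bound on the size of orthonormal
  sets, because for holomorphic sections that bound is what analysis provides.\<close>

lemma gram_schmidt:
  fixes scale :: "complex \<Rightarrow> 'b::ab_group_add \<Rightarrow> 'b" and h :: "'b \<Rightarrow> 'b \<Rightarrow> complex"
  assumes vs: "vector_space scale" and sub: "module.subspace scale V"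
    and add: "\<And>s t u. s \<in> V \<Longrightarrow> t \<in> V \<Longrightarrow> u \<in> V \<Longrightarrow> h (s + t) u = h s u + h t u"
    and scal: "\<And>c s u. s \<in> V \<Longrightarrow> u \<in> V \<Longrightarrow> h (scale c s) u = c * h s u"
    and sym: "\<And>s t. s \<in> V \<Longrightarrow> t \<in> V \<Longrightarrow> h t s = cnj (h s t)"
    and pos: "\<And>s. s \<in> V \<Longrightarrow> s \<noteq> 0 \<Longrightarrow> Re (h s s) > 0"
    and bound: "\<And>E. finite E \<Longrightarrow> E \<subseteq> V \<Longrightarrow> orthonormal h E \<Longrightarrow> card E \<le> N"
  obtains E where "finite E" "E \<subseteq> V" "orthonormal h E"
    "\<forall>s\<in>V. s = (\<Sum>e\<in>E. scale (h s e) e)" "vector_space.dim scale V = card E"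
proof -
  interpret vector_space scale by (rule vs)
  let ?on = "\<lambda>E. finite E \<and> E \<subseteq> V \<and> orthonormal h E"
  have h_sum: "h (\<Sum>e\<in>E. scale (c e) e) t = (\<Sum>e\<in>E. c e * h e t)"
    if "finite E" "E \<subseteq> V" "t \<in> V" for E c t
    using that
  proof (induction E rule: finite_induct)
    case empty
    have "h (scale 0 t) t = 0 * h t t" using scal that by blast
    then show ?case by simp
  next
    case (insert a E)
    have "(\<Sum>e\<in>E. scale (c e) e) \<in> V" using insert sub by (intro subspace_sum subspace_scale) auto
    then show ?case using insert sub by (simp add: add scal subspace_scale)
  qed
  have on_bound: "card E \<le> N" if "?on E" for E
    using that bound by blast
  define K where "K = card ` Collect ?on"
  have "K \<subseteq> {..N}" using on_bound by (auto simp: K_def)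
  then have K: "finite K" by (rule finite_subset) simp
  have "card ({} :: 'b set) \<in> K" unfolding K_def by (rule imageI) (simp add: orthonormal_def)
  then have "K \<noteq> {}" by blast
  with K have "Max K \<in> K" by (rule Max_in)
  then obtain E where E0: "?on E" "card E = Max K" unfolding K_def by auto
  have mx: "card E' \<le> card E" if "?on E'" for E'
    unfolding E0(2) using K that by (intro Max_ge) (auto simp: K_def)
  from E0(1) have E': "finite E" "E \<subseteq> V" "orthonormal h E" by blast+
  then have E: "finite E" "E \<subseteq> V" "\<forall>s\<in>E. \<forall>t\<in>E. h s t = (if s = t then 1 else 0)"
    by (simp_all add: orthonormal_def)
  have rep: "s = (\<Sum>e\<in>E. scale (h s e) e)" if s: "s \<in> V" for s
  proof (rule ccontr)
    define p where "p = (\<Sum>e\<in>E. scale (h s e) e)"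
    define r where "r = s - p"
    assume "s \<noteq> (\<Sum>e\<in>E. scale (h s e) e)"
    then have r0: "r \<noteq> 0" by (simp add: r_def p_def)
    have p: "p \<in> V" unfolding p_def using E sub by (intro subspace_sum subspace_scale) auto
    have r: "r \<in> V" using s p sub by (simp add: r_def subspace_diff)
    have s_eq: "s = r + p" by (simp add: r_def)
    have re: "h r e = 0" if "e \<in> E" for e
    proof -
      have "h p e = (\<Sum>e'\<in>E. h s e' * h e' e)" unfolding p_def using E that by (intro h_sum) auto
      also have "\<dots> = (\<Sum>e'\<in>E. if e' = e then h s e else 0)"
        using E that by (intro sum.cong) auto
      also have "\<dots> = h s e" using E that by simp
      finally have "h p e = h s e" .
      moreover have "h s e = h r e + h p e" using add[OF r p, of e] that E s_eq by auto
      ultimately show ?thesis by simp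
    qed
    have hr: "Re (h r r) > 0" by (rule pos[OF r r0])
    have him: "h r r = of_real (Re (h r r))" using sym[OF r r] by (simp add: complex_eq_iff)
    define c where "c = complex_of_real (1 / sqrt (Re (h r r)))"
    define f where "f = scale c r"
    have f: "f \<in> V" using r sub by (simp add: f_def subspace_scale)
    have hfr: "h f t = c * h r t" if "t \<in> V" for t unfolding f_def using scal[OF r that] .
    have hfe: "h f e = 0" "h e f = 0" if "e \<in> E" for e
      using hfr[of e] re[OF that] sym[of f e] f E that by auto
    have "h f f = c * h r f" using hfr f by simp
    also have "h r f = cnj (h f r)" using sym[OF f r] by simp
    also have "h f r = c * h r r" using hfr r by simp
    also have "c * cnj (c * h r r) = 1"
      using hr by (subst him) (simp add: c_def complex_eq_iff field_simps flip: power2_eq_square)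
    finally have hff: "h f f = 1" .
    have fE: "f \<notin> E" using hfe hff by force
    have "?on (insert f E)" using E f hfe hff fE by (auto simp: orthonormal_def)
    then have "card (insert f E) \<le> card E" using mx by blast
    then show False using fE E by simp
  qed
  have ind: "independent E"
  proof
    assume "dependent E"
    then obtain u v where u: "v \<in> E" "u v \<noteq> 0" "(\<Sum>e\<in>E. scale (u e) e) = 0"
      using dependent_finite[OF E(1)] by auto
    have "(\<Sum>e\<in>E. u e * h e v) = h 0 v" using h_sum[OF E(1,2), of v u] u E by auto
    also have "\<dots> = 0" using scal[of v v 0] u E by auto
    also have "(\<Sum>e\<in>E. u e * h e v) = (\<Sum>e\<in>E. if e = v then u v else 0)"
      using E u by (intro sum.cong) auto
    finally show False using u E by simp
  qed
  have "V \<subseteq> span E"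
  proof
    fix s assume "s \<in> V"
    then have "s = (\<Sum>e\<in>E. scale (h s e) e)" by (rule rep)
    also have "\<dots> \<in> span E" by (intro span_sum span_scale span_base)
    finally show "s \<in> span E" .
  qed
  then have "span E = span V" using E span_mono span_minimal[OF _ subspace_span] by blast
  then have "dim V = card E" using ind by (rule dim_eq_card)
  then show ?thesis using that E' rep by blast
qed

lemma orthonormal_independent:
  fixes h :: "complex^'n \<Rightarrow> complex^'n \<Rightarrow> complex"
  assumes add: "\<And>s t u. h (s + t) u = h s u + h t u" and scal: "\<And>c s u. h (c *s s) u = c * h s u"
    and E: "finite E" "orthonormal h E"
  shows "card E \<le> CARD('n)"
proof -
  note on = E(2)[unfolded orthonormal_def]
  have h0: "h 0 v = 0" for v using scal[of 0 0 v] by simp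
  have h_sum: "h (\<Sum>e\<in>E. u e *s e) t = (\<Sum>e\<in>E. u e * h e t)" for u t
    using E(1) by (induction E rule: finite_induct) (auto simp: h0 add scal)
  have "vec.independent E"
  proof
    assume "vec.dependent E"
    then obtain u v where u: "v \<in> E" "u v \<noteq> 0" "(\<Sum>e\<in>E. u e *s e) = 0"
      using vec.dependent_finite[OF E(1)] by auto
    have "(\<Sum>e\<in>E. u e * h e v) = 0" using h_sum[of u v] u h0 by simp
    also have "(\<Sum>e\<in>E. u e * h e v) = (\<Sum>e\<in>E. if e = v then u v else 0)"
      using on u by (intro sum.cong) auto
    finally show False using u E by simp
  qed
  then have "card E = vec.dim E" by (simp add: vec.dim_eq_card_independent)
  also have "\<dots> \<le> vec.dim (UNIV :: (complex^'n) set)" by (rule vec.dim_subset) simp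
  also have "\<dots> = CARD('n)" by (metis vec_dim_card)
  finally show ?thesis .
qed

text \<open>The expression of \<open>top_power\<close> for an arbitrary family of vectors, that is,
  the Pfaffian of the matrix of values of the form on that family.\<close>

definition pfaffian :: "('v \<Rightarrow> 'v \<Rightarrow> real) \<Rightarrow> ('n::finite \<times> bool \<Rightarrow> 'v) \<Rightarrow> real" where
  "pfaffian \<omega> v = (\<Sum>p | p permutes (UNIV :: ('n \<times> bool) set). of_int (sign p) *
        (\<Prod>k\<in>UNIV. \<omega> (v (p (k, False))) (v (p (k, True))))) / (2 ^ CARD('n) * fact CARD('n))"

lemma prod_pairs:
  fixes f :: "'n::finite \<times> bool \<Rightarrow> 'a::comm_monoid_mult"
  shows "(\<Prod>i\<in>UNIV. f i) = (\<Prod>k\<in>UNIV. f (k, False) * f (k, True))"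
proof -
  have "(\<Prod>i\<in>UNIV. f i) = (\<Prod>k\<in>UNIV. \<Prod>b\<in>UNIV. f (k, b))"
    by (simp add: prod.cartesian_product)
  then show ?thesis by (simp add: UNIV_bool mult.commute)
qed

lemma sum_pairs:
  fixes f :: "'n::finite \<times> bool \<Rightarrow> 'a::comm_monoid_add"
  shows "(\<Sum>i\<in>UNIV. f i) = (\<Sum>k\<in>UNIV. f (k, False) + f (k, True))"
proof -
  have "(\<Sum>i\<in>UNIV. f i) = (\<Sum>k\<in>UNIV. \<Sum>b\<in>UNIV. f (k, b))"
    by (simp add: sum.cartesian_product)
  then show ?thesis by (simp add: UNIV_bool add.commute)
qed

lemma det_select_rows:
  fixes B :: "real^'i^'i"
  shows "det (\<chi> i. B $ \<psi> i) = (if \<psi> permutes UNIV then of_int (sign \<psi>) * det B else 0)"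
proof (cases "\<psi> permutes UNIV")
  case True
  then show ?thesis using det_permute_rows[OF True, of B] by simp
next
  case False
  then have "\<not> inj \<psi>"
    by (meson UNIV_I bij_imp_permutes finite inj_on_imp_bij_betw top_greatest finite_UNIV_inj_surj bij_def)
  then obtain i j where "i \<noteq> j" "\<psi> i = \<psi> j" by (auto simp: inj_def)
  then have "det (\<chi> i. B $ \<psi> i) = 0" by (intro det_identical_rows[of i j]) (auto simp: row_def)
  then show ?thesis using False by simp
qed

text \<open>Multilinear expansion gives a sum over all index maps. Its inner sum over permutations
  is a determinant with rows selected by the index map, which vanishes unless the map is a
  permutation and is otherwise \<open>det B\<close> up to sign.\<close>

lemma pfaffian_basis_change:
  fixes \<omega> :: "'v::real_vector \<Rightarrow> 'v \<Rightarrow> real" and w :: "'n::finite \<times> bool \<Rightarrow> 'v"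
    and B :: "real^('n\<times>bool)^('n\<times>bool)"
  assumes l: "\<And>u. linear (\<omega> u)" and r: "\<And>u. linear (\<lambda>v. \<omega> v u)"
  shows "pfaffian \<omega> (\<lambda>i. \<Sum>j\<in>UNIV. B $ i $ j *\<^sub>R w j) = det B * pfaffian \<omega> w"
proof -
  let ?P = "{p. p permutes (UNIV :: ('n \<times> bool) set)}"
  define W where "W \<psi> = (\<Prod>k\<in>UNIV. \<omega> (w (\<psi> (k, False))) (w (\<psi> (k, True))))" for \<psi> :: "'n \<times> bool \<Rightarrow> 'n \<times> bool"
  have om: "\<omega> (\<Sum>j\<in>UNIV. a j *\<^sub>R w j) (\<Sum>l\<in>UNIV. b l *\<^sub>R w l) =
      (\<Sum>q\<in>UNIV. a (fst q) * b (snd q) * \<omega> (w (fst q)) (w (snd q)))" for a b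
  proof -
    have "\<omega> (\<Sum>j\<in>UNIV. a j *\<^sub>R w j) (\<Sum>l\<in>UNIV. b l *\<^sub>R w l) =
       (\<Sum>j\<in>UNIV. a j * \<omega> (w j) (\<Sum>l\<in>UNIV. b l *\<^sub>R w l))"
      by (simp add: linear_sum[OF r] linear_scale[OF r])
    also have "\<dots> = (\<Sum>j\<in>UNIV. \<Sum>l\<in>UNIV. a j * b l * \<omega> (w j) (w l))"
      by (simp add: linear_sum[OF l] linear_scale[OF l] sum_distrib_left mult_ac)
    also have "\<dots> = (\<Sum>q\<in>UNIV. a (fst q) * b (snd q) * \<omega> (w (fst q)) (w (snd q)))"
      by (simp add: sum.cartesian_product case_prod_beta)
    finally show ?thesis .
  qed
  have expand: "(\<Prod>k\<in>UNIV. \<omega> (\<Sum>j\<in>UNIV. B $ p (k, False) $ j *\<^sub>R w j) (\<Sum>j\<in>UNIV. B $ p (k, True) $ j *\<^sub>R w j)) =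
    (\<Sum>\<psi>\<in>UNIV. (\<Prod>i\<in>UNIV. B $ p i $ \<psi> i) * W \<psi>)" for p
  proof -
    let ?f = "\<lambda>k q. B $ p (k, False) $ fst q * B $ p (k, True) $ snd q * \<omega> (w (fst q)) (w (snd q))"
    have "(\<Prod>k\<in>UNIV. \<omega> (\<Sum>j\<in>UNIV. B $ p (k, False) $ j *\<^sub>R w j) (\<Sum>j\<in>UNIV. B $ p (k, True) $ j *\<^sub>R w j)) =
      (\<Prod>k\<in>UNIV. \<Sum>q\<in>UNIV. ?f k q)" by (simp add: om)
    also have "\<dots> = (\<Sum>g\<in>UNIV. \<Prod>k\<in>UNIV. ?f k (g k))"
      using prod_sum_PiE[of UNIV "\<lambda>_. UNIV" ?f] by simp
    \<comment> \<open>Choosing a pair of indices for every \<open>k\<close> is the same as choosing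
      one index for every element of the doubled index type.\<close>
    also have "\<dots> = (\<Sum>\<psi>\<in>UNIV. (\<Prod>i\<in>UNIV. B $ p i $ \<psi> i) * W \<psi>)"
      by (rule sum.reindex_bij_witness[where i = "\<lambda>\<psi> k. (\<psi> (k, False), \<psi> (k, True))"
            and j = "\<lambda>g i. if snd i then snd (g (fst i)) else fst (g (fst i))"])
        (auto simp: fun_eq_iff prod_pairs W_def prod.distrib)
    finally show ?thesis .
  qed
  have "(\<Sum>p\<in>?P. of_int (sign p) * (\<Prod>k\<in>UNIV. \<omega> (\<Sum>j\<in>UNIV. B $ p (k, False) $ j *\<^sub>R w j) (\<Sum>j\<in>UNIV. B $ p (k, True) $ j *\<^sub>R w j))) =
     (\<Sum>p\<in>?P. \<Sum>\<psi>\<in>UNIV. of_int (sign p) * (\<Prod>i\<in>UNIV. B $ p i $ \<psi> i) * W \<psi>)"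
    by (simp add: expand sum_distrib_left mult.assoc)
  also have "\<dots> = (\<Sum>\<psi>\<in>UNIV. (\<Sum>p\<in>?P. of_int (sign p) * (\<Prod>i\<in>UNIV. B $ p i $ \<psi> i)) * W \<psi>)"
    by (subst sum.swap) (simp add: sum_distrib_right)
  also have "\<dots> = (\<Sum>\<psi>\<in>UNIV. det (\<chi> i. transpose B $ \<psi> i) * W \<psi>)"
    by (simp add: det_def transpose_def)
  also have "\<dots> = (\<Sum>\<psi>\<in>UNIV. if \<psi> permutes UNIV then of_int (sign \<psi>) * det B * W \<psi> else 0)"
    unfolding det_select_rows by (intro sum.cong) auto
  also have "\<dots> = (\<Sum>\<psi>\<in>?P. of_int (sign \<psi>) * det B * W \<psi>)"
    by (simp add: sum.If_cases)
  also have "\<dots> = det B * (\<Sum>\<psi>\<in>?P. of_int (sign \<psi>) * W \<psi>)"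
    by (simp add: sum_distrib_left mult_ac)
  finally show ?thesis unfolding pfaffian_def W_def by simp
qed

text \<open>Interchanges the two members of the pairs labelled by \<open>A\<close>. Combined with
  permutations of the pairs, these maps exhaust the permutations that contribute to the Pfaffian in
  a symplectic basis.\<close>

definition flip :: "'n set \<Rightarrow> 'n \<times> bool \<Rightarrow> 'n \<times> bool" where
  "flip A = (\<lambda>(k, b). (k, b \<noteq> (k \<in> A)))"

lemma flip_permutes: "flip A permutes (UNIV :: ('n::finite \<times> bool) set)"
  by (rule inj_imp_permutes) (auto simp: flip_def inj_def)

lemma permutation_finite: "p permutes (UNIV :: 'i::finite set) \<Longrightarrow> permutation p"
  by (auto simp: permutation_permutes intro!: exI[of _ "UNIV :: 'i set"])

lemma sign_flip: "sign (flip A :: 'n::finite \<times> bool \<Rightarrow> _) = (\<Prod>k\<in>UNIV. if k \<in> A then -1 else 1)"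
proof -
  have "finite A" by simp
  then have "sign (flip A :: 'n::finite \<times> bool \<Rightarrow> _) = (\<Prod>k\<in>A. -1)"
  proof (induction A rule: finite_induct)
    case empty
    have "flip {} = (id :: 'n \<times> bool \<Rightarrow> _)" by (auto simp: flip_def)
    then show ?case by simp
  next
    case (insert a A)
    have eq: "flip (insert a A) = Transposition.transpose (a, False) (a, True) \<circ> flip A"
      using insert by (auto simp: flip_def fun_eq_iff Transposition.transpose_def)
    have "sign (Transposition.transpose (a, False) (a, True) \<circ> flip A) = - sign (flip A)"
      using sign_compose[OF permutation_finite[OF permutes_swap_id] permutation_finite[OF flip_permutes],
          of "(a, False)" "(a, True)" A] by (simp add: sign_swap_id)
    then have "sign (flip (insert a A)) = - sign (flip A)" by (simp only: eq)
    then show ?case using insert by simp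
  qed
  also have "\<dots> = (\<Prod>k\<in>UNIV. if k \<in> A then -1 else 1)" by (simp add: prod.If_cases)
  finally show ?thesis .
qed

text \<open>A transposition of two pairs moves both members, so it is a product of two
  transpositions of indices.\<close>

lemma sign_map_fst:
  assumes "\<sigma> permutes (UNIV :: 'n::finite set)"
  shows "map_prod \<sigma> id permutes (UNIV :: ('n \<times> bool) set)"
    and "sign (map_prod \<sigma> id :: 'n \<times> bool \<Rightarrow> _) = 1"
proof -
  have "map_prod \<sigma> id permutes (UNIV :: ('n \<times> bool) set) \<and> sign (map_prod \<sigma> id :: 'n \<times> bool \<Rightarrow> _) = 1"
    using assms finite_class.finite_UNIV
  proof (induction rule: permutes_induct)
    case id
    have "map_prod id id = (id :: 'n \<times> bool \<Rightarrow> _)" by auto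
    then show ?case by (simp only: sign_id permutes_id simp_thms)
  next
    case (swap a b p)
    let ?s = "Transposition.transpose (a, False) (b, False) \<circ> Transposition.transpose (a, True) (b, True)"
    have p: "?s permutes (UNIV :: ('n \<times> bool) set)" by (intro permutes_compose permutes_swap_id) auto
    have eq: "map_prod (Transposition.transpose a b \<circ> p) id = ?s \<circ> map_prod p (id :: bool \<Rightarrow> bool)"
      by (auto simp: fun_eq_iff Transposition.transpose_def)
    have "sign ?s = 1"
      using swap by (subst sign_compose) (auto simp: sign_swap_id intro!: permutation_finite permutes_swap_id)
    moreover have q: "map_prod p id permutes (UNIV :: ('n \<times> bool) set)" "sign (map_prod p id :: 'n \<times> bool \<Rightarrow> _) = 1"
      using swap by blast+
    ultimately have "sign (?s \<circ> map_prod p (id :: bool \<Rightarrow> bool)) = 1"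
      by (subst sign_compose[OF permutation_finite[OF p] permutation_finite[OF q(1)]]) simp
    then show ?case unfolding eq using permutes_compose[OF q(1) p] by blast
  qed
  then show "map_prod \<sigma> id permutes (UNIV :: ('n \<times> bool) set)"
    and "sign (map_prod \<sigma> id :: 'n \<times> bool \<Rightarrow> _) = 1" by auto
qed

text \<open>A term is nonzero only if its permutation carries pairs to pairs. There are 2^n n! of
  these, and each contributes 1: a swap inside a pair changes the sign of the permutation and the
  sign of one factor.\<close>

lemma pfaffian_symplectic:
  fixes w :: "'n::finite \<times> bool \<Rightarrow> 'v"
  assumes "\<And>k l. \<omega> (w (k, False)) (w (l, True)) = (if k = l then 1 else 0)"
    and "\<And>k l. \<omega> (w (k, True)) (w (l, False)) = (if k = l then -1 else 0)"
    and "\<And>k l b. \<omega> (w (k, b)) (w (l, b)) = 0"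
  shows "pfaffian \<omega> w = 1"
proof -
  let ?P = "{p. p permutes (UNIV :: ('n \<times> bool) set)}"
  let ?t = "\<lambda>p. of_int (sign p) * (\<Prod>k\<in>UNIV. \<omega> (w (p (k, False))) (w (p (k, True)))) :: real"
  define \<Phi> where "\<Phi> = (\<lambda>(\<sigma> :: 'n \<Rightarrow> 'n, A). map_prod \<sigma> id \<circ> (flip A :: 'n \<times> bool \<Rightarrow> _))"
  define D where "D = {\<sigma>. \<sigma> permutes (UNIV :: 'n set)} \<times> (UNIV :: 'n set set)"
  have om: "\<omega> (w (k, b)) (w (l, c)) = (if k = l \<and> b \<noteq> c then (if b then -1 else 1) else 0)" for k l b c
    using assms by (cases b; cases c) auto
  have inj: "inj_on \<Phi> D"
  proof (rule inj_onI)
    fix x y assume xy: "x \<in> D" "y \<in> D" "\<Phi> x = \<Phi> y"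
    obtain \<sigma> A \<tau> B where [simp]: "x = (\<sigma>, A)" "y = (\<tau>, B)" by (metis prod.exhaust)
    have "\<Phi> x (k, False) = \<Phi> y (k, False)" for k using xy by simp
    then have "\<sigma> k = \<tau> k \<and> (k \<in> A) = (k \<in> B)" for k by (simp add: \<Phi>_def flip_def)
    then show "x = y" by (auto simp: fun_eq_iff)
  qed
  have img: "\<Phi> ` D \<subseteq> ?P"
    unfolding \<Phi>_def D_def using sign_map_fst(1) flip_permutes by (auto intro!: permutes_compose)
  have val: "?t (\<Phi> x) = 1" if "x \<in> D" for x
  proof -
    obtain \<sigma> A where [simp]: "x = (\<sigma>, A)" by (metis prod.exhaust)
    have \<sigma>: "\<sigma> permutes UNIV" using that by (simp add: D_def)
    have "sign (\<Phi> x) = sign (flip A :: 'n \<times> bool \<Rightarrow> _)"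
      by (simp add: \<Phi>_def sign_compose permutation_finite sign_map_fst[OF \<sigma>] flip_permutes)
    moreover have "(\<Prod>k\<in>UNIV. \<omega> (w (\<Phi> x (k, False))) (w (\<Phi> x (k, True)))) = (\<Prod>k\<in>UNIV. if k \<in> A then -1 else 1)"
      by (intro prod.cong) (auto simp: \<Phi>_def flip_def om)
    moreover have "(\<Prod>k\<in>UNIV. if k \<in> A then -1 else 1 :: real) * (\<Prod>k\<in>UNIV. if k \<in> A then -1 else 1) = 1"
      unfolding prod.distrib[symmetric] by (intro prod.neutral) auto
    ultimately show ?thesis by (simp add: sign_flip if_distrib of_int_prod cong: if_cong)
  qed
  have zero: "?t p = 0" if p: "p \<in> ?P - \<Phi> ` D" for p
  proof (rule ccontr)
    assume "?t p \<noteq> 0"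
    then have nz: "\<omega> (w (p (k, False))) (w (p (k, True))) \<noteq> 0" for k by auto
    have bij: "bij p" using p permutes_bij by blast
    define \<sigma> where "\<sigma> k = fst (p (k, False))" for k
    define A where "A = {k. snd (p (k, False))}"
    have pF: "p (k, False) = (\<sigma> k, k \<in> A)" for k by (simp add: \<sigma>_def A_def)
    have pT: "p (k, True) = (\<sigma> k, k \<notin> A)" for k
    proof -
      obtain l c where lc: "p (k, True) = (l, c)" by fastforce
      show ?thesis using nz[of k] unfolding pF lc om by (auto split: if_splits)
    qed
    have pk: "p = \<Phi> (\<sigma>, A)" by (auto simp: fun_eq_iff \<Phi>_def flip_def) (metis pF pT)+
    have "inj \<sigma>"
    proof (rule injI)
      fix k l assume e: "\<sigma> k = \<sigma> l"
      have "p (k, False) = p (l, False) \<or> p (k, False) = p (l, True)" using e pF pT by auto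
      then show "k = l" using bij by (auto simp: bij_def inj_def)
    qed
    then have "\<sigma> permutes UNIV" by (intro inj_imp_permutes) auto
    then have "p \<in> \<Phi> ` D" unfolding pk by (auto simp: D_def)
    then show False using p by blast
  qed
  have "(\<Sum>p\<in>?P. ?t p) = (\<Sum>p\<in>\<Phi> ` D. ?t p)"
    using img zero by (intro sum.mono_neutral_right) auto
  also have "\<dots> = (\<Sum>x\<in>D. ?t (\<Phi> x))" by (rule sum.reindex_cong[OF inj]) auto
  also have "\<dots> = of_nat (card D)" using val by simp
  also have "card D = fact CARD('n) * 2 ^ CARD('n)"
    using card_Pow[of "UNIV :: 'n set"]
    by (simp add: D_def card_cartesian_product card_permutations)
  finally show ?thesis unfolding pfaffian_def by simp
qed

subsection \<open>Hermitian metrics on complex vector spaces\<close>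

lemma inner_axis_complex: "v \<bullet> axis k (c::complex) = v $ k \<bullet> c"
  by (rule inner_axis)

lemma rbasis_nth: "rbasis (l, b) $ k = (if k = l then (if b then \<i> else 1) else 0)"
  by (simp add: rbasis_def axis_def)

lemma inner_rbasis [simp]:
  "v \<bullet> rbasis (k, False) = Re (v $ k)" "v \<bullet> rbasis (k, True) = Im (v $ k)"
  unfolding rbasis_def prod.case if_True if_False inner_axis_complex
  by (simp_all add: inner_complex_def)

lemma rbasis_expansion: "(\<Sum>i\<in>UNIV. (v \<bullet> rbasis i) *\<^sub>R rbasis i) = (v :: complex^'n)"
  by (auto simp: sum_pairs vec_eq_iff rbasis_nth complex_eq_iff if_distrib cong: if_cong)

lemma inner_rbasis_rbasis: "rbasis i \<bullet> (rbasis j :: complex^'n) = (if i = j then 1 else 0)"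
proof -
  obtain k b l c where "i = (k, b)" "j = (l, c)" by fastforce
  then show ?thesis by (cases b; cases c) (auto simp: rbasis_nth)
qed

lemma rbasis_True: "rbasis (k, True) = J (rbasis (k, False))"
  by (simp add: rbasis_def J_def vec_eq_iff axis_def)

lemma J_J [simp]: "J (J v) = - v"
  by (simp add: J_def vec_eq_iff)

lemma linear_J: "linear J"
  by (rule linearI) (auto simp: J_def vec_eq_iff algebra_simps complex_eq_iff)

definition hermitian_metric :: "(complex^'n \<Rightarrow> complex^'n \<Rightarrow> real) \<Rightarrow> bool" where
  "hermitian_metric g \<longleftrightarrow> (\<forall>u. linear (g u)) \<and> (\<forall>u v. g u v = g v u) \<and>
     (\<forall>u v. g (J u) (J v) = g u v) \<and> (\<forall>v. v \<noteq> 0 \<longrightarrow> g v v > 0)"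

lemma hermitian_metricD:
  assumes "hermitian_metric g"
  shows "linear (g u)" "linear (\<lambda>v. g v u)" "g u v = g v u" "g (J u) (J v) = g u v"
    "v \<noteq> 0 \<Longrightarrow> g v v > 0" "g (J u) v = - g u (J v)"
proof -
  show l: "linear (g u)" "g u v = g v u" "g (J u) (J v) = g u v" "v \<noteq> 0 \<Longrightarrow> g v v > 0" for u v
    using assms unfolding hermitian_metric_def by auto
  have "(\<lambda>v. g v u) = g u" using l(2) by blast
  then show "linear (\<lambda>v. g v u)" using l(1) by simp
  have "g (J u) v = g (J (J u)) (J v)" by (rule l(3)[symmetric])
  also have "\<dots> = g (J v) (- u)" using l(2)[of "- u" "J v"] by simp
  also have "\<dots> = - g u (J v)" using linear_neg[OF l(1), of "J v" u] l(2)[of u "J v"] by simp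
  finally show "g (J u) v = - g u (J v)" .
qed

section \<open>Representation of linear forms and Gram matrices\<close>

lemma real_riesz:
  fixes g :: "'v::euclidean_space \<Rightarrow> 'v \<Rightarrow> real"
  assumes l: "\<And>u. linear (g u)" "\<And>u. linear (\<lambda>v. g v u)" and pos: "\<And>v. v \<noteq> 0 \<Longrightarrow> g v v > 0"
    and \<alpha>: "linear \<alpha>"
  shows "\<exists>!a. \<forall>v. \<alpha> v = g a v"
proof -
  define T where "T a = (\<Sum>b\<in>Basis. g a b *\<^sub>R b)" for a
  have lT: "linear T"
    unfolding T_def
    by (rule linearI) (simp_all add: linear_add[OF l(2)] linear_scale[OF l(2)] scaleR_add_left sum.distrib scaleR_sum_right)
  have eq: "g a v = (\<Sum>b\<in>Basis. (v \<bullet> b) * g a b)" for a v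
  proof -
    have "g a (\<Sum>b\<in>Basis. (v \<bullet> b) *\<^sub>R b) = (\<Sum>b\<in>Basis. (v \<bullet> b) * g a b)"
      by (simp add: linear_sum[OF l(1)] linear_scale[OF l(1)])
    then show ?thesis by (simp add: euclidean_representation)
  qed
  have \<alpha>eq: "\<alpha> v = (\<Sum>b\<in>Basis. (v \<bullet> b) * \<alpha> b)" for v
  proof -
    have "\<alpha> (\<Sum>b\<in>Basis. (v \<bullet> b) *\<^sub>R b) = (\<Sum>b\<in>Basis. (v \<bullet> b) * \<alpha> b)"
      by (simp add: linear_sum[OF \<alpha>] linear_scale[OF \<alpha>])
    then show ?thesis by (simp add: euclidean_representation)
  qed
  have Tb: "T a \<bullet> b = g a b" if "b \<in> Basis" for a b
    unfolding T_def by (rule inner_sum_left_Basis[OF that])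
  have "inj T"
  proof (rule linear_injective_0[OF lT, THEN iffD2], intro allI impI)
    fix a assume "T a = 0"
    then have "g a b = 0" if "b \<in> Basis" for b using Tb[OF that, of a] by simp
    then have "g a a = 0" using eq[of a a] by simp
    then show "a = 0" using pos[of a] by force
  qed
  then have "surj T" using lT linear_injective_imp_surjective by blast
  then obtain a where a: "T a = (\<Sum>b\<in>Basis. \<alpha> b *\<^sub>R b)" by (metis surjD)
  have ab: "g a b = \<alpha> b" if "b \<in> Basis" for b
    using Tb[OF that, of a] unfolding a inner_sum_left_Basis[OF that] by (rule sym)
  have ex: "\<forall>v. \<alpha> v = g a v"
  proof
    fix v
    have "\<alpha> v = (\<Sum>b\<in>Basis. (v \<bullet> b) * \<alpha> b)" by (rule \<alpha>eq)
    also have "\<dots> = (\<Sum>b\<in>Basis. (v \<bullet> b) * g a b)" by (rule sum.cong) (auto simp: ab)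
    also have "\<dots> = g a v" by (rule eq[symmetric])
    finally show "\<alpha> v = g a v" .
  qed
  show ?thesis
  proof (rule ex1I[of _ a])
    show "\<forall>v. \<alpha> v = g a v" by (rule ex)
    fix a' assume "\<forall>v. \<alpha> v = g a' v"
    then have "g a' v = g a v" for v using ex by simp
    then have "g (a' - a) (a' - a) = 0"
      by (simp add: linear_diff[OF l(2)])
    then show "a' = a" using pos[of "a' - a"] by force
  qed
qed

lemma det_gram_nonzero:
  fixes e :: "'i::finite \<Rightarrow> 'v::real_vector" and g :: "'v \<Rightarrow> 'v \<Rightarrow> real"
  assumes l: "\<And>u. linear (g u)" "\<And>u. linear (\<lambda>v. g v u)" and pos: "\<And>v. v \<noteq> 0 \<Longrightarrow> g v v > 0"
    and ind: "\<And>x. (\<Sum>i\<in>UNIV. x i *\<^sub>R e i) = 0 \<Longrightarrow> (\<forall>i. x i = 0)"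
  shows "det (\<chi> i j. g (e i) (e j)) \<noteq> 0"
proof -
  let ?G = "(\<chi> i j. g (e i) (e j)) :: real^'i^'i"
  have "x = 0" if "?G *v x = 0" for x
  proof -
    let ?v = "\<Sum>i\<in>UNIV. (x $ i) *\<^sub>R e i"
    have "g (e i) ?v = (?G *v x) $ i" for i
      by (simp add: matrix_vector_mult_def linear_sum[OF l(1)] linear_scale[OF l(1)] mult.commute)
    then have "g (e i) ?v = 0" for i using that by simp
    then have "g ?v ?v = 0" by (simp add: linear_sum[OF l(2)] linear_scale[OF l(2)])
    then have "?v = 0" using pos[of ?v] by force
    then show "x = 0" using ind[of "\<lambda>i. x $ i"] by (simp add: vec_eq_iff)
  qed
  then show ?thesis
    using matrix_left_invertible_ker[of ?G] invertible_left_inverse[of ?G] invertible_det_nz[of ?G] by blast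
qed

lemma rbasis_independent:
  assumes "(\<Sum>i\<in>UNIV. x i *\<^sub>R (rbasis i :: complex^'n)) = 0"
  shows "\<forall>i. x i = 0"
proof
  fix j
  have "(\<Sum>i\<in>UNIV. x i *\<^sub>R (rbasis i :: complex^'n)) \<bullet> rbasis j = x j"
    by (simp add: inner_sum_left inner_rbasis_rbasis if_distrib cong: if_cong)
  then show "x j = 0" using assms by simp
qed

text \<open>The metric is the real part of a Hermitian form. A unitary basis of that form, completed
  by the images under J, is orthonormal for the metric.\<close>

lemma unitary_basis:
  fixes g :: "complex^'n \<Rightarrow> complex^'n \<Rightarrow> real"
  assumes g: "hermitian_metric g"
  obtains w :: "'n \<times> bool \<Rightarrow> complex^'n" where
    "\<And>k. w (k, True) = J (w (k, False))" "\<And>i j. g (w i) (w j) = (if i = j then 1 else 0)"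
    "\<And>v. v = (\<Sum>i\<in>UNIV. g v (w i) *\<^sub>R w i)"
proof -
  note [simp] = hermitian_metricD(4)[OF g]
  note gl = linear_add[OF hermitian_metricD(2)[OF g]] linear_scale[OF hermitian_metricD(2)[OF g]]
  \<comment> \<open>The imaginary part carries the sign that makes \<open>h\<close> complex linear
    in its first argument.\<close>
  define h where "h u v = Complex (g u v) (g u (J v))" for u v
  have smult: "c *s s = Re c *\<^sub>R s + Im c *\<^sub>R J s" for c s
    by (auto simp: vec_eq_iff J_def complex_eq_iff)
  have hadd: "h (s + t) u = h s u + h t u" for s t u
    by (simp add: h_def gl complex_eq_iff)
  have hscal: "h (c *s s) u = c * h s u" for c s u
    unfolding smult by (simp add: h_def gl complex_eq_iff hermitian_metricD(6)[OF g])
      (simp add: linear_neg[OF hermitian_metricD(1)[OF g]])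
  obtain E where E: "finite E" "orthonormal h E" "\<forall>s\<in>UNIV. s = (\<Sum>e\<in>E. h s e *s e)"
    "vec.dim (UNIV :: (complex^'n) set) = card E"
  proof (rule gram_schmidt[of "(*s)" UNIV h "CARD('n)"])
    show "vector_space ((*s) :: complex \<Rightarrow> complex^'n \<Rightarrow> _)" by unfold_locales
    show "vec.subspace (UNIV :: (complex^'n) set)" by (rule vec.subspace_UNIV)
    show "h t s = cnj (h s t)" for s t
      using hermitian_metricD(3)[OF g, of t s] hermitian_metricD(6)[OF g, of s t] hermitian_metricD(3)[OF g, of "J s" t]
      by (simp add: h_def complex_eq_iff)
    show "0 < Re (h s s)" if "s \<noteq> 0" for s using hermitian_metricD(5)[OF g that] by (simp add: h_def)
    show "card E \<le> CARD('n)" if "finite E" "orthonormal h E" for E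
      using orthonormal_independent[OF hadd hscal that] .
  qed (use hadd hscal in auto)
  have "card E = CARD('n)" using E(4) vec_dim_card[where 'a=complex and 'n='n] by simp
  then obtain u where u: "bij_betw u (UNIV :: 'n set) E"
    using E(1) finite_same_card_bij[of "UNIV :: 'n set" E] by auto
  have hu: "h (u k) (u l) = (if k = l then 1 else 0)" for k l
    using E(2) u unfolding orthonormal_def bij_betw_def inj_def by (metis UNIV_I image_eqI)
  have gu: "g (u k) (u l) = (if k = l then 1 else 0)" "g (u k) (J (u l)) = 0" for k l
    using hu[of k l] by (auto simp: h_def complex_eq_iff split: if_splits)
  define w where "w = (\<lambda>(k, b). if b then J (u k) else u k)"
  show ?thesis
  proof
    show "w (k, True) = J (w (k, False))" for k by (simp add: w_def)
    show "g (w i) (w j) = (if i = j then 1 else 0)" for i j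
      using gu hermitian_metricD(6)[OF g]
      by (cases i; cases j) (auto simp: w_def linear_neg[OF hermitian_metricD(1)[OF g]])
    show "v = (\<Sum>i\<in>UNIV. g v (w i) *\<^sub>R w i)" for v
    proof -
      have "v = (\<Sum>e\<in>E. h v e *s e)" using E(3) by blast
      also have "\<dots> = (\<Sum>k\<in>UNIV. h v (u k) *s u k)"
        using sum.reindex_bij_betw[OF u, of "\<lambda>e. h v e *s e"] by simp
      also have "\<dots> = (\<Sum>i\<in>UNIV. g v (w i) *\<^sub>R w i)"
        by (simp add: sum_pairs w_def smult h_def)
      finally show ?thesis .
    qed
  qed
qed

text \<open>In a unitary basis the Pfaffian is 1 and the Gram matrix is the identity. Passing to
  \<open>rbasis\<close> multiplies the former by \<open>det B\<close> and the Gram determinant by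
  its square.\<close>

lemma pfaffian_square:
  fixes g :: "complex^'n \<Rightarrow> complex^'n \<Rightarrow> real"
  assumes g: "hermitian_metric g"
  shows "(pfaffian (\<lambda>u v. g (J u) v) rbasis)^2 = det (\<chi> i j. g (rbasis i) (rbasis j :: complex^'n))"
proof -
  obtain w :: "'n \<times> bool \<Rightarrow> complex^'n" where w:
    "\<And>k. w (k, True) = J (w (k, False))" "\<And>i j. g (w i) (w j) = (if i = j then 1 else 0)"
    "\<And>v. v = (\<Sum>i\<in>UNIV. g v (w i) *\<^sub>R w i)"
    using unitary_basis[OF g] by blast
  note gl = hermitian_metricD(1,2)[OF g]
  define B where "B = (\<chi> i j. g (rbasis i) (w j))"
  have rb: "rbasis = (\<lambda>i. \<Sum>j\<in>UNIV. B $ i $ j *\<^sub>R w j)"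
    unfolding B_def using w(3) by (auto simp: fun_eq_iff)
  have lJ: "linear (\<lambda>v. g (J v) u)" for u
    using linear_compose[OF linear_J gl(2)] by (simp add: o_def)
  have "pfaffian (\<lambda>u v. g (J u) v) w = 1"
  proof (rule pfaffian_symplectic)
    fix k l b
    show "g (J (w (k, False))) (w (l, True)) = (if k = l then 1 else 0)"
      using w(2)[of "(k, False)" "(l, False)"] by (simp add: w(1) hermitian_metricD(4)[OF g])
    show "g (J (w (k, True))) (w (l, False)) = (if k = l then -1 else 0)"
      using w(2)[of "(k, False)" "(l, False)"] linear_neg[OF gl(2)] by (simp add: w(1))
    have F: "g (J (w (k, False))) (w (l, False)) = 0" for k l
      using w(2)[of "(k, True)" "(l, False)"] by (simp add: w(1))
    show "g (J (w (k, b))) (w (l, b)) = 0"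
      using F[of l k] linear_neg[OF gl(2)] hermitian_metricD(3)[OF g, of "J (w (l, False))" "w (k, False)"]
      by (cases b) (simp_all add: F w(1))
  qed
  then have pf: "pfaffian (\<lambda>u v. g (J u) v) rbasis = det B"
    unfolding rb using pfaffian_basis_change[of "\<lambda>u v. g (J u) v" B w] gl lJ by simp
  have "(\<chi> i j. g (rbasis i) (rbasis j)) = B ** transpose B"
  proof -
    have "g (rbasis i) (rbasis j) = (\<Sum>k\<in>UNIV. g (rbasis i) (w k) * g (rbasis j) (w k))" for i j
    proof -
      have "g (rbasis i) (rbasis j) = g (rbasis i) (\<Sum>k\<in>UNIV. g (rbasis j) (w k) *\<^sub>R w k)"
        using w(3)[of "rbasis j"] by simp
      then show ?thesis by (simp add: linear_sum[OF gl(1)] linear_scale[OF gl(1)] mult.commute)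
    qed
    then show ?thesis by (simp add: B_def matrix_matrix_mult_def transpose_def vec_eq_iff)
  qed
  then show ?thesis using pf by (simp add: det_mul det_transpose power2_eq_square)
qed

lemma hermitian_metric_inner: "hermitian_metric (\<lambda>u v :: complex^'n. u \<bullet> v)"
  unfolding hermitian_metric_def
proof (intro conjI allI impI)
  show "linear ((\<bullet>) u)" for u :: "complex^'n" by (rule bounded_linear.linear[OF bounded_linear_inner_right])
  show "J u \<bullet> J v = u \<bullet> v" for u v :: "complex^'n"
    by (simp add: inner_vec_def J_def inner_complex_def algebra_simps)
qed (auto simp: inner_commute)

lemma hermitian_metric_convex:
  assumes "hermitian_metric g" "hermitian_metric h" "0 \<le> t" "t \<le> 1"
  shows "hermitian_metric (\<lambda>u v. (1 - t) * g u v + t * h u v)"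
  unfolding hermitian_metric_def
proof (intro conjI allI impI)
  note G = hermitian_metricD[OF assms(1)] and H = hermitian_metricD[OF assms(2)]
  show "linear (\<lambda>v. (1 - t) * g u v + t * h u v)" for u
    by (rule linearI) (simp_all add: linear_add[OF G(1)] linear_add[OF H(1)] linear_scale[OF G(1)] linear_scale[OF H(1)] algebra_simps)
  show "(1 - t) * g u v + t * h u v = (1 - t) * g v u + t * h v u" for u v
    using G(3) H(3) by simp
  show "(1 - t) * g (J u) (J v) + t * h (J u) (J v) = (1 - t) * g u v + t * h u v" for u v
    by (simp add: G(4) H(4))
  show "0 < (1 - t) * g v v + t * h v v" if "v \<noteq> 0" for v
  proof (cases "t = 0")
    case True
    then show ?thesis using G(5)[OF that] by simp
  next
    case False
    then show ?thesis using G(5)[OF that] H(5)[OF that] assms(3,4)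
      by (intro add_nonneg_pos mult_nonneg_nonneg mult_pos_pos) auto
  qed
qed

lemma det_gram_rbasis:
  assumes "hermitian_metric g"
  shows "det (\<chi> i j. g (rbasis i) (rbasis j :: complex^'n)) > 0"
proof -
  have "det (\<chi> i j. g (rbasis i) (rbasis j :: complex^'n)) \<noteq> 0"
    by (rule det_gram_nonzero[OF hermitian_metricD(1,2)[OF assms]])
      (use hermitian_metricD(5)[OF assms] rbasis_independent in blast)+
  then show ?thesis using pfaffian_square[OF assms] by (metis zero_le_power2 less_le)
qed

text \<open>The sign is fixed by deforming \<open>g\<close> to the Euclidean metric through Hermitian metrics, along
  which the Pfaffian does not vanish.\<close>

lemma pfaffian_eq_sqrt_det:
  fixes g :: "complex^'n \<Rightarrow> complex^'n \<Rightarrow> real"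
  assumes g: "hermitian_metric g"
  shows "pfaffian (\<lambda>u v. g (J u) v) rbasis = sqrt (det (\<chi> i j. g (rbasis i) (rbasis j :: complex^'n)))"
proof -
  define gt where "gt t u v = (1 - t) * (u \<bullet> v) + t * g u v" for t :: real and u v :: "complex^'n"
  define P where "P t = pfaffian (\<lambda>u v. gt t (J u) v) (rbasis :: 'n \<times> bool \<Rightarrow> complex^'n)" for t
  have nz: "P t \<noteq> 0" if "0 \<le> t" "t \<le> 1" for t
  proof -
    have h: "hermitian_metric (gt t)"
      unfolding gt_def using hermitian_metric_convex[OF hermitian_metric_inner g that] .
    show ?thesis using pfaffian_square[OF h] det_gram_rbasis[OF h] unfolding P_def by force
  qed
  have cont: "continuous_on {0..1} P"
    unfolding P_def pfaffian_def gt_def by (intro continuous_intros) auto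
  have "P 0 = 1"
    unfolding P_def
  proof (rule pfaffian_symplectic)
    fix k l :: 'n and b
    have J2: "J (rbasis (k, True)) = - rbasis (k, False)" for k :: 'n
      unfolding rbasis_True by simp
    show "gt 0 (J (rbasis (k, False))) (rbasis (l, True)) = (if k = l then 1 else 0)"
      by (simp add: gt_def inner_rbasis_rbasis rbasis_True[symmetric] del: inner_rbasis)
    show "gt 0 (J (rbasis (k, True))) (rbasis (l, False)) = (if k = l then -1 else 0)"
      by (simp add: gt_def J2 inner_rbasis_rbasis del: inner_rbasis)
    show "gt 0 (J (rbasis (k, b))) (rbasis (l, b)) = 0"
      by (cases b) (simp_all add: gt_def J2 inner_rbasis_rbasis rbasis_True[symmetric] del: inner_rbasis)
  qed
  have "P 1 > 0"
  proof (rule ccontr)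
    assume "\<not> P 1 > 0"
    then obtain t where "0 \<le> t" "t \<le> 1" "P t = 0"
      using IVT2'[of P 1 0 0] cont \<open>P 0 = 1\<close> by auto
    then show False using nz by blast
  qed
  then have "pfaffian (\<lambda>u v. g (J u) v) (rbasis :: 'n \<times> bool \<Rightarrow> complex^'n) > 0" by (simp add: P_def gt_def)
  then show ?thesis
    using pfaffian_square[OF g] by (metis real_sqrt_abs abs_of_pos)
qed

text \<open>The dual metric does not depend on the basis used to write it: on covectors represented
  by vectors it is the metric of those vectors. It is applied both to \<open>rbasis\<close> and to
  the coordinate frame of a chart.\<close>

lemma gram_inverse_pairing:
  fixes e :: "'i::finite \<Rightarrow> 'v::real_vector" and g :: "'v \<Rightarrow> 'v \<Rightarrow> real"
  assumes l: "\<And>u. linear (g u)" "\<And>u. linear (\<lambda>v. g v u)" and sym: "\<And>u v. g u v = g v u"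
    and det: "det (\<chi> i j. g (e i) (e j)) \<noteq> 0"
    and span: "\<And>v. \<exists>x. v = (\<Sum>i\<in>UNIV. x i *\<^sub>R e i)"
  shows "(\<Sum>i\<in>UNIV. \<Sum>j\<in>UNIV. of_real (matrix_inv (\<chi> i j. g (e i) (e j)) $ i $ j)
      * Complex (g a1 (e i)) (g a2 (e i)) * cnj (Complex (g b1 (e j)) (g b2 (e j)))) =
    Complex (g a1 b1 + g a2 b2) (g a2 b1 - g a1 b2)"
proof -
  let ?G = "(\<chi> i j. g (e i) (e j)) :: real^'i^'i"
  define H where "H = matrix_inv ?G"
  have inv: "?G ** H = mat 1" "H ** ?G = mat 1"
    using det invertible_det_nz[of ?G] someI_ex[of "\<lambda>B. ?G ** B = mat 1 \<and> B ** ?G = mat 1"]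
    unfolding H_def matrix_inv_def invertible_def by blast+
  have R: "(\<Sum>i\<in>UNIV. \<Sum>j\<in>UNIV. H $ i $ j * (g a (e i) * g b (e j))) = g a b" for a b
  proof -
    obtain x where a: "a = (\<Sum>i\<in>UNIV. x i *\<^sub>R e i)" using span by blast
    have "(\<Sum>i\<in>UNIV. \<Sum>j\<in>UNIV. H $ i $ j * (g a (e i) * g b (e j))) =
      (\<Sum>j\<in>UNIV. (\<Sum>i\<in>UNIV. g a (e i) * H $ i $ j) * g b (e j))"
      by (subst sum.swap) (simp add: sum_distrib_left sum_distrib_right mult_ac)
    also have "\<dots> = (\<Sum>j\<in>UNIV. x j * g b (e j))"
    proof (rule sum.cong)
      fix j
      have "(\<Sum>i\<in>UNIV. g a (e i) * H $ i $ j) = (\<Sum>i\<in>UNIV. \<Sum>k\<in>UNIV. x k * (?G $ k $ i * H $ i $ j))"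
        unfolding a by (simp add: linear_sum[OF l(2)] linear_scale[OF l(2)] sum_distrib_left sum_distrib_right mult_ac)
      also have "\<dots> = (\<Sum>k\<in>UNIV. x k * (?G ** H) $ k $ j)"
        by (subst sum.swap) (simp add: matrix_matrix_mult_def sum_distrib_left)
      also have "\<dots> = x j" unfolding inv by (simp add: mat_def if_distrib cong: if_cong)
      finally show "(\<Sum>i\<in>UNIV. g a (e i) * H $ i $ j) * g b (e j) = x j * g b (e j)" by simp
    qed simp
    also have "\<dots> = g a b"
      unfolding a sym[of _ b] by (simp add: linear_sum[OF l(1)] linear_scale[OF l(1)])
    finally show ?thesis .
  qed
  have "complex_of_real (H $ i $ j) * Complex (g a1 (e i)) (g a2 (e i)) * cnj (Complex (g b1 (e j)) (g b2 (e j))) =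
    Complex (H $ i $ j * (g a1 (e i) * g b1 (e j)) + H $ i $ j * (g a2 (e i) * g b2 (e j)))
     (H $ i $ j * (g a2 (e i) * g b1 (e j)) - H $ i $ j * (g a1 (e i) * g b2 (e j)))" for i j
    by (simp add: complex_eq_iff algebra_simps)
  then show ?thesis
    unfolding H_def[symmetric]
    by (simp add: complex_eq_iff sum.distrib sum_subtractf R[unfolded mult.assoc[symmetric]] mult.assoc[symmetric] del: complex_cnj)
qed

lemma det_gram_change:
  fixes e :: "'i::finite \<Rightarrow> 'v::real_vector" and g :: "'v \<Rightarrow> 'v \<Rightarrow> real" and B :: "real^'i^'i"
  assumes l: "\<And>u. linear (g u)" "\<And>u. linear (\<lambda>v. g v u)"
    and e': "\<And>i. e' i = (\<Sum>j\<in>UNIV. B $ i $ j *\<^sub>R e j)"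
  shows "det (\<chi> i j. g (e' i) (e' j)) = (det B)^2 * det (\<chi> i j. g (e i) (e j))"
proof -
  have "(\<chi> i j. g (e' i) (e' j)) = B ** (\<chi> i j. g (e i) (e j)) ** transpose B"
    by (simp add: vec_eq_iff matrix_matrix_mult_def transpose_def e' linear_sum[OF l(1)] linear_sum[OF l(2)]
        linear_scale[OF l(1)] linear_scale[OF l(2)] sum_distrib_left sum_distrib_right mult_ac)
  then show ?thesis by (simp add: det_mul det_transpose power2_eq_square)
qed

section \<open>Change of variables on \<open>\<complex>\<^sup>n\<close>\<close>

text \<open>The library's change-of-variables theorem is restricted to well-ordered index types; a copy of
  an arbitrary finite type carries such an order.\<close>

typedef 'a wordered = "UNIV :: 'a set" morphisms unwrap wrap by simp

instance wordered :: (finite) finite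
proof
  have "(UNIV :: 'a wordered set) = wrap ` UNIV" by (metis UNIV_I surjI unwrap_inverse)
  then show "finite (UNIV :: 'a wordered set)" by (metis finite finite_imageI)
qed

instantiation wordered :: (finite) linorder
begin
definition less_eq_wordered :: "'a wordered \<Rightarrow> 'a wordered \<Rightarrow> bool" where
  "less_eq_wordered x y \<longleftrightarrow> to_nat (unwrap x) \<le> to_nat (unwrap y)"
definition less_wordered :: "'a wordered \<Rightarrow> 'a wordered \<Rightarrow> bool" where
  "less_wordered x y \<longleftrightarrow> to_nat (unwrap x) < to_nat (unwrap y)"
instance
proof
  fix x y z :: "'a wordered"
  show "(x < y) = (x \<le> y \<and> \<not> y \<le> x)" unfolding less_eq_wordered_def less_wordered_def by linarith
  show "x \<le> x" unfolding less_eq_wordered_def by (rule order_refl)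
  show "x \<le> z" if "x \<le> y" "y \<le> z" using that unfolding less_eq_wordered_def by (rule order_trans)
  show "x = y" if "x \<le> y" "y \<le> x"
  proof -
    have "to_nat (unwrap x) = to_nat (unwrap y)"
      using that unfolding less_eq_wordered_def by (rule order_antisym)
    then show ?thesis by (simp only: unwrap_inject inj_eq[OF inj_to_nat])
  qed
  show "x \<le> y \<or> y \<le> x" unfolding less_eq_wordered_def by (rule linear)
qed
end

instance wordered :: (finite) wellorder
proof
  fix P and a :: "('a :: finite) wordered"
  assume step: "\<And>x :: 'a wordered. (\<And>y. y < x \<Longrightarrow> P y) \<Longrightarrow> P x"
  show "P a"
  proof (induction a rule: measure_induct_rule[of "\<lambda>x. to_nat (unwrap x)"])
    case (less x)
    show ?case by (rule step, rule less, simp only: less_wordered_def)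
  qed
qed

lemma bij_unwrap: "bij (unwrap :: 'a wordered \<Rightarrow> 'a)"
  by (rule o_bij[of wrap]) (auto simp: fun_eq_iff unwrap_inverse wrap_inverse)

text \<open>Conjugation by a bijection preserves the sign of permutations. This identifies
  determinants over an index type with those over its well-ordered copy.\<close>

lemma det_reindex:
  fixes A :: "real^'i^'i" and f :: "'j::finite \<Rightarrow> 'i::finite"
  assumes f: "bij f"
  shows "det (\<chi> i j. A $ f i $ f j) = det A"
proof -
  let ?c = "\<lambda>p. inv f \<circ> p \<circ> f"
  have ff: "f (inv f x) = x" "inv f (f y) = y" for x y
    using f by (simp_all add: bij_is_surj surj_f_inv_f bij_is_inj inv_f_f)
  have cp: "?c p permutes UNIV" if "p permutes UNIV" for p
    using bij_comp[OF bij_comp[OF f permutes_bij[OF that]] bij_imp_bij_inv[OF f]]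
    by (intro inj_imp_permutes) (auto simp: bij_def o_assoc)
  have sgn: "sign (?c p) = sign p" if "p permutes UNIV" for p
    using that finite_class.finite_UNIV
  proof (induction rule: permutes_induct)
    case id
    then show ?case by (simp add: fun_eq_iff ff o_def id_def[symmetric])
  next
    case (swap a b p)
    have eq: "?c (Transposition.transpose a b \<circ> p) = Transposition.transpose (inv f a) (inv f b) \<circ> ?c p"
      by (auto simp: fun_eq_iff Transposition.transpose_def ff) (metis ff)+
    have "inv f a \<noteq> inv f b" using swap.hyps(3) ff by metis
    then have "sign (Transposition.transpose (inv f a) (inv f b) \<circ> ?c p) = - sign (?c p)"
      using sign_compose[OF permutation_finite[OF permutes_swap_id] permutation_finite[OF cp[OF swap.hyps(4)]]]
      by (simp add: sign_swap_id)
    moreover have "sign (Transposition.transpose a b \<circ> p) = - sign p"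
      using sign_compose[OF permutation_finite[OF permutes_swap_id] permutation_finite[OF swap.hyps(4)], of a b]
        swap.hyps(3) by (simp add: sign_swap_id)
    ultimately show ?case unfolding eq by (simp only: swap.IH)
  qed
  have prd: "(\<Prod>i\<in>UNIV. A $ f i $ f (?c p i)) = (\<Prod>i\<in>UNIV. A $ i $ p i)" for p
    using prod.reindex_bij_betw[OF f, of "\<lambda>i. A $ i $ p i"] by (simp add: ff)
  have "det A = (\<Sum>p | p permutes UNIV. of_int (sign (?c p)) * (\<Prod>i\<in>UNIV. A $ f i $ f (?c p i)))"
    unfolding det_def by (rule sum.cong[OF refl]) (simp only: mem_Collect_eq sgn prd)
  also have "\<dots> = (\<Sum>q | q permutes UNIV. of_int (sign q) * (\<Prod>i\<in>UNIV. A $ f i $ f (q i)))"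
  proof (rule sum.reindex_bij_betw)
    show "bij_betw ?c {p. p permutes UNIV} {q. q permutes UNIV}"
    proof (rule bij_betw_byWitness[where f' = "\<lambda>q. f \<circ> q \<circ> inv f"])
      show "(\<lambda>q. f \<circ> q \<circ> inv f) ` {q. q permutes UNIV} \<subseteq> {p. p permutes UNIV}"
      proof clarsimp
        fix q :: "'j \<Rightarrow> 'j" assume "q permutes UNIV"
        then have "bij (f \<circ> q \<circ> inv f)"
          using bij_comp[OF bij_comp[OF bij_imp_bij_inv[OF f] permutes_bij] f] by (simp add: o_assoc)
        then show "f \<circ> q \<circ> inv f permutes UNIV" by (intro inj_imp_permutes) (auto simp: bij_def)
      qed
    qed (use cp in \<open>auto simp: fun_eq_iff ff\<close>)
  qed
  finally show ?thesis by (simp add: det_def)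
qed

subsection \<open>Real coordinates\<close>

definition real_coords :: "complex^'n \<Rightarrow> real^(('n::finite \<times> bool) wordered)" where
  "real_coords v = (\<chi> i. v \<bullet> rbasis (unwrap i))"

definition of_real_coords :: "real^(('n::finite \<times> bool) wordered) \<Rightarrow> complex^'n" where
  "of_real_coords x = (\<Sum>i\<in>UNIV. (x $ i) *\<^sub>R rbasis (unwrap i))"

lemma sum_unwrap: "(\<Sum>i\<in>UNIV. F (unwrap i)) = (\<Sum>i\<in>UNIV. F i)" for F :: "'a::finite \<Rightarrow> 'b::comm_monoid_add"
  by (rule sum.reindex_bij_betw[OF bij_unwrap])

lemma of_real_coords_inverse [simp]:
  "real_coords (of_real_coords x) = x" "of_real_coords (real_coords v) = v"
proof -
  have orth: "(rbasis (unwrap j) :: complex^'a) \<bullet> rbasis (unwrap i) = (if j = i then 1 else 0)" for i j :: "('a \<times> bool) wordered"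
    by (simp add: inner_rbasis_rbasis unwrap_inject)
  show "real_coords (of_real_coords x) = x"
    by (simp add: real_coords_def of_real_coords_def vec_eq_iff inner_sum_left orth if_distrib cong: if_cong)
  show "of_real_coords (real_coords v) = v"
    using sum_unwrap[of "\<lambda>i. (v \<bullet> rbasis i) *\<^sub>R rbasis i"] rbasis_expansion[of v]
    by (simp add: real_coords_def of_real_coords_def)
qed

lemma bounded_linear_real_coords:
  "bounded_linear (real_coords :: complex^'n \<Rightarrow> real^(('n \<times> bool) wordered))"
  "bounded_linear (of_real_coords :: real^(('n \<times> bool) wordered) \<Rightarrow> complex^'n)"
  unfolding linear_conv_bounded_linear[symmetric] real_coords_def of_real_coords_def
  by (rule linearI; simp add: vec_eq_iff inner_add_left scaleR_add_left sum.distrib scaleR_sum_right)+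

lemma continuous_real_coords:
  "continuous_on S (real_coords :: complex^'n \<Rightarrow> real^(('n \<times> bool) wordered))"
  "continuous_on T (of_real_coords :: real^(('n \<times> bool) wordered) \<Rightarrow> complex^'n)"
  using bounded_linear_real_coords linear_continuous_on by blast+

lemma Basis_complex_vec: "(Basis :: (complex^'n) set) = range rbasis"
  by (auto simp: Basis_vec_def Basis_complex_def rbasis_def image_iff split: if_splits)
    (metis prod.exhaust)+

lemma inj_rbasis: "inj (rbasis :: 'n::finite \<times> bool \<Rightarrow> complex^'n)"
proof (rule injI)
  fix i j assume e: "rbasis i = (rbasis j :: complex^'n)"
  show "i = j" using inner_rbasis_rbasis[of i j] inner_rbasis_rbasis[of j j] unfolding e
    by (auto split: if_splits)
qed

text \<open>The coordinate isomorphism matches boxes with boxes of equal volume, and the volumes of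
  boxes determine Lebesgue measure.\<close>

lemma lborel_of_real_coords:
  "lborel = distr lborel borel (of_real_coords :: real^(('n::finite \<times> bool) wordered) \<Rightarrow> complex^'n)"
proof (rule lborel_eqI)
  let ?\<psi> = "of_real_coords :: real^(('n \<times> bool) wordered) \<Rightarrow> complex^'n"
  have meas: "?\<psi> \<in> borel_measurable borel"
    by (intro borel_measurable_continuous_onI continuous_real_coords)
  fix l u :: "complex^'n" assume le: "\<And>b. b \<in> Basis \<Longrightarrow> l \<bullet> b \<le> u \<bullet> b"
  have nth: "(real_coords v) $ i = v \<bullet> rbasis (unwrap i)" for v :: "complex^'n" and i
    by (simp add: real_coords_def)
  have "?\<psi> -` box l u = box (real_coords l) (real_coords u)"
  proof -
    have "x \<in> box (real_coords l) (real_coords u) \<longleftrightarrow> ?\<psi> x \<in> box l u" for x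
    proof -
      have "x \<in> box (real_coords l) (real_coords u) \<longleftrightarrow>
        (\<forall>i. l \<bullet> rbasis (unwrap i) < ?\<psi> x \<bullet> rbasis (unwrap i) \<and> ?\<psi> x \<bullet> rbasis (unwrap i) < u \<bullet> rbasis (unwrap i))"
        using nth[of "?\<psi> x"] by (simp add: mem_box_cart nth)
      also have "\<dots> \<longleftrightarrow> (\<forall>j. l \<bullet> rbasis j < ?\<psi> x \<bullet> rbasis j \<and> ?\<psi> x \<bullet> rbasis j < u \<bullet> rbasis j)"
        by (metis wrap_inverse UNIV_I)
      also have "\<dots> \<longleftrightarrow> ?\<psi> x \<in> box l u"
        unfolding mem_box Basis_complex_vec by simp
      finally show ?thesis .
    qed
    then show ?thesis by auto
  qed
  then have "emeasure (distr lborel borel ?\<psi>) (box l u) = emeasure lborel (box (real_coords l) (real_coords u))"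
    using meas by (simp add: emeasure_distr)
  also have "\<dots> = ennreal (\<Prod>b\<in>Basis. (real_coords u - real_coords l) \<bullet> b)"
    using le unfolding Basis_complex_vec
    by (intro emeasure_lborel_box) (auto simp: Basis_vec_def inner_axis nth)
  also have "(\<Prod>b\<in>Basis. (real_coords u - real_coords l) \<bullet> b) =
     (\<Prod>i\<in>UNIV. (real_coords u - real_coords l) \<bullet> axis i 1)"
  proof -
    have B: "(Basis :: (real^('n \<times> bool) wordered) set) = range (\<lambda>i. axis i 1)" by (auto simp: Basis_vec_def)
    have "inj (\<lambda>i :: ('n \<times> bool) wordered. axis i (1::real))" by (auto simp: inj_def axis_eq_axis)
    then show ?thesis unfolding B by (subst prod.reindex) auto
  qed
  also have "\<dots> = (\<Prod>i\<in>UNIV. (u - l) \<bullet> rbasis (unwrap i))"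
    by (simp add: inner_axis nth inner_diff_left)
  also have "\<dots> = (\<Prod>i\<in>UNIV. (u - l) \<bullet> rbasis i)"
    by (rule prod.reindex_bij_betw[OF bij_unwrap])
  also have "\<dots> = (\<Prod>b\<in>Basis. (u - l) \<bullet> b)"
    unfolding Basis_complex_vec by (simp add: prod.reindex[OF inj_rbasis] o_def)
  finally show "emeasure (distr lborel borel ?\<psi>) (box l u) = ennreal (\<Prod>b\<in>Basis. (u - l) \<bullet> b)" .
qed simp

text \<open>The change-of-variables theorem is an equivalence about finite values: whenever one side
  is finite, so is the other and they agree. In the remaining case both are infinite.\<close>

lemma emeasure_differentiable_image:
  fixes g :: "real^'m::{finite,wellorder} \<Rightarrow> real^'m::_"
  assumes S: "S \<in> sets borel" "g ` S \<in> sets borel" and inj: "inj_on g S"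
    and der: "\<And>x. x \<in> S \<Longrightarrow> (g has_derivative g' x) (at x)"
    and meas: "(\<lambda>x. indicator S x * \<bar>det (matrix (g' x))\<bar>) \<in> borel_measurable borel"
  shows "emeasure lborel (g ` S) = (\<integral>\<^sup>+x. ennreal (indicator S x * \<bar>det (matrix (g' x))\<bar>) \<partial>lborel)"
proof -
  let ?f = "\<lambda>x. indicator S x * \<bar>det (matrix (g' x))\<bar>"
  let ?I = "\<integral>\<^sup>+x. ennreal (?f x) \<partial>lborel"
  have leb: "S \<in> sets lebesgue" using S by (simp add: sets_completionI_sets)
  have I: "(?f has_integral r) UNIV \<longleftrightarrow> ?I = ennreal r" if "0 \<le> r" for r
  proof -
    have "?f \<in> borel_measurable lborel" using meas by simp
    then have "?f \<in> lebesgue \<rightarrow>\<^sub>M borel" by (rule measurable_completion)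
    then show ?thesis
      using has_integral_iff_nn_integral_lebesgue[of ?f r] that
      by (simp add: nn_integral_completion) 
  qed
  have key: "(g ` S \<in> lmeasurable \<and> measure lebesgue (g ` S) = r) \<longleftrightarrow> (?f has_integral r) UNIV" for r
  proof -
    have "((\<lambda>x. \<bar>det (matrix (g' x))\<bar>) has_integral r) S \<longleftrightarrow> (?f has_integral r) UNIV"
    proof -
      have "?f = (\<lambda>x. if x \<in> S then \<bar>det (matrix (g' x))\<bar> else 0)" by (auto simp: indicator_def)
      then show ?thesis by (simp only: has_integral_restrict_UNIV)
    qed
    then show ?thesis
      using has_measure_differentiable_image[OF leb, of g g' r] der inj
      by (auto intro: has_derivative_at_withinI)
  qed
  show ?thesis
  proof (cases "emeasure lborel (g ` S) < \<infinity>")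
    case True
    then have lm: "g ` S \<in> lmeasurable" using S by (intro fmeasurableI) (auto simp: sets_completionI_sets main_part_sets)
    then have "(?f has_integral measure lebesgue (g ` S)) UNIV" using key by blast
    then have "?I = ennreal (measure lebesgue (g ` S))" using I by simp
    also have "\<dots> = emeasure lborel (g ` S)"
      using emeasure_eq_measure2[OF lm] S by (simp add: sets_completionI_sets main_part_sets)
    finally show ?thesis by simp
  next
    case False
    have "?I = \<infinity>"
    proof (rule ccontr)
      assume "?I \<noteq> \<infinity>"
      then obtain r where r: "?I = ennreal r" "r \<ge> 0" by (cases ?I) auto
      then have "(?f has_integral r) UNIV" using I[of r] by simp
      then have "g ` S \<in> lmeasurable" using key[of r] by simp
      then show False using False S by (auto simp: fmeasurable_def sets_completionI_sets main_part_sets)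
    qed
    then show ?thesis using False by (simp add: top.not_eq_extremum[symmetric])
  qed
qed

definition jacobian :: "(complex^'n::finite \<Rightarrow> complex^'n) \<Rightarrow> real^('n\<times>bool)^('n\<times>bool)" where
  "jacobian D = (\<chi> i j. D (rbasis j) \<bullet> rbasis i)"

lemma emeasure_image_complex:
  fixes \<tau> :: "complex^'n \<Rightarrow> complex^'n"
  assumes S: "S \<in> sets borel" "\<tau> ` S \<in> sets borel" and inj: "inj_on \<tau> S"
    and der: "\<And>z. z \<in> S \<Longrightarrow> (\<tau> has_derivative \<tau>' z) (at z)"
    and meas: "(\<lambda>z. indicator S z * \<bar>det (jacobian (\<tau>' z))\<bar>) \<in> borel_measurable borel"
  shows "emeasure lborel (\<tau> ` S) = (\<integral>\<^sup>+z. ennreal (indicator S z * \<bar>det (jacobian (\<tau>' z))\<bar>) \<partial>lborel)"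
proof -
  let ?\<phi> = "real_coords :: complex^'n \<Rightarrow> real^(('n \<times> bool) wordered)"
  let ?\<psi> = "of_real_coords :: real^(('n \<times> bool) wordered) \<Rightarrow> complex^'n"
  have \<psi>m: "?\<psi> \<in> borel_measurable borel"
    by (intro borel_measurable_continuous_onI continuous_real_coords)
  have vm: "?\<psi> -` A \<in> sets borel" if "A \<in> sets borel" for A
    using measurable_sets[OF \<psi>m that] by simp
  define g where "g x = ?\<phi> (\<tau> (?\<psi> x))" for x
  define g' where "g' x = (\<lambda>h. ?\<phi> (\<tau>' (?\<psi> x) (?\<psi> h)))" for x
  have gS: "g ` (?\<psi> -` S) = ?\<psi> -` (\<tau> ` S)"
  proof (intro equalityI subsetI)
    fix x assume "x \<in> ?\<psi> -` (\<tau> ` S)"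
    then obtain z where z: "z \<in> S" "?\<psi> x = \<tau> z" by auto
    have "g (?\<phi> z) = ?\<phi> (?\<psi> x)" unfolding g_def z(2) by simp
    then show "x \<in> g ` (?\<psi> -` S)" using z(1) by (intro image_eqI[of _ _ "?\<phi> z"]) auto
  qed (auto simp: g_def)
  have d: "det (matrix (g' x)) = det (jacobian (\<tau>' (?\<psi> x)))" for x
  proof -
    have ax: "?\<psi> (axis j 1) = rbasis (unwrap j)" for j
    proof -
      have "?\<psi> (axis j 1) = (\<Sum>i\<in>UNIV. if i = j then rbasis (unwrap i) else 0)"
        unfolding of_real_coords_def by (intro sum.cong) (auto simp: axis_def)
      then show ?thesis by simp
    qed
    have "matrix (g' x) = (\<chi> i j. jacobian (\<tau>' (?\<psi> x)) $ unwrap i $ unwrap j)"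
      by (simp add: matrix_def g'_def jacobian_def real_coords_def vec_eq_iff ax)
    then show ?thesis using det_reindex[OF bij_unwrap, of "jacobian (\<tau>' (?\<psi> x))"] by simp
  qed
  have "emeasure lborel (\<tau> ` S) = emeasure lborel (?\<psi> -` (\<tau> ` S))"
    by (subst lborel_of_real_coords) (use \<psi>m S in \<open>simp add: emeasure_distr\<close>)
  also have "\<dots> = emeasure lborel (g ` (?\<psi> -` S))" unfolding gS ..
  also have "\<dots> = (\<integral>\<^sup>+x. ennreal (indicator (?\<psi> -` S) x * \<bar>det (matrix (g' x))\<bar>) \<partial>lborel)"
  proof (rule emeasure_differentiable_image)
    show "?\<psi> -` S \<in> sets borel" "g ` (?\<psi> -` S) \<in> sets borel" using vm S unfolding gS by auto
    show "inj_on g (?\<psi> -` S)"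
      unfolding g_def inj_on_def using inj unfolding inj_on_def by (metis of_real_coords_inverse vimageE)
    show "(g has_derivative g' x) (at x)" if "x \<in> ?\<psi> -` S" for x
      unfolding g_def g'_def
      by (intro bounded_linear.has_derivative[OF bounded_linear_real_coords(1)]
          has_derivative_compose[OF bounded_linear.has_derivative[OF bounded_linear_real_coords(2) has_derivative_ident]]
          der) (use that in auto)
    have "(\<lambda>x. indicator S (?\<psi> x) * \<bar>det (jacobian (\<tau>' (?\<psi> x)))\<bar>) \<in> borel_measurable borel"
      using measurable_compose[OF \<psi>m meas] by simp
    then show "(\<lambda>x. indicator (?\<psi> -` S) x * \<bar>det (matrix (g' x))\<bar>) \<in> borel_measurable borel"
      unfolding d by (simp add: indicator_vimage[symmetric] o_def indicator_def)
  qed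
  also have "\<dots> = (\<integral>\<^sup>+x. ennreal (indicator S (?\<psi> x) * \<bar>det (jacobian (\<tau>' (?\<psi> x)))\<bar>) \<partial>lborel)"
    unfolding d by (simp add: indicator_def)
  also have "\<dots> = (\<integral>\<^sup>+z. ennreal (indicator S z * \<bar>det (jacobian (\<tau>' z))\<bar>) \<partial>distr lborel borel ?\<psi>)"
    using \<psi>m meas by (subst nn_integral_distr) auto
  finally show ?thesis unfolding lborel_of_real_coords[symmetric] .
qed

abbreviation density_measure :: "'b measure \<Rightarrow> ('b \<Rightarrow> ennreal) \<Rightarrow> 'b measure" where
  "density_measure \<equiv> Nonnegative_Lebesgue_Integration.density"

text \<open>Passage from sets to functions. Pushing the density |det| forward by the map gives
  Lebesgue measure on the image, as the values on Borel sets show; then \<open>f\<close> is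
  integrated against this one measure.\<close>

lemma nn_integral_image_complex:
  fixes \<tau> :: "complex^'n \<Rightarrow> complex^'n" and f :: "complex^'n \<Rightarrow> ennreal"
  assumes B: "B \<in> sets borel" and img: "\<And>A. A \<in> sets borel \<Longrightarrow> A \<subseteq> B \<Longrightarrow> \<tau> ` A \<in> sets borel"
    and inj: "inj_on \<tau> B" and cont: "continuous_on B \<tau>"
    and der: "\<And>z. z \<in> B \<Longrightarrow> (\<tau> has_derivative \<tau>' z) (at z)"
    and meas: "continuous_on B (\<lambda>z. det (jacobian (\<tau>' z)))"
    and f: "(\<lambda>y. f y * indicator (\<tau> ` B) y) \<in> borel_measurable borel"
  shows "(\<integral>\<^sup>+y. f y * indicator (\<tau> ` B) y \<partial>lborel) =
    (\<integral>\<^sup>+z. ennreal \<bar>det (jacobian (\<tau>' z))\<bar> * f (\<tau> z) * indicator B z \<partial>lborel)"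
proof -
  \<comment> \<open>Extended by 0 so as to be Borel measurable on the whole space; the density of
    \<open>N\<close> vanishes where the extension is artificial.\<close>
  define \<kappa> where "\<kappa> z = (if z \<in> B then \<tau> z else 0)" for z
  have \<kappa>m: "\<kappa> \<in> borel_measurable borel"
    unfolding \<kappa>_def using B cont by (intro borel_measurable_continuous_on_if) auto
  have dm: "(\<lambda>z. indicator A z * \<bar>det (jacobian (\<tau>' z))\<bar>) \<in> borel_measurable borel"
    if "A \<in> sets borel" "A \<subseteq> B" for A
  proof -
    have "(\<lambda>z. if z \<in> A then \<bar>det (jacobian (\<tau>' z))\<bar> else 0) \<in> borel_measurable borel"
      using that by (intro borel_measurable_continuous_on_if continuous_intros continuous_on_subset[OF meas]) auto
    moreover have "(\<lambda>z. indicator A z * \<bar>det (jacobian (\<tau>' z))\<bar>) = (\<lambda>z. if z \<in> A then \<bar>det (jacobian (\<tau>' z))\<bar> else 0)"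
      by (auto simp: indicator_def)
    ultimately show ?thesis by simp
  qed
  define N where "N = distr (density_measure lborel (\<lambda>z. ennreal (indicator B z * \<bar>det (jacobian (\<tau>' z))\<bar>))) borel \<kappa>"
  have dmB: "(\<lambda>z. ennreal (indicator B z * \<bar>det (jacobian (\<tau>' z))\<bar>)) \<in> borel_measurable borel"
    using dm[OF B] by simp
  have N: "N = density_measure lborel (indicator (\<tau> ` B))"
  proof (rule measure_eqI)
    show "sets N = sets (density_measure lborel (indicator (\<tau> ` B)))" by (simp add: N_def)
    fix A assume "A \<in> sets N"
    then have A: "A \<in> sets borel" by (simp add: N_def)
    define C where "C = B \<inter> \<kappa> -` A"
    have C: "C \<in> sets borel" "C \<subseteq> B" using B measurable_sets[OF \<kappa>m A] by (auto simp: C_def)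
    have "emeasure N A = (\<integral>\<^sup>+z. ennreal (indicator B z * \<bar>det (jacobian (\<tau>' z))\<bar>) * indicator (\<kappa> -` A) z \<partial>lborel)"
      unfolding N_def using \<kappa>m dmB A measurable_sets[OF \<kappa>m A]
      by (simp add: emeasure_distr emeasure_density)
    also have "\<dots> = (\<integral>\<^sup>+z. ennreal (indicator C z * \<bar>det (jacobian (\<tau>' z))\<bar>) \<partial>lborel)"
      by (intro nn_integral_cong) (auto simp: C_def indicator_def)
    also have "\<dots> = emeasure lborel (\<tau> ` C)"
      by (rule emeasure_image_complex[symmetric])
        (use C img inj der dm in \<open>auto intro: inj_on_subset\<close>)
    also have "\<tau> ` C = A \<inter> \<tau> ` B" by (auto simp: C_def \<kappa>_def)
    also have "emeasure lborel (A \<inter> \<tau> ` B) = (\<integral>\<^sup>+y. indicator (A \<inter> \<tau> ` B) y \<partial>lborel)"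
      using A img[OF B] by (intro nn_integral_indicator[symmetric]) auto
    also have "\<dots> = (\<integral>\<^sup>+y. indicator (\<tau> ` B) y * indicator A y \<partial>lborel)"
      by (intro nn_integral_cong) (auto simp: indicator_def)
    also have "\<dots> = emeasure (density_measure lborel (indicator (\<tau> ` B))) A"
      using A img[OF B] by (intro emeasure_density[symmetric]) auto
    finally show "emeasure N A = emeasure (density_measure lborel (indicator (\<tau> ` B))) A" .
  qed
  have "(\<integral>\<^sup>+y. f y * indicator (\<tau> ` B) y \<partial>lborel) = (\<integral>\<^sup>+y. indicator (\<tau> ` B) y * (f y * indicator (\<tau> ` B) y) \<partial>lborel)"
    by (intro nn_integral_cong) (auto simp: indicator_def)
  also have "\<dots> = (\<integral>\<^sup>+y. f y * indicator (\<tau> ` B) y \<partial>density_measure lborel (indicator (\<tau> ` B)))"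
    using f img[OF B] by (subst nn_integral_density) auto
  also have "\<dots> = (\<integral>\<^sup>+y. f y * indicator (\<tau> ` B) y \<partial>N)" unfolding N ..
  also have "\<dots> = (\<integral>\<^sup>+z. ennreal (indicator B z * \<bar>det (jacobian (\<tau>' z))\<bar>) * (f (\<kappa> z) * indicator (\<tau> ` B) (\<kappa> z)) \<partial>lborel)"
    unfolding N_def using f \<kappa>m dmB measurable_compose[OF \<kappa>m f]
    by (subst nn_integral_distr) (auto simp: nn_integral_density)
  also have "\<dots> = (\<integral>\<^sup>+z. ennreal \<bar>det (jacobian (\<tau>' z))\<bar> * f (\<tau> z) * indicator B z \<partial>lborel)"
    by (intro nn_integral_cong) (auto simp: indicator_def \<kappa>_def)
  finally show ?thesis .
qed

section \<open>Calculus and integration on a compact complex manifold\<close>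

locale compact_complex_manifold =
  fixes \<A> :: "('a::t2_space, 'n::finite) chart set"
  assumes mfd: "complex_manifold \<A>" and cpt: "compact (UNIV :: 'a set)"
begin

section \<open>Charts, transition maps and tangent vectors\<close>

abbreviation im :: "('a, 'n) chart \<Rightarrow> (complex^'n) set" where
  "im c \<equiv> snd c ` fst c"

abbreviation transition :: "('a, 'n) chart \<Rightarrow> ('a, 'n) chart \<Rightarrow> complex^'n \<Rightarrow> complex^'n" where
  "transition c d \<equiv> (\<lambda>z. snd d (cinv c z))"

lemma chart_open: "c \<in> \<A> \<Longrightarrow> open (fst c)" "c \<in> \<A> \<Longrightarrow> open (im c)"
  using mfd unfolding complex_manifold_def by simp_all

lemma chart_homeo: "c \<in> \<A> \<Longrightarrow> homeomorphism (fst c) (im c) (snd c) (cinv c)"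
  using mfd unfolding complex_manifold_def by simp

lemma chart_continuous: "c \<in> \<A> \<Longrightarrow> continuous_on (fst c) (snd c)" "c \<in> \<A> \<Longrightarrow> continuous_on (im c) (cinv c)"
  using chart_homeo unfolding homeomorphism_def by simp_all

lemma cinv_chart [simp]: "c \<in> \<A> \<Longrightarrow> x \<in> fst c \<Longrightarrow> cinv c (snd c x) = x"
  using chart_homeo unfolding homeomorphism_def by simp

lemma chart_cinv: "c \<in> \<A> \<Longrightarrow> z \<in> im c \<Longrightarrow> snd c (cinv c z) = z" "c \<in> \<A> \<Longrightarrow> z \<in> im c \<Longrightarrow> cinv c z \<in> fst c"
  by auto

lemma chart_at: "chart_at \<A> x \<in> \<A>" "x \<in> fst (chart_at \<A> x)"
proof -
  have "x \<in> (\<Union>c\<in>\<A>. fst c)" using mfd unfolding complex_manifold_def by simp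
  then have "\<exists>c. c \<in> \<A> \<and> x \<in> fst c" by auto
  then have "chart_at \<A> x \<in> \<A> \<and> x \<in> fst (chart_at \<A> x)" unfolding chart_at_def by (rule someI_ex)
  then show "chart_at \<A> x \<in> \<A>" "x \<in> fst (chart_at \<A> x)" by simp_all
qed

lemma open_chart_image:
  assumes "c \<in> \<A>" "open U"
  shows "open (snd c ` (fst c \<inter> U))"
proof -
  have "snd c ` (fst c \<inter> U) = im c \<inter> cinv c -` U" using assms(1) by (auto simp: image_iff)
  moreover have "open (im c \<inter> cinv c -` U)"
    by (rule continuous_open_preimage[OF chart_continuous(2)[OF assms(1)] chart_open(2)[OF assms(1)] assms(2)])
  ultimately show ?thesis by simp
qed

lemma open_overlap: "c \<in> \<A> \<Longrightarrow> d \<in> \<A> \<Longrightarrow> open (snd c ` (fst c \<inter> fst d))"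
  using open_chart_image chart_open(1) by blast

lemma transition_hol: "c \<in> \<A> \<Longrightarrow> d \<in> \<A> \<Longrightarrow> hol_on (snd c ` (fst c \<inter> fst d)) (\<lambda>z. transition c d z $ k)"
  using mfd unfolding complex_manifold_def by blast

lemma transition_smooth: "c \<in> \<A> \<Longrightarrow> d \<in> \<A> \<Longrightarrow> smooth_on (snd c ` (fst c \<inter> fst d)) (transition c d)"
  by (rule hol_map_smooth[OF open_overlap transition_hol])

definition dtrans :: "('a, 'n) chart \<Rightarrow> ('a, 'n) chart \<Rightarrow> 'a \<Rightarrow> complex^'n \<Rightarrow> complex^'n" where
  "dtrans c d x = frechet_derivative (transition c d) (at (snd c x))"

lemma dtrans_has_derivative:
  assumes "c \<in> \<A>" "d \<in> \<A>" "x \<in> fst c" "x \<in> fst d"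
  shows "(transition c d has_derivative dtrans c d x) (at (snd c x))"
  unfolding dtrans_def
  by (rule smooth_on_has_derivative[OF transition_smooth[OF assms(1,2)]]) (use assms in auto)

lemma dtrans_smult:
  assumes "c \<in> \<A>" "d \<in> \<A>" "x \<in> fst c" "x \<in> fst d"
  shows "dtrans c d x (a *s v) = a *s dtrans c d x v"
  unfolding dtrans_def
  by (rule hol_map_deriv_smult[OF open_overlap[OF assms(1,2)] transition_hol[OF assms(1,2)]]) (use assms in auto)

lemma dtrans_linear:
  assumes "c \<in> \<A>" "d \<in> \<A>" "x \<in> fst c" "x \<in> fst d"
  shows "linear (dtrans c d x)"
  using dtrans_has_derivative[OF assms] by (rule has_derivative_linear)

lemma dtrans_compose:
  assumes "c \<in> \<A>" "d \<in> \<A>" "e \<in> \<A>" and x: "x \<in> fst c" "x \<in> fst d" "x \<in> fst e"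
  shows "dtrans c e x v = dtrans d e x (dtrans c d x v)"
proof -
  let ?U = "snd c ` (fst c \<inter> (fst d \<inter> fst e))"
  have U: "open ?U" "snd c x \<in> ?U"
    using open_chart_image[OF assms(1) open_Int[OF chart_open(1)[OF assms(2)] chart_open(1)[OF assms(3)]]] x by auto
  have "((\<lambda>z. transition d e (transition c d z)) has_derivative (\<lambda>v. dtrans d e x (dtrans c d x v))) (at (snd c x))"
  proof (rule has_derivative_compose[OF dtrans_has_derivative[OF assms(1,2) x(1,2)]])
    show "(transition d e has_derivative dtrans d e x) (at (transition c d (snd c x)))"
      using dtrans_has_derivative[OF assms(2,3) x(2,3)] assms x by simp
  qed
  then have "(transition c e has_derivative (\<lambda>v. dtrans d e x (dtrans c d x v))) (at (snd c x))"
    by (rule has_derivative_transform_within_open[OF _ U]) (use assms in auto)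
  then have "dtrans c e x = (\<lambda>v. dtrans d e x (dtrans c d x v))"
    unfolding dtrans_def using frechet_derivative_at by metis
  then show ?thesis by simp
qed

lemma dtrans_self:
  assumes "c \<in> \<A>" "x \<in> fst c"
  shows "dtrans c c x v = v"
proof -
  have "((\<lambda>z. z) has_derivative (\<lambda>v. v)) (at (snd c x))" by (rule has_derivative_ident)
  then have "(transition c c has_derivative (\<lambda>v. v)) (at (snd c x))"
    by (rule has_derivative_transform_within_open[OF _ chart_open(2)[OF assms(1)]]) (use assms in auto)
  then have "dtrans c c x = (\<lambda>v. v)"
    unfolding dtrans_def using frechet_derivative_at by metis
  then show ?thesis by simp
qed

lemma dtrans_inverse:
  assumes "c \<in> \<A>" "d \<in> \<A>" "x \<in> fst c" "x \<in> fst d"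
  shows "dtrans d c x (dtrans c d x v) = v"
  using dtrans_compose[OF assms(1,2,1,3,4,3), of v] dtrans_self[OF assms(1,3)] by simp

lemma tangent_eq: "tangent \<A> c x = dtrans c (chart_at \<A> x) x"
  by (simp add: tangent_def dtrans_def o_def fun_eq_iff)

lemma tangent_dtrans:
  assumes "c \<in> \<A>" "d \<in> \<A>" "x \<in> fst c" "x \<in> fst d"
  shows "tangent \<A> c x v = tangent \<A> d x (dtrans c d x v)"
  unfolding tangent_eq by (rule dtrans_compose[OF assms(1,2) chart_at(1) assms(3,4) chart_at(2)])

lemma tangent_linear: "c \<in> \<A> \<Longrightarrow> x \<in> fst c \<Longrightarrow> linear (tangent \<A> c x)"
  unfolding tangent_eq by (rule dtrans_linear[OF _ chart_at(1) _ chart_at(2)])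

lemma tangent_smult: "c \<in> \<A> \<Longrightarrow> x \<in> fst c \<Longrightarrow> tangent \<A> c x (a *s v) = a *s tangent \<A> c x v"
  unfolding tangent_eq by (rule dtrans_smult[OF _ chart_at(1) _ chart_at(2)])

lemma tangent_inverse:
  assumes "c \<in> \<A>" "x \<in> fst c"
  shows "tangent \<A> c x (dtrans (chart_at \<A> x) c x v) = v" "dtrans (chart_at \<A> x) c x (tangent \<A> c x v) = v"
  unfolding tangent_eq using dtrans_inverse assms chart_at by blast+

subsection \<open>Smooth functions\<close>

text \<open>Since transition maps are holomorphic and therefore smooth, one suitable chart around
  each point decides smoothness in all charts.\<close>

lemma smooth_fun_on_local:
  fixes f :: "'a \<Rightarrow> 'w::real_normed_vector"
  assumes "open S"
    and "\<And>x. x \<in> S \<Longrightarrow> \<exists>c\<in>\<A>. \<exists>U. open U \<and> x \<in> U \<and> U \<subseteq> fst c \<and> smooth_on (snd c ` U) (f \<circ> cinv c)"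
  shows "smooth_fun_on \<A> S f"
  unfolding smooth_fun_on_def
proof
  fix d assume d: "d \<in> \<A>"
  show "smooth_on (snd d ` (fst d \<inter> S)) (f \<circ> cinv d)"
  proof (rule smooth_on_local)
    fix z assume "z \<in> snd d ` (fst d \<inter> S)"
    then obtain x where x: "x \<in> fst d" "x \<in> S" "z = snd d x" by auto
    obtain c U where c: "c \<in> \<A>" "open U" "x \<in> U" "U \<subseteq> fst c" "smooth_on (snd c ` U) (f \<circ> cinv c)"
      using assms(2)[OF x(2)] by blast
    let ?V = "snd d ` (fst d \<inter> U)"
    have V: "open ?V" "z \<in> ?V" using open_chart_image[OF d c(2)] x c(3) by auto
    have "smooth_on ?V (\<lambda>z. (f \<circ> cinv c) (transition d c z))"
    proof (rule smooth_on_compose[OF c(5) _ V(1)])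
      show "smooth_on ?V (transition d c)"
        by (rule smooth_on_subset[OF transition_smooth[OF d c(1)]]) (use c in auto)
      show "transition d c ` ?V \<subseteq> snd c ` U" using d by auto
    qed
    moreover have "(f \<circ> cinv c) (transition d c z) = (f \<circ> cinv d) z" if "z \<in> ?V" for z
      using that c d by auto
    ultimately have "smooth_on ?V (f \<circ> cinv d)"
      using smooth_on_cong[OF V(1), of "\<lambda>z. (f \<circ> cinv c) (transition d c z)" "f \<circ> cinv d"] by simp
    then show "\<exists>U. open U \<and> z \<in> U \<and> smooth_on U (f \<circ> cinv d)" using V by blast
  qed
qed

lemma smooth_fun_on_chart:
  "smooth_fun_on \<A> S f \<Longrightarrow> c \<in> \<A> \<Longrightarrow> smooth_on (snd c ` (fst c \<inter> S)) (\<lambda>z. f (cinv c z))"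
  by (simp add: smooth_fun_on_def o_def)

lemma smooth_fun_chart:
  "smooth_fun_on \<A> UNIV f \<Longrightarrow> c \<in> \<A> \<Longrightarrow> smooth_on (im c) (\<lambda>z. f (cinv c z))"
  using smooth_fun_on_chart[of UNIV f c] by simp

lemma smooth_fun_on_continuous:
  fixes f :: "'a \<Rightarrow> 'w::real_normed_vector"
  assumes "smooth_fun_on \<A> S f" "open S"
  shows "continuous_on S f"
proof (rule continuous_at_imp_continuous_on, rule ballI)
  fix x assume x: "x \<in> S"
  let ?c = "chart_at \<A> x" and ?U = "fst (chart_at \<A> x) \<inter> S"
  have U: "open ?U" "x \<in> ?U"
    using open_Int[OF chart_open(1)[OF chart_at(1)] assms(2)] chart_at(2) x by simp_all
  have "continuous_on ?U (\<lambda>y. f (cinv ?c (snd ?c y)))"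
  proof (rule continuous_on_compose2[where g = "\<lambda>z. f (cinv ?c z)" and f = "snd ?c"])
    show "continuous_on (snd ?c ` ?U) (\<lambda>z. f (cinv ?c z))"
      by (rule smooth_on_continuous[OF smooth_fun_on_chart[OF assms(1) chart_at(1)]])
    show "continuous_on ?U (snd ?c)"
      by (rule continuous_on_subset[OF chart_continuous(1)[OF chart_at(1)]]) auto
  qed auto
  then have "continuous_on ?U f"
    by (rule continuous_on_eq) (use chart_at in auto)
  then show "isCont f x" using U continuous_on_eq_continuous_at by blast
qed

lemma smooth_fun_continuous:
  fixes f :: "'a \<Rightarrow> 'w::real_normed_vector"
  shows "smooth_fun_on \<A> UNIV f \<Longrightarrow> continuous_on UNIV f"
  using smooth_fun_on_continuous by blast

lemma smooth_fun_sum: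
  assumes "\<And>i. i \<in> I \<Longrightarrow> smooth_fun_on \<A> S (f i)" "open S"
  shows "smooth_fun_on \<A> S (\<lambda>x. \<Sum>i\<in>I. f i x)"
  unfolding smooth_fun_on_def o_def
  by (intro ballI smooth_on_sum smooth_fun_on_chart[OF assms(1)] open_chart_image assms)

lemma smooth_fun_diff:
  assumes "smooth_fun_on \<A> S f" "smooth_fun_on \<A> S g" "open S"
  shows "smooth_fun_on \<A> S (\<lambda>x. f x - g x)"
  unfolding smooth_fun_on_def o_def
  by (intro ballI smooth_on_diff smooth_fun_on_chart[OF assms(1)] smooth_fun_on_chart[OF assms(2)] open_chart_image assms)

text \<open>\<open>mderiv\<close> refers to the preferred chart at \<open>x\<close>, which may jump
  from point to point. The chain rule moves the derivative to a fixed chart, where it can be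
  differentiated again or integrated.\<close>

lemma mderiv_tangent:
  fixes f :: "'a \<Rightarrow> 'w::real_normed_vector"
  assumes f: "smooth_fun_on \<A> S f" "open S" "x \<in> S" and c: "c \<in> \<A>" "x \<in> fst c"
  shows "mderiv \<A> f x (tangent \<A> c x v) = frechet_derivative (\<lambda>z. f (cinv c z)) (at (snd c x)) v"
proof -
  let ?d = "chart_at \<A> x"
  let ?U = "snd c ` (fst c \<inter> (fst ?d \<inter> S))"
  have U: "open ?U" "snd c x \<in> ?U"
    using open_chart_image[OF c(1) open_Int[OF chart_open(1)[OF chart_at(1)[of x]] f(2)]] c f chart_at[of x] by auto
  have "((\<lambda>z. f (cinv ?d (transition c ?d z))) has_derivative (\<lambda>v. mderiv \<A> f x (tangent \<A> c x v))) (at (snd c x))"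
  proof (rule has_derivative_compose[where f = "transition c ?d" and g = "\<lambda>z. f (cinv ?d z)"])
    show "(transition c ?d has_derivative tangent \<A> c x) (at (snd c x))"
      unfolding tangent_eq by (rule dtrans_has_derivative[OF c(1) chart_at(1) c(2) chart_at(2)])
    have "((\<lambda>z. f (cinv ?d z)) has_derivative mderiv \<A> f x) (at (snd ?d x))"
      unfolding mderiv_def o_def
      by (rule smooth_on_has_derivative[OF smooth_fun_on_chart[OF f(1) chart_at(1)]]) (use f chart_at in auto)
    then show "((\<lambda>z. f (cinv ?d z)) has_derivative mderiv \<A> f x) (at (transition c ?d (snd c x)))"
      using c by simp
  qed
  then have "((\<lambda>z. f (cinv c z)) has_derivative (\<lambda>v. mderiv \<A> f x (tangent \<A> c x v))) (at (snd c x))"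
    by (rule has_derivative_transform_within_open[OF _ U]) (use c chart_at(1) in auto)
  then have "frechet_derivative (\<lambda>z. f (cinv c z)) (at (snd c x)) = (\<lambda>v. mderiv \<A> f x (tangent \<A> c x v))"
    using frechet_derivative_at by metis
  then show ?thesis by simp
qed

subsection \<open>The measure with a given density\<close>

text \<open>The transformation law of a positive continuous density on the manifold; the Jacobian
  factor is what makes the chart-wise measures agree on overlaps.\<close>

definition consistent :: "(('a, 'n) chart \<Rightarrow> 'a \<Rightarrow> real) \<Rightarrow> bool" where
  "consistent \<delta> \<longleftrightarrow> (\<forall>c\<in>\<A>. \<forall>x\<in>fst c. \<delta> c x > 0) \<and>
     (\<forall>c\<in>\<A>. continuous_on (im c) (\<lambda>z. \<delta> c (cinv c z))) \<and>
     (\<forall>c\<in>\<A>. \<forall>d\<in>\<A>. \<forall>x\<in>fst c \<inter> fst d. \<delta> c x = \<bar>det (jacobian (dtrans c d x))\<bar> * \<delta> d x)"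

lemma consistentD:
  assumes "consistent \<delta>"
  shows "c \<in> \<A> \<Longrightarrow> x \<in> fst c \<Longrightarrow> \<delta> c x > 0"
    and "c \<in> \<A> \<Longrightarrow> continuous_on (im c) (\<lambda>z. \<delta> c (cinv c z))"
    and "c \<in> \<A> \<Longrightarrow> d \<in> \<A> \<Longrightarrow> x \<in> fst c \<Longrightarrow> x \<in> fst d \<Longrightarrow> \<delta> c x = \<bar>det (jacobian (dtrans c d x))\<bar> * \<delta> d x"
  using assms unfolding consistent_def by blast+

text \<open>A total inverse of the chart: the constant value outside the image makes it Borel
  measurable.\<close>

definition \<kappa> :: "('a, 'n) chart \<Rightarrow> complex^'n \<Rightarrow> 'a" where
  "\<kappa> c z = (if z \<in> im c then cinv c z else undefined)"

lemma chart_mem_image: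
  assumes c: "c \<in> \<A>" and "x \<in> fst c" "A \<subseteq> fst c"
  shows "snd c x \<in> snd c ` A \<longleftrightarrow> x \<in> A"
proof
  assume "snd c x \<in> snd c ` A"
  then obtain y where y: "y \<in> A" "snd c x = snd c y" by blast
  then have "y \<in> fst c" using assms(3) by blast
  have "x = cinv c (snd c x)" by (rule cinv_chart[OF c assms(2), symmetric])
  also have "\<dots> = cinv c (snd c y)" by (simp only: y(2))
  also have "\<dots> = y" by (rule cinv_chart[OF c \<open>y \<in> fst c\<close>])
  finally have "x = y" .
  then show "x \<in> A" using y by simp
qed simp

lemma \<kappa>_chart [simp]: "c \<in> \<A> \<Longrightarrow> x \<in> fst c \<Longrightarrow> \<kappa> c (snd c x) = x"
  by (simp add: \<kappa>_def)

lemma \<kappa>_measurable: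
  assumes c: "c \<in> \<A>"
  shows "\<kappa> c \<in> borel_measurable borel"
proof (rule borel_measurableI)
  fix U :: "'a set" assume U: "open U"
  have "\<kappa> c -` U \<inter> space borel = snd c ` (fst c \<inter> U) \<union> (if undefined \<in> U then - im c else {})"
  proof (rule set_eqI)
    fix z
    show "z \<in> \<kappa> c -` U \<inter> space borel \<longleftrightarrow> z \<in> snd c ` (fst c \<inter> U) \<union> (if undefined \<in> U then - im c else {})"
    proof (cases "z \<in> im c")
      case True
      then obtain x where x: "x \<in> fst c" "z = snd c x" by blast
      then show ?thesis using c chart_mem_image[OF c x(1), of "fst c \<inter> U"] by simp
    next
      case False
      then show ?thesis by (auto simp: \<kappa>_def)
    qed
  qed
  moreover have "snd c ` (fst c \<inter> U) \<in> sets borel" using open_chart_image[OF c U] by simp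
  moreover have "- im c \<in> sets borel" using chart_open(2)[OF c] by simp
  ultimately show "\<kappa> c -` U \<inter> space borel \<in> sets borel" by simp
qed

lemma chart_image_borel:
  assumes c: "c \<in> \<A>" and B: "B \<in> sets borel" "B \<subseteq> fst c"
  shows "snd c ` B \<in> sets borel"
proof -
  have "snd c ` B = im c \<inter> (\<kappa> c -` B \<inter> space borel)"
  proof (rule set_eqI)
    fix z
    show "z \<in> snd c ` B \<longleftrightarrow> z \<in> im c \<inter> (\<kappa> c -` B \<inter> space borel)"
    proof (cases "z \<in> im c")
      case True
      then obtain x where x: "x \<in> fst c" "z = snd c x" by blast
      then show ?thesis using c chart_mem_image[OF c x(1) B(2)] by simp
    qed (use B(2) in auto)
  qed
  then show ?thesis using measurable_sets[OF \<kappa>_measurable[OF c] B(1)] chart_open(2)[OF c] by simp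
qed

definition chart_mass :: "(('a, 'n) chart \<Rightarrow> 'a \<Rightarrow> real) \<Rightarrow> ('a, 'n) chart \<Rightarrow> 'a set \<Rightarrow> ennreal" where
  "chart_mass \<delta> c B = (\<integral>\<^sup>+z\<in>snd c ` B. ennreal (\<delta> c (cinv c z)) \<partial>lborel)"

text \<open>The value 0 outside the image ensures that the default value of \<open>\<kappa>\<close>
  receives no mass in \<open>chart_measure\<close>.\<close>

definition dens :: "(('a, 'n) chart \<Rightarrow> 'a \<Rightarrow> real) \<Rightarrow> ('a, 'n) chart \<Rightarrow> complex^'n \<Rightarrow> real" where
  "dens \<delta> c z = (if z \<in> im c then \<delta> c (cinv c z) else 0)"

lemma dens_measurable:
  assumes "consistent \<delta>" and c: "c \<in> \<A>"
  shows "dens \<delta> c \<in> borel_measurable borel"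
proof -
  have "continuous_on (im c) (\<lambda>z. \<delta> c (cinv c z))" by (rule consistentD(2)[OF assms])
  then show ?thesis
    unfolding dens_def using chart_open(2)[OF c] by (intro borel_measurable_continuous_on_if) auto
qed

lemma dens_nonneg: "consistent \<delta> \<Longrightarrow> c \<in> \<A> \<Longrightarrow> dens \<delta> c z \<ge> 0"
proof (cases "z \<in> im c")
  assume *: "consistent \<delta>" "c \<in> \<A>"
  case True
  then obtain x where x: "x \<in> fst c" "z = snd c x" by blast
  have "\<delta> c x \<ge> 0" using consistentD(1)[OF *(1,2) x(1)] by simp
  then show ?thesis unfolding dens_def x(2) cinv_chart[OF *(2) x(1)] by simp
qed (simp add: dens_def)

definition chart_measure :: "(('a, 'n) chart \<Rightarrow> 'a \<Rightarrow> real) \<Rightarrow> ('a, 'n) chart \<Rightarrow> 'a measure" where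
  "chart_measure \<delta> c = distr (density_measure lborel (\<lambda>z. ennreal (dens \<delta> c z))) borel (\<kappa> c)"

lemma emeasure_chart_measure:
  assumes \<delta>: "consistent \<delta>" and c: "c \<in> \<A>" and B: "B \<in> sets borel"
  shows "emeasure (chart_measure \<delta> c) B = chart_mass \<delta> c (B \<inter> fst c)"
proof -
  have km: "\<kappa> c -` B \<in> sets borel" using measurable_sets[OF \<kappa>_measurable[OF c] B] by simp
  have "emeasure (chart_measure \<delta> c) B = (\<integral>\<^sup>+z. ennreal (dens \<delta> c z) * indicator (\<kappa> c -` B) z \<partial>lborel)"
    unfolding chart_measure_def using \<kappa>_measurable[OF c] B dens_measurable[OF \<delta> c] km
    by (simp add: emeasure_distr emeasure_density)
  also have "\<dots> = chart_mass \<delta> c (B \<inter> fst c)"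
    unfolding chart_mass_def
  proof (rule nn_integral_cong)
    fix z
    have "z \<in> snd c ` (B \<inter> fst c) \<longleftrightarrow> z \<in> im c \<and> \<kappa> c z \<in> B"
    proof (cases "z \<in> im c")
      case True
      then obtain x where x: "x \<in> fst c" "z = snd c x" by blast
      then show ?thesis using c chart_mem_image[OF c x(1), of "B \<inter> fst c"] by simp
    qed auto
    then show "ennreal (dens \<delta> c z) * indicator (\<kappa> c -` B) z =
        ennreal (\<delta> c (cinv c z)) * indicator (snd c ` (B \<inter> fst c)) z"
      by (auto simp: dens_def indicator_def)
  qed
  finally show ?thesis .
qed

lemma sets_chart_measure: "sets (chart_measure \<delta> c) = sets borel"
  by (simp add: chart_measure_def)

lemma chart_preimage_borel:
  assumes c: "c \<in> \<A>" and A: "A \<in> sets borel"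
  shows "fst c \<inter> snd c -` A \<in> sets borel"
proof -
  define \<sigma> where "\<sigma> x = (if x \<in> fst c then snd c x else 0)" for x
  have "\<sigma> \<in> borel_measurable borel"
  proof (rule borel_measurableI)
    fix U :: "(complex^'n) set" assume U: "open U"
    have "\<sigma> -` U \<inter> space borel = (fst c \<inter> snd c -` U) \<union> (if 0 \<in> U then - fst c else {})"
      by (auto simp: \<sigma>_def split: if_splits)
    moreover have "open (fst c \<inter> snd c -` U)"
      by (rule continuous_open_preimage[OF chart_continuous(1)[OF c] chart_open(1)[OF c] U])
    moreover have "- fst c \<in> sets borel" using chart_open(1)[OF c] by simp
    ultimately show "\<sigma> -` U \<inter> space borel \<in> sets borel" by simp
  qed
  then have "fst c \<inter> (\<sigma> -` A \<inter> space borel) \<in> sets borel"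
    using A chart_open(1)[OF c] by (intro sets.Int measurable_sets[of \<sigma>]) auto
  moreover have "fst c \<inter> (\<sigma> -` A \<inter> space borel) = fst c \<inter> snd c -` A" by (auto simp: \<sigma>_def)
  ultimately show ?thesis by simp
qed

lemma continuous_on_det_jacobian:
  fixes \<tau> :: "complex^'n \<Rightarrow> complex^'n"
  assumes "smooth_on S \<tau>"
  shows "continuous_on S (\<lambda>z. det (jacobian (frechet_derivative \<tau> (at z))))"
  unfolding det_def jacobian_def
  by (intro continuous_intros) (auto intro!: continuous_intros smooth_on_continuous smooth_on_deriv assms)

text \<open>The Jacobian produced by the change of variables is absorbed by the transformation law
  in \<open>consistent\<close>, so a set inside two chart domains has one mass.\<close>

lemma chart_mass_change:
  assumes \<delta>: "consistent \<delta>" and c: "c \<in> \<A>" and d: "d \<in> \<A>" and B: "B \<in> sets borel" "B \<subseteq> fst c" "B \<subseteq> fst d"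
  shows "chart_mass \<delta> d B = chart_mass \<delta> c B"
proof -
  have img: "transition c d ` snd c ` A = snd d ` A" if "A \<subseteq> fst c" for A
    using that c by (force simp: image_iff)
  have sub: "snd c ` B \<subseteq> snd c ` (fst c \<inter> fst d)" using B by auto
  have "(\<integral>\<^sup>+z. ennreal (\<delta> d (cinv d z)) * indicator (transition c d ` snd c ` B) z \<partial>lborel) =
    (\<integral>\<^sup>+z. ennreal \<bar>det (jacobian (frechet_derivative (transition c d) (at z)))\<bar> * ennreal (\<delta> d (cinv d (transition c d z))) * indicator (snd c ` B) z \<partial>lborel)"
  proof (rule nn_integral_image_complex)
    show "snd c ` B \<in> sets borel" by (rule chart_image_borel[OF c B(1,2)])
    show "transition c d ` A \<in> sets borel" if "A \<in> sets borel" "A \<subseteq> snd c ` B" for A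
    proof -
      let ?A = "fst c \<inter> snd c -` A"
      have sA: "snd c ` ?A = A" "?A \<subseteq> fst d"
      proof -
        have "A \<subseteq> im c" using that(2) B(2) by blast
        then show "snd c ` ?A = A" by blast
        show "?A \<subseteq> fst d"
        proof
          fix x assume "x \<in> ?A"
          then have "x \<in> fst c" "snd c x \<in> snd c ` B" using that(2) by auto
          then have "x \<in> B" using chart_mem_image[OF c _ B(2)] by blast
          then show "x \<in> fst d" using B(3) by blast
        qed
      qed
      have "transition c d ` A = snd d ` ?A" using img[of ?A] sA(1) by simp
      then show ?thesis using chart_image_borel[OF d chart_preimage_borel[OF c that(1)] sA(2)] by simp
    qed
    show "inj_on (transition c d) (snd c ` B)"
    proof (rule inj_onI)
      fix z w assume zw: "z \<in> snd c ` B" "w \<in> snd c ` B" "transition c d z = transition c d w"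
      then obtain x y where xy: "x \<in> B" "z = snd c x" "y \<in> B" "w = snd c y" by blast
      then have f: "x \<in> fst c" "y \<in> fst c" "x \<in> fst d" "y \<in> fst d" using B by auto
      then have "snd d x = snd d y" using zw(3) c xy by simp
      have "x = cinv d (snd d x)" by (rule cinv_chart[OF d f(3), symmetric])
      also have "\<dots> = cinv d (snd d y)" by (simp only: \<open>snd d x = snd d y\<close>)
      also have "\<dots> = y" by (rule cinv_chart[OF d f(4)])
      finally have "x = y" .
      then show "z = w" using xy by simp
    qed
    show "continuous_on (snd c ` B) (transition c d)"
      by (rule continuous_on_subset[OF smooth_on_continuous[OF transition_smooth[OF c d]] sub])
    show "(transition c d has_derivative frechet_derivative (transition c d) (at z)) (at z)" if "z \<in> snd c ` B" for z
      by (rule smooth_on_has_derivative[OF transition_smooth[OF c d]]) (use that sub in blast)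
    show "continuous_on (snd c ` B) (\<lambda>z. det (jacobian (frechet_derivative (transition c d) (at z))))"
      by (rule continuous_on_subset[OF continuous_on_det_jacobian[OF transition_smooth[OF c d]] sub])
    have "(\<lambda>y. ennreal (dens \<delta> d y) * indicator (snd d ` B) y) \<in> borel_measurable borel"
      using dens_measurable[OF \<delta> d] chart_image_borel[OF d B(1,3)] by simp
    moreover have "(\<lambda>y. ennreal (\<delta> d (cinv d y)) * indicator (transition c d ` snd c ` B) y) =
        (\<lambda>y. ennreal (dens \<delta> d y) * indicator (snd d ` B) y)"
    proof (rule ext)
      fix y
      show "ennreal (\<delta> d (cinv d y)) * indicator (transition c d ` snd c ` B) y =
        ennreal (dens \<delta> d y) * indicator (snd d ` B) y"
      proof (cases "y \<in> snd d ` B")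
        case True
        then have "y \<in> im d" using B(3) by blast
        then show ?thesis unfolding img[OF B(2)] by (simp add: dens_def)
      qed (simp add: img[OF B(2)])
    qed
    ultimately show "(\<lambda>y. ennreal (\<delta> d (cinv d y)) * indicator (transition c d ` snd c ` B) y) \<in> borel_measurable borel"
      by simp
  qed
  also have "\<dots> = (\<integral>\<^sup>+z. ennreal (\<delta> c (cinv c z)) * indicator (snd c ` B) z \<partial>lborel)"
  proof (rule nn_integral_cong)
    fix z
    show "ennreal \<bar>det (jacobian (frechet_derivative (transition c d) (at z)))\<bar> * ennreal (\<delta> d (cinv d (transition c d z))) * indicator (snd c ` B) z =
      ennreal (\<delta> c (cinv c z)) * indicator (snd c ` B) z"
    proof (cases "z \<in> snd c ` B")
      case True
      then obtain x where x: "x \<in> B" "z = snd c x" by blast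
      then have xx: "x \<in> fst c" "x \<in> fst d" using B by auto
      have "\<delta> c x = \<bar>det (jacobian (dtrans c d x))\<bar> * \<delta> d x" by (rule consistentD(3)[OF \<delta> c d xx])
      then show ?thesis using x xx c d
        by (simp add: dtrans_def ennreal_mult'[symmetric])
    qed simp
  qed
  finally show ?thesis unfolding chart_mass_def img[OF B(2)] .
qed

section \<open>Existence and uniqueness of the measure with given densities\<close>

lemma finite_cover:
  obtains N and cs :: "nat \<Rightarrow> ('a, 'n) chart" where "\<And>k. k < N \<Longrightarrow> cs k \<in> \<A>" "(\<Union>k<N. fst (cs k)) = UNIV"
proof -
  obtain D where D: "D \<subseteq> \<A>" "finite D" "UNIV \<subseteq> (\<Union>c\<in>D. fst c)"
  proof (rule compactE_image[OF cpt, of \<A> fst])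
    show "open (fst c)" if "c \<in> \<A>" for c by (rule chart_open(1)[OF that])
    show "UNIV \<subseteq> (\<Union>c\<in>\<A>. fst c)" using chart_at by blast
  qed (use that in blast)
  obtain xs where xs: "set xs = D" using D(2) finite_list by blast
  have "(\<Union>k<length xs. fst (xs ! k)) = UNIV"
  proof -
    have "x \<in> (\<Union>k<length xs. fst (xs ! k))" for x
    proof -
      obtain c where "c \<in> set xs" "x \<in> fst c" using D(3) xs by blast
      then show ?thesis by (auto simp: in_set_conv_nth)
    qed
    then show ?thesis by blast
  qed
  moreover have "xs ! k \<in> \<A>" if "k < length xs" for k using that xs D(1) nth_mem by blast
  ultimately show ?thesis using that[of "length xs" "(!) xs"] by blast
qed

definition is_mass :: "(('a, 'n) chart \<Rightarrow> 'a \<Rightarrow> real) \<Rightarrow> 'a measure \<Rightarrow> bool" where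
  "is_mass \<delta> \<mu> \<longleftrightarrow> sets \<mu> = sets borel \<and>
     (\<forall>c\<in>\<A>. \<forall>B\<in>sets borel. B \<subseteq> fst c \<longrightarrow> emeasure \<mu> B = chart_mass \<delta> c B)"

lemma manifold_measure_eq: "manifold_measure \<A> \<delta> = (THE \<mu>. is_mass \<delta> \<mu>)"
  unfolding manifold_measure_def is_mass_def chart_mass_def ..

text \<open>Each piece lies in one chart domain, so a measure on the manifold is determined by, and
  can be assembled from, its restrictions to these finitely many pieces.\<close>

lemma disjoint_cover:
  obtains N and cs :: "nat \<Rightarrow> ('a, 'n) chart" and D :: "nat \<Rightarrow> 'a set" where
    "\<And>k. k < N \<Longrightarrow> cs k \<in> \<A>" "\<And>k. k < N \<Longrightarrow> D k \<subseteq> fst (cs k)" "\<And>k. D k \<in> sets borel"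
    "disjoint_family D" "(\<Union>k<N. D k) = UNIV"
proof -
  obtain N and cs :: "nat \<Rightarrow> ('a, 'n) chart" where cs: "\<And>k. k < N \<Longrightarrow> cs k \<in> \<A>" "(\<Union>k<N. fst (cs k)) = UNIV"
    using finite_cover by blast
  define A where "A k = (if k < N then fst (cs k) else {})" for k
  have A: "A k \<in> sets borel" for k using cs(1) chart_open(1) by (auto simp: A_def)
  have D0: "disjointed A k \<subseteq> A k" for k by (rule disjointed_subset)
  have "(\<Union>k. disjointed A k) = (\<Union>k. A k)" by (rule UN_disjointed_eq)
  also have "\<dots> = UNIV" using cs(2) by (auto simp: A_def)
  finally have U: "(\<Union>k. disjointed A k) = UNIV" .
  have "(\<Union>k<N. disjointed A k) = UNIV"
  proof -
    have "x \<in> (\<Union>k<N. disjointed A k)" for x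
    proof -
      obtain k where k: "x \<in> disjointed A k" using U by blast
      then have "x \<in> A k" using D0 by blast
      then have "k < N" by (auto simp: A_def split: if_splits)
      then show ?thesis using k by blast
    qed
    then show ?thesis by blast
  qed
  moreover have "disjointed A k \<in> sets borel" for k
    unfolding disjointed_def using A by (intro sets.Diff sets.finite_UN) auto
  moreover have "disjointed A k \<subseteq> fst (cs k)" if "k < N" for k using D0[of k] that by (simp add: A_def)
  ultimately show ?thesis using that[of N cs "disjointed A"] cs(1) disjoint_family_disjointed by blast
qed

lemma emeasure_finite_partition:
  assumes "sets M = sets borel" "\<And>k. D k \<in> sets borel" "disjoint_family (D :: nat \<Rightarrow> 'a set)" "(\<Union>k<N. D k) = UNIV" "B \<in> sets borel"
  shows "emeasure M B = (\<Sum>k<N. emeasure M (B \<inter> D k))"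
proof -
  have "(\<Sum>k<N. emeasure M (B \<inter> D k)) = emeasure M (\<Union>k<N. B \<inter> D k)"
  proof (rule sum_emeasure)
    show "(\<lambda>k. B \<inter> D k) ` {..<N} \<subseteq> sets M" using assms by auto
    show "disjoint_family_on (\<lambda>k. B \<inter> D k) {..<N}"
      using assms(3) unfolding disjoint_family_on_def by blast
  qed simp
  also have "(\<Union>k<N. B \<inter> D k) = B" using assms(4) by blast
  finally show ?thesis by simp
qed

lemma is_mass_unique: "is_mass \<delta> \<mu> \<Longrightarrow> is_mass \<delta> \<nu> \<Longrightarrow> \<mu> = \<nu>"
proof (rule measure_eqI)
  assume m: "is_mass \<delta> \<mu>" "is_mass \<delta> \<nu>"
  then have s: "sets \<mu> = sets borel" "sets \<nu> = sets borel" unfolding is_mass_def by simp_all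
  then show "sets \<mu> = sets \<nu>" by simp
  fix B assume "B \<in> sets \<mu>"
  then have B: "B \<in> sets borel" using s by simp
  obtain N and cs :: "nat \<Rightarrow> ('a, 'n) chart" and D where D: "\<And>k. k < N \<Longrightarrow> cs k \<in> \<A>" "\<And>k. k < N \<Longrightarrow> D k \<subseteq> fst (cs k)" "\<And>k. D k \<in> sets borel"
    "disjoint_family D" "(\<Union>k<N. D k) = UNIV"
    using disjoint_cover by blast
  have "emeasure \<mu> (B \<inter> D k) = emeasure \<nu> (B \<inter> D k)" if "k < N" for k
  proof -
    have "B \<inter> D k \<in> sets borel" "B \<inter> D k \<subseteq> fst (cs k)" using B D(3)[of k] D(2)[OF that] by auto
    then show ?thesis using m D(1)[OF that] unfolding is_mass_def by simp
  qed
  then show "emeasure \<mu> B = emeasure \<nu> B"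
    unfolding emeasure_finite_partition[OF s(1) D(3-5) B] emeasure_finite_partition[OF s(2) D(3-5) B] by simp
qed

text \<open>The measure is the sum of the chart measures restricted to the pieces of a partition.
  That it has the prescribed value in every other chart follows on each piece from
  \<open>chart_mass_change\<close>.\<close>

lemma is_mass_exists:
  assumes \<delta>: "consistent \<delta>"
  shows "\<exists>\<mu>. is_mass \<delta> \<mu>"
proof -
  obtain N and cs :: "nat \<Rightarrow> ('a, 'n) chart" and D where D: "\<And>k. k < N \<Longrightarrow> cs k \<in> \<A>" "\<And>k. k < N \<Longrightarrow> D k \<subseteq> fst (cs k)" "\<And>k. D k \<in> sets borel"
    "disjoint_family D" "(\<Union>k<N. D k) = UNIV"
    using disjoint_cover by blast
  define F where "F B = (\<Sum>k<N. emeasure (chart_measure \<delta> (cs k)) (B \<inter> D k))" for B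
  define \<mu> where "\<mu> = measure_of UNIV (sets borel) F"
  have sets: "sets \<mu> = sets borel"
    unfolding \<mu>_def by (metis sets.sets_measure_of_eq space_borel)
  have F: "emeasure \<mu> B = F B" if "B \<in> sets borel" for B
  proof (rule emeasure_measure_of[OF \<mu>_def])
    show "sets borel \<subseteq> Pow (UNIV :: 'a set)" by simp
    show "positive (sets \<mu>) F" by (simp add: positive_def F_def)
    show "countably_additive (sets \<mu>) F"
    proof (rule countably_additiveI)
      fix A :: "nat \<Rightarrow> 'a set" assume A: "range A \<subseteq> sets \<mu>" "disjoint_family A"
      have "emeasure (chart_measure \<delta> (cs k)) (\<Union> (range A) \<inter> D k) = (\<Sum>i. emeasure (chart_measure \<delta> (cs k)) (A i \<inter> D k))" for k
      proof -
        have "(\<Union>i. A i \<inter> D k) = \<Union> (range A) \<inter> D k" by blast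
        moreover have "range (\<lambda>i. A i \<inter> D k) \<subseteq> sets (chart_measure \<delta> (cs k))"
          using A(1) D(3) sets by (auto simp: sets_chart_measure)
        moreover have "disjoint_family (\<lambda>i. A i \<inter> D k)"
          using A(2) by (auto simp: disjoint_family_on_def)
        ultimately show ?thesis using suminf_emeasure[of "\<lambda>i. A i \<inter> D k" "chart_measure \<delta> (cs k)"] by simp
      qed
      then have "F (\<Union> (range A)) = (\<Sum>k<N. \<Sum>i. emeasure (chart_measure \<delta> (cs k)) (A i \<inter> D k))"
        by (simp add: F_def)
      also have "\<dots> = (\<Sum>i. F (A i))"
        unfolding F_def by (rule suminf_sum[symmetric]) simp
      finally show "(\<Sum>i. F (A i)) = F (\<Union> (range A))" by simp
    qed
    show "B \<in> sets \<mu>" using that sets by simp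
  qed
  have "emeasure \<mu> B = chart_mass \<delta> c B" if c: "c \<in> \<A>" and B: "B \<in> sets borel" "B \<subseteq> fst c" for c B
  proof -
    have "emeasure (chart_measure \<delta> (cs k)) (B \<inter> D k) = emeasure (chart_measure \<delta> c) (B \<inter> D k)" if "k < N" for k
    proof -
      have BD: "B \<inter> D k \<in> sets borel" "B \<inter> D k \<subseteq> fst c" "B \<inter> D k \<subseteq> fst (cs k)"
        using B D(3)[of k] D(2)[OF that] by auto
      then have e: "B \<inter> D k \<inter> fst c = B \<inter> D k" "B \<inter> D k \<inter> fst (cs k) = B \<inter> D k" by auto
      show ?thesis
        using emeasure_chart_measure[OF \<delta> c BD(1)] emeasure_chart_measure[OF \<delta> D(1)[OF that] BD(1)]
          chart_mass_change[OF \<delta> c D(1)[OF that] BD] unfolding e by simp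
    qed
    then have "emeasure \<mu> B = (\<Sum>k<N. emeasure (chart_measure \<delta> c) (B \<inter> D k))"
      using F[OF B(1)] by (simp add: F_def)
    also have "\<dots> = emeasure (chart_measure \<delta> c) B"
      by (rule emeasure_finite_partition[OF sets_chart_measure D(3-5) B(1), symmetric])
    also have "\<dots> = chart_mass \<delta> c (B \<inter> fst c)" by (rule emeasure_chart_measure[OF \<delta> c B(1)])
    also have "B \<inter> fst c = B" using B by auto
    finally show ?thesis .
  qed
  then show ?thesis using sets unfolding is_mass_def by blast
qed

lemma is_mass_manifold_measure:
  assumes "consistent \<delta>"
  shows "is_mass \<delta> (manifold_measure \<A> \<delta>)"
proof -
  obtain \<mu> where \<mu>: "is_mass \<delta> \<mu>" using is_mass_exists[OF assms] by blast
  show ?thesis unfolding manifold_measure_eq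
    by (rule theI[of "is_mass \<delta>", OF \<mu> is_mass_unique[OF _ \<mu>]])
qed

lemma sets_manifold_measure [simp]: "consistent \<delta> \<Longrightarrow> sets (manifold_measure \<A> \<delta>) = sets borel"
  using is_mass_manifold_measure unfolding is_mass_def by blast

lemma space_manifold_measure [simp]: "consistent \<delta> \<Longrightarrow> space (manifold_measure \<A> \<delta>) = UNIV"
  using sets_eq_imp_space_eq[OF sets_manifold_measure] by simp

lemma manifold_measure_chart:
  assumes \<delta>: "consistent \<delta>" and c: "c \<in> \<A>"
  shows "density_measure (manifold_measure \<A> \<delta>) (indicator (fst c)) = chart_measure \<delta> c"
proof (rule measure_eqI)
  let ?\<mu> = "manifold_measure \<A> \<delta>"
  have m: "sets ?\<mu> = sets borel" using \<delta> by simp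
  show "sets (density_measure ?\<mu> (indicator (fst c))) = sets (chart_measure \<delta> c)"
    by (simp add: m sets_chart_measure)
  fix A assume "A \<in> sets (density_measure ?\<mu> (indicator (fst c)))"
  then have A: "A \<in> sets borel" by (simp add: m)
  have f: "fst c \<in> sets borel" using chart_open(1)[OF c] by simp
  have fm: "indicator (fst c) \<in> borel_measurable ?\<mu>"
    by (rule borel_measurable_indicator) (simp add: m f)
  have "emeasure (density_measure ?\<mu> (indicator (fst c))) A = (\<integral>\<^sup>+x. indicator (fst c) x * indicator A x \<partial>?\<mu>)"
    by (rule emeasure_density[OF fm]) (simp add: m A)
  also have "\<dots> = (\<integral>\<^sup>+x. indicator (A \<inter> fst c) x \<partial>?\<mu>)"
    by (intro nn_integral_cong) (auto simp: indicator_def)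
  also have "\<dots> = emeasure ?\<mu> (A \<inter> fst c)" using A f by (intro nn_integral_indicator) (auto simp: m)
  also have "\<dots> = chart_mass \<delta> c (A \<inter> fst c)"
    using is_mass_manifold_measure[OF \<delta>] A f c unfolding is_mass_def by auto
  also have "\<dots> = emeasure (chart_measure \<delta> c) A" by (rule emeasure_chart_measure[OF \<delta> c A, symmetric])
  finally show "emeasure (density_measure ?\<mu> (indicator (fst c))) A = emeasure (chart_measure \<delta> c) A" .
qed

section \<open>Integrals, finiteness and support of the measure\<close>

lemma integral_chart:
  fixes f :: "'a \<Rightarrow> 'b::{banach, second_countable_topology}"
  assumes \<delta>: "consistent \<delta>" and c: "c \<in> \<A>" and f: "f \<in> borel_measurable borel" and supp: "\<And>x. x \<notin> fst c \<Longrightarrow> f x = 0"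
  shows "(LINT x|manifold_measure \<A> \<delta>. f x) = (LINT z|lborel. dens \<delta> c z *\<^sub>R f (\<kappa> c z))"
proof -
  let ?\<mu> = "manifold_measure \<A> \<delta>"
  have fc: "fst c \<in> sets borel" using chart_open(1)[OF c] by simp
  have m: "f \<in> borel_measurable ?\<mu>" using f measurable_cong_sets[OF sets_manifold_measure[OF \<delta>] refl] by blast
  have "(LINT x|?\<mu>. f x) = (LINT x|?\<mu>. indicator (fst c) x *\<^sub>R f x)"
    by (intro Bochner_Integration.integral_cong) (auto simp: indicator_def supp)
  also have "\<dots> = (LINT x|density_measure ?\<mu> (\<lambda>x. ennreal (indicator (fst c) x)). f x)"
  proof (rule integral_density[symmetric])
    show "(\<lambda>x. indicator (fst c) x) \<in> borel_measurable ?\<mu>"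
      by (rule borel_measurable_indicator) (simp add: \<delta> fc)
  qed (use m in auto)
  also have "\<dots> = (LINT x|chart_measure \<delta> c. f x)"
    using manifold_measure_chart[OF \<delta> c] by (simp add: ennreal_indicator)
  also have "\<dots> = (LINT z|density_measure lborel (\<lambda>z. ennreal (dens \<delta> c z)). f (\<kappa> c z))"
    unfolding chart_measure_def using \<kappa>_measurable[OF c] f by (intro integral_distr) auto
  also have "\<dots> = (LINT z|lborel. dens \<delta> c z *\<^sub>R f (\<kappa> c z))"
    using dens_measurable[OF \<delta> c] dens_nonneg[OF \<delta> c] measurable_compose[OF \<kappa>_measurable[OF c] f]
    by (intro integral_density) auto
  finally show ?thesis .
qed

text \<open>Around each point the density is bounded on a compact coordinate ball, so small
  neighbourhoods have finite mass; compactness leaves finitely many of them.\<close>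

lemma finite_manifold_measure:
  assumes \<delta>: "consistent \<delta>"
  shows "finite_measure (manifold_measure \<A> \<delta>)"
proof (rule finite_measureI)
  let ?\<mu> = "manifold_measure \<A> \<delta>"
  have "\<exists>U. open U \<and> x \<in> U \<and> emeasure ?\<mu> U < \<infinity>" for x
  proof -
    let ?c = "chart_at \<A> x"
    note c = chart_at(1)[of x]
    obtain e where e: "e > 0" "cball (snd ?c x) e \<subseteq> im ?c"
      using chart_open(2)[OF c] chart_at(2)[of x] open_contains_cball by blast
    let ?U = "fst ?c \<inter> snd ?c -` ball (snd ?c x) e"
    have U: "open ?U" by (rule continuous_open_preimage[OF chart_continuous(1)[OF c] chart_open(1)[OF c] open_ball])
    have cont: "continuous_on (cball (snd ?c x) e) (\<lambda>z. \<delta> ?c (cinv ?c z))"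
      by (rule continuous_on_subset[OF consistentD(2)[OF \<delta> c] e(2)])
    obtain K where K0: "\<forall>y\<in>(\<lambda>z. \<delta> ?c (cinv ?c z)) ` cball (snd ?c x) e. norm y \<le> K"
      using compact_imp_bounded[OF compact_continuous_image[OF cont compact_cball]]
      unfolding bounded_iff by blast
    have K: "\<bar>\<delta> ?c (cinv ?c z)\<bar> \<le> K" if "z \<in> cball (snd ?c x) e" for z
      using bspec[OF K0 imageI[OF that]] by simp
    have "emeasure ?\<mu> ?U = chart_mass \<delta> ?c ?U"
      using is_mass_manifold_measure[OF \<delta>] c U unfolding is_mass_def by auto
    also have "\<dots> \<le> (\<integral>\<^sup>+z. ennreal K * indicator (cball (snd ?c x) e) z \<partial>lborel)"
      unfolding chart_mass_def
    proof (rule nn_integral_mono)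
      fix z show "ennreal (\<delta> ?c (cinv ?c z)) * indicator (snd ?c ` ?U) z \<le> ennreal K * indicator (cball (snd ?c x) e) z"
      proof (cases "z \<in> snd ?c ` ?U")
        case True
        then have z: "z \<in> cball (snd ?c x) e" by auto
        then show ?thesis using K[OF z] True by (auto intro!: ennreal_leI)
      qed simp
    qed
    also have "\<dots> = ennreal K * emeasure lborel (cball (snd ?c x) e)"
      by (rule nn_integral_cmult_indicator) simp
    also have "\<dots> < \<infinity>"
      using emeasure_bounded_finite[OF bounded_cball[of "snd ?c x" e]] by (simp add: ennreal_mult_less_top)
    finally show ?thesis using U e chart_at(2)[of x] by auto
  qed
  then obtain U where U: "\<And>x. open (U x)" "\<And>x. x \<in> U x" "\<And>x. emeasure ?\<mu> (U x) < \<infinity>" by metis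
  obtain D where D: "finite D" "UNIV \<subseteq> (\<Union>x\<in>D. U x)"
  proof (rule compactE_image[OF cpt, of UNIV U])
    show "UNIV \<subseteq> (\<Union>x\<in>UNIV. U x)" using U(2) by blast
  qed (use that U(1) in blast)+
  have "emeasure ?\<mu> (space ?\<mu>) \<le> emeasure ?\<mu> (\<Union>x\<in>D. U x)"
    using D U(1) by (intro emeasure_mono) (auto simp: \<delta>)
  also have "\<dots> \<le> (\<Sum>x\<in>D. emeasure ?\<mu> (U x))"
    using D U(1) by (intro emeasure_subadditive_finite) (auto simp: \<delta>)
  also have "\<dots> < \<infinity>" using U(3) D(1) by (simp add: sum_Pinfty less_top)
  finally show "emeasure ?\<mu> (space ?\<mu>) \<noteq> \<infinity>" by simp
qed

lemma continuous_integrable: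
  fixes f :: "'a \<Rightarrow> 'b::{banach, second_countable_topology}"
  assumes \<delta>: "consistent \<delta>" and f: "continuous_on UNIV f"
  shows "integrable (manifold_measure \<A> \<delta>) f"
proof -
  obtain K where K0: "\<forall>y\<in>range f. norm y \<le> K"
    using compact_imp_bounded[OF compact_continuous_image[OF f cpt]] unfolding bounded_iff by blast
  have K: "norm (f x) \<le> K" for x using bspec[OF K0 rangeI] .
  have "f \<in> borel_measurable (manifold_measure \<A> \<delta>)"
    using borel_measurable_continuous_onI[OF f] measurable_cong_sets[OF sets_manifold_measure[OF \<delta>] refl] by blast
  then show ?thesis
    using K by (intro finite_measure.integrable_const_bound[OF finite_manifold_measure[OF \<delta>], of _ K]) auto
qed

text \<open>Full support turns vanishing integrals of nonnegative continuous functions into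
  pointwise vanishing. This underlies the positivity of the product on sections and the uniqueness
  of weakly defined functions.\<close>

lemma manifold_measure_open_pos:
  assumes \<delta>: "consistent \<delta>" and U: "open U" "x \<in> U"
  shows "emeasure (manifold_measure \<A> \<delta>) U > 0"
proof (rule ccontr)
  let ?\<mu> = "manifold_measure \<A> \<delta>" and ?c = "chart_at \<A> x"
  note c = chart_at(1)[of x]
  let ?V = "fst ?c \<inter> U"
  have V: "open ?V" "x \<in> ?V" using chart_open(1)[OF c] U chart_at(2) by auto
  assume "\<not> emeasure ?\<mu> U > 0"
  then have "emeasure ?\<mu> U = 0" by simp
  then have "emeasure ?\<mu> ?V = 0"
    using emeasure_mono[of ?V U ?\<mu>] U \<delta> by auto
  then have "chart_mass \<delta> ?c ?V = 0"
    using is_mass_manifold_measure[OF \<delta>] c V unfolding is_mass_def by auto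
  then have "(\<integral>\<^sup>+z. ennreal (dens \<delta> ?c z) * indicator (snd ?c ` ?V) z \<partial>lborel) = 0"
    unfolding chart_mass_def
    by (subst (asm) nn_integral_cong[where v = "\<lambda>z. ennreal (dens \<delta> ?c z) * indicator (snd ?c ` ?V) z"])
      (auto simp: dens_def indicator_def)
  moreover have "snd ?c ` ?V \<in> sets borel" using open_chart_image[OF c U(1)] by simp
  moreover have "(\<lambda>z. ennreal (dens \<delta> ?c z)) \<in> borel_measurable borel" using dens_measurable[OF \<delta> c] by simp
  ultimately have "AE z in lborel. ennreal (dens \<delta> ?c z) * indicator (snd ?c ` ?V) z = 0"
    by (subst (asm) nn_integral_0_iff_AE) auto
  moreover have pos: "dens \<delta> ?c z > 0" if "z \<in> snd ?c ` ?V" for z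
  proof -
    obtain y where y: "y \<in> fst ?c" "z = snd ?c y" using \<open>z \<in> snd ?c ` ?V\<close> by blast
    show ?thesis unfolding y(2) dens_def cinv_chart[OF c y(1)] using consistentD(1)[OF \<delta> c y(1)] y(1) by simp
  qed
  ultimately have "AE z in lborel. z \<notin> snd ?c ` ?V"
  proof (elim eventually_mono)
    fix z assume z: "ennreal (dens \<delta> ?c z) * indicator (snd ?c ` ?V) z = 0"
    show "z \<notin> snd ?c ` ?V"
    proof
      assume "z \<in> snd ?c ` ?V"
      then show False using z pos[of z] by (simp add: ennreal_eq_0_iff)
    qed
  qed
  then have "snd ?c ` ?V \<in> null_sets lborel"
    using \<open>snd ?c ` ?V \<in> sets borel\<close> by (subst AE_iff_null_sets) simp_all
  then have "negligible (snd ?c ` ?V)"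
    using negligible_iff_null_sets null_sets_completionI by blast
  then show False
    using open_not_negligible[OF open_chart_image[OF c U(1)]] V by blast
qed

lemma integral_zero_imp_zero:
  fixes f :: "'a \<Rightarrow> real"
  assumes \<delta>: "consistent \<delta>" and f: "continuous_on UNIV f" "\<And>x. f x \<ge> 0" and 0: "(LINT x|manifold_measure \<A> \<delta>. f x) = 0"
  shows "f x = 0"
proof (rule ccontr)
  let ?\<mu> = "manifold_measure \<A> \<delta>"
  assume "f x \<noteq> 0"
  have "AE x in ?\<mu>. f x = 0"
    using integral_nonneg_eq_0_iff_AE[OF continuous_integrable[OF \<delta> f(1)]] f(2) 0 by simp
  moreover have O: "open {y. f y \<noteq> 0}" using f(1) by (intro open_Collect_neq) (auto intro: continuous_intros)
  ultimately have "emeasure ?\<mu> {y. f y \<noteq> 0} = 0"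
    using \<delta> AE_iff_measurable[of "{y. f y \<noteq> 0}" ?\<mu> "\<lambda>y. f y = 0"] by auto
  then show False using manifold_measure_open_pos[OF \<delta> O] \<open>f x \<noteq> 0\<close> by simp
qed

end

section \<open>The Levi form\<close>

definition D2 :: "('v::real_normed_vector \<Rightarrow> 'w::real_normed_vector) \<Rightarrow> 'v \<Rightarrow> 'v \<Rightarrow> 'v \<Rightarrow> 'w" where
  "D2 f z u v = frechet_derivative (\<lambda>y. frechet_derivative f (at y) u) (at z) v"

lemma D2_cong:
  assumes "open S" "z \<in> S" "\<And>y. y \<in> S \<Longrightarrow> f y = g y"
  shows "D2 f z u v = D2 g z u v"
proof -
  have "frechet_derivative f (at y) u = frechet_derivative g (at y) u" if "y \<in> S" for y
    using frechet_derivative_cong_open[OF assms(1) that assms(3)] by simp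
  then have "frechet_derivative (\<lambda>y. frechet_derivative f (at y) u) (at z) =
      frechet_derivative (\<lambda>y. frechet_derivative g (at y) u) (at z)"
    by (intro frechet_derivative_cong_open[OF assms(1,2)])
  then show ?thesis by (simp add: D2_def)
qed

lemma D2_sym:
  fixes f :: "'a::real_normed_vector \<Rightarrow> 'b::euclidean_space"
  shows "smooth_on S f \<Longrightarrow> z \<in> S \<Longrightarrow> open S \<Longrightarrow> D2 f z u v = D2 f z v u"
  unfolding D2_def by (rule second_derivative_symmetric)

lemma D2_linear_right:
  assumes "smooth_on S f" "z \<in> S"
  shows "linear (D2 f z u)"
proof -
  have "D2 f z u = frechet_derivative (\<lambda>y. frechet_derivative f (at y) u) (at z)" by (simp add: D2_def fun_eq_iff)
  then show ?thesis
    using has_derivative_linear[OF smooth_on_has_derivative[OF smooth_on_deriv[OF assms(1)] assms(2)]] by simp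
qed

lemma D2_linear_left:
  fixes f :: "'a::real_normed_vector \<Rightarrow> 'b::euclidean_space"
  assumes "smooth_on S f" "z \<in> S" "open S"
  shows "linear (\<lambda>u. D2 f z u v)"
proof -
  have "(\<lambda>u. D2 f z u v) = D2 f z v" using D2_sym[OF assms] by (simp add: fun_eq_iff)
  then show ?thesis using D2_linear_right[OF assms(1,2)] by simp
qed

lemma smooth_on_frechet_linear: "smooth_on S f \<Longrightarrow> z \<in> S \<Longrightarrow> linear (frechet_derivative f (at z))"
  using smooth_on_has_derivative has_derivative_linear by blast

lemma smooth_on_D2: "smooth_on S f \<Longrightarrow> smooth_on S (\<lambda>z. D2 f z u v)"
  unfolding D2_def by (intro smooth_on_deriv)

lemma D2_add:
  assumes f: "smooth_on S f" and g: "smooth_on S g" and S: "z \<in> S" "open S"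
  shows "D2 (\<lambda>y. f y + g y) z u v = D2 f z u v + D2 g z u v"
proof -
  have 1: "frechet_derivative (\<lambda>y. f y + g y) (at y) u = frechet_derivative f (at y) u + frechet_derivative g (at y) u"
    if "y \<in> S" for y
    using frechet_derivative_at[OF has_derivative_add[OF smooth_on_has_derivative[OF f that] smooth_on_has_derivative[OF g that]]]
    by (metis (no_types))
  have "frechet_derivative (\<lambda>y. frechet_derivative (\<lambda>y. f y + g y) (at y) u) (at z) =
    frechet_derivative (\<lambda>y. frechet_derivative f (at y) u + frechet_derivative g (at y) u) (at z)"
    by (rule frechet_derivative_cong_open[OF S(2,1) 1])
  also have "\<dots> = (\<lambda>v. D2 f z u v + D2 g z u v)"
    unfolding D2_def
    by (rule frechet_derivative_at[symmetric, OF has_derivative_add[OF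
          smooth_on_has_derivative[OF smooth_on_deriv[OF f] S(1)] smooth_on_has_derivative[OF smooth_on_deriv[OF g] S(1)]]])
  finally show ?thesis by (simp add: D2_def)
qed

text \<open>The first summand, with the second derivative of the inner map, is the part of a Hessian
  that is not tensorial; the Levi form is designed to remove it.\<close>

lemma D2_compose:
  fixes f :: "complex^'n \<Rightarrow> real" and \<tau> :: "complex^'n \<Rightarrow> complex^'n"
  assumes f: "smooth_on T f" "open T" and \<tau>: "smooth_on S \<tau>" "open S" "\<tau> ` S \<subseteq> T" and z: "z \<in> S"
  shows "D2 (\<lambda>y. f (\<tau> y)) z u v = frechet_derivative f (at (\<tau> z)) (D2 \<tau> z u v) +
    D2 f (\<tau> z) (frechet_derivative \<tau> (at z) u) (frechet_derivative \<tau> (at z) v)"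
proof -
  let ?Df = "\<lambda>y. frechet_derivative f (at y)" and ?Dt = "\<lambda>y. frechet_derivative \<tau> (at y)"
  have inT: "\<tau> y \<in> T" if "y \<in> S" for y using \<tau> that by blast
  have lin: "linear (?Df (\<tau> y))" if "y \<in> S" for y by (rule smooth_on_frechet_linear[OF f(1) inT[OF that]])
  have expand: "L a = (\<Sum>b\<in>Basis. (a \<bullet> b) *\<^sub>R L b)" if "linear L" for a :: "complex^'n" and L :: "complex^'n \<Rightarrow> real"
  proof -
    have "L (\<Sum>b\<in>Basis. (a \<bullet> b) *\<^sub>R b) = (\<Sum>b\<in>Basis. (a \<bullet> b) *\<^sub>R L b)"
      using that by (simp add: linear_sum linear_scale)
    then show ?thesis by (simp only: euclidean_representation)
  qed
  have 1: "frechet_derivative (\<lambda>y. f (\<tau> y)) (at y) u = (\<Sum>b\<in>Basis. (?Dt y u \<bullet> b) *\<^sub>R ?Df (\<tau> y) b)" if "y \<in> S" for y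
  proof -
    have "((\<lambda>y. f (\<tau> y)) has_derivative (\<lambda>v. ?Df (\<tau> y) (?Dt y v))) (at y)"
      by (rule has_derivative_compose[OF smooth_on_has_derivative[OF \<tau>(1) that] smooth_on_has_derivative[OF f(1) inT[OF that]]])
    then have "frechet_derivative (\<lambda>y. f (\<tau> y)) (at y) = (\<lambda>v. ?Df (\<tau> y) (?Dt y v))"
      by (rule frechet_derivative_at[symmetric])
    then have "frechet_derivative (\<lambda>y. f (\<tau> y)) (at y) u = ?Df (\<tau> y) (?Dt y u)" by (rule fun_cong)
    also have "\<dots> = (\<Sum>b\<in>Basis. (?Dt y u \<bullet> b) *\<^sub>R ?Df (\<tau> y) b)" by (rule expand[OF lin[OF that]])
    finally show ?thesis .
  qed
  have d: "((\<lambda>y. \<Sum>b\<in>Basis. (?Dt y u \<bullet> b) *\<^sub>R ?Df (\<tau> y) b) has_derivative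
      (\<lambda>v. \<Sum>b\<in>Basis. (?Dt z u \<bullet> b) *\<^sub>R D2 f (\<tau> z) b (?Dt z v) + (D2 \<tau> z u v \<bullet> b) *\<^sub>R ?Df (\<tau> z) b)) (at z)"
  proof (intro has_derivative_sum has_derivative_scaleR)
    fix b :: "complex^'n"
    have "((\<lambda>y. ?Dt y u) has_derivative D2 \<tau> z u) (at z)"
      using smooth_on_has_derivative[OF smooth_on_deriv[OF \<tau>(1)] z] unfolding D2_def .
    then show "((\<lambda>y. ?Dt y u \<bullet> b) has_derivative (\<lambda>v. D2 \<tau> z u v \<bullet> b)) (at z)"
      by (rule bounded_linear.has_derivative[OF bounded_linear_inner_left])
    have "((\<lambda>y. ?Df y b) has_derivative D2 f (\<tau> z) b) (at (\<tau> z))"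
      using smooth_on_has_derivative[OF smooth_on_deriv[OF f(1)] inT[OF z]] unfolding D2_def .
    then show "((\<lambda>y. ?Df (\<tau> y) b) has_derivative (\<lambda>v. D2 f (\<tau> z) b (?Dt z v))) (at z)"
      by (rule has_derivative_compose[OF smooth_on_has_derivative[OF \<tau>(1) z]])
  qed
  have "frechet_derivative (\<lambda>y. frechet_derivative (\<lambda>y. f (\<tau> y)) (at y) u) (at z) =
     frechet_derivative (\<lambda>y. \<Sum>b\<in>Basis. (?Dt y u \<bullet> b) *\<^sub>R ?Df (\<tau> y) b) (at z)"
    by (rule frechet_derivative_cong_open[OF \<tau>(2) z 1])
  also have "\<dots> = (\<lambda>v. \<Sum>b\<in>Basis. (?Dt z u \<bullet> b) *\<^sub>R D2 f (\<tau> z) b (?Dt z v) + (D2 \<tau> z u v \<bullet> b) *\<^sub>R ?Df (\<tau> z) b)"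
    by (rule frechet_derivative_at[symmetric, OF d])
  finally have "D2 (\<lambda>y. f (\<tau> y)) z u v = (\<Sum>b\<in>Basis. (?Dt z u \<bullet> b) *\<^sub>R D2 f (\<tau> z) b (?Dt z v)) +
      (\<Sum>b\<in>Basis. (D2 \<tau> z u v \<bullet> b) *\<^sub>R ?Df (\<tau> z) b)"
    by (simp add: D2_def[of "\<lambda>y. f (\<tau> y)"] sum.distrib)
  also have "(\<Sum>b\<in>Basis. (?Dt z u \<bullet> b) *\<^sub>R D2 f (\<tau> z) b (?Dt z v)) = D2 f (\<tau> z) (?Dt z u) (?Dt z v)"
    by (rule expand[OF D2_linear_left[OF f(1) inT[OF z] f(2)], of "?Dt z u" "?Dt z v", symmetric])
  also have "(\<Sum>b\<in>Basis. (D2 \<tau> z u v \<bullet> b) *\<^sub>R ?Df (\<tau> z) b) = ?Df (\<tau> z) (D2 \<tau> z u v)"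
    by (rule expand[OF lin[OF z], of "D2 \<tau> z u v", symmetric])
  finally show ?thesis by (simp only: add.commute)
qed

text \<open>Twice the J-invariant part of the real Hessian; in coordinates, 4 times the real part of
  the sum of the mixed derivatives f_{j kbar} u_j conj(v_k).\<close>

definition levi :: "(complex^'n \<Rightarrow> real) \<Rightarrow> complex^'n \<Rightarrow> complex^'n \<Rightarrow> complex^'n \<Rightarrow> real" where
  "levi f z u v = D2 f z u v + D2 f z (J u) (J v)"

text \<open>The nontensorial term of \<open>D2_compose\<close> changes sign when J is applied to
  both arguments of a holomorphic map, so it cancels in the sum defining
  \<open>levi\<close>.\<close>

lemma levi_compose:
  fixes f :: "complex^'n \<Rightarrow> real" and \<tau> :: "complex^'n \<Rightarrow> complex^'n"
  assumes f: "smooth_on T f" "open T" and S: "open S" and \<tau>: "\<And>k. hol_on S (\<lambda>z. \<tau> z $ k)" "\<tau> ` S \<subseteq> T" and z: "z \<in> S"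
  shows "levi (\<lambda>y. f (\<tau> y)) z u v = levi f (\<tau> z) (frechet_derivative \<tau> (at z) u) (frechet_derivative \<tau> (at z) v)"
proof -
  note sm = hol_map_smooth[OF S \<tau>(1)]
  have J1: "frechet_derivative \<tau> (at y) (J u) = J (frechet_derivative \<tau> (at y) u)" if "y \<in> S" for y u
    unfolding J_def by (rule hol_map_deriv_smult[OF S \<tau>(1) that])
  have r: "D2 \<tau> z u (J v) = J (D2 \<tau> z u v)" for u v
    unfolding D2_def J_def by (rule hol_map_deriv2_smult[OF S \<tau>(1) z])
  have l: "D2 \<tau> z (J u) v = J (D2 \<tau> z u v)" for u v
    using D2_sym[OF sm z S] r by metis
  have "D2 \<tau> z (J u) (J v) = - D2 \<tau> z u v" unfolding l r by simp
  then have "frechet_derivative f (at (\<tau> z)) (D2 \<tau> z (J u) (J v)) = - frechet_derivative f (at (\<tau> z)) (D2 \<tau> z u v)"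
    using linear_neg[OF smooth_on_frechet_linear[OF f(1)]] \<tau>(2) z by auto
  then show ?thesis
    unfolding levi_def D2_compose[OF f sm S \<tau>(2) z] J1[OF z] by simp
qed

lemma smooth_on_levi: "smooth_on S f \<Longrightarrow> open S \<Longrightarrow> smooth_on S (\<lambda>z. levi f z u v)"
  unfolding levi_def by (intro smooth_on_add smooth_on_D2)

lemma levi_cong:
  assumes "open S" "z \<in> S" "\<And>y. y \<in> S \<Longrightarrow> f y = g y"
  shows "levi f z u v = levi g z u v"
  unfolding levi_def using D2_cong[OF assms] by simp

lemma levi_add:
  assumes "smooth_on S f" "smooth_on S g" "z \<in> S" "open S"
  shows "levi (\<lambda>y. f y + g y) z u v = levi f z u v + levi g z u v"
  unfolding levi_def D2_add[OF assms] by simp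

lemma levi_cmult:
  assumes f: "smooth_on S f" and S: "z \<in> S" "open S"
  shows "levi (\<lambda>y. a * f y) z u v = a * levi f z u v"
  unfolding levi_def D2_def frechet_derivative2_bounded_linear[OF bounded_linear_mult_right f S]
  by (simp add: algebra_simps)

lemma levi_linear:
  assumes f: "smooth_on S f" and S: "z \<in> S" "open S"
  shows "linear (levi f z u)"
proof -
  have "linear (\<lambda>v. D2 f z u v + D2 f z (J u) (J v))"
    using linear_compose_add[OF D2_linear_right[OF f S(1)] linear_compose[OF linear_J D2_linear_right[OF f S(1)]]]
    by (simp add: o_def)
  then show ?thesis unfolding levi_def[abs_def] .
qed

lemma levi_sym:
  assumes f: "smooth_on S f" and S: "z \<in> S" "open S"
  shows "levi f z u v = levi f z v u"
  unfolding levi_def using D2_sym[OF f S] by simp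

lemma levi_J:
  assumes f: "smooth_on S f" and S: "z \<in> S" "open S"
  shows "levi f z (J u) (J v) = levi f z u v"
  unfolding levi_def
  using linear_neg[OF D2_linear_right[OF f S(1)]] linear_neg[OF D2_linear_left[OF f S]] by simp

lemma cmod2_eq_Re: "(cmod w)^2 = Re (cnj w * w)"
  unfolding cmod_power2 by (simp add: power2_eq_square)

lemma smooth_on_sum_norm2:
  fixes s :: "'e \<Rightarrow> complex^'n \<Rightarrow> complex"
  assumes "open S" "\<And>e. e \<in> I \<Longrightarrow> hol_on S (s e)"
  shows "smooth_on S (\<lambda>z. \<Sum>e\<in>I. (cmod (s e z))^2)"
proof -
  have "smooth_on S (\<lambda>z. \<Sum>e\<in>I. Re (cnj (s e z) * s e z))"
    by (intro smooth_on_sum smooth_on_Re smooth_on_mult smooth_on_cnj hol_on_smooth assms)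
  then show ?thesis unfolding cmod2_eq_Re .
qed

text \<open>Pure second derivatives of the holomorphic functions cancel between the arguments u, v
  and J u, J v; only products of a derivative with a conjugate derivative remain. The result is the
  Fubini-Study expression, to be met again in \<open>fs_hess\<close>.\<close>

lemma levi_ln_sum_norm2:
  fixes s :: "'e \<Rightarrow> complex^'n \<Rightarrow> complex"
  assumes S: "open S" "z \<in> S" and hol: "\<And>e. e \<in> I \<Longrightarrow> hol_on S (s e)" 
    and pos: "\<And>z. z \<in> S \<Longrightarrow> (\<Sum>e\<in>I. (cmod (s e z))^2) > 0"
  defines "N \<equiv> (\<lambda>z. \<Sum>e\<in>I. (cmod (s e z))^2)" and "d \<equiv> (\<lambda>e. frechet_derivative (s e) (at z))"
  shows "levi (\<lambda>y. ln (N y)) z u v = 4 * Re ((\<Sum>e\<in>I. d e u * cnj (d e v)) / N z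
    - (\<Sum>e\<in>I. cnj (s e z) * d e u) * cnj (\<Sum>e\<in>I. cnj (s e z) * d e v) / (N z)^2)"
proof -
  let ?d = "\<lambda>e y. frechet_derivative (s e) (at y)"
  define P where "P y v = 2 * Re (\<Sum>e\<in>I. cnj (s e y) * ?d e y v)" for y v
  have sd: "(s e has_derivative ?d e y) (at y)" if "e \<in> I" "y \<in> S" for e y
    by (rule hol_on_has_derivative(1)[OF hol[OF that(1)] that(2)])
  have dJ: "?d e y (J v) = \<i> * ?d e y v" if "e \<in> I" "y \<in> S" for e y v
    unfolding J_def by (rule hol_on_has_derivative(2)[OF hol[OF that(1)] that(2)])
  have Neq: "N = (\<lambda>y. Re (\<Sum>e\<in>I. cnj (s e y) * s e y))"
    unfolding N_def cmod2_eq_Re Re_sum ..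
  have dN: "(N has_derivative P y) (at y)" if y: "y \<in> S" for y
  proof -
    have "((\<lambda>y. Re (\<Sum>e\<in>I. cnj (s e y) * s e y)) has_derivative
        (\<lambda>v. Re (\<Sum>e\<in>I. cnj (s e y) * ?d e y v + cnj (?d e y v) * s e y))) (at y)"
      by (intro bounded_linear.has_derivative[OF bounded_linear_Re] has_derivative_sum has_derivative_mult
          bounded_linear.has_derivative[OF bounded_linear_cnj] sd y)
    moreover have "Re (\<Sum>e\<in>I. cnj (s e y) * ?d e y v + cnj (?d e y v) * s e y) = P y v" for v
      unfolding P_def by (simp add: sum_distrib_left sum.distrib[symmetric] algebra_simps)
    ultimately show ?thesis unfolding Neq by simp
  qed
  have Npos: "N y > 0" if "y \<in> S" for y using pos[OF that] by (simp add: N_def)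
  have D1: "frechet_derivative (\<lambda>y. ln (N y)) (at y) v = P y v / N y" if y: "y \<in> S" for y v
  proof -
    have "((\<lambda>y. ln (N y)) has_derivative (\<lambda>v. inverse (N y) * P y v)) (at y)"
      using has_derivative_compose[OF dN[OF y] DERIV_ln[OF Npos[OF y], unfolded has_field_derivative_def]] .
    then have "frechet_derivative (\<lambda>y. ln (N y)) (at y) = (\<lambda>v. inverse (N y) * P y v)"
      by (rule frechet_derivative_at[symmetric])
    then show ?thesis by (simp add: divide_inverse mult.commute)
  qed
  define Q where "Q u v = 2 * Re (\<Sum>e\<in>I. cnj (s e z) * D2 (s e) z u v + cnj (d e v) * d e u)" for u v
  have dP: "((\<lambda>y. P y u) has_derivative Q u) (at z)" for u
  proof -
    have "((\<lambda>y. ?d e y u) has_derivative D2 (s e) z u) (at z)" if "e \<in> I" for e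
      using hol_on_has_derivative(1)[OF hol_on_deriv[OF S(1) hol[OF that]] S(2)] unfolding D2_def .
    then show ?thesis
      unfolding P_def Q_def[abs_def] d_def
      by (intro has_derivative_mult_right bounded_linear.has_derivative[OF bounded_linear_Re] has_derivative_sum has_derivative_mult
          bounded_linear.has_derivative[OF bounded_linear_cnj] sd S)
  qed
  have D2N: "D2 (\<lambda>y. ln (N y)) z u v = (Q u v * N z - P z u * P z v) / (N z)^2" for u v
  proof -
    have "frechet_derivative (\<lambda>y. frechet_derivative (\<lambda>y. ln (N y)) (at y) u) (at z) =
        frechet_derivative (\<lambda>y. P y u / N y) (at z)"
      by (rule frechet_derivative_cong_open[OF S D1])
    also have "\<dots> = (\<lambda>v. (Q u v * N z - P z u * P z v) / (N z * N z))"
      by (rule frechet_derivative_at[symmetric, OF has_derivative_divide'[OF dP dN[OF S(2)]]])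
        (use Npos[OF S(2)] in simp)
    finally show ?thesis by (simp add: D2_def power2_eq_square)
  qed
  have D2J: "D2 (s e) z (J u) (J v) = - D2 (s e) z u v" if e: "e \<in> I" for e
  proof -
    have r: "D2 (s e) z u (J v) = \<i> * D2 (s e) z u v" for u v
      unfolding D2_def J_def by (rule hol_on_has_derivative(2)[OF hol_on_deriv[OF S(1) hol[OF e]] S(2)])
    have "D2 (s e) z (J u) (J v) = \<i> * D2 (s e) z (J u) v" by (rule r)
    also have "D2 (s e) z (J u) v = D2 (s e) z v (J u)" by (rule D2_sym[OF hol_on_smooth[OF S(1) hol[OF e]] S(2,1)])
    also have "\<dots> = \<i> * D2 (s e) z v u" by (rule r)
    also have "D2 (s e) z v u = D2 (s e) z u v" by (rule D2_sym[OF hol_on_smooth[OF S(1) hol[OF e]] S(2,1)])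
    finally show ?thesis by simp
  qed
  define A where "A v = (\<Sum>e\<in>I. cnj (s e z) * d e v)" for v
  define B where "B = (\<Sum>e\<in>I. d e u * cnj (d e v))"
  have dJz: "d e (J v) = \<i> * d e v" if "e \<in> I" for e v unfolding d_def by (rule dJ[OF that S(2)])
  have AJ: "A (J v) = \<i> * A v" for v
    unfolding A_def sum_distrib_left by (rule sum.cong) (auto simp: dJz)
  have PA: "P z v = 2 * Re (A v)" for v by (simp add: P_def A_def d_def)
  have Qs: "Q u v + Q (J u) (J v) = 4 * Re B"
  proof -
    have "Q u v + Q (J u) (J v) = 2 * Re (\<Sum>e\<in>I. (cnj (s e z) * D2 (s e) z u v + cnj (d e v) * d e u)
       + (cnj (s e z) * D2 (s e) z (J u) (J v) + cnj (d e (J v)) * d e (J u)))"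
      unfolding Q_def by (simp add: sum.distrib)
    also have "(\<Sum>e\<in>I. (cnj (s e z) * D2 (s e) z u v + cnj (d e v) * d e u)
       + (cnj (s e z) * D2 (s e) z (J u) (J v) + cnj (d e (J v)) * d e (J u))) = (\<Sum>e\<in>I. 2 * (d e u * cnj (d e v)))"
      by (rule sum.cong) (auto simp: D2J dJz algebra_simps)
    also have "\<dots> = 2 * B" by (simp add: B_def sum_distrib_left)
    finally show ?thesis by simp
  qed
  have "levi (\<lambda>y. ln (N y)) z u v = ((Q u v + Q (J u) (J v)) * N z - (P z u * P z v + P z (J u) * P z (J v))) / (N z)^2"
    unfolding levi_def D2N by (simp add: add_divide_distrib[symmetric] algebra_simps)
  also have "P z u * P z v + P z (J u) * P z (J v) = 4 * Re (A u * cnj (A v))"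
    unfolding PA AJ by simp
  also have "((Q u v + Q (J u) (J v)) * N z - 4 * Re (A u * cnj (A v))) / (N z)^2 =
      4 * Re (B / N z - A u * cnj (A v) / (N z)^2)"
    unfolding Qs using Npos[OF S(2)] by (simp add: field_simps power2_eq_square)
  finally show ?thesis unfolding A_def B_def .
qed

section \<open>Bump functions and the divergence theorem\<close>

text \<open>The polynomial parameter makes the family closed under differentiation, so smoothness at
  0 follows by an induction over all of its members at once.\<close>

definition flat_exp :: "real poly \<Rightarrow> real \<Rightarrow> real" where
  "flat_exp p t = (if t > 0 then poly p (1 / t) * exp (- (1 / t)) else 0)"

lemma poly_exp_tendsto: "((\<lambda>s. poly p s * exp (- s)) \<longlongrightarrow> 0) at_top" for p :: "real poly"
proof -
  have "((\<lambda>s. \<Sum>i\<le>degree p. coeff p i * (s ^ i / exp s)) \<longlongrightarrow> (\<Sum>i\<le>degree p. coeff p i * 0)) at_top"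
    by (intro tendsto_sum tendsto_mult_left tendsto_power_div_exp_0)
  moreover have "(\<Sum>i\<le>degree p. coeff p i * (s ^ i / exp s)) = poly p s * exp (- s)" for s
    by (simp add: poly_altdef exp_minus sum_distrib_right divide_inverse mult.assoc)
  ultimately show ?thesis by simp
qed

text \<open>With s = 1/t, differentiation in t is -s^2 times differentiation in s, whence the
  polynomial (p - p') s^2. At t = 0 the right difference quotient is s p(s) exp(-s), which tends to
  0 as s grows.\<close>

lemma flat_exp_derivative:
  "(flat_exp p has_real_derivative flat_exp ((p - pderiv p) * [:0, 0, 1:]) t) (at t)"
proof (cases t "0::real" rule: linorder_cases)
  case greater
  have "((\<lambda>t. poly p (1 / t) * exp (- (1 / t))) has_real_derivative
      (poly (pderiv p) (1 / t) * (- 1 / t^2)) * exp (- (1 / t)) + (exp (- (1 / t)) * (1 / t^2)) * poly p (1 / t)) (at t)"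
  proof (rule DERIV_mult)
    have i: "((\<lambda>t. 1 / t) has_real_derivative - 1 / t^2) (at t)"
      using greater by (auto intro!: derivative_eq_intros simp: power2_eq_square)
    show "((\<lambda>t. poly p (1 / t)) has_real_derivative poly (pderiv p) (1 / t) * (- 1 / t^2)) (at t)"
      by (rule DERIV_chain'[where g = "poly p", OF i poly_DERIV])
    have "((\<lambda>t. - (1 / t)) has_real_derivative 1 / t^2) (at t)"
      using DERIV_minus[OF i] by simp
    then show "((\<lambda>t. exp (- (1 / t))) has_real_derivative exp (- (1 / t)) * (1 / t^2)) (at t)"
      by (rule DERIV_chain'[where g = exp, OF _ DERIV_exp])
  qed
  then have d: "((\<lambda>t. poly p (1 / t) * exp (- (1 / t))) has_real_derivative flat_exp ((p - pderiv p) * [:0, 0, 1:]) t) (at t)"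
    using greater by (elim DERIV_cong) (simp add: flat_exp_def field_simps power2_eq_square)
  show ?thesis
    by (rule has_field_derivative_transform_within_open[OF d, of "{0<..}"]) (use greater in \<open>auto simp: flat_exp_def\<close>)
next
  case less
  have "((\<lambda>t. 0) has_real_derivative 0) (at t)" by simp
  then have "(flat_exp p has_real_derivative 0) (at t)"
    by (rule has_field_derivative_transform_within_open[of _ _ _ "{..<0}"]) (use less in \<open>auto simp: flat_exp_def\<close>)
  then show ?thesis using less by (simp add: flat_exp_def)
next
  case equal
  have "((\<lambda>h. poly (p * [:0, 1:]) (inverse h) * exp (- inverse h)) \<longlongrightarrow> 0) (at_right 0)"
    by (rule filterlim_compose[OF poly_exp_tendsto filterlim_inverse_at_top_right])
  then have r: "((\<lambda>h. (flat_exp p (0 + h) - flat_exp p 0) / h) \<longlongrightarrow> 0) (at_right 0)"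
    by (rule Lim_transform_eventually)
      (auto simp: eventually_at_right_field flat_exp_def field_simps intro!: exI[of _ 1])
  have "((\<lambda>h. 0::real) \<longlongrightarrow> 0) (at_left 0)" by simp
  then have l: "((\<lambda>h. (flat_exp p (0 + h) - flat_exp p 0) / h) \<longlongrightarrow> 0) (at_left 0)"
    by (rule Lim_transform_eventually)
      (auto simp: eventually_at_left_field flat_exp_def intro!: exI[of _ "-1"])
  have "(flat_exp p has_real_derivative 0) (at 0)"
    unfolding DERIV_def by (rule filterlim_split_at_real[OF l r])
  then show ?thesis using equal by (simp add: flat_exp_def)
qed

lemma flat_exp_smooth: "smooth_on UNIV (flat_exp p)"
proof -
  have "Ck_on k UNIV (flat_exp p)" for k
  proof (induction k arbitrary: p)
    case 0
    show ?case unfolding Ck_on.simps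
      by (intro continuous_at_imp_continuous_on ballI DERIV_isCont[OF flat_exp_derivative])
  next
    case (Suc k)
    show ?case
    proof (rule Ck_on_SucI[where f' = "\<lambda>t v. flat_exp ((p - pderiv p) * [:0, 0, 1:]) t * v"])
      show "(flat_exp p has_derivative (\<lambda>v. flat_exp ((p - pderiv p) * [:0, 0, 1:]) t * v)) (at t)" for t
        using flat_exp_derivative[of p t] unfolding has_field_derivative_def .
      show "Ck_on k UNIV (\<lambda>t. flat_exp ((p - pderiv p) * [:0, 0, 1:]) t * v)" for v
        by (intro Ck_on_bilinear[OF bounded_bilinear_mult] Suc.IH Ck_on_const) simp
    qed simp
  qed
  then show ?thesis by (simp add: smooth_on_def)
qed

definition bump :: "real \<Rightarrow> real" where
  "bump = flat_exp 1"

lemma bump: "smooth_on UNIV bump" "bump t \<ge> 0" "bump t > 0 \<longleftrightarrow> t > 0" "t \<le> 0 \<Longrightarrow> bump t = 0"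
  using flat_exp_smooth by (auto simp: bump_def flat_exp_def)

text \<open>By translation invariance every difference quotient has integral 0; dominated
  convergence passes this to the derivative. It is the form of the divergence theorem used for
  integration by parts in a chart.\<close>

lemma integral_derivative_zero:
  fixes \<psi> :: "'v::euclidean_space \<Rightarrow> complex"
  assumes K: "compact K" "\<And>z. z \<notin> K \<Longrightarrow> \<psi> z = 0"
    and der: "\<And>z. (\<psi> has_derivative \<psi>' z) (at z)" and cont: "continuous_on UNIV (\<lambda>z. \<psi>' z v)"
  shows "(LINT z|lborel. \<psi>' z v) = 0"
proof -
  obtain R where R: "\<And>z. z \<in> K \<Longrightarrow> norm z \<le> R" "R > 0" 
    using compact_imp_bounded[OF K(1)] unfolding bounded_pos by blast
  have c\<psi>: "continuous_on UNIV \<psi>"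
    by (intro continuous_at_imp_continuous_on ballI has_derivative_continuous[OF der])
  have \<psi>'0: "\<psi>' z v = 0" if "z \<notin> K" for z
  proof -
    have "open (- K)" using K(1) compact_imp_closed by blast
    then have "((\<lambda>z. 0) has_derivative \<psi>' z) (at z)"
      using has_derivative_transform_within_open[OF der[of z], of "- K" "\<lambda>z. 0"] that K(2) by auto
    then have "\<psi>' z = (\<lambda>v. 0)" using has_derivative_unique has_derivative_const by blast
    then show ?thesis by simp
  qed
  have "bounded ((\<lambda>z. \<psi>' z v) ` K)"
    by (intro compact_imp_bounded compact_continuous_image continuous_on_subset[OF cont] K) simp
  then obtain M where M0: "\<forall>y\<in>(\<lambda>z. \<psi>' z v) ` K. norm y \<le> M" unfolding bounded_iff by blast
  have M: "norm (\<psi>' z v) \<le> max M 0" for z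
  proof (cases "z \<in> K")
    case True
    then have "norm (\<psi>' z v) \<le> M" using M0 by blast
    then show ?thesis by simp
  qed (simp add: \<psi>'0)
  \<comment> \<open>Difference quotients with step 1/(n+1) in the direction
    \<open>v\<close>.\<close>
  define F where "F n z = of_nat (Suc n) * (\<psi> (z + (1 / Suc n) *\<^sub>R v) - \<psi> z)" for n z
  have \<psi>m: "\<psi> \<in> borel_measurable borel" using c\<psi> by (rule borel_measurable_continuous_onI)
  have \<psi>i: "integrable lborel \<psi>"
  proof -
    have "integrable lborel (\<lambda>z. indicator K z *\<^sub>R \<psi> z)"
      by (intro borel_integrable_compact K continuous_on_subset[OF c\<psi>]) simp
    moreover have "(\<lambda>z. indicator K z *\<^sub>R \<psi> z) = \<psi>" using K(2) by (auto simp: indicator_def fun_eq_iff)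
    ultimately show ?thesis by simp
  qed
  have trans: "integrable lborel (\<lambda>z. \<psi> (z + w))" "(LINT z|lborel. \<psi> (z + w)) = (LINT z|lborel. \<psi> z)" for w
  proof -
    have lb: "distr lborel borel ((+) w) = lborel" by (rule lborel_distr_plus)
    have "integrable (distr lborel borel ((+) w)) \<psi>" using \<psi>i lb by simp
    then have "integrable lborel (\<lambda>z. \<psi> (w + z))" using \<psi>m by (subst (asm) integrable_distr_eq) auto
    then show "integrable lborel (\<lambda>z. \<psi> (z + w))" by (simp add: add.commute)
    have "(LINT z|lborel. \<psi> (w + z)) = (LINT z|distr lborel borel ((+) w). \<psi> z)"
      using \<psi>m by (subst integral_distr) auto
    then show "(LINT z|lborel. \<psi> (z + w)) = (LINT z|lborel. \<psi> z)" using lb by (simp add: add.commute)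
  qed
  have F0: "(LINT z|lborel. F n z) = 0" for n
  proof -
    have "(LINT z|lborel. F n z) = of_nat (Suc n) * ((LINT z|lborel. \<psi> (z + (1 / Suc n) *\<^sub>R v)) - (LINT z|lborel. \<psi> z))"
      unfolding F_def integral_mult_right_zero Bochner_Integration.integral_diff[OF trans(1) \<psi>i] ..
    then show ?thesis using trans(2) by simp
  qed
  \<comment> \<open>All steps are at most 1, so the difference quotients live in one ball of radius
    \<open>R + norm v\<close>, where the mean value inequality bounds them uniformly.\<close>
  have bound: "norm (F n z) \<le> max M 0 * indicator (cball 0 (R + norm v)) z" for n z
  proof (cases "z \<in> cball 0 (R + norm v)")
    case True
    let ?h = "1 / real (Suc n)"
    have "\<exists>q\<in>{0<..<?h}. norm (\<psi> (z + ?h *\<^sub>R v) - \<psi> (z + 0 *\<^sub>R v)) \<le> norm ((?h - 0) *\<^sub>R \<psi>' (z + q *\<^sub>R v) v)"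
    proof (rule mvt_general)
      show "(0::real) < ?h" by simp
      show "continuous_on {0..?h} (\<lambda>q. \<psi> (z + q *\<^sub>R v))"
        by (rule continuous_on_compose2[OF c\<psi>]) (auto intro!: continuous_intros)
      show "((\<lambda>q. \<psi> (z + q *\<^sub>R v)) has_derivative (\<lambda>h. h *\<^sub>R \<psi>' (z + q *\<^sub>R v) v)) (at q)" for q
        using has_vector_derivative_line[OF der[of "z + q *\<^sub>R v"]] unfolding has_vector_derivative_def .
    qed
    then obtain q where "norm (\<psi> (z + ?h *\<^sub>R v) - \<psi> z) \<le> norm (?h *\<^sub>R \<psi>' (z + q *\<^sub>R v) v)" by auto
    also have "\<dots> \<le> ?h * max M 0" using M[of "z + q *\<^sub>R v"] by (simp add: divide_right_mono)
    finally have le: "norm (\<psi> (z + ?h *\<^sub>R v) - \<psi> z) \<le> ?h * max M 0" .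
    have "norm (F n z) = real (Suc n) * norm (\<psi> (z + ?h *\<^sub>R v) - \<psi> z)"
      unfolding F_def norm_mult norm_of_nat ..
    also have "\<dots> \<le> real (Suc n) * (?h * max M 0)" by (rule mult_left_mono[OF le]) simp
    also have "\<dots> = max M 0" by (simp del: of_nat_Suc)
    finally have "norm (F n z) \<le> max M 0" .
    then show ?thesis using True by simp
  next
    case False
    then have z: "norm z > R + norm v" by simp
    have "norm ((1 / real (Suc n)) *\<^sub>R v) \<le> norm v" by (simp add: divide_le_eq mult_le_cancel_left1)
    moreover have "norm z \<le> norm (z + (1 / real (Suc n)) *\<^sub>R v) + norm ((1 / real (Suc n)) *\<^sub>R v)"
      using norm_triangle_ineq4[of "z + (1 / real (Suc n)) *\<^sub>R v" "(1 / real (Suc n)) *\<^sub>R v"] by simp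
    ultimately have "norm (z + (1 / real (Suc n)) *\<^sub>R v) > R" using z by linarith
    then have "z + (1 / real (Suc n)) *\<^sub>R v \<notin> K" using R(1) by force
    moreover have "norm z > R" using z norm_ge_zero[of v] by linarith
    then have "z \<notin> K" using R(1) by force
    ultimately show ?thesis using K(2) False by (simp add: F_def)
  qed
  have lim: "(\<lambda>n. F n z) \<longlonglongrightarrow> \<psi>' z v" for z
  proof -
    have "((\<lambda>q. \<psi> (z + q *\<^sub>R v)) has_vector_derivative \<psi>' z v) (at 0)"
      using has_vector_derivative_line[of \<psi> "\<psi>' z" z 0 v] der[of z] by simp
    then have "((\<lambda>h. norm (\<psi> (z + h *\<^sub>R v) - \<psi> z - h *\<^sub>R \<psi>' z v) / norm h) \<longlongrightarrow> 0) (at 0)"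
      unfolding has_vector_derivative_def has_derivative_at by simp
    then have "((\<lambda>h. norm ((1 / h) *\<^sub>R (\<psi> (z + h *\<^sub>R v) - \<psi> z) - \<psi>' z v)) \<longlongrightarrow> 0) (at 0)"
    proof (rule Lim_transform_eventually)
      have "norm (a - h *\<^sub>R D) / norm h = norm ((1 / h) *\<^sub>R a - D)" if "h \<noteq> 0" for h and a D :: complex
      proof -
        have "(1 / h) *\<^sub>R a - D = (1 / h) *\<^sub>R (a - h *\<^sub>R D)" using that by (simp add: scaleR_diff_right)
        then show ?thesis by (simp add: divide_inverse mult.commute)
      qed
      then show "\<forall>\<^sub>F h in at 0. norm (\<psi> (z + h *\<^sub>R v) - \<psi> z - h *\<^sub>R \<psi>' z v) / norm h =
          norm ((1 / h) *\<^sub>R (\<psi> (z + h *\<^sub>R v) - \<psi> z) - \<psi>' z v)"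
        by (intro eventually_mono[OF eventually_neq_at_within[of 0 0]]) blast
    qed
    then have "((\<lambda>h. (1 / h) *\<^sub>R (\<psi> (z + h *\<^sub>R v) - \<psi> z)) \<longlongrightarrow> \<psi>' z v) (at 0)"
      by (rule LIM_zero_cancel[OF tendsto_norm_zero_cancel])
    moreover have "filterlim (\<lambda>n. 1 / real (Suc n)) (at 0) sequentially"
      using LIMSEQ_inverse_real_of_nat by (auto simp: filterlim_at inverse_eq_divide)
    ultimately have "(\<lambda>n. (1 / (1 / real (Suc n))) *\<^sub>R (\<psi> (z + (1 / real (Suc n)) *\<^sub>R v) - \<psi> z)) \<longlonglongrightarrow> \<psi>' z v"
      by (rule filterlim_compose)
    moreover have "(\<lambda>n. (1 / (1 / real (Suc n))) *\<^sub>R (\<psi> (z + (1 / real (Suc n)) *\<^sub>R v) - \<psi> z)) = (\<lambda>n. F n z)"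
      unfolding F_def by (rule ext) (simp only: scaleR_conv_of_real, simp)
    ultimately show ?thesis by simp
  qed
  have "(\<lambda>n. LINT z|lborel. F n z) \<longlonglongrightarrow> (LINT z|lborel. \<psi>' z v)"
  proof (rule integral_dominated_convergence)
    show "(\<lambda>z. \<psi>' z v) \<in> borel_measurable lborel" using borel_measurable_continuous_onI[OF cont] by simp
    show "F n \<in> borel_measurable lborel" for n
      using borel_measurable_integrable[OF trans(1)] borel_measurable_integrable[OF \<psi>i] unfolding F_def by measurable
    show "integrable lborel (\<lambda>z::'v. max M 0 * indicator (cball 0 (R + norm v)) z :: real)"
      using emeasure_bounded_finite[OF bounded_cball[of "0::'v" "R + norm v"]]
      by (intro integrable_mult_right integrable_real_indicator) auto
  qed (use bound lim in auto)
  then show ?thesis unfolding F0 by (simp add: LIMSEQ_const_iff)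
qed

section \<open>Cut-off functions and a partition of unity on the manifold\<close>

context compact_complex_manifold
begin

text \<open>The chart domain and the complement of \<open>K\<close> form an open cover: on the first
  the function is \<open>F\<close> in coordinates, on the second it vanishes. \<open>K\<close> is
  closed because the space is Hausdorff.\<close>

lemma smooth_fun_extend:
  fixes F :: "complex^'n \<Rightarrow> 'w::real_normed_vector"
  assumes c: "c \<in> \<A>" and K: "compact K" "K \<subseteq> fst c" and F: "smooth_on (im c) F" 
    and zero: "\<And>x. x \<in> fst c \<Longrightarrow> x \<notin> K \<Longrightarrow> F (snd c x) = 0"
  shows "smooth_fun_on \<A> UNIV (\<lambda>x. if x \<in> fst c then F (snd c x) else 0)" (is "smooth_fun_on \<A> UNIV ?f")
proof (rule smooth_fun_on_local[OF open_UNIV])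
  fix x
  show "\<exists>c\<in>\<A>. \<exists>U. open U \<and> x \<in> U \<and> U \<subseteq> fst c \<and> smooth_on (snd c ` U) (?f \<circ> cinv c)"
  proof (cases "x \<in> fst c")
    case True
    have "smooth_on (im c) (?f \<circ> cinv c)"
    proof (subst smooth_on_cong[OF chart_open(2)[OF c], of "?f \<circ> cinv c" F])
      fix z assume z: "z \<in> im c"
      show "(?f \<circ> cinv c) z = F z"
        using chart_cinv[OF c z] by simp
    qed (rule F)
    then show ?thesis using c chart_open(1)[OF c] True by blast
  next
    case False
    let ?d = "chart_at \<A> x"
    let ?U = "fst ?d \<inter> - K"
    have U: "open ?U" "x \<in> ?U"
      using open_Int[OF chart_open(1)[OF chart_at(1)] open_Compl[OF compact_imp_closed[OF K(1)]]] chart_at(2) False K(2) by blast+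
    have f0: "?f y = 0" if "y \<notin> K" for y using zero that by simp
    have "(?f \<circ> cinv ?d) z = 0" if "z \<in> snd ?d ` ?U" for z
    proof -
      obtain y where y: "y \<in> fst ?d" "y \<notin> K" "z = snd ?d y" using \<open>z \<in> snd ?d ` ?U\<close> by blast
      show ?thesis unfolding o_def y(3) cinv_chart[OF chart_at(1) y(1)] by (rule f0[OF y(2)])
    qed
    then have "smooth_on (snd ?d ` ?U) (?f \<circ> cinv ?d)"
      using smooth_on_cong[OF open_chart_image[OF chart_at(1)[of x] open_Compl[OF compact_imp_closed[OF K(1)]]], of "?f \<circ> cinv ?d" "\<lambda>_. 0"]
      by (simp add: smooth_on_const)
    then show ?thesis using U chart_at(1) by blast
  qed
qed

lemma bump_function:
  obtains K and b :: "'a \<Rightarrow> real" where "compact K" "K \<subseteq> fst (chart_at \<A> x)" "smooth_fun_on \<A> UNIV b" "b x > 0"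
    "\<And>y. b y \<ge> 0" "\<And>y. y \<notin> K \<Longrightarrow> b y = 0"
proof -
  let ?c = "chart_at \<A> x"
  note c = chart_at(1)[of x]
  let ?z = "snd ?c x"
  obtain r where r: "r > 0" "cball ?z r \<subseteq> im ?c"
    using chart_open(2)[OF c] chart_at(2)[of x] open_contains_cball by blast
  define F where "F z = bump (r^2 - (z - ?z) \<bullet> (z - ?z))" for z
  define K where "K = cinv ?c ` cball ?z r"
  have K: "compact K" unfolding K_def
    by (intro compact_continuous_image continuous_on_subset[OF chart_continuous(2)[OF c] r(2)] compact_cball)
  have Kc: "K \<subseteq> fst ?c" unfolding K_def using r(2) chart_cinv(2)[OF c] by blast
  have zero: "F (snd ?c y) = 0" if y: "y \<in> fst ?c" "y \<notin> K" for y
  proof -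
    have "snd ?c y \<notin> cball ?z r"
    proof
      assume "snd ?c y \<in> cball ?z r"
      then have "cinv ?c (snd ?c y) \<in> K" unfolding K_def by blast
      then show False using y cinv_chart[OF c y(1)] by simp
    qed
    then have "norm (snd ?c y - ?z) > r" by (simp add: dist_norm norm_minus_commute)
    then have "r^2 \<le> (norm (snd ?c y - ?z))^2" using r(1) by (intro power_mono) auto
    then show ?thesis unfolding F_def by (intro bump(4)) (simp add: power2_norm_eq_inner)
  qed
  have Fs: "smooth_on (im ?c) F"
    unfolding F_def
    by (rule smooth_on_compose[OF bump(1)])
      (auto intro!: smooth_on_diff smooth_on_const smooth_on_bilinear[OF bounded_bilinear_inner] smooth_on_id chart_open(2)[OF c])
  have s: "smooth_fun_on \<A> UNIV (\<lambda>y. if y \<in> fst ?c then F (snd ?c y) else 0)"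
    by (rule smooth_fun_extend[OF c K Kc Fs]) (rule zero)
  show ?thesis
  proof (rule that[OF K Kc s])
    show "(if x \<in> fst ?c then F (snd ?c x) else 0) > 0" using chart_at(2)[of x] r(1) by (simp add: F_def bump(3))
    show "(if y \<in> fst ?c then F (snd ?c y) else 0) \<ge> 0" for y by (simp add: F_def bump(2))
    show "(if y \<in> fst ?c then F (snd ?c y) else 0) = 0" if "y \<notin> K" for y using zero that by simp
  qed
qed

text \<open>Quotients of finitely many bump functions by their positive sum. The members are
  labelled by points, and member \<open>k\<close> is carried by a compact subset of the preferred
  chart at \<open>k\<close>.\<close>

lemma partition_of_unity:
  obtains I :: "'a set" and \<zeta> :: "'a \<Rightarrow> 'a \<Rightarrow> real" and K where "finite I"
    "\<And>k. compact (K k)" "\<And>k. K k \<subseteq> fst (chart_at \<A> k)" "\<And>k. smooth_fun_on \<A> UNIV (\<zeta> k)"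
    "\<And>k y. y \<notin> K k \<Longrightarrow> \<zeta> k y = 0" "\<And>y. (\<Sum>k\<in>I. \<zeta> k y) = 1"
proof -
  have "\<forall>x. \<exists>K b. compact K \<and> K \<subseteq> fst (chart_at \<A> x) \<and> smooth_fun_on \<A> UNIV b \<and> b x > (0::real) \<and>
    (\<forall>y. b y \<ge> 0) \<and> (\<forall>y. y \<notin> K \<longrightarrow> b y = 0)"
  proof
    fix x
    obtain K and b :: "'a \<Rightarrow> real" where "compact K" "K \<subseteq> fst (chart_at \<A> x)" "smooth_fun_on \<A> UNIV b" "b x > 0"
      "\<And>y. b y \<ge> 0" "\<And>y. y \<notin> K \<Longrightarrow> b y = 0" using bump_function[of x] by blast
    then show "\<exists>K b. compact K \<and> K \<subseteq> fst (chart_at \<A> x) \<and> smooth_fun_on \<A> UNIV b \<and> b x > (0::real) \<and>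
      (\<forall>y. b y \<ge> 0) \<and> (\<forall>y. y \<notin> K \<longrightarrow> b y = 0)" by blast
  qed
  from choice[OF this] obtain K where "\<forall>x. \<exists>b. compact (K x) \<and> K x \<subseteq> fst (chart_at \<A> x) \<and> smooth_fun_on \<A> UNIV b \<and> b x > (0::real) \<and>
    (\<forall>y. b y \<ge> 0) \<and> (\<forall>y. y \<notin> K x \<longrightarrow> b y = 0)" by blast
  from choice[OF this] obtain b where Kb: "\<And>x. compact (K x)" "\<And>x. K x \<subseteq> fst (chart_at \<A> x)" "\<And>x. smooth_fun_on \<A> UNIV (b x)"
    "\<And>x. b x x > (0::real)" "\<And>x y. b x y \<ge> 0" "\<And>x y. y \<notin> K x \<Longrightarrow> b x y = 0" by blast
  have op: "open {y. b x y > 0}" for x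
    by (intro open_Collect_less continuous_on_const smooth_fun_continuous[OF Kb(3)])
  obtain I where I: "finite I" "UNIV \<subseteq> (\<Union>x\<in>I. {y. b x y > 0})"
  proof (rule compactE_image[OF cpt, of UNIV "\<lambda>x. {y. b x y > 0}"])
    show "UNIV \<subseteq> (\<Union>x\<in>UNIV. {y. b x y > 0})" using Kb(4) by blast
  qed (use that op in blast)+
  define B where "B y = (\<Sum>k\<in>I. b k y)" for y
  have Bpos: "B y > 0" for y
  proof -
    obtain k where "k \<in> I" "b k y > 0" using I(2) by blast
    then show ?thesis unfolding B_def using I(1) Kb(5) by (intro sum_pos2) auto
  qed
  have Bs: "smooth_fun_on \<A> UNIV B" unfolding B_def by (intro smooth_fun_sum Kb(3)) simp
  have "smooth_fun_on \<A> UNIV (\<lambda>y. b k y / B y)" for k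
    unfolding smooth_fun_on_def o_def
    by (intro ballI smooth_on_divide smooth_fun_on_chart[OF Kb(3)] smooth_fun_on_chart[OF Bs] open_chart_image open_UNIV Bpos)
  moreover have "(\<Sum>k\<in>I. b k y / B y) = 1" for y
    using Bpos[of y] by (simp add: sum_divide_distrib[symmetric] B_def)
  ultimately show ?thesis using Kb(1,2,6) I(1) by (intro that[of I K "\<lambda>k y. b k y / B y"]) auto
qed

end

section \<open>The Laplacian of a Hermitian metric\<close>

lemma (in compact_complex_manifold) manifold_measure_cong:
  assumes "\<And>c x. c \<in> \<A> \<Longrightarrow> x \<in> fst c \<Longrightarrow> \<delta> c x = \<delta>' c x"
  shows "manifold_measure \<A> \<delta> = manifold_measure \<A> \<delta>'"
proof -
  have "chart_mass \<delta> c B = chart_mass \<delta>' c B" if c: "c \<in> \<A>" and B: "B \<subseteq> fst c" for c B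
    unfolding chart_mass_def
  proof (rule nn_integral_cong)
    fix z
    show "ennreal (\<delta> c (cinv c z)) * indicator (snd c ` B) z = ennreal (\<delta>' c (cinv c z)) * indicator (snd c ` B) z"
    proof (cases "z \<in> snd c ` B")
      case True
      then have "cinv c z \<in> fst c" using B c by auto
      then show ?thesis using assms[OF c] by simp
    qed simp
  qed
  then have "is_mass \<delta> = is_mass \<delta>'" unfolding is_mass_def by (intro ext) auto
  then show ?thesis unfolding manifold_measure_eq by simp
qed

text \<open>Cramer's rule; it exhibits the entries of the inverse metric as quotients of
  determinants, from which their smoothness is read off.\<close>

lemma matrix_inv_entry:
  fixes A :: "real^'i^'i"
  assumes "det A \<noteq> 0"
  shows "matrix_inv A $ i $ j = det (\<chi> a b. if b = i then (if a = j then 1 else 0) else A $ a $ b) / det A"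
proof -
  have inv: "A ** matrix_inv A = mat 1"
    using assms invertible_det_nz[of A] someI_ex[of "\<lambda>B. A ** B = mat 1 \<and> B ** A = mat 1"]
    unfolding matrix_inv_def invertible_def by blast
  let ?x = "(\<chi> k. matrix_inv A $ k $ j) :: real^'i" and ?b = "(\<chi> a. if a = j then 1 else 0) :: real^'i"
  have "A *v ?x = ?b"
    using inv by (simp add: vec_eq_iff matrix_vector_mult_def matrix_matrix_mult_def mat_def)
  then have "?x = (\<chi> k. det (\<chi> a b. if b = k then ?b $ a else A $ a $ b) / det A)"
    using cramer[OF assms] by blast
  then have "?x $ i = (\<chi> k. det (\<chi> a b. if b = k then ?b $ a else A $ a $ b) / det A) $ i" by (rule arg_cong)
  moreover have "(\<chi> a b. if b = i then ?b $ a else A $ a $ b) = (\<chi> a b. if b = i then (if a = j then 1 else 0) else A $ a $ b)"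
    by (simp add: vec_eq_iff)
  ultimately show ?thesis by (simp only: vec_lambda_beta)
qed

lemma smooth_on_det:
  fixes M :: "'v::real_normed_vector \<Rightarrow> real^'i^'i"
  assumes "\<And>i j. smooth_on S (\<lambda>z. M z $ i $ j)" "open S"
  shows "smooth_on S (\<lambda>z. det (M z))"
  unfolding det_def by (intro smooth_on_sum smooth_on_mult smooth_on_const smooth_on_prod assms)

lemma integrable_compact_support:
  fixes \<psi> :: "'v::euclidean_space \<Rightarrow> complex"
  assumes "compact K" "\<And>z. z \<notin> K \<Longrightarrow> \<psi> z = 0" "continuous_on UNIV \<psi>"
  shows "integrable lborel \<psi>"
proof -
  have "integrable lborel (\<lambda>z. indicator K z *\<^sub>R \<psi> z)"
    by (intro borel_integrable_compact assms continuous_on_subset[OF assms(3)]) simp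
  moreover have "(\<lambda>z. indicator K z *\<^sub>R \<psi> z) = \<psi>" using assms(2) by (auto simp: indicator_def fun_eq_iff)
  ultimately show ?thesis by simp
qed

locale hermitian_manifold = compact_complex_manifold \<A>
  for \<A> :: "('a::t2_space, 'n::finite) chart set" +
  fixes g :: "'a \<Rightarrow> complex^'n \<Rightarrow> complex^'n \<Rightarrow> real"
  assumes herm_g: "\<And>x. hermitian_metric (g x)"
    and smooth_g: "\<And>c u v. c \<in> \<A> \<Longrightarrow>
      smooth_on (snd c ` fst c) (\<lambda>z. g (cinv c z) (tangent \<A> c (cinv c z) u) (tangent \<A> c (cinv c z) v))"
begin

text \<open>The metric in the components of a fixed chart. \<open>g x\<close> itself takes
  components in the preferred chart at \<open>x\<close>, so it has no useful regularity in
  \<open>x\<close> before this pull-back.\<close>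

definition gc :: "('a, 'n) chart \<Rightarrow> 'a \<Rightarrow> complex^'n \<Rightarrow> complex^'n \<Rightarrow> real" where
  "gc c x u v = g x (tangent \<A> c x u) (tangent \<A> c x v)"

lemma tangent_J: "c \<in> \<A> \<Longrightarrow> x \<in> fst c \<Longrightarrow> tangent \<A> c x (J v) = J (tangent \<A> c x v)"
  unfolding J_def by (rule tangent_smult)

lemma herm_gc:
  assumes c: "c \<in> \<A>" "x \<in> fst c"
  shows "hermitian_metric (gc c x)"
  unfolding hermitian_metric_def
proof (intro conjI allI impI)
  note G = hermitian_metricD[OF herm_g[of x]]
  show "linear (gc c x u)" for u
    using linear_compose[OF tangent_linear[OF c] G(1)] by (simp add: gc_def[abs_def] o_def)
  show "gc c x u v = gc c x v u" for u v unfolding gc_def by (rule G(3))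
  show "gc c x (J u) (J v) = gc c x u v" for u v unfolding gc_def tangent_J[OF c] by (rule G(4))
  show "gc c x v v > 0" if "v \<noteq> 0" for v
  proof -
    have "tangent \<A> c x v \<noteq> 0"
    proof
      assume "tangent \<A> c x v = 0"
      then have "dtrans (chart_at \<A> x) c x 0 = v" using tangent_inverse(2)[OF c, of v] by simp
      then show False using linear_0[OF dtrans_linear[OF chart_at(1) c(1) chart_at(2) c(2)]] that by simp
    qed
    then show ?thesis unfolding gc_def by (rule G(5))
  qed
qed

definition gram :: "('a, 'n) chart \<Rightarrow> 'a \<Rightarrow> real^('n\<times>bool)^('n\<times>bool)" where
  "gram c x = (\<chi> i j. gc c x (rbasis i) (rbasis j))"

definition vden :: "('a, 'n) chart \<Rightarrow> 'a \<Rightarrow> real" where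
  "vden c x = sqrt (det (gram c x))"

lemma det_gram_pos: "c \<in> \<A> \<Longrightarrow> x \<in> fst c \<Longrightarrow> det (gram c x) > 0"
  unfolding gram_def by (rule det_gram_rbasis[OF herm_gc])

lemma vden_pos: "c \<in> \<A> \<Longrightarrow> x \<in> fst c \<Longrightarrow> vden c x > 0"
  using det_gram_pos by (simp add: vden_def)

lemma det_gram_pos_im: "c \<in> \<A> \<Longrightarrow> z \<in> im c \<Longrightarrow> det (gram c (cinv c z)) > 0"
  using det_gram_pos chart_cinv(2) by blast

lemma smooth_gram: "c \<in> \<A> \<Longrightarrow> smooth_on (im c) (\<lambda>z. gram c (cinv c z) $ i $ j)"
  unfolding gram_def gc_def using smooth_g by simp

lemma smooth_det_gram: "c \<in> \<A> \<Longrightarrow> smooth_on (im c) (\<lambda>z. det (gram c (cinv c z)))"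
  by (intro smooth_on_det smooth_gram chart_open(2))

lemma smooth_vden: "c \<in> \<A> \<Longrightarrow> smooth_on (im c) (\<lambda>z. vden c (cinv c z))"
  unfolding vden_def by (intro smooth_on_sqrt smooth_det_gram chart_open(2) det_gram_pos_im)

definition gi :: "('a, 'n) chart \<Rightarrow> 'a \<Rightarrow> 'n \<times> bool \<Rightarrow> 'n \<times> bool \<Rightarrow> real" where
  "gi c x i j = matrix_inv (gram c x) $ i $ j"

lemma smooth_gi:
  assumes c: "c \<in> \<A>"
  shows "smooth_on (im c) (\<lambda>z. gi c (cinv c z) i j)"
proof -
  let ?A = "\<lambda>z. gram c (cinv c z)"
  let ?N = "\<lambda>z. (\<chi> a b. if b = i then (if a = j then 1 else 0) else ?A z $ a $ b) :: real^('n\<times>bool)^('n\<times>bool)"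
  have "smooth_on (im c) (\<lambda>z. ?N z $ a $ b)" for a b
    by (cases "b = i") (simp_all add: smooth_on_const smooth_gram[OF c])
  then have "smooth_on (im c) (\<lambda>z. det (?N z) / det (?A z))"
    by (intro smooth_on_divide smooth_on_det smooth_det_gram chart_open(2) det_gram_pos_im c)
  moreover have "gi c (cinv c z) i j = det (?N z) / det (?A z)" if "z \<in> im c" for z
    unfolding gi_def by (rule matrix_inv_entry) (use det_gram_pos_im[OF c that] in simp)
  ultimately show ?thesis
    by (subst smooth_on_cong[OF chart_open(2)[OF c], of _ "\<lambda>z. det (?N z) / det (?A z)"])
qed

lemma consistent_vden: "consistent vden"
  unfolding consistent_def
proof (intro conjI ballI)
  show "vden c x > 0" if "c \<in> \<A>" "x \<in> fst c" for c x by (rule vden_pos[OF that])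
  show "continuous_on (im c) (\<lambda>z. vden c (cinv c z))" if "c \<in> \<A>" for c
    by (rule smooth_on_continuous[OF smooth_vden[OF that]])
  fix c d x assume c: "c \<in> \<A>" and d: "d \<in> \<A>" and x: "x \<in> fst c \<inter> fst d"
  have xc: "x \<in> fst c" "x \<in> fst d" using x by auto
  note G = hermitian_metricD[OF herm_g[of x]]
  let ?B = "transpose (jacobian (dtrans c d x))"
  have "tangent \<A> c x (rbasis i) = (\<Sum>j\<in>UNIV. ?B $ i $ j *\<^sub>R tangent \<A> d x (rbasis j))" for i
  proof -
    have "tangent \<A> c x (rbasis i) = tangent \<A> d x (dtrans c d x (rbasis i))"
      by (rule tangent_dtrans[OF c d xc])
    also have "\<dots> = tangent \<A> d x (\<Sum>j\<in>UNIV. (dtrans c d x (rbasis i) \<bullet> rbasis j) *\<^sub>R rbasis j)"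
      by (simp only: rbasis_expansion)
    also have "\<dots> = (\<Sum>j\<in>UNIV. ?B $ i $ j *\<^sub>R tangent \<A> d x (rbasis j))"
      using tangent_linear[OF d xc(2)] by (simp add: linear_sum linear_scale jacobian_def transpose_def)
    finally show ?thesis .
  qed
  then have "det (gram c x) = (det ?B)^2 * det (gram d x)"
    unfolding gram_def gc_def by (intro det_gram_change[OF G(1,2)])
  then show "vden c x = \<bar>det (jacobian (dtrans c d x))\<bar> * vden d x"
    by (simp add: vden_def det_transpose real_sqrt_mult)
qed

abbreviation \<mu> :: "'a measure" where
  "\<mu> \<equiv> manifold_measure \<A> vden"

lemma riemannian_measure_eq: "riemannian_measure \<A> g = \<mu>"
  unfolding riemannian_measure_def vden_def[abs_def] gram_def gc_def ..

text \<open>Wirtinger's identity, from \<open>pfaffian_eq_sqrt_det\<close>. It allows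
  \<open>form_measure\<close> and the Riemannian measure inside \<open>codiff\<close> to be replaced
  by the same measure.\<close>

lemma top_power_kaehler_form:
  assumes c: "c \<in> \<A>" "x \<in> fst c"
  shows "top_power \<A> (kaehler_form_of g) c x = vden c x"
proof -
  have "top_power \<A> (kaehler_form_of g) c x = pfaffian (\<lambda>u v. gc c x (J u) v) rbasis"
    unfolding top_power_def pfaffian_def kaehler_form_of_def gc_def tangent_J[OF c] ..
  also have "\<dots> = vden c x" unfolding vden_def gram_def by (rule pfaffian_eq_sqrt_det[OF herm_gc[OF c]])
  finally show ?thesis .
qed

lemma form_measure_eq: "form_measure \<A> (kaehler_form_of g) = \<mu>"
  unfolding form_measure_def by (rule manifold_measure_cong) (rule top_power_kaehler_form)

lemma complex_riesz:
  fixes \<alpha> :: "complex^'n \<Rightarrow> complex"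
  assumes "linear \<alpha>"
  obtains a b where "\<And>v. \<alpha> v = Complex (g x a v) (g x b v)"
proof -
  note G = hermitian_metricD[OF herm_g[of x]]
  have "linear (\<lambda>v. Re (\<alpha> v))" "linear (\<lambda>v. Im (\<alpha> v))"
    using linear_compose[OF assms bounded_linear.linear[OF bounded_linear_Re]]
      linear_compose[OF assms bounded_linear.linear[OF bounded_linear_Im]] by (simp_all add: o_def)
  then obtain a b where "\<forall>v. Re (\<alpha> v) = g x a v" "\<forall>v. Im (\<alpha> v) = g x b v"
    using real_riesz[OF G(1,2,5)] by meson
  then show ?thesis using that[of a b] by (simp add: complex_eq_iff)
qed

lemma cotangent_inner_riesz:
  assumes "\<And>v. \<alpha> v = Complex (g x a1 v) (g x a2 v)" "\<And>v. \<beta> v = Complex (g x b1 v) (g x b2 v)"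
  shows "cotangent_inner g x \<alpha> \<beta> = Complex (g x a1 b1 + g x a2 b2) (g x a2 b1 - g x a1 b2)"
  unfolding cotangent_inner_def assms
proof (rule gram_inverse_pairing)
  note G = hermitian_metricD[OF herm_g[of x]]
  show "linear (g x u)" "linear (\<lambda>v. g x v u)" "g x u v = g x v u" for u v by (rule G(1), rule G(2), rule G(3))
  show "det (\<chi> i j. g x (rbasis i) (rbasis j)) \<noteq> 0" using det_gram_rbasis[OF herm_g[of x]] by simp
  show "\<exists>y. v = (\<Sum>i\<in>UNIV. y i *\<^sub>R rbasis i)" for v :: "complex^'n"
    by (rule exI[of _ "\<lambda>i. v \<bullet> rbasis i"]) (simp only: rbasis_expansion)
qed

text \<open>Both the defining sum over \<open>rbasis\<close> and the sum over the coordinate frame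
  of \<open>c\<close> equal the Hermitian pairing of the representing vectors, by two uses of
  \<open>gram_inverse_pairing\<close>.\<close>

lemma cotangent_inner_chart:
  assumes c: "c \<in> \<A>" "x \<in> fst c" and lin: "linear \<alpha>" "linear \<beta>"
  shows "cotangent_inner g x \<alpha> \<beta> = (\<Sum>i\<in>UNIV. \<Sum>j\<in>UNIV. of_real (gi c x i j)
     * \<alpha> (tangent \<A> c x (rbasis i)) * cnj (\<beta> (tangent \<A> c x (rbasis j))))"
proof -
  note G = hermitian_metricD[OF herm_g[of x]]
  obtain a1 a2 where a: "\<And>v. \<alpha> v = Complex (g x a1 v) (g x a2 v)" using complex_riesz[OF lin(1)] by blast
  obtain b1 b2 where b: "\<And>v. \<beta> v = Complex (g x b1 v) (g x b2 v)" using complex_riesz[OF lin(2)] by blast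
  have "cotangent_inner g x \<alpha> \<beta> = Complex (g x a1 b1 + g x a2 b2) (g x a2 b1 - g x a1 b2)"
    by (rule cotangent_inner_riesz[OF a b])
  also have "\<dots> = (\<Sum>i\<in>UNIV. \<Sum>j\<in>UNIV. of_real (matrix_inv (\<chi> i j. g x (tangent \<A> c x (rbasis i)) (tangent \<A> c x (rbasis j))) $ i $ j)
      * Complex (g x a1 (tangent \<A> c x (rbasis i))) (g x a2 (tangent \<A> c x (rbasis i)))
      * cnj (Complex (g x b1 (tangent \<A> c x (rbasis j))) (g x b2 (tangent \<A> c x (rbasis j)))))"
  proof (rule gram_inverse_pairing[symmetric])
    show "linear (g x u)" "linear (\<lambda>v. g x v u)" "g x u v = g x v u" for u v by (rule G(1), rule G(2), rule G(3))
    show "det (\<chi> i j. g x (tangent \<A> c x (rbasis i)) (tangent \<A> c x (rbasis j))) \<noteq> 0"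
      using det_gram_pos[OF c] unfolding gram_def gc_def by simp
    show "\<exists>y. v = (\<Sum>i\<in>UNIV. y i *\<^sub>R tangent \<A> c x (rbasis i))" for v
    proof -
      let ?w = "dtrans (chart_at \<A> x) c x v"
      have "v = tangent \<A> c x ?w" by (rule tangent_inverse(1)[OF c, symmetric])
      also have "\<dots> = tangent \<A> c x (\<Sum>i\<in>UNIV. (?w \<bullet> rbasis i) *\<^sub>R rbasis i)" by (simp only: rbasis_expansion)
      also have "\<dots> = (\<Sum>i\<in>UNIV. (?w \<bullet> rbasis i) *\<^sub>R tangent \<A> c x (rbasis i))"
        using tangent_linear[OF c] by (simp add: linear_sum linear_scale)
      finally show ?thesis by (intro exI[of _ "\<lambda>i. ?w \<bullet> rbasis i"])
    qed
  qed
  finally show ?thesis unfolding a b gi_def gram_def gc_def .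
qed

lemma mderiv_linear:
  fixes f :: "'a \<Rightarrow> complex"
  assumes "smooth_fun_on \<A> UNIV f"
  shows "linear (mderiv \<A> f x)"
proof -
  have "mderiv \<A> f x = frechet_derivative (\<lambda>z. f (cinv (chart_at \<A> x) z)) (at (snd (chart_at \<A> x) x))"
    by (simp add: mderiv_def fun_eq_iff o_def)
  then show ?thesis
    using smooth_on_frechet_linear[OF smooth_fun_chart[OF assms chart_at(1)]] chart_at(2) by simp
qed

section \<open>Dirichlet energy and the weak Laplacian\<close>

definition energy :: "('a \<Rightarrow> complex) \<Rightarrow> ('a \<Rightarrow> complex) \<Rightarrow> 'a \<Rightarrow> complex" where
  "energy f \<phi> x = cotangent_inner g x (mderiv \<A> f x) (mderiv \<A> \<phi> x)"

lemma energy_chart: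
  assumes f: "smooth_fun_on \<A> UNIV f" "smooth_fun_on \<A> UNIV \<phi>" and c: "c \<in> \<A>" "x \<in> fst c"
  shows "energy f \<phi> x = (\<Sum>i\<in>UNIV. \<Sum>j\<in>UNIV. of_real (gi c x i j)
     * frechet_derivative (\<lambda>z. f (cinv c z)) (at (snd c x)) (rbasis i)
     * cnj (frechet_derivative (\<lambda>z. \<phi> (cinv c z)) (at (snd c x)) (rbasis j)))"
  unfolding energy_def cotangent_inner_chart[OF c mderiv_linear[OF f(1)] mderiv_linear[OF f(2)]]
    mderiv_tangent[OF f(1) open_UNIV UNIV_I c] mderiv_tangent[OF f(2) open_UNIV UNIV_I c] ..

lemma energy_smooth:
  assumes f: "smooth_fun_on \<A> UNIV f" "smooth_fun_on \<A> UNIV \<phi>"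
  shows "smooth_fun_on \<A> UNIV (energy f \<phi>)"
  unfolding smooth_fun_on_def o_def
proof
  fix c assume c: "c \<in> \<A>"
  let ?E = "\<lambda>z. \<Sum>i\<in>UNIV. \<Sum>j\<in>UNIV. complex_of_real (gi c (cinv c z) i j)
     * frechet_derivative (\<lambda>z. f (cinv c z)) (at z) (rbasis i)
     * cnj (frechet_derivative (\<lambda>z. \<phi> (cinv c z)) (at z) (rbasis j))"
  have "smooth_on (im c) ?E"
    by (intro smooth_on_sum smooth_on_mult smooth_on_of_real smooth_on_cnj smooth_on_deriv smooth_gi
        smooth_fun_chart f c chart_open(2))
  moreover have "energy f \<phi> (cinv c z) = ?E z" if z: "z \<in> im c" for z
    using energy_chart[OF f c chart_cinv(2)[OF c z]] unfolding chart_cinv(1)[OF c z] .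
  ultimately show "smooth_on (snd c ` (fst c \<inter> UNIV)) (\<lambda>z. energy f \<phi> (cinv c z))"
    using smooth_on_cong[OF chart_open(2)[OF c], of "\<lambda>z. energy f \<phi> (cinv c z)" ?E] by simp
qed

text \<open>The codifferential of \<open>\<zeta> df\<close>, where the cut-off \<open>\<zeta>\<close> is supported in a chart: there it is given by
  the coordinate formula, and integration by parts needs no invariance of that formula.\<close>

lemma local_codifferential:
  fixes \<zeta> :: "'a \<Rightarrow> real" and f :: "'a \<Rightarrow> complex"
  assumes c: "c \<in> \<A>" and K: "compact K" "K \<subseteq> fst c" and \<zeta>: "smooth_fun_on \<A> UNIV \<zeta>" "\<And>y. y \<notin> K \<Longrightarrow> \<zeta> y = 0"
    and f: "smooth_fun_on \<A> UNIV f"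
  obtains u where "smooth_fun_on \<A> UNIV u"
    "\<And>\<phi>. smooth_fun_on \<A> UNIV \<phi> \<Longrightarrow> (LINT x|\<mu>. u x * cnj (\<phi> x)) = (LINT x|\<mu>. of_real (\<zeta> x) * energy f \<phi> x)"
proof -
  note op = chart_open(2)[OF c]
  let ?r = "rbasis :: 'n \<times> bool \<Rightarrow> complex^'n"
  \<comment> \<open>Component j of the gradient of \<open>f\<close>, cut off by
    \<open>\<zeta>\<close> and multiplied by the volume density. \<open>U\<close> is then minus its
    divergence divided by that density.\<close>
  define W where "W j z = complex_of_real (vden c (cinv c z)) * (\<Sum>i\<in>UNIV. of_real (gi c (cinv c z) i j) * of_real (\<zeta> (cinv c z))
      * frechet_derivative (\<lambda>z. f (cinv c z)) (at z) (?r i))" for j z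
  define U where "U z = - (\<Sum>j\<in>UNIV. frechet_derivative (W j) (at z) (?r j)) * of_real (inverse (vden c (cinv c z)))" for z
  define u where "u x = (if x \<in> fst c then U (snd c x) else 0)" for x
  have Ws: "smooth_on (im c) (W j)" for j
    unfolding W_def
    by (intro smooth_on_mult smooth_on_sum smooth_on_of_real smooth_vden smooth_gi smooth_on_deriv smooth_fun_chart c op f \<zeta>)
  have Us: "smooth_on (im c) U"
    unfolding U_def
    by (intro smooth_on_mult smooth_on_uminus smooth_on_sum smooth_on_deriv Ws smooth_on_of_real smooth_on_inverse smooth_vden c op vden_pos chart_cinv(2))
  let ?K = "snd c ` K"
  have cK: "compact ?K" by (intro compact_continuous_image continuous_on_subset[OF chart_continuous(1)[OF c] K(2)] K(1))
  have oK: "open (- ?K)" using compact_imp_closed[OF cK] by (rule open_Compl)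
  have mem: "cinv c z \<notin> K" if "z \<in> im c" "z \<notin> ?K" for z
  proof
    assume "cinv c z \<in> K"
    then have "snd c (cinv c z) \<in> ?K" by blast
    then show False using chart_cinv(1)[OF c that(1)] that(2) by simp
  qed
  have W0: "W j z = 0" if "z \<in> im c" "z \<notin> ?K" for j z
    unfolding W_def \<zeta>(2)[OF mem[OF that]] by simp
  have DW0: "frechet_derivative (W j) (at z) v = 0" if z: "z \<in> im c" "z \<notin> ?K" for j z v
  proof -
    have "frechet_derivative (W j) (at z) = frechet_derivative (\<lambda>_. 0) (at z)"
      by (rule frechet_derivative_cong_open[of "im c \<inter> - ?K"]) (use op oK z W0 in auto)
    then show ?thesis by simp
  qed
  have usm: "smooth_fun_on \<A> UNIV u"
    unfolding u_def
  proof (rule smooth_fun_extend[OF c K Us])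
    fix x assume x: "x \<in> fst c" "x \<notin> K"
    then have "snd c x \<notin> ?K" using chart_mem_image[OF c x(1) K(2)] by simp
    then show "U (snd c x) = 0" unfolding U_def using DW0 x(1) by simp
  qed
  have "(LINT x|\<mu>. u x * cnj (\<phi> x)) = (LINT x|\<mu>. of_real (\<zeta> x) * energy f \<phi> x)" if \<phi>: "smooth_fun_on \<A> UNIV \<phi>" for \<phi>
  proof -
    define h where "h z = cnj (\<phi> (cinv c z))" for z
    have hs: "smooth_on (im c) h" unfolding h_def by (intro smooth_on_cnj smooth_fun_chart \<phi> c op)
    \<comment> \<open>\<open>A\<close> and \<open>B\<close> are the two halves of the divergence of
      the compactly supported field \<open>W j * h\<close>; since the integral of the sum vanishes,
      one half can be exchanged for minus the other.\<close>
    define A where "A z = (if z \<in> im c then \<Sum>j\<in>UNIV. frechet_derivative (W j) (at z) (?r j) * h z else 0)" for z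
    define B where "B z = (if z \<in> im c then \<Sum>j\<in>UNIV. W j z * frechet_derivative h (at z) (?r j) else 0)" for z
    define \<psi> where "\<psi> j z = (if z \<in> im c then W j z * h z else 0)" for j z
    define \<psi>' where "\<psi>' j z v = (if z \<in> im c then W j z * frechet_derivative h (at z) v + frechet_derivative (W j) (at z) v * h z else 0)" for j z v
    have cover: "im c \<union> - ?K = UNIV" using K(2) by auto
    have glue: "continuous_on UNIV F" if "continuous_on (im c) F" "\<And>z. z \<notin> ?K \<Longrightarrow> F z = 0" for F :: "complex^'n \<Rightarrow> complex"
    proof -
      have "continuous_on (- ?K) F" by (rule continuous_on_eq[OF continuous_on_const[of _ 0]]) (use that(2) in auto)
      then have "continuous_on (im c \<union> - ?K) F" by (intro continuous_on_open_Un op oK that(1))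
      then show ?thesis by (simp only: cover)
    qed
    have cA: "continuous_on UNIV A"
    proof (rule glue)
      have "continuous_on (im c) (\<lambda>z. \<Sum>j\<in>UNIV. frechet_derivative (W j) (at z) (?r j) * h z)"
        by (intro smooth_on_continuous[of "im c"] smooth_on_sum smooth_on_mult smooth_on_deriv Ws hs op)
      then show "continuous_on (im c) A" by (rule continuous_on_eq) (simp add: A_def)
      show "A z = 0" if "z \<notin> ?K" for z using DW0[OF _ that] by (simp add: A_def)
    qed
    have cB: "continuous_on UNIV B"
    proof (rule glue)
      have "continuous_on (im c) (\<lambda>z. \<Sum>j\<in>UNIV. W j z * frechet_derivative h (at z) (?r j))"
        by (intro smooth_on_continuous[of "im c"] smooth_on_sum smooth_on_mult smooth_on_deriv Ws hs op)
      then show "continuous_on (im c) B" by (rule continuous_on_eq) (simp add: B_def)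
      show "B z = 0" if "z \<notin> ?K" for z using W0[OF _ that] by (simp add: B_def)
    qed
    have c\<psi>': "continuous_on UNIV (\<lambda>z. \<psi>' j z v)" for j v
    proof (rule glue)
      have "continuous_on (im c) (\<lambda>z. W j z * frechet_derivative h (at z) v + frechet_derivative (W j) (at z) v * h z)"
        by (intro smooth_on_continuous[of "im c"] smooth_on_add smooth_on_mult smooth_on_deriv Ws hs op)
      then show "continuous_on (im c) (\<lambda>z. \<psi>' j z v)" by (rule continuous_on_eq) (simp add: \<psi>'_def)
      show "\<psi>' j z v = 0" if "z \<notin> ?K" for z using W0[OF _ that] DW0[OF _ that] by (simp add: \<psi>'_def)
    qed
    have \<psi>'0: "\<psi>' j z v = 0" if "z \<notin> ?K" for j z v using W0[OF _ that] DW0[OF _ that] by (simp add: \<psi>'_def)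
    have \<psi>0: "\<psi> j z = 0" if "z \<notin> ?K" for j z using W0[OF _ that] by (simp add: \<psi>_def)
    have d\<psi>: "(\<psi> j has_derivative \<psi>' j z) (at z)" for j z
    proof (cases "z \<in> im c")
      case True
      have "((\<lambda>z. W j z * h z) has_derivative (\<lambda>v. W j z * frechet_derivative h (at z) v + frechet_derivative (W j) (at z) v * h z)) (at z)"
        by (rule has_derivative_mult[OF smooth_on_has_derivative[OF Ws True] smooth_on_has_derivative[OF hs True]])
      then have "(\<psi> j has_derivative (\<lambda>v. W j z * frechet_derivative h (at z) v + frechet_derivative (W j) (at z) v * h z)) (at z)"
        by (rule has_derivative_transform_within_open[OF _ op True]) (simp add: \<psi>_def)
      then show ?thesis using True by (simp add: \<psi>'_def[abs_def])
    next
      case False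
      then have z: "z \<in> - ?K" using cover by blast
      have "((\<lambda>_. 0) has_derivative (\<lambda>v. 0)) (at z)" by simp
      then have "(\<psi> j has_derivative (\<lambda>v. 0)) (at z)"
        by (rule has_derivative_transform_within_open[OF _ oK z]) (simp add: \<psi>0)
      moreover have "\<psi>' j z = (\<lambda>v. 0)" by (rule ext, rule \<psi>'0) (use z in simp)
      ultimately show ?thesis by simp
    qed
    have AB: "A z + B z = (\<Sum>j\<in>UNIV. \<psi>' j z (?r j))" for z
      by (simp add: A_def B_def \<psi>'_def sum.distrib)
    have A0: "A z = 0" if "z \<notin> ?K" for z using DW0[OF _ that] by (simp add: A_def)
    have B0: "B z = 0" if "z \<notin> ?K" for z using W0[OF _ that] by (simp add: B_def)
    have iA: "integrable lborel A" by (rule integrable_compact_support[OF cK A0 cA])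
    have iB: "integrable lborel B" by (rule integrable_compact_support[OF cK B0 cB])
    have "(LINT z|lborel. A z) + (LINT z|lborel. B z) = (LINT z|lborel. A z + B z)"
      by (rule Bochner_Integration.integral_add[symmetric, OF iA iB])
    also have "\<dots> = (\<Sum>j\<in>UNIV. LINT z|lborel. \<psi>' j z (?r j))"
      unfolding AB
      by (rule Bochner_Integration.integral_sum) (rule integrable_compact_support[OF cK \<psi>'0 c\<psi>'])
    also have "\<dots> = 0"
      by (rule sum.neutral, rule ballI, rule integral_derivative_zero[OF cK \<psi>0 d\<psi> c\<psi>'])
    finally have sum0: "(LINT z|lborel. A z) + (LINT z|lborel. B z) = 0" .
    have u0: "u x * cnj (\<phi> x) = 0" if "x \<notin> fst c" for x using that by (simp add: u_def)
    have e0: "complex_of_real (\<zeta> x) * energy f \<phi> x = 0" if "x \<notin> fst c" for x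
      using \<zeta>(2)[of x] K(2) that by auto
    have um: "(\<lambda>x. u x * cnj (\<phi> x)) \<in> borel_measurable borel"
      by (intro borel_measurable_continuous_onI continuous_intros smooth_fun_continuous usm \<phi>)
    have em: "(\<lambda>x. of_real (\<zeta> x) * energy f \<phi> x) \<in> borel_measurable borel"
      by (intro borel_measurable_continuous_onI continuous_intros smooth_fun_continuous \<zeta> energy_smooth f \<phi>)
    have "(LINT x|\<mu>. u x * cnj (\<phi> x)) = (LINT z|lborel. dens vden c z *\<^sub>R (u (\<kappa> c z) * cnj (\<phi> (\<kappa> c z))))"
      by (rule integral_chart[OF consistent_vden c um u0])
    also have "\<dots> = (LINT z|lborel. - A z)"
    proof (rule Bochner_Integration.integral_cong[OF refl])
      fix z
      show "dens vden c z *\<^sub>R (u (\<kappa> c z) * cnj (\<phi> (\<kappa> c z))) = - A z"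
      proof (cases "z \<in> im c")
        case True
        have v: "vden c (cinv c z) \<noteq> 0" using vden_pos[OF c chart_cinv(2)[OF c True]] by simp
        have uU: "u (cinv c z) = U z" unfolding u_def using chart_cinv[OF c True] by simp
        have "complex_of_real r * (- S * of_real (inverse r) * H) = - (S * H)" if "r \<noteq> 0" for r S H
          using that by simp
        from this[OF v] have "complex_of_real (vden c (cinv c z)) * (U z * h z) =
            - ((\<Sum>j\<in>UNIV. frechet_derivative (W j) (at z) (?r j)) * h z)"
          unfolding U_def .
        also have "\<dots> = - A z" using True by (simp only: A_def if_True sum_distrib_right)
        finally show ?thesis using True
          by (simp only: dens_def \<kappa>_def if_True scaleR_conv_of_real uU h_def)
      qed (simp add: dens_def A_def)
    qed
    also have "\<dots> = (LINT z|lborel. B z)" using sum0 add_eq_0_iff[of "LINT z|lborel. A z" "LINT z|lborel. B z"] by simp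
    also have "\<dots> = (LINT z|lborel. dens vden c z *\<^sub>R (of_real (\<zeta> (\<kappa> c z)) * energy f \<phi> (\<kappa> c z)))"
    proof (rule Bochner_Integration.integral_cong[OF refl])
      fix z
      show "B z = dens vden c z *\<^sub>R (of_real (\<zeta> (\<kappa> c z)) * energy f \<phi> (\<kappa> c z))"
      proof (cases "z \<in> im c")
        case True
        have dh: "frechet_derivative h (at z) v = cnj (frechet_derivative (\<lambda>z. \<phi> (cinv c z)) (at z) v)" for v
          unfolding h_def
          by (rule frechet_derivative_bounded_linear[OF bounded_linear_cnj smooth_on_differentiable[OF smooth_fun_chart[OF \<phi> c] True]])
        have e: "energy f \<phi> (cinv c z) = (\<Sum>i\<in>UNIV. \<Sum>j\<in>UNIV. of_real (gi c (cinv c z) i j)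
           * frechet_derivative (\<lambda>z. f (cinv c z)) (at z) (?r i) * frechet_derivative h (at z) (?r j))"
          using energy_chart[OF f \<phi> c chart_cinv(2)[OF c True]] unfolding chart_cinv(1)[OF c True] dh .
        have "B z = (\<Sum>j\<in>UNIV. \<Sum>i\<in>UNIV. of_real (vden c (cinv c z)) * (of_real (\<zeta> (cinv c z)) * (of_real (gi c (cinv c z) i j)
           * frechet_derivative (\<lambda>z. f (cinv c z)) (at z) (?r i) * frechet_derivative h (at z) (?r j))))"
          using True by (simp add: B_def W_def sum_distrib_left sum_distrib_right mult_ac)
        also have "\<dots> = of_real (vden c (cinv c z)) * (of_real (\<zeta> (cinv c z)) * energy f \<phi> (cinv c z))"
          unfolding e by (subst sum.swap) (simp only: sum_distrib_left)
        finally show ?thesis using True by (simp add: dens_def \<kappa>_def scaleR_conv_of_real)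
      qed (simp add: dens_def B_def)
    qed
    also have "\<dots> = (LINT x|\<mu>. of_real (\<zeta> x) * energy f \<phi> x)"
      by (rule integral_chart[symmetric, OF consistent_vden c em e0])
    finally show ?thesis .
  qed
  then show ?thesis using that usm by blast
qed

text \<open>Summing the local codifferentials of \<open>\<zeta> k\<close> times df over the
  partition of unity gives a global one, because the cut-offs add up to 1.\<close>

lemma weak_laplacian_exists:
  assumes f: "smooth_fun_on \<A> UNIV f"
  obtains u where "smooth_fun_on \<A> UNIV u"
    "\<And>\<phi>. smooth_fun_on \<A> UNIV \<phi> \<Longrightarrow> (LINT x|\<mu>. u x * cnj (\<phi> x)) = (LINT x|\<mu>. energy f \<phi> x)"
proof (rule partition_of_unity)
  fix I and \<zeta> :: "'a \<Rightarrow> 'a \<Rightarrow> real" and K assume Z: "finite I"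
    "\<And>k. compact (K k)" "\<And>k. K k \<subseteq> fst (chart_at \<A> k)" "\<And>k. smooth_fun_on \<A> UNIV (\<zeta> k)"
    "\<And>k y. y \<notin> K k \<Longrightarrow> \<zeta> k y = 0" "\<And>y. (\<Sum>k\<in>I. \<zeta> k y) = 1"
  have "\<forall>k. \<exists>u. smooth_fun_on \<A> UNIV u \<and> (\<forall>\<phi>. smooth_fun_on \<A> UNIV \<phi> \<longrightarrow>
     (LINT x|\<mu>. u x * cnj (\<phi> x)) = (LINT x|\<mu>. of_real (\<zeta> k x) * energy f \<phi> x))"
  proof
    fix k
    show "\<exists>u. smooth_fun_on \<A> UNIV u \<and> (\<forall>\<phi>. smooth_fun_on \<A> UNIV \<phi> \<longrightarrow>
     (LINT x|\<mu>. u x * cnj (\<phi> x)) = (LINT x|\<mu>. of_real (\<zeta> k x) * energy f \<phi> x))"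
    proof (rule local_codifferential[OF chart_at(1)[of k] Z(2,3,4) Z(5) f])
      fix u assume "smooth_fun_on \<A> UNIV u"
        "\<And>\<phi>. smooth_fun_on \<A> UNIV \<phi> \<Longrightarrow> (LINT x|\<mu>. u x * cnj (\<phi> x)) = (LINT x|\<mu>. of_real (\<zeta> k x) * energy f \<phi> x)"
      then show ?thesis by blast
    qed
  qed
  from choice[OF this] obtain w where w: "\<And>k. smooth_fun_on \<A> UNIV (w k)"
    "\<And>k \<phi>. smooth_fun_on \<A> UNIV \<phi> \<Longrightarrow> (LINT x|\<mu>. w k x * cnj (\<phi> x)) = (LINT x|\<mu>. of_real (\<zeta> k x) * energy f \<phi> x)"
    by blast
  show ?thesis
  proof
    show "smooth_fun_on \<A> UNIV (\<lambda>x. \<Sum>k\<in>I. w k x)" by (intro smooth_fun_sum w) simp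
    fix \<phi> :: "'a \<Rightarrow> complex" assume \<phi>: "smooth_fun_on \<A> UNIV \<phi>"
    have "(LINT x|\<mu>. (\<Sum>k\<in>I. w k x) * cnj (\<phi> x)) = (\<Sum>k\<in>I. (LINT x|\<mu>. w k x * cnj (\<phi> x)))"
      unfolding sum_distrib_right
      by (intro Bochner_Integration.integral_sum continuous_integrable[OF consistent_vden] continuous_intros smooth_fun_continuous w \<phi>)
    also have "\<dots> = (\<Sum>k\<in>I. (LINT x|\<mu>. of_real (\<zeta> k x) * energy f \<phi> x))" using w(2)[OF \<phi>] by simp
    also have "\<dots> = (LINT x|\<mu>. (\<Sum>k\<in>I. of_real (\<zeta> k x) * energy f \<phi> x))"
      by (intro Bochner_Integration.integral_sum[symmetric] continuous_integrable[OF consistent_vden] continuous_intros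
          smooth_fun_continuous Z energy_smooth f \<phi>)
    also have "\<dots> = (LINT x|\<mu>. energy f \<phi> x)"
      using Z(6) by (simp add: sum_distrib_right[symmetric] of_real_sum[symmetric] del: of_real_sum)
    finally show "(LINT x|\<mu>. (\<Sum>k\<in>I. w k x) * cnj (\<phi> x)) = (LINT x|\<mu>. energy f \<phi> x)" .
  qed
qed

lemma smooth_weak_unique:
  assumes u: "smooth_fun_on \<A> UNIV u" and v: "smooth_fun_on \<A> UNIV v"
    and eq: "\<And>\<phi>. smooth_fun_on \<A> UNIV \<phi> \<Longrightarrow> (LINT x|\<mu>. u x * cnj (\<phi> x)) = (LINT x|\<mu>. v x * cnj (\<phi> x))"
  shows "u = v"
proof
  fix x
  \<comment> \<open>The difference is itself an admissible test function; testing against it yields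
    its squared norm.\<close>
  let ?w = "\<lambda>x. u x - v x"
  have w: "smooth_fun_on \<A> UNIV ?w" by (rule smooth_fun_diff[OF u v open_UNIV])
  have i: "integrable \<mu> (\<lambda>x. u x * cnj (?w x))" "integrable \<mu> (\<lambda>x. v x * cnj (?w x))"
    by (intro continuous_integrable[OF consistent_vden] continuous_intros smooth_fun_continuous u v)+
  have "(LINT x|\<mu>. complex_of_real ((cmod (?w x))^2)) = (LINT x|\<mu>. u x * cnj (?w x) - v x * cnj (?w x))"
    by (intro Bochner_Integration.integral_cong refl) (simp only: complex_norm_square left_diff_distrib)
  also have "\<dots> = 0" using Bochner_Integration.integral_diff[OF i] eq[OF w] by simp
  finally have "(LINT x|\<mu>. (cmod (?w x))^2) = 0" by (simp only: integral_complex_of_real of_real_eq_0_iff)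
  then have "(cmod (?w x))^2 = 0"
    by (intro integral_zero_imp_zero[OF consistent_vden, of "\<lambda>x. (cmod (?w x))^2"] continuous_intros smooth_fun_continuous u v) auto
  then show "u x = v x" by simp
qed

lemma laplacian:
  assumes f: "smooth_fun_on \<A> UNIV f"
  shows "smooth_fun_on \<A> UNIV (laplacian \<A> g f)"
    and "smooth_fun_on \<A> UNIV \<phi> \<Longrightarrow> (LINT x|\<mu>. laplacian \<A> g f x * cnj (\<phi> x)) = (LINT x|\<mu>. energy f \<phi> x)"
proof -
  let ?P = "\<lambda>u. smooth_fun_on \<A> UNIV u \<and>
     (\<forall>\<phi>. smooth_fun_on \<A> UNIV \<phi> \<longrightarrow> (LINT x|\<mu>. u x * cnj (\<phi> x)) = (LINT x|\<mu>. energy f \<phi> x))"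
  obtain u where u: "?P u" using weak_laplacian_exists[OF f] by blast
  have "laplacian \<A> g f = (THE u. ?P u)"
    unfolding laplacian_def codiff_def riemannian_measure_eq energy_def ..
  moreover have "?P (THE u. ?P u)"
  proof (rule theI[of ?P, OF u])
    fix v assume v: "?P v"
    show "v = u" by (rule smooth_weak_unique) (use u v in auto)
  qed
  ultimately show "smooth_fun_on \<A> UNIV (laplacian \<A> g f)"
    and "smooth_fun_on \<A> UNIV \<phi> \<Longrightarrow> (LINT x|\<mu>. laplacian \<A> g f x * cnj (\<phi> x)) = (LINT x|\<mu>. energy f \<phi> x)"
    by simp_all
qed

end

section \<open>The metric of a positive line bundle\<close>

lemma dw_of_real:
  fixes f :: "complex^'n \<Rightarrow> real"
  assumes "(f has_derivative D) (at z)"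
  shows "dw (\<lambda>w. of_real (f (z + w *s v))) = Complex (D v / 2) (- D (J v) / 2)"
proof -
  have line: "vector_derivative (\<lambda>t. complex_of_real (f (z + t *\<^sub>R w))) (at 0) = of_real (D w)" for w
  proof -
    have "((\<lambda>t. f (z + t *\<^sub>R w)) has_vector_derivative D w) (at 0)"
      by (rule has_vector_derivative_line) (simp add: assms)
    then have "((\<lambda>t. complex_of_real (f (z + t *\<^sub>R w))) has_vector_derivative of_real (D w)) (at 0)"
      by (rule bounded_linear.has_vector_derivative[OF bounded_linear_of_real])
    then show ?thesis by (rule vector_derivative_at)
  qed
  have e: "z + complex_of_real t *s v = z + t *\<^sub>R v" "z + (\<i> * complex_of_real t) *s v = z + t *\<^sub>R J v" for t
    by (auto simp: scaleR_smult J_def vec_eq_iff)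
  show ?thesis unfolding dw_def e line by (simp add: complex_eq_iff)
qed

locale positive_bundle = compact_complex_manifold \<A>
  for \<A> :: "('a::t2_space, 'n::finite) chart set" +
  fixes L :: "('i, 'a) herm_bundle"
  assumes line_bundle: "hermitian_line_bundle \<A> L" and positive: "positive_form (curvature_form \<A> L)"
begin

lemma patch_open: "open (patch L i)"
  using line_bundle unfolding hermitian_line_bundle_def by blast

lemma triv_at: "x \<in> patch L (triv_at L x)"
proof -
  have "x \<in> (\<Union>i. patch L i)" using line_bundle unfolding hermitian_line_bundle_def by simp
  then have "\<exists>i. x \<in> patch L i" by blast
  then show ?thesis unfolding triv_at_def by (rule someI_ex)
qed

lemma hmet_pos: "x \<in> patch L i \<Longrightarrow> hmet L i x > 0"
  using line_bundle unfolding hermitian_line_bundle_def by blast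

lemma hmet_smooth: "smooth_fun_on \<A> (patch L i) (hmet L i)"
  using line_bundle unfolding hermitian_line_bundle_def by blast

lemma hmet_trans: "x \<in> patch L i \<Longrightarrow> x \<in> patch L j \<Longrightarrow> hmet L j x = (cmod (trans L i j x))^2 * hmet L i x"
  using line_bundle unfolding hermitian_line_bundle_def by blast

lemma trans_nonzero: "x \<in> patch L i \<Longrightarrow> x \<in> patch L j \<Longrightarrow> trans L i j x \<noteq> 0"
  using line_bundle unfolding hermitian_line_bundle_def by blast

lemma trans_hol: "hol_fun_on \<A> (patch L i \<inter> patch L j) (trans L i j)"
  using line_bundle unfolding hermitian_line_bundle_def by blast

abbreviation dom :: "('a, 'n) chart \<Rightarrow> 'i \<Rightarrow> (complex^'n) set" where
  "dom c i \<equiv> snd c ` (fst c \<inter> patch L i)"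

lemma dom_open: "c \<in> \<A> \<Longrightarrow> open (dom c i)"
  by (rule open_chart_image[OF _ patch_open])

lemma dom_cinv: "c \<in> \<A> \<Longrightarrow> z \<in> dom c i \<Longrightarrow> cinv c z \<in> patch L i" "c \<in> \<A> \<Longrightarrow> z \<in> dom c i \<Longrightarrow> cinv c z \<in> fst c"
    "c \<in> \<A> \<Longrightarrow> z \<in> dom c i \<Longrightarrow> z \<in> im c"
  by auto

text \<open>The logarithm of the length of the frame in coordinates. Its negative is a local Kaehler
  potential of the curvature form, up to a constant factor.\<close>

definition lh :: "'i \<Rightarrow> ('a, 'n) chart \<Rightarrow> complex^'n \<Rightarrow> real" where
  "lh i c z = ln (hmet L i (cinv c z))"

lemma smooth_hmet: "c \<in> \<A> \<Longrightarrow> smooth_on (dom c i) (\<lambda>z. hmet L i (cinv c z))"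
  by (rule smooth_fun_on_chart[OF hmet_smooth])

lemma smooth_lh: "c \<in> \<A> \<Longrightarrow> smooth_on (dom c i) (lh i c)"
  unfolding lh_def by (intro smooth_on_ln smooth_hmet dom_open hmet_pos dom_cinv)

text \<open>The connection form is the (1,0)-part of d log h: half of the derivative along v minus i
  times the derivative along J v.\<close>

lemma chern_form_eq:
  assumes c: "c \<in> \<A>" "z \<in> dom c i"
  shows "chern_form L i c z v = Complex (frechet_derivative (lh i c) (at z) v / 2)
    (- frechet_derivative (lh i c) (at z) (J v) / 2)"
proof -
  let ?H = "\<lambda>z. hmet L i (cinv c z)"
  have H: "?H z > 0" using hmet_pos dom_cinv(1)[OF c] by blast
  have dH: "(?H has_derivative frechet_derivative ?H (at z)) (at z)"
    by (rule smooth_on_has_derivative[OF smooth_hmet[OF c(1)] c(2)])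
  have "((\<lambda>z. ln (?H z)) has_derivative (\<lambda>v. inverse (?H z) * frechet_derivative ?H (at z) v)) (at z)"
    by (rule has_derivative_compose[OF dH DERIV_ln[OF H, unfolded has_field_derivative_def]])
  then have "frechet_derivative (\<lambda>z. ln (?H z)) (at z) = (\<lambda>v. inverse (?H z) * frechet_derivative ?H (at z) v)"
    by (rule frechet_derivative_at[symmetric])
  moreover have "lh i c = (\<lambda>z. ln (?H z))" by (rule ext) (rule lh_def)
  ultimately have d: "frechet_derivative (lh i c) (at z) v = inverse (?H z) * frechet_derivative ?H (at z) v" for v
    by (simp only:)
  have "chern_form L i c z v = Complex (frechet_derivative ?H (at z) v / 2) (- frechet_derivative ?H (at z) (J v) / 2) / of_real (?H z)"
    unfolding chern_form_def by (simp only: dw_of_real[OF dH])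
  also have "\<dots> = Complex (inverse (?H z) * frechet_derivative ?H (at z) v / 2) (- (inverse (?H z) * frechet_derivative ?H (at z) (J v)) / 2)"
  proof -
    have "Complex (a / 2) (- b / 2) / of_real h = Complex (inverse h * a / 2) (- (inverse h * b) / 2)" for a b h
      by (simp add: complex_eq_iff inverse_eq_divide)
    then show ?thesis .
  qed
  finally show ?thesis by (simp only: d)
qed

text \<open>Antisymmetrising the derivative of the (1,0)-part of d log h cancels its real part by
  symmetry of second derivatives. The remaining factor 1/2 together with i/(2 pi) gives 1/(4
  pi).\<close>

lemma curvature_form_eq:
  fixes x u v
  defines "c \<equiv> chart_at \<A> x" and "i \<equiv> triv_at L x"
  shows "curvature_form \<A> L x u v = (D2 (lh i c) (snd c x) (J v) u - D2 (lh i c) (snd c x) (J u) v) / (4 * pi)"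
proof -
  let ?z = "snd c x" and ?f = "lh i c"
  have c: "c \<in> \<A>" "x \<in> fst c" unfolding c_def by (rule chart_at)+
  have z: "?z \<in> dom c i" using c triv_at unfolding i_def by blast
  note sm = smooth_lh[OF c(1), of i]
  have der: "frechet_derivative (\<lambda>z. chern_form L i c z v) (at ?z) u = Complex (D2 ?f ?z v u / 2) (- D2 ?f ?z (J v) u / 2)" for u v
  proof -
    have d: "((\<lambda>z. frechet_derivative ?f (at z) v) has_derivative D2 ?f ?z v) (at ?z)" for v
      using smooth_on_has_derivative[OF smooth_on_deriv[OF sm] z] unfolding D2_def .
    have "((\<lambda>z. complex_of_real (frechet_derivative ?f (at z) v) * (1/2) - complex_of_real (frechet_derivative ?f (at z) (J v)) * (\<i>/2)) has_derivative
       (\<lambda>u. complex_of_real (D2 ?f ?z v u) * (1/2) - complex_of_real (D2 ?f ?z (J v) u) * (\<i>/2))) (at ?z)"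
      by (intro has_derivative_diff has_derivative_mult_left has_derivative_of_real d)
    moreover have "(\<lambda>z. complex_of_real (frechet_derivative ?f (at z) v) * (1/2) - complex_of_real (frechet_derivative ?f (at z) (J v)) * (\<i>/2)) =
       (\<lambda>z. Complex (frechet_derivative ?f (at z) v / 2) (- frechet_derivative ?f (at z) (J v) / 2))"
      by (simp add: fun_eq_iff complex_eq_iff)
    ultimately have "((\<lambda>z. Complex (frechet_derivative ?f (at z) v / 2) (- frechet_derivative ?f (at z) (J v) / 2)) has_derivative
       (\<lambda>u. complex_of_real (D2 ?f ?z v u) * (1/2) - complex_of_real (D2 ?f ?z (J v) u) * (\<i>/2))) (at ?z)" by simp
    then have "((\<lambda>z. chern_form L i c z v) has_derivative
       (\<lambda>u. complex_of_real (D2 ?f ?z v u) * (1/2) - complex_of_real (D2 ?f ?z (J v) u) * (\<i>/2))) (at ?z)"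
      by (rule has_derivative_transform_within_open[OF _ dom_open[OF c(1)] z]) (simp add: chern_form_eq[OF c(1)])
    from frechet_derivative_at[OF this, symmetric] show ?thesis by (simp add: complex_eq_iff)
  qed
  have "chern_curvature \<A> L x u v = frechet_derivative (\<lambda>z. chern_form L i c z v) (at ?z) u
        - frechet_derivative (\<lambda>z. chern_form L i c z u) (at ?z) v"
    unfolding chern_curvature_def Let_def c_def i_def ..
  also have "\<dots> = Complex 0 ((D2 ?f ?z (J u) v - D2 ?f ?z (J v) u) / 2)"
    unfolding der using D2_sym[OF sm z dom_open[OF c(1)], of u v] by (simp add: complex_eq_iff diff_divide_distrib)
  finally show ?thesis unfolding curvature_form_def by (simp add: field_simps)
qed

abbreviation g :: "'a \<Rightarrow> complex^'n \<Rightarrow> complex^'n \<Rightarrow> real" where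
  "g \<equiv> metric_of (curvature_form \<A> L)"

lemma metric_levi_at:
  "g x u v = - levi (lh (triv_at L x) (chart_at \<A> x)) (snd (chart_at \<A> x) x) u v / (4 * pi)"
proof -
  let ?c = "chart_at \<A> x" and ?i = "triv_at L x"
  have z: "snd ?c x \<in> dom ?c ?i" using chart_at triv_at by blast
  note sm = smooth_lh[OF chart_at(1), of x ?i]
  note op = dom_open[OF chart_at(1), of x ?i]
  show ?thesis
    unfolding metric_of_def curvature_form_eq levi_def
    using D2_sym[OF sm z op, of v u] linear_neg[OF D2_linear_left[OF sm z op]] by (simp add: field_simps)
qed

lemma kaehler_form_metric: "kaehler_form_of g = curvature_form \<A> L"
proof (intro ext)
  fix x u v
  let ?c = "chart_at \<A> x" and ?i = "triv_at L x"
  have z: "snd ?c x \<in> dom ?c ?i" using chart_at triv_at by blast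
  note sm = smooth_lh[OF chart_at(1), of x ?i]
  note op = dom_open[OF chart_at(1), of x ?i]
  show "kaehler_form_of g x u v = curvature_form \<A> L x u v"
    unfolding kaehler_form_of_def metric_levi_at curvature_form_eq levi_def
    using D2_sym[OF sm z op, of u "J v"] linear_neg[OF D2_linear_left[OF sm z op]] by (simp add: field_simps)
qed

text \<open>The logarithm of the squared modulus of a nowhere zero holomorphic function is
  pluriharmonic. Here this is \<open>levi_ln_sum_norm2\<close> with a single summand, where equality
  in Cauchy-Schwarz makes the two terms cancel.\<close>

lemma levi_ln_norm2:
  fixes t :: "complex^'n \<Rightarrow> complex"
  assumes "open S" "z \<in> S" "hol_on S t" "\<And>z. z \<in> S \<Longrightarrow> t z \<noteq> 0"
  shows "levi (\<lambda>y. ln ((cmod (t y))^2)) z u v = 0"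
proof -
  let ?d = "frechet_derivative t (at z)"
  have "levi (\<lambda>y. ln (\<Sum>e\<in>{()}. (cmod (t y))^2)) z u v = 4 * Re ((\<Sum>e\<in>{()}. ?d u * cnj (?d v)) / (\<Sum>e\<in>{()}. (cmod (t z))^2)
    - (\<Sum>e\<in>{()}. cnj (t z) * ?d u) * cnj (\<Sum>e\<in>{()}. cnj (t z) * ?d v) / (\<Sum>e\<in>{()}. (cmod (t z))^2)^2)"
    using levi_ln_sum_norm2[OF assms(1,2), of "{()}" "\<lambda>_. t" u v] assms(3,4) by simp
  also have "\<dots> = 4 * Re (?d u * cnj (?d v) / (t z * cnj (t z)) - cnj (t z) * ?d u * (t z * cnj (?d v)) / (t z * cnj (t z))^2)"
    by (simp flip: complex_norm_square)
  also have "\<dots> = 0" using assms(4)[OF assms(2)] by (simp add: field_simps power2_eq_square)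
  finally show ?thesis by simp
qed

text \<open>A change of frame adds the logarithm of |trans|^2 to the potential, which is
  pluriharmonic.\<close>

lemma levi_lh_trivialisation:
  assumes c: "c \<in> \<A>" "x \<in> fst c" and i: "x \<in> patch L i" "x \<in> patch L j"
  shows "levi (lh i c) (snd c x) u v = levi (lh j c) (snd c x) u v"
proof -
  let ?S = "snd c ` (fst c \<inter> (patch L i \<inter> patch L j))"
  have S: "open ?S" "snd c x \<in> ?S" using open_chart_image[OF c(1) open_Int[OF patch_open patch_open]] c i by auto
  let ?t = "\<lambda>z. trans L i j (cinv c z)"
  have t: "hol_on ?S ?t" using trans_hol[of i j] c(1) unfolding hol_fun_on_def o_def by blast
  have tn: "?t z \<noteq> 0" if "z \<in> ?S" for z
  proof -
    have "cinv c z \<in> patch L i" "cinv c z \<in> patch L j" using that c(1) by auto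
    then show ?thesis by (rule trans_nonzero)
  qed
  have eq: "lh j c z = ln ((cmod (?t z))^2) + lh i c z" if "z \<in> ?S" for z
  proof -
    have p: "cinv c z \<in> patch L i" "cinv c z \<in> patch L j" using that c(1) by auto
    show ?thesis unfolding lh_def hmet_trans[OF p]
      using tn[OF that] hmet_pos[OF p(1)] by (intro ln_mult_pos) auto
  qed
  have sl: "smooth_on ?S (\<lambda>z. ln ((cmod (?t z))^2))"
    using smooth_on_sum_norm2[of ?S "{()}" "\<lambda>_. ?t"] S(1) t tn
    by (intro smooth_on_ln) auto
  have "levi (lh j c) (snd c x) u v = levi (\<lambda>z. ln ((cmod (?t z))^2) + lh i c z) (snd c x) u v"
    by (rule levi_cong[OF S eq])
  also have "\<dots> = levi (\<lambda>z. ln ((cmod (?t z))^2)) (snd c x) u v + levi (lh i c) (snd c x) u v"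
    by (rule levi_add[OF sl smooth_on_subset[OF smooth_lh[OF c(1)]] S(2,1)]) auto
  also have "levi (\<lambda>z. ln ((cmod (?t z))^2)) (snd c x) u v = 0"
    by (rule levi_ln_norm2[OF S t tn])
  finally show ?thesis by simp
qed

text \<open>\<open>curvature_form\<close> is computed in the chart and frame preferred at each
  point. Tensoriality of the Levi form and its independence of the frame carry the formula to a
  fixed chart and frame, where the metric is visibly smooth.\<close>

lemma metric_levi:
  assumes c: "c \<in> \<A>" "x \<in> fst c" and i: "x \<in> patch L i"
  shows "g x (tangent \<A> c x u) (tangent \<A> c x v) = - levi (lh i c) (snd c x) u v / (4 * pi)"
proof -
  let ?d = "chart_at \<A> x"
  note d = chart_at[of x]
  let ?S = "snd c ` (fst c \<inter> (fst ?d \<inter> patch L i))"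
  have S: "open ?S" "snd c x \<in> ?S"
    using open_chart_image[OF c(1) open_Int[OF chart_open(1)[OF d(1)] patch_open]] c i d by auto
  have "levi (lh i c) (snd c x) u v = levi (\<lambda>z. lh i ?d (transition c ?d z)) (snd c x) u v"
    by (rule levi_cong[OF S]) (use c d in \<open>auto simp: lh_def\<close>)
  also have "\<dots> = levi (lh i ?d) (transition c ?d (snd c x)) (frechet_derivative (transition c ?d) (at (snd c x)) u)
      (frechet_derivative (transition c ?d) (at (snd c x)) v)"
  proof (rule levi_compose[OF smooth_lh[OF d(1)] dom_open[OF d(1)] S(1) _ _ S(2)])
    show "hol_on ?S (\<lambda>z. transition c ?d z $ k)" for k
      by (rule hol_on_subset[OF transition_hol[OF c(1) d(1)]]) auto
    show "transition c ?d ` ?S \<subseteq> dom ?d i" using c(1) by auto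
  qed
  also have "\<dots> = levi (lh i ?d) (snd ?d x) (tangent \<A> c x u) (tangent \<A> c x v)"
    unfolding tangent_eq dtrans_def cinv_chart[OF c] ..
  also have "\<dots> = levi (lh (triv_at L x) ?d) (snd ?d x) (tangent \<A> c x u) (tangent \<A> c x v)"
    by (rule levi_lh_trivialisation[OF d i triv_at])
  finally show ?thesis unfolding metric_levi_at by simp
qed

lemma hermitian_metric_g: "hermitian_metric (g x)"
  unfolding hermitian_metric_def
proof (intro conjI allI impI)
  let ?c = "chart_at \<A> x" and ?i = "triv_at L x"
  have z: "snd ?c x \<in> dom ?c ?i" using chart_at triv_at by blast
  note sm = smooth_lh[OF chart_at(1), of x ?i]
  note op = dom_open[OF chart_at(1), of x ?i]
  note lin = levi_linear[OF sm z op]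
  show "linear (g x u)" for u
    by (rule linearI) (simp_all add: metric_levi_at linear_add[OF lin] linear_scale[OF lin] add_divide_distrib diff_divide_distrib)
  show "g x u v = g x v u" for u v unfolding metric_levi_at levi_sym[OF sm z op, of u v] ..
  show "g x (J u) (J v) = g x u v" for u v unfolding metric_levi_at levi_J[OF sm z op] ..
  show "0 < g x v v" if "v \<noteq> 0" for v
    using positive that unfolding positive_form_def metric_of_def by blast
qed

lemma smooth_metric:
  assumes c: "c \<in> \<A>"
  shows "smooth_on (im c) (\<lambda>z. g (cinv c z) (tangent \<A> c (cinv c z) u) (tangent \<A> c (cinv c z) v))"
proof (rule smooth_on_local)
  fix z assume z: "z \<in> im c"
  let ?i = "triv_at L (cinv c z)"
  have zS: "z \<in> dom c ?i"
  proof -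
    obtain x where x: "x \<in> fst c" "z = snd c x" using z by blast
    then show ?thesis using c triv_at[of x] by auto
  qed
  have eq: "g (cinv c w) (tangent \<A> c (cinv c w) u) (tangent \<A> c (cinv c w) v) = levi (lh ?i c) w u v * (- 1 / (4 * pi))"
    if w: "w \<in> dom c ?i" for w
    using metric_levi[OF c dom_cinv(2,1)[OF c w], of u v] chart_cinv(1)[OF c dom_cinv(3)[OF c w]] by simp
  have "smooth_on (dom c ?i) (\<lambda>z. g (cinv c z) (tangent \<A> c (cinv c z) u) (tangent \<A> c (cinv c z) v))"
    by (subst smooth_on_cong[OF dom_open[OF c] eq], assumption)
      (intro smooth_on_mult smooth_on_levi smooth_lh smooth_on_const dom_open c)
  then show "\<exists>U. open U \<and> z \<in> U \<and> smooth_on U (\<lambda>z. g (cinv c z) (tangent \<A> c (cinv c z) u) (tangent \<A> c (cinv c z) v))"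
    using zS dom_open[OF c] by blast
qed

sublocale hermitian_manifold \<A> "metric_of (curvature_form \<A> L)"
  by unfold_locales (rule hermitian_metric_g, rule smooth_metric)

lemma vol_eq: "vol \<A> L = \<mu>"
  unfolding vol_def using form_measure_eq unfolding kaehler_form_metric .

end

section \<open>The space of holomorphic sections\<close>

text \<open>Fewer linear equations than unknowns. By induction on the equations, one unknown with
  nonzero coefficient in the new equation is eliminated from all others.\<close>

lemma nontrivial_relation:
  fixes F :: "'x \<Rightarrow> 'e \<Rightarrow> complex"
  assumes "finite X" "finite E" "card E > card X"
  shows "\<exists>c. (\<exists>e\<in>E. c e \<noteq> 0) \<and> (\<forall>x\<in>X. (\<Sum>e\<in>E. c e * F x e) = 0)"
  using assms
proof (induction X arbitrary: E F rule: finite_induct)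
  case empty
  then obtain e where "e \<in> E" by fastforce
  then show ?case by (intro exI[of _ "\<lambda>_. 1"]) auto
next
  case (insert a X)
  show ?case
  proof (cases "\<forall>e\<in>E. F a e = 0")
    case True
    obtain c where c: "\<exists>e\<in>E. c e \<noteq> 0" "\<forall>x\<in>X. (\<Sum>e\<in>E. c e * F x e) = 0"
      using insert.IH[of E F] insert.prems insert.hyps by auto
    have "(\<Sum>e\<in>E. c e * F a e) = 0" using True by (intro sum.neutral) auto
    then show ?thesis using c by (intro exI[of _ c]) auto
  next
    case False
    then obtain e0 where e0: "e0 \<in> E" "F a e0 \<noteq> 0" by blast
    define F' where "F' x e = F x e - F a e / F a e0 * F x e0" for x e
    have "card (E - {e0}) > card X" using insert e0 by simp
    then obtain c where c: "\<exists>e\<in>E - {e0}. c e \<noteq> 0" "\<forall>x\<in>X. (\<Sum>e\<in>E - {e0}. c e * F' x e) = 0"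
      using insert.IH[of "E - {e0}" F'] insert.prems by auto
    define S where "S = (\<Sum>e\<in>E - {e0}. c e * (F a e / F a e0))"
    \<comment> \<open>The value at \<open>e0\<close> is the one that solves the eliminated
      equation.\<close>
    define c' where "c' e = (if e = e0 then - S else c e)" for e
    have sum: "(\<Sum>e\<in>E. c' e * F x e) = (\<Sum>e\<in>E - {e0}. c e * F x e) - S * F x e0" for x
    proof -
      have "(\<Sum>e\<in>E. c' e * F x e) = c' e0 * F x e0 + (\<Sum>e\<in>E - {e0}. c' e * F x e)"
        using insert.prems(1) e0(1) by (rule sum.remove)
      also have "(\<Sum>e\<in>E - {e0}. c' e * F x e) = (\<Sum>e\<in>E - {e0}. c e * F x e)"
        by (intro sum.cong) (auto simp: c'_def)
      finally show ?thesis by (simp add: c'_def)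
    qed
    have F': "(\<Sum>e\<in>E - {e0}. c e * F' x e) = (\<Sum>e\<in>E - {e0}. c e * F x e) - S * F x e0" for x
      unfolding F'_def S_def sum_distrib_right sum_subtractf[symmetric]
      by (intro sum.cong) (auto simp: algebra_simps)
    have "(\<Sum>e\<in>E. c' e * F x e) = 0" if "x \<in> insert a X" for x
    proof (cases "x = a")
      case True
      have "S * F a e0 = (\<Sum>e\<in>E - {e0}. c e * F a e)"
        unfolding S_def sum_distrib_right using e0(2) by (intro sum.cong) auto
      then show ?thesis using sum[of a] True by simp
    next
      case False
      then have "x \<in> X" using that by blast
      then show ?thesis using c(2) F'[of x] sum[of x] by simp
    qed
    moreover have "\<exists>e\<in>E. c' e \<noteq> 0" using c(1) by (auto simp: c'_def)
    ultimately show ?thesis by blast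
  qed
qed

lemma vector_space_scl: "vector_space (scl :: complex \<Rightarrow> ('i, 'a) sect \<Rightarrow> ('i, 'a) sect)"
  by unfold_locales (auto simp: scl_def fun_eq_iff algebra_simps)

lemma sum_sect_apply: "(\<Sum>e\<in>E. f e) i x = (\<Sum>e\<in>E. f e i x)" for f :: "'e \<Rightarrow> ('i, 'a) sect"
  by (induction E rule: infinite_finite_induct) auto

lemma scl_apply [simp]: "(c \<cdot>s s) i x = c * s i x"
  by (simp add: scl_def)

locale quantisation = positive_bundle \<A> L
  for \<A> :: "('a::t2_space, 'n::finite) chart set" and L :: "('i, 'a) herm_bundle" +
  fixes m :: nat
begin

abbreviation H :: "('i, 'a) sect set" where "H \<equiv> hol_sections \<A> L m"
abbreviation hh :: "('i, 'a) sect \<Rightarrow> ('i, 'a) sect \<Rightarrow> 'a \<Rightarrow> complex" where "hh \<equiv> herm (bundle_power L m)"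
abbreviation ip :: "('i, 'a) sect \<Rightarrow> ('i, 'a) sect \<Rightarrow> complex" where "ip \<equiv> l2 \<A> L m"

lemma power_simps [simp]: "patch (bundle_power L m) = patch L" "trans (bundle_power L m) i j x = trans L i j x ^ m"
  "hmet (bundle_power L m) i x = hmet L i x ^ m" "triv_at (bundle_power L m) x = triv_at L x"
  by (simp_all add: bundle_power_def Defs.triv_at_def)

lemma H_section: "s \<in> H \<Longrightarrow> is_section (bundle_power L m) s"
  by (simp add: hol_sections_def)

lemma H_hol: "s \<in> H \<Longrightarrow> c \<in> \<A> \<Longrightarrow> hol_on (dom c i) (\<lambda>z. s i (cinv c z))"
  unfolding hol_sections_def hol_fun_on_def o_def by blast

lemma H_outside: "s \<in> H \<Longrightarrow> x \<notin> patch L i \<Longrightarrow> s i x = 0"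
  using H_section unfolding is_section_def by simp

lemma H_trans: "s \<in> H \<Longrightarrow> x \<in> patch L i \<Longrightarrow> x \<in> patch L j \<Longrightarrow> s i x = trans L i j x ^ m * s j x"
  using H_section unfolding is_section_def by simp

text \<open>The factor |trans|^(2m) in the metric is compensated by trans^m in each of the two
  components, so the preferred frame in \<open>herm\<close> may be replaced by any frame around
  \<open>x\<close>.\<close>

lemma hh_eq:
  assumes s: "s \<in> H" "t \<in> H" and x: "x \<in> patch L i"
  shows "hh s t x = of_real (hmet L i x ^ m) * s i x * cnj (t i x)"
proof -
  let ?j = "triv_at L x"
  note j = triv_at[of x]
  let ?T = "trans L i ?j x"
  have "hmet L ?j x ^ m = ((cmod ?T)^2)^m * hmet L i x ^ m"
    unfolding hmet_trans[OF x j] power_mult_distrib ..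
  then have "complex_of_real (hmet L ?j x ^ m) = (?T * cnj ?T)^m * of_real (hmet L i x ^ m)"
    by (simp only: of_real_mult of_real_power[of "(cmod ?T)^2"] complex_norm_square)
  then show ?thesis
    unfolding herm_def Let_def power_simps H_trans[OF s(1) x j] H_trans[OF s(2) x j]
    by (simp add: power_mult_distrib mult_ac)
qed

lemma hh_smooth:
  assumes s: "s \<in> H" "t \<in> H"
  shows "smooth_fun_on \<A> UNIV (hh s t)"
proof (rule smooth_fun_on_local[OF open_UNIV])
  fix x
  let ?c = "chart_at \<A> x" and ?i = "triv_at L x"
  note c = chart_at(1)[of x]
  have "smooth_on (dom ?c ?i) (\<lambda>z. of_real (hmet L ?i (cinv ?c z) ^ m) * s ?i (cinv ?c z) * cnj (t ?i (cinv ?c z)))"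
    by (intro smooth_on_mult smooth_on_of_real smooth_on_power smooth_on_cnj smooth_hmet hol_on_smooth H_hol dom_open c s)
  moreover have "(hh s t \<circ> cinv ?c) z = of_real (hmet L ?i (cinv ?c z) ^ m) * s ?i (cinv ?c z) * cnj (t ?i (cinv ?c z))"
    if "z \<in> dom ?c ?i" for z
    unfolding o_def by (rule hh_eq[OF s dom_cinv(1)[OF c that]])
  ultimately have "smooth_on (dom ?c ?i) (hh s t \<circ> cinv ?c)"
    by (subst smooth_on_cong[OF dom_open[OF c]])
  then show "\<exists>c\<in>\<A>. \<exists>U. open U \<and> x \<in> U \<and> U \<subseteq> fst c \<and> smooth_on (snd c ` U) (hh s t \<circ> cinv c)"
    using c open_Int[OF chart_open(1)[OF c] patch_open[of ?i]] chart_at(2)[of x] triv_at[of x]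
    by (intro bexI[of _ ?c] exI[of _ "fst ?c \<inter> patch L ?i"]) auto
qed

lemma hh_continuous: "s \<in> H \<Longrightarrow> t \<in> H \<Longrightarrow> continuous_on UNIV (hh s t)"
  by (rule smooth_fun_continuous[OF hh_smooth])

lemma hh_simps:
  "hh (s + t) u x = hh s u x + hh t u x" "hh (c \<cdot>s s) u x = c * hh s u x"
  "hh s (t + u) x = hh s t x + hh s u x" "hh s (c \<cdot>s t) x = cnj c * hh s t x"
  "hh t s x = cnj (hh s t x)" "hh (\<lambda>i x. f x * s i x) u x = f x * hh s u x"
  "hh (s - t) u x = hh s u x - hh t u x"
  by (simp_all add: herm_def Let_def algebra_simps)

lemma ip_eq: "ip s t = (LINT x|\<mu>. hh s t x)"
  unfolding l2_def vol_eq ..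

lemma hh_integrable: "s \<in> H \<Longrightarrow> t \<in> H \<Longrightarrow> integrable \<mu> (hh s t)"
  by (rule continuous_integrable[OF consistent_vden hh_continuous])

lemma H_zero: "0 \<in> H"
  by (simp add: hol_sections_def is_section_def hol_fun_on_def o_def hol_on_zero)

lemma H_I:
  assumes "\<And>i x. x \<notin> patch L i \<Longrightarrow> s i x = 0"
    "\<And>i j x. x \<in> patch L i \<Longrightarrow> x \<in> patch L j \<Longrightarrow> s i x = trans L i j x ^ m * s j x"
    "\<And>i c. c \<in> \<A> \<Longrightarrow> hol_on (dom c i) (\<lambda>z. s i (cinv c z))"
  shows "s \<in> H"
  using assms by (simp add: hol_sections_def is_section_def hol_fun_on_def o_def)

lemma H_add:
  assumes s: "s \<in> H" "t \<in> H"
  shows "s + t \<in> H"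
proof (rule H_I)
  show "(s + t) i x = 0" if "x \<notin> patch L i" for i x using that s by (simp add: H_outside)
  show "(s + t) i x = trans L i j x ^ m * (s + t) j x" if "x \<in> patch L i" "x \<in> patch L j" for i j x
    unfolding plus_fun_apply H_trans[OF s(1) that] H_trans[OF s(2) that] distrib_left ..
  show "hol_on (dom c i) (\<lambda>z. (s + t) i (cinv c z))" if "c \<in> \<A>" for c i
    unfolding plus_fun_apply by (intro hol_on_add H_hol s that)
qed

lemma H_scl:
  assumes s: "s \<in> H"
  shows "a \<cdot>s s \<in> H"
proof (rule H_I)
  show "(a \<cdot>s s) i x = 0" if "x \<notin> patch L i" for i x using that s by (simp add: H_outside)
  show "(a \<cdot>s s) i x = trans L i j x ^ m * (a \<cdot>s s) j x" if "x \<in> patch L i" "x \<in> patch L j" for i j x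
    unfolding scl_apply H_trans[OF s that] by (simp add: mult_ac)
  show "hol_on (dom c i) (\<lambda>z. (a \<cdot>s s) i (cinv c z))" if "c \<in> \<A>" for c i
    unfolding scl_apply by (intro hol_on_cmult H_hol s that)
qed

lemma H_subspace: "module.subspace scl H"
proof -
  interpret vector_space "scl :: complex \<Rightarrow> ('i, 'a) sect \<Rightarrow> ('i, 'a) sect" by (rule vector_space_scl)
  show ?thesis by (rule subspaceI[OF H_zero H_add H_scl])
qed

lemma H_sum: "(\<And>e. e \<in> E \<Longrightarrow> f e \<in> H) \<Longrightarrow> (\<Sum>e\<in>E. f e) \<in> H"
  by (induction E rule: infinite_finite_induct) (auto simp: H_zero[simplified zero_fun_def] H_zero intro: H_add)

lemma ip_add: "s \<in> H \<Longrightarrow> t \<in> H \<Longrightarrow> u \<in> H \<Longrightarrow> ip (s + t) u = ip s u + ip t u"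
  unfolding ip_eq hh_simps(1) by (intro Bochner_Integration.integral_add hh_integrable)

lemma ip_scl: "ip (c \<cdot>s s) u = c * ip s u"
  unfolding ip_eq hh_simps(2) by simp

lemma ip_sym: "ip t s = cnj (ip s t)"
  unfolding ip_eq hh_simps(5)[of t s] by simp

lemma ip_add_right: "s \<in> H \<Longrightarrow> t \<in> H \<Longrightarrow> u \<in> H \<Longrightarrow> ip u (s + t) = ip u s + ip u t"
  using ip_add[of s t u] ip_sym[of u] by simp

lemma ip_scl_right: "ip u (c \<cdot>s s) = cnj c * ip u s"
  using ip_scl[of c s u] ip_sym[of u] by simp

lemma ip_sum: "finite E \<Longrightarrow> (\<And>e. e \<in> E \<Longrightarrow> f e \<in> H) \<Longrightarrow> u \<in> H \<Longrightarrow> ip (\<Sum>e\<in>E. f e) u = (\<Sum>e\<in>E. ip (f e) u)"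
proof (induction E rule: finite_induct)
  case empty
  have "ip (0 \<cdot>s u) u = 0" unfolding ip_scl by simp
  moreover have "0 \<cdot>s u = 0" by (simp add: fun_eq_iff)
  ultimately show ?case by (simp only: sum.empty)
next
  case (insert a E)
  have "ip (f a + (\<Sum>e\<in>E. f e)) u = ip (f a) u + ip (\<Sum>e\<in>E. f e) u"
    by (intro ip_add H_sum) (use insert in auto)
  then show ?case using insert by (simp only: sum.insert insert_iff simp_thms)
qed

lemma ip_sum_right:
  assumes "finite E" "\<And>e. e \<in> E \<Longrightarrow> f e \<in> H" "u \<in> H"
  shows "ip u (\<Sum>e\<in>E. f e) = (\<Sum>e\<in>E. ip u (f e))"
proof -
  have "ip u (\<Sum>e\<in>E. f e) = cnj (ip (\<Sum>e\<in>E. f e) u)" by (rule ip_sym)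
  also have "ip (\<Sum>e\<in>E. f e) u = (\<Sum>e\<in>E. ip (f e) u)" by (rule ip_sum[OF assms])
  also have "cnj (\<Sum>e\<in>E. ip (f e) u) = (\<Sum>e\<in>E. cnj (ip (f e) u))" by (rule cnj_sum)
  also have "\<dots> = (\<Sum>e\<in>E. ip u (f e))" by (simp add: ip_sym[of u])
  finally show ?thesis .
qed

section \<open>Pointwise norms and finite dimension of the space of sections\<close>

definition n2 :: "('i, 'a) sect \<Rightarrow> 'a \<Rightarrow> real" where
  "n2 s x = Re (hh s s x)"

lemma n2_eq: "s \<in> H \<Longrightarrow> x \<in> patch L i \<Longrightarrow> n2 s x = hmet L i x ^ m * (cmod (s i x))^2"
  unfolding n2_def hh_eq[of s s x i] mult.assoc complex_norm_square[symmetric] by (simp flip: of_real_mult of_real_power)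

lemma n2_nonneg: "s \<in> H \<Longrightarrow> n2 s x \<ge> 0"
  using n2_eq[OF _ triv_at] hmet_pos[OF triv_at[of x]] by simp

lemma n2_hh: "s \<in> H \<Longrightarrow> hh s s x = of_real (n2 s x)"
  using hh_simps(5)[of s s x] by (simp add: n2_def complex_eq_iff)

lemma n2_continuous: "s \<in> H \<Longrightarrow> continuous_on UNIV (n2 s)"
  unfolding n2_def by (intro continuous_intros hh_continuous)

lemma n2_zero: "s \<in> H \<Longrightarrow> (\<And>x. n2 s x = 0) \<Longrightarrow> s = 0"
proof (intro ext)
  fix i x assume s: "s \<in> H" "\<And>x. n2 s x = 0"
  show "s i x = 0 i x"
  proof (cases "x \<in> patch L i")
    case True
    then have "hmet L i x ^ m * (cmod (s i x))^2 = 0" using n2_eq[OF s(1) True] s(2) by simp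
    then show ?thesis using hmet_pos[OF True] by simp
  next
    case False
    then show ?thesis using H_outside[OF s(1)] by simp
  qed
qed

lemma ip_self:
  assumes "s \<in> H"
  shows "ip s s = of_real (LINT x|\<mu>. n2 s x)"
proof -
  have "hh s s = (\<lambda>x. of_real (n2 s x))" by (rule ext) (rule n2_hh[OF assms])
  then show ?thesis by (simp add: ip_eq)
qed

lemma ip_pos: "s \<in> H \<Longrightarrow> s \<noteq> 0 \<Longrightarrow> Re (ip s s) > 0"
proof -
  assume s: "s \<in> H" "s \<noteq> 0"
  have nn: "(LINT x|\<mu>. n2 s x) \<ge> 0" by (intro Bochner_Integration.integral_nonneg n2_nonneg s)
  have "(LINT x|\<mu>. n2 s x) \<noteq> 0"
  proof
    assume 0: "(LINT x|\<mu>. n2 s x) = 0"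
    have "n2 s x = 0" for x
      by (rule integral_zero_imp_zero[OF consistent_vden n2_continuous[OF s(1)] n2_nonneg[OF s(1)] 0])
    then show False using n2_zero[OF s(1)] s(2) by blast
  qed
  then show ?thesis unfolding ip_self[OF s(1)] using nn by simp
qed

text \<open>By the Schwarz lemma a section that vanishes at \<open>x\<close> is small near \<open>x\<close>; so a section that
  vanishes on a suitable finite net vanishes identically.\<close>

lemma vanishing_small:
  obtains V where "open V" "x \<in> V"
    "\<And>s S y. s \<in> H \<Longrightarrow> (\<And>y. n2 s y \<le> S) \<Longrightarrow> s (triv_at L x) x = 0 \<Longrightarrow> y \<in> V \<Longrightarrow> n2 s y \<le> S / 4"
proof -
  let ?c = "chart_at \<A> x" and ?i = "triv_at L x"
  note c = chart_at(1)[of x]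
  let ?p = "snd ?c x"
  have p: "?p \<in> dom ?c ?i" using chart_at(2)[of x] triv_at[of x] by blast
  obtain r where r: "r > 0" "cball ?p r \<subseteq> dom ?c ?i"
    using dom_open[OF c, of ?i] p open_contains_cball by blast
  define hm where "hm z = hmet L ?i (cinv ?c z) ^ m" for z
  have hc: "continuous_on (cball ?p r) hm"
    unfolding hm_def by (intro continuous_intros continuous_on_subset[OF smooth_on_continuous[OF smooth_hmet[OF c]] r(2)])
  have hpos: "hm z > 0" if "z \<in> cball ?p r" for z
    unfolding hm_def using hmet_pos[OF dom_cinv(1)[OF c subsetD[OF r(2) that]]] by simp
  have ne: "cball ?p r \<noteq> {}" using r(1) by simp
  obtain z1 where z1: "z1 \<in> cball ?p r" "\<And>z. z \<in> cball ?p r \<Longrightarrow> hm z1 \<le> hm z"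
    using continuous_attains_inf[OF compact_cball ne hc] by blast
  obtain z2 where z2: "z2 \<in> cball ?p r" "\<And>z. z \<in> cball ?p r \<Longrightarrow> hm z \<le> hm z2"
    using continuous_attains_sup[OF compact_cball ne hc] by blast
  define a b where "a = hm z1" and "b = hm z2"
  have a: "a > 0" "b > 0" using hpos[OF z1(1)] hpos[OF z2(1)] by (simp_all add: a_def b_def)
  \<comment> \<open>On a ball of radius at most \<open>r * q\<close> the Schwarz lemma gains the
    factor q^2 and the variation of the metric costs at most b/a; \<open>q\<close> is chosen so that
    the product is 1/4.\<close>
  define q where "q = sqrt (a / b) / 2"
  have q: "q > 0" "b / a * q^2 = 1 / 4" using a by (simp_all add: q_def power_divide)
  define \<epsilon> where "\<epsilon> = min r (r * q)"
  have \<epsilon>: "\<epsilon> > 0" "\<epsilon> \<le> r" "\<epsilon> \<le> r * q" using r q by (simp_all add: \<epsilon>_def)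
  define V where "V = fst ?c \<inter> snd ?c -` ball ?p \<epsilon>"
  have Vo: "open V" unfolding V_def
    by (rule continuous_open_preimage[OF chart_continuous(1)[OF c] chart_open(1)[OF c] open_ball])
  have Vx: "x \<in> V" using \<epsilon>(1) chart_at(2)[of x] by (simp add: V_def)
  have main: "n2 s y \<le> S / 4" if s: "s \<in> H" and S: "\<And>y. n2 s y \<le> S" and v: "s ?i x = 0" and y: "y \<in> V" for s S y
  proof -
    have S0: "S \<ge> 0" using n2_nonneg[OF s, of x] S[of x] by simp
    let ?f = "\<lambda>z. s ?i (cinv ?c z)"
    have n2z: "n2 s (cinv ?c z) = hm z * (cmod (?f z))^2" if "z \<in> cball ?p r" for z
      unfolding hm_def by (rule n2_eq[OF s dom_cinv(1)[OF c subsetD[OF r(2) that]]])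
    have B: "cmod (?f z) \<le> sqrt (S / a)" if "z \<in> ball ?p r" for z
    proof -
      have zc: "z \<in> cball ?p r" using that by simp
      have "a * (cmod (?f z))^2 \<le> hm z * (cmod (?f z))^2"
        using z1(2)[OF zc] by (intro mult_right_mono) (simp_all add: a_def)
      also have "\<dots> \<le> S" by (simp only: n2z[OF zc, symmetric] S)
      finally have "(cmod (?f z))^2 \<le> S / a" using a(1) by (simp add: pos_le_divide_eq mult.commute)
      then show ?thesis by (rule real_le_rsqrt)
    qed
    have yc: "y \<in> fst ?c" "snd ?c y \<in> ball ?p \<epsilon>" using y by (auto simp: V_def)
    have yr: "snd ?c y \<in> ball ?p r" using yc(2) \<epsilon>(2) by simp
    have "cmod (?f (snd ?c y)) \<le> sqrt (S / a) * (dist ?p (snd ?c y) / r)"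
      by (rule hol_on_Schwarz[OF H_hol[OF s c] _ B _ yr]) (use r(2) v c chart_at(2)[of x] in \<open>auto intro: less_imp_le\<close>)
    also have "\<dots> \<le> sqrt (S / a) * q"
      using yc(2) \<epsilon>(3) r(1) S0 a by (intro mult_left_mono) (auto simp: pos_divide_le_eq mult.commute)
    finally have "(cmod (?f (snd ?c y)))^2 \<le> (sqrt (S / a) * q)^2" by (rule power_mono) simp
    also have "\<dots> = S / a * q^2" using S0 a by (simp add: power_mult_distrib)
    finally have le: "(cmod (?f (snd ?c y)))^2 \<le> S / a * q^2" .
    have ycb: "snd ?c y \<in> cball ?p r" using yr by simp
    have "n2 s y = hm (snd ?c y) * (cmod (?f (snd ?c y)))^2" using n2z[OF ycb] yc(1) c by simp
    also have "\<dots> \<le> b * (S / a * q^2)"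
      using z2(2)[OF ycb] le a by (intro mult_mono) (simp_all add: b_def)
    also have "\<dots> = S * (b / a * q^2)" by simp
    also have "\<dots> = S / 4" unfolding q(2) by simp
    finally show ?thesis .
  qed
  show ?thesis by (rule that[OF Vo Vx main])
qed

lemma finite_net:
  obtains X :: "'a set" where "finite X" "\<And>s. s \<in> H \<Longrightarrow> (\<forall>x\<in>X. s (triv_at L x) x = 0) \<Longrightarrow> s = 0"
proof -
  have "\<forall>x. \<exists>V. open V \<and> x \<in> V \<and> (\<forall>s\<in>H. \<forall>S. (\<forall>y. n2 s y \<le> S) \<longrightarrow> s (triv_at L x) x = 0 \<longrightarrow> (\<forall>y\<in>V. n2 s y \<le> S / 4))"
  proof
    fix x
    show "\<exists>V. open V \<and> x \<in> V \<and> (\<forall>s\<in>H. \<forall>S. (\<forall>y. n2 s y \<le> S) \<longrightarrow> s (triv_at L x) x = 0 \<longrightarrow> (\<forall>y\<in>V. n2 s y \<le> S / 4))"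
    proof (rule vanishing_small[of x])
      fix V assume V: "open V" "x \<in> V"
        "\<And>s S y. s \<in> H \<Longrightarrow> (\<And>y. n2 s y \<le> S) \<Longrightarrow> s (triv_at L x) x = 0 \<Longrightarrow> y \<in> V \<Longrightarrow> n2 s y \<le> S / 4"
      show ?thesis
      proof (intro exI[of _ V] conjI ballI allI impI V(1,2))
        fix s S y assume "s \<in> H" "\<forall>y. n2 s y \<le> S" "s (triv_at L x) x = 0" "y \<in> V"
        then show "n2 s y \<le> S / 4" by (intro V(3)) simp_all
      qed
    qed
  qed
  from choice[OF this] obtain V where V: "\<And>x. open (V x)" "\<And>x. x \<in> V x"
    "\<And>x s S y. s \<in> H \<Longrightarrow> (\<forall>y. n2 s y \<le> S) \<Longrightarrow> s (triv_at L x) x = 0 \<Longrightarrow> y \<in> V x \<Longrightarrow> n2 s y \<le> S / 4" by blast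
  obtain X where X: "finite X" "UNIV \<subseteq> (\<Union>x\<in>X. V x)"
  proof (rule compactE_image[OF cpt, of UNIV V])
    show "UNIV \<subseteq> (\<Union>x\<in>UNIV. V x)" using V(2) by blast
  qed (use that V(1) in blast)+
  have "s = 0" if s: "s \<in> H" and v: "\<forall>x\<in>X. s (triv_at L x) x = 0" for s
  proof -
    obtain y0 where y0: "\<And>y. n2 s y \<le> n2 s y0"
      using continuous_attains_sup[OF cpt UNIV_not_empty n2_continuous[OF s]] by blast
    obtain x where x: "x \<in> X" "y0 \<in> V x" using X(2) by blast
    \<comment> \<open>At a point where the norm is maximal, the bound by a quarter of the maximum
      forces the maximum to be 0.\<close>
    have "n2 s y0 \<le> n2 s y0 / 4"
      by (rule V(3)[OF s _ _ x(2)]) (use y0 v x(1) in auto)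
    then have "n2 s y0 \<le> 0" by simp
    then have "n2 s y = 0" for y using y0[of y] n2_nonneg[OF s, of y] by simp
    then show "s = 0" by (rule n2_zero[OF s])
  qed
  then show ?thesis using that X(1) by blast
qed

text \<open>More orthonormal sections than points of the net would have a nontrivial combination
  vanishing on the net, hence zero; pairing with a member of the set contradicts this.\<close>

lemma orthonormal_bound: "\<exists>N. \<forall>E. finite E \<longrightarrow> E \<subseteq> H \<longrightarrow> orthonormal ip E \<longrightarrow> card E \<le> N"
proof -
  obtain X :: "'a set" where X: "finite X" "\<And>s. s \<in> H \<Longrightarrow> (\<forall>x\<in>X. s (triv_at L x) x = 0) \<Longrightarrow> s = 0"
    using finite_net by blast
  have "card E \<le> card X" if E: "finite E" "E \<subseteq> H" "orthonormal ip E" for E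
  proof (rule ccontr)
    assume "\<not> card E \<le> card X"
    then obtain c where c: "\<exists>e\<in>E. c e \<noteq> 0" "\<forall>x\<in>X. (\<Sum>e\<in>E. c e * e (triv_at L x) x) = 0"
      using nontrivial_relation[OF X(1) E(1), of "\<lambda>x e. e (triv_at L x) x"] by auto
    let ?s = "\<Sum>e\<in>E. c e \<cdot>s e"
    have "?s \<in> H" using E(2) by (intro H_sum H_scl) blast
    moreover have "\<forall>x\<in>X. ?s (triv_at L x) x = 0" using c(2) by (simp add: sum_sect_apply)
    ultimately have s0: "?s = 0" by (rule X(2))
    obtain e' where e': "e' \<in> E" "c e' \<noteq> 0" using c(1) by blast
    have "ip ?s e' = (\<Sum>e\<in>E. c e * ip e e')"
      using ip_sum[OF E(1), of "\<lambda>e. c e \<cdot>s e" e'] H_scl E(2) e'(1) by (simp add: ip_scl subset_iff)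
    also have "\<dots> = (\<Sum>e\<in>E. if e = e' then c e' else 0)"
      using E(3) e'(1) unfolding orthonormal_def by (intro sum.cong) auto
    also have "\<dots> = c e'" using E(1) e'(1) by simp
    finally have "ip ?s e' = c e'" .
    moreover have "ip (0 \<cdot>s e') e' = 0" unfolding ip_scl by simp
    moreover have "0 \<cdot>s e' = ?s" unfolding s0 by (simp add: fun_eq_iff)
    ultimately show False using e'(2) by simp
  qed
  then show ?thesis by blast
qed

lemma onb_exists: "\<exists>E. is_onb \<A> L m E \<and> vector_space.dim scl H = card E"
proof -
  obtain N where N: "\<And>E. finite E \<Longrightarrow> E \<subseteq> H \<Longrightarrow> orthonormal ip E \<Longrightarrow> card E \<le> N"
    using orthonormal_bound by blast
  show ?thesis
  proof (rule gram_schmidt[OF vector_space_scl H_subspace ip_add ip_scl ip_sym ip_pos N])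
    fix E assume E: "finite E" "E \<subseteq> H" "orthonormal ip E" "\<forall>s\<in>H. s = (\<Sum>e\<in>E. ip s e \<cdot>s e)" "vector_space.dim scl H = card E"
    then have "is_onb \<A> L m E" unfolding is_onb_def orthonormal_def by blast
    then show ?thesis using E(5) by blast
  qed
qed

section \<open>The chosen orthonormal basis\<close>

abbreviation B :: "('i, 'a) sect set" where "B \<equiv> onb \<A> L m"

lemma is_onb_B: "is_onb \<A> L m B"
proof -
  have "\<exists>E. is_onb \<A> L m E" using onb_exists by blast
  then show ?thesis unfolding onb_def by (rule someI_ex)
qed

lemma B: "finite B" "B \<subseteq> H" "\<And>s t. s \<in> B \<Longrightarrow> t \<in> B \<Longrightarrow> ip s t = (if s = t then 1 else 0)"
  "\<And>s. s \<in> H \<Longrightarrow> s = (\<Sum>e\<in>B. ip s e \<cdot>s e)"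
  using is_onb_B unfolding is_onb_def by blast+

lemma B_H: "e \<in> B \<Longrightarrow> e \<in> H"
  using B(2) by blast

lemma parseval:
  assumes "is_onb \<A> L m E" "s \<in> H" "t \<in> H"
  shows "ip s t = (\<Sum>e\<in>E. ip s e * ip e t)"
proof -
  have E: "finite E" "E \<subseteq> H" "s = (\<Sum>e\<in>E. ip s e \<cdot>s e)" using assms unfolding is_onb_def by blast+
  have "ip s t = ip (\<Sum>e\<in>E. ip s e \<cdot>s e) t" using E(3) by simp
  also have "\<dots> = (\<Sum>e\<in>E. ip (ip s e \<cdot>s e) t)" using E(2) assms(3) by (intro ip_sum E(1) H_scl) auto
  finally show ?thesis unfolding ip_scl .
qed

text \<open>The sum of |<e, f>|^2 over both bases is evaluated in two orders by Parseval. Since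
  \<open>onb\<close> is an arbitrary choice, this is how its size is identified with the
  dimension.\<close>

lemma card_onb:
  assumes E: "is_onb \<A> L m E" and F: "is_onb \<A> L m F"
  shows "card E = card F"
proof -
  have one: "of_nat (card E) = (\<Sum>e\<in>E. \<Sum>f\<in>F. ip e f * ip f e)" if E: "is_onb \<A> L m E" and F: "is_onb \<A> L m F" for E F
  proof -
    have "(\<Sum>f\<in>F. ip e f * ip f e) = 1" if "e \<in> E" for e
    proof -
      have "e \<in> H" "ip e e = 1" using E that unfolding is_onb_def by auto
      then show ?thesis using parseval[OF F, of e e] by simp
    qed
    then show ?thesis by simp
  qed
  have "complex_of_nat (card E) = (\<Sum>e\<in>E. \<Sum>f\<in>F. ip e f * ip f e)" by (rule one[OF E F])
  also have "\<dots> = (\<Sum>f\<in>F. \<Sum>e\<in>E. ip f e * ip e f)" by (subst sum.swap) (simp add: mult.commute)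
  also have "\<dots> = of_nat (card F)" by (rule one[OF F E, symmetric])
  finally show ?thesis by simp
qed

lemma dim_H: "vector_space.dim scl H = card B"
  using onb_exists card_onb[OF is_onb_B] by metis

lemma H_eqI:
  assumes "s \<in> H" "t \<in> H" "\<And>e. e \<in> B \<Longrightarrow> ip s e = ip t e"
  shows "s = t"
proof -
  have "s = (\<Sum>e\<in>B. ip s e \<cdot>s e)" by (rule B(4)[OF assms(1)])
  also have "\<dots> = (\<Sum>e\<in>B. ip t e \<cdot>s e)" by (intro sum.cong) (simp_all add: assms(3))
  also have "\<dots> = t" by (rule B(4)[OF assms(2), symmetric])
  finally show ?thesis .
qed

end

section \<open>Endomorphisms and Toeplitz operators\<close>

context quantisation
begin

abbreviation EndoH :: "(('i, 'a) sect \<Rightarrow> ('i, 'a) sect) set" where "EndoH \<equiv> Endo \<A> L m"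
abbreviation adjH :: "(('i, 'a) sect \<Rightarrow> ('i, 'a) sect) \<Rightarrow> ('i, 'a) sect \<Rightarrow> ('i, 'a) sect" where
  "adjH \<equiv> adj \<A> L m"

lemma EndoI:
  assumes "F \<in> extensional H" "\<And>s. s \<in> H \<Longrightarrow> F s \<in> H" "\<And>s t. s \<in> H \<Longrightarrow> t \<in> H \<Longrightarrow> F (s + t) = F s + F t"
    "\<And>c s. s \<in> H \<Longrightarrow> F (c \<cdot>s s) = c \<cdot>s F s"
  shows "F \<in> EndoH"
  using assms unfolding Endo_def PiE_def by simp

lemma Endo_D:
  assumes "F \<in> EndoH"
  shows "F \<in> extensional H" "s \<in> H \<Longrightarrow> F s \<in> H" "s \<in> H \<Longrightarrow> t \<in> H \<Longrightarrow> F (s + t) = F s + F t"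
    "s \<in> H \<Longrightarrow> F (c \<cdot>s s) = c \<cdot>s F s"
proof -
  have F: "F \<in> H \<rightarrow>\<^sub>E H" "\<forall>s\<in>H. \<forall>t\<in>H. F (s + t) = F s + F t" "\<forall>c. \<forall>s\<in>H. F (c \<cdot>s s) = c \<cdot>s F s"
    using assms unfolding Endo_def by blast+
  show "F \<in> extensional H" using F(1) unfolding PiE_def by blast
  show "s \<in> H \<Longrightarrow> F s \<in> H" using F(1) by (rule PiE_mem)
  show "s \<in> H \<Longrightarrow> t \<in> H \<Longrightarrow> F (s + t) = F s + F t" using F(2) by blast
  show "s \<in> H \<Longrightarrow> F (c \<cdot>s s) = c \<cdot>s F s" using F(3) by blast
qed

lemma Endo_sum:
  assumes F: "F \<in> EndoH" and E: "finite E" "\<And>e. e \<in> E \<Longrightarrow> f e \<in> H"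
  shows "F (\<Sum>e\<in>E. c e \<cdot>s f e) = (\<Sum>e\<in>E. c e \<cdot>s F (f e))"
  using E
proof (induction E rule: finite_induct)
  case empty
  have z: "0 \<cdot>s s = 0" for s :: "('i, 'a) sect" by (simp add: fun_eq_iff)
  have "F (0 \<cdot>s 0) = 0 \<cdot>s F 0" by (rule Endo_D(4)[OF F H_zero])
  then show ?case by (simp only: z sum.empty)
next
  case (insert a E)
  have "F (c a \<cdot>s f a + (\<Sum>e\<in>E. c e \<cdot>s f e)) = F (c a \<cdot>s f a) + F (\<Sum>e\<in>E. c e \<cdot>s f e)"
    by (intro Endo_D(3)[OF F] H_scl H_sum) (use insert.prems in simp_all)
  moreover have "F (c a \<cdot>s f a) = c a \<cdot>s F (f a)" by (rule Endo_D(4)[OF F]) (use insert.prems in simp)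
  moreover have "F (\<Sum>e\<in>E. c e \<cdot>s f e) = (\<Sum>e\<in>E. c e \<cdot>s F (f e))" by (rule insert.IH) (use insert.prems in simp)
  ultimately show ?case unfolding sum.insert[OF insert.hyps] by (simp only:)
qed

lemma Endo_ext:
  assumes "F \<in> EndoH" "G \<in> EndoH" "\<And>s. s \<in> H \<Longrightarrow> F s = G s"
  shows "F = G"
  using Endo_D(1)[OF assms(1)] Endo_D(1)[OF assms(2)] assms(3) by (rule extensionalityI)

lemma Endo_eqI:
  assumes F: "F \<in> EndoH" and G: "G \<in> EndoH" and eq: "\<And>a b. a \<in> B \<Longrightarrow> b \<in> B \<Longrightarrow> ip (F a) b = ip (G a) b"
  shows "F = G"
proof (rule Endo_ext[OF F G])
  fix s assume s: "s \<in> H"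
  have FG: "F e = G e" if "e \<in> B" for e
    by (rule H_eqI[OF Endo_D(2)[OF F] Endo_D(2)[OF G]]) (use that B_H eq in auto)
  have "F s = F (\<Sum>e\<in>B. ip s e \<cdot>s e)" using B(4)[OF s] by (rule arg_cong)
  also have "\<dots> = (\<Sum>e\<in>B. ip s e \<cdot>s F e)" by (rule Endo_sum[OF F B(1) B_H])
  also have "\<dots> = (\<Sum>e\<in>B. ip s e \<cdot>s G e)" by (intro sum.cong) (simp_all add: FG)
  also have "\<dots> = G (\<Sum>e\<in>B. ip s e \<cdot>s e)" by (rule Endo_sum[OF G B(1) B_H, symmetric])
  also have "\<dots> = G s" using B(4)[OF s, symmetric] by (rule arg_cong)
  finally show "F s = G s" .
qed

lemma sum_scl_add: "(\<Sum>e\<in>E. (a e + b e) \<cdot>s f e) = (\<Sum>e\<in>E. a e \<cdot>s f e) + (\<Sum>e\<in>E. b e \<cdot>s (f e :: ('i, 'a) sect))"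
  unfolding sum.distrib[symmetric] by (intro sum.cong) (auto simp: fun_eq_iff algebra_simps)

lemma sum_scl_scl: "(\<Sum>e\<in>E. (c * a e) \<cdot>s f e) = c \<cdot>s (\<Sum>e\<in>E. a e \<cdot>s (f e :: ('i, 'a) sect))"
  by (intro ext) (simp add: sum_sect_apply sum_distrib_left mult.assoc)

text \<open>A template for endomorphisms written through the basis with linear coefficients: the
  adjoint, Toeplitz operators and the rank-one maps used as tests are all of this shape.\<close>

lemma matrix_Endo:
  assumes f: "\<And>e. e \<in> B \<Longrightarrow> f e \<in> H" "\<And>e s t. e \<in> B \<Longrightarrow> s \<in> H \<Longrightarrow> t \<in> H \<Longrightarrow> a (s + t) e = a s e + a t e"
    "\<And>e s c. e \<in> B \<Longrightarrow> s \<in> H \<Longrightarrow> a (c \<cdot>s s) e = c * a s e"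
  shows "(\<lambda>s\<in>H. \<Sum>e\<in>B. a s e \<cdot>s f e) \<in> EndoH"
proof (rule EndoI)
  let ?F = "\<lambda>s\<in>H. \<Sum>e\<in>B. a s e \<cdot>s f e"
  show "?F s \<in> H" if "s \<in> H" for s using that by (simp add: H_sum H_scl f(1))
  show "?F (s + t) = ?F s + ?F t" if s: "s \<in> H" "t \<in> H" for s t
  proof -
    have "(\<Sum>e\<in>B. a (s + t) e \<cdot>s f e) = (\<Sum>e\<in>B. (a s e + a t e) \<cdot>s f e)"
      by (intro sum.cong) (simp_all add: f(2) s)
    then show ?thesis unfolding restrict_apply'[OF H_add[OF s]] restrict_apply'[OF s(1)] restrict_apply'[OF s(2)]
      by (simp only: sum_scl_add)
  qed
  show "?F (c \<cdot>s s) = c \<cdot>s ?F s" if s: "s \<in> H" for c s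
  proof -
    have "(\<Sum>e\<in>B. a (c \<cdot>s s) e \<cdot>s f e) = (\<Sum>e\<in>B. (c * a s e) \<cdot>s f e)"
      by (intro sum.cong) (simp_all add: f(3) s)
    then show ?thesis unfolding restrict_apply'[OF H_scl[OF s]] restrict_apply'[OF s]
      by (simp only: sum_scl_scl)
  qed
qed simp

lemma ip_comb_left:
  assumes "\<And>e. e \<in> B \<Longrightarrow> f e \<in> H" "t \<in> H"
  shows "ip (\<Sum>e\<in>B. a e \<cdot>s f e) t = (\<Sum>e\<in>B. a e * ip (f e) t)"
  using ip_sum[OF B(1), of "\<lambda>e. a e \<cdot>s f e" t] assms H_scl by (simp add: ip_scl)

lemma ip_comb_right:
  assumes "\<And>e. e \<in> B \<Longrightarrow> f e \<in> H" "t \<in> H"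
  shows "ip t (\<Sum>e\<in>B. a e \<cdot>s f e) = (\<Sum>e\<in>B. cnj (a e) * ip t (f e))"
  using ip_sum_right[OF B(1), of "\<lambda>e. a e \<cdot>s f e" t] assms H_scl by (simp add: ip_scl_right)

lemma ip_expand: "s \<in> H \<Longrightarrow> t \<in> H \<Longrightarrow> ip s t = (\<Sum>e\<in>B. ip s e * ip e t)"
  by (rule parseval[OF is_onb_B])

text \<open>The description in \<open>adj\<close> is met by the formula with coefficients <t, F e>;
  two solutions have the same matrix entries.\<close>

lemma adj:
  assumes F: "F \<in> EndoH"
  shows "adjH F \<in> EndoH" "s \<in> H \<Longrightarrow> t \<in> H \<Longrightarrow> ip (F s) t = ip s (adjH F t)"
proof -
  define G where "G = (\<lambda>t\<in>H. \<Sum>e\<in>B. ip t (F e) \<cdot>s e)"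
  have FH: "F e \<in> H" if "e \<in> B" for e by (rule Endo_D(2)[OF F B_H[OF that]])
  have G: "G \<in> EndoH"
    unfolding G_def by (rule matrix_Endo) (auto simp: B_H FH ip_add ip_scl)
  have adjG: "ip (F s) t = ip s (G t)" if s: "s \<in> H" "t \<in> H" for s t
  proof -
    have "F s = F (\<Sum>e\<in>B. ip s e \<cdot>s e)" using B(4)[OF s(1)] by (rule arg_cong)
    also have "\<dots> = (\<Sum>e\<in>B. ip s e \<cdot>s F e)" by (rule Endo_sum[OF F B(1) B_H])
    finally have "ip (F s) t = ip (\<Sum>e\<in>B. ip s e \<cdot>s F e) t" by (rule arg_cong)
    also have "\<dots> = (\<Sum>e\<in>B. ip s e * ip (F e) t)" by (rule ip_comb_left[OF FH s(2)])
    also have "\<dots> = (\<Sum>e\<in>B. cnj (ip t (F e)) * ip s e)"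
      by (intro sum.cong) (simp_all add: ip_sym[of _ t] mult.commute)
    also have "\<dots> = ip s (\<Sum>e\<in>B. ip t (F e) \<cdot>s e)" by (rule ip_comb_right[OF B_H s(1), symmetric])
    finally show ?thesis using s(2) by (simp add: G_def)
  qed
  have "adjH F = G"
    unfolding adj_def
  proof (rule the_equality)
    show "G \<in> EndoH \<and> (\<forall>s\<in>H. \<forall>t\<in>H. ip (F s) t = ip s (G t))" using G adjG by blast
    fix G' assume G': "G' \<in> EndoH \<and> (\<forall>s\<in>H. \<forall>t\<in>H. ip (F s) t = ip s (G' t))"
    show "G' = G"
    proof (rule Endo_eqI[OF _ G])
      show "G' \<in> EndoH" using G' by blast
      fix a b assume ab: "a \<in> B" "b \<in> B"
      have "ip b (G' a) = ip b (G a)" using G' adjG[of b a] ab B_H by simp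
      then show "ip (G' a) b = ip (G a) b" using ip_sym[of _ b] by simp
    qed
  qed
  then show "adjH F \<in> EndoH" "s \<in> H \<Longrightarrow> t \<in> H \<Longrightarrow> ip (F s) t = ip s (adjH F t)"
    using G adjG by blast+
qed

lemma comb_Endo:
  assumes F: "F \<in> EndoH" and G: "G \<in> EndoH"
  shows "(\<lambda>s\<in>H. c \<cdot>s (F s + d \<cdot>s G s)) \<in> EndoH"
proof (rule EndoI)
  show "(\<lambda>s\<in>H. c \<cdot>s (F s + d \<cdot>s G s)) s \<in> H" if "s \<in> H" for s
    using that by (simp add: H_scl H_add Endo_D(2)[OF F] Endo_D(2)[OF G])
  show "(\<lambda>s\<in>H. c \<cdot>s (F s + d \<cdot>s G s)) (s + t) = (\<lambda>s\<in>H. c \<cdot>s (F s + d \<cdot>s G s)) s + (\<lambda>s\<in>H. c \<cdot>s (F s + d \<cdot>s G s)) t"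
    if s: "s \<in> H" "t \<in> H" for s t
    unfolding restrict_apply'[OF H_add[OF s]] restrict_apply'[OF s(1)] restrict_apply'[OF s(2)]
      Endo_D(3)[OF F s] Endo_D(3)[OF G s] by (auto simp: fun_eq_iff algebra_simps)
  show "(\<lambda>s\<in>H. c \<cdot>s (F s + d \<cdot>s G s)) (a \<cdot>s s) = a \<cdot>s (\<lambda>s\<in>H. c \<cdot>s (F s + d \<cdot>s G s)) s" if s: "s \<in> H" for a s
    unfolding restrict_apply'[OF H_scl[OF s]] restrict_apply'[OF s] Endo_D(4)[OF F s] Endo_D(4)[OF G s]
    by (auto simp: fun_eq_iff algebra_simps)
qed simp

definition selfadjoint :: "(('i, 'a) sect \<Rightarrow> ('i, 'a) sect) \<Rightarrow> bool" where
  "selfadjoint F \<longleftrightarrow> F \<in> EndoH \<and> (\<forall>s\<in>H. \<forall>t\<in>H. ip (F s) t = ip s (F t))"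

lemma re_im_part:
  assumes F: "F \<in> EndoH"
  shows "selfadjoint (re_part \<A> L m F)" "selfadjoint (im_part \<A> L m F)"
    "s \<in> H \<Longrightarrow> F s = re_part \<A> L m F s + \<i> \<cdot>s im_part \<A> L m F s"
proof -
  note A = adj[OF F]
  have adj2: "ip (adjH F s) t = ip s (F t)" if "s \<in> H" "t \<in> H" for s t
    using A(2)[OF that(2,1)] ip_sym[of "adjH F s" t] ip_sym[of s "F t"] by simp
  have FH: "F s \<in> H" "adjH F s \<in> H" if "s \<in> H" for s
    by (rule Endo_D(2)[OF F that], rule Endo_D(2)[OF A(1) that])
  have r: "re_part \<A> L m F = (\<lambda>s\<in>H. (1/2) \<cdot>s (F s + 1 \<cdot>s adjH F s))"
    unfolding re_part_def by (auto simp: fun_eq_iff restrict_def)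
  have i: "im_part \<A> L m F = (\<lambda>s\<in>H. (1/(2*\<i>)) \<cdot>s (F s + (-1) \<cdot>s adjH F s))"
    unfolding im_part_def by (auto simp: fun_eq_iff restrict_def)
  show "selfadjoint (re_part \<A> L m F)"
    unfolding selfadjoint_def
  proof (intro conjI ballI)
    show "re_part \<A> L m F \<in> EndoH" unfolding r by (rule comb_Endo[OF F A(1)])
    show "ip (re_part \<A> L m F s) t = ip s (re_part \<A> L m F t)" if st: "s \<in> H" "t \<in> H" for s t
      unfolding r restrict_apply'[OF st(1)] restrict_apply'[OF st(2)]
      using FH st by (simp add: ip_scl ip_scl_right ip_add ip_add_right H_scl A(2) adj2)
  qed
  show "selfadjoint (im_part \<A> L m F)"
    unfolding selfadjoint_def
  proof (intro conjI ballI)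
    show "im_part \<A> L m F \<in> EndoH" unfolding i by (rule comb_Endo[OF F A(1)])
    show "ip (im_part \<A> L m F s) t = ip s (im_part \<A> L m F t)" if st: "s \<in> H" "t \<in> H" for s t
      unfolding i restrict_apply'[OF st(1)] restrict_apply'[OF st(2)]
      using FH st by (simp add: ip_scl ip_scl_right ip_add ip_add_right H_scl A(2) adj2 field_simps)
  qed
  show "s \<in> H \<Longrightarrow> F s = re_part \<A> L m F s + \<i> \<cdot>s im_part \<A> L m F s"
    unfolding re_part_def im_part_def by (auto simp: fun_eq_iff restrict_apply' field_simps)
qed

subsection \<open>Toeplitz operators and their symbols\<close>

text \<open>The trace density of \<open>F\<close> on the diagonal, i.e. its covariant Berezin symbol
  before division by the Bergman density. It turns out to be the explicit form of
  \<open>toeplitz_adj\<close>.\<close>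

definition symbol :: "(('i, 'a) sect \<Rightarrow> ('i, 'a) sect) \<Rightarrow> 'a \<Rightarrow> complex" where
  "symbol F x = (\<Sum>e\<in>B. hh (F e) e x)"

lemma symbol_smooth:
  assumes F: "F \<in> EndoH"
  shows "smooth_fun_on \<A> UNIV (symbol F)"
  unfolding symbol_def[abs_def]
  by (intro smooth_fun_sum hh_smooth Endo_D(2)[OF F] B_H open_UNIV)

lemma hh_comb: "hh (\<Sum>e\<in>E. a e \<cdot>s f e) t x = (\<Sum>e\<in>E. a e * hh (f e) t x)"
  by (simp add: herm_def Let_def sum_sect_apply sum_distrib_left sum_distrib_right mult_ac)

lemma symbol_adj:
  assumes F: "F \<in> EndoH"
  shows "symbol (adjH F) x = cnj (symbol F x)"
proof -
  have FH: "F e \<in> H" "adjH F e \<in> H" if "e \<in> B" for e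
    by (rule Endo_D(2)[OF F B_H[OF that]], rule Endo_D(2)[OF adj(1)[OF F] B_H[OF that]])
  have ex: "hh s t x = (\<Sum>e\<in>B. ip s e * hh e t x)" if "s \<in> H" for s t
  proof -
    have "hh s t x = hh (\<Sum>e\<in>B. ip s e \<cdot>s e) t x" using B(4)[OF that] by (rule arg_cong)
    then show ?thesis unfolding hh_comb .
  qed
  have "symbol (adjH F) x = (\<Sum>e\<in>B. \<Sum>f\<in>B. ip (adjH F e) f * hh f e x)"
    unfolding symbol_def by (intro sum.cong refl ex FH)
  also have "\<dots> = (\<Sum>e\<in>B. \<Sum>f\<in>B. cnj (ip (F f) e * hh e f x))"
  proof (intro sum.cong refl)
    fix e f assume ef: "e \<in> B" "f \<in> B"
    have "ip (adjH F e) f = cnj (ip (F f) e)"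
      using adj(2)[OF F B_H[OF ef(2)] B_H[OF ef(1)]] ip_sym[of "adjH F e" f] by simp
    then show "ip (adjH F e) f * hh f e x = cnj (ip (F f) e * hh e f x)"
      using hh_simps(5)[of f e x] by simp
  qed
  also have "\<dots> = cnj (\<Sum>f\<in>B. \<Sum>e\<in>B. ip (F f) e * hh e f x)"
    by (subst sum.swap) (simp add: cnj_sum)
  also have "\<dots> = cnj (symbol F x)"
    unfolding symbol_def by (intro arg_cong[of _ _ cnj] sum.cong refl ex[symmetric] FH)
  finally show ?thesis .
qed

lemma weighted_integrable:
  assumes "continuous_on UNIV f" "s \<in> H" "t \<in> H"
  shows "integrable \<mu> (\<lambda>x. f x * hh s t x)"
  by (intro continuous_integrable[OF consistent_vden] continuous_intros assms hh_continuous)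

text \<open>The section \<open>f s\<close> lies outside \<open>H\<close> in general, so its pairings
  are split at the level of integrals. The orthogonal projection is then the usual expansion with
  these pairings as coefficients.\<close>

lemma bergman_proj_eq:
  assumes f: "continuous_on UNIV f" and s: "s \<in> H"
  shows "bergman_proj \<A> L m (\<lambda>i x. f x * s i x) = (\<Sum>e\<in>B. (LINT x|\<mu>. f x * hh s e x) \<cdot>s e)"
proof -
  let ?p = "\<Sum>e\<in>B. (LINT x|\<mu>. f x * hh s e x) \<cdot>s e"
  let ?fs = "\<lambda>i x. f x * s i x"
  have pH: "?p \<in> H" by (intro H_sum H_scl B_H)
  have ipd: "ip (?fs - q) t = (LINT x|\<mu>. f x * hh s t x) - ip q t" if "q \<in> H" "t \<in> H" for q t
    unfolding ip_eq hh_simps(7) hh_simps(6)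
    by (rule Bochner_Integration.integral_diff[OF weighted_integrable[OF f s that(2)] hh_integrable[OF that]])
  have pe: "ip ?p e = (LINT x|\<mu>. f x * hh s e x)" if "e \<in> B" for e
  proof -
    have "ip ?p e = (\<Sum>e'\<in>B. (LINT x|\<mu>. f x * hh s e' x) * ip e' e)" by (rule ip_comb_left[OF B_H B_H[OF that]])
    also have "\<dots> = (\<Sum>e'\<in>B. if e' = e then (LINT x|\<mu>. f x * hh s e x) else 0)"
      by (intro sum.cong refl) (auto simp: B(3) that)
    finally show ?thesis using B(1) that by simp
  qed
  have pt: "ip ?p t = (LINT x|\<mu>. f x * hh s t x)" if t: "t \<in> H" for t
  proof -
    have c: "hh s t x = (\<Sum>e\<in>B. cnj (ip t e) * hh s e x)" for x
    proof -
      have "hh t s x = hh (\<Sum>e\<in>B. ip t e \<cdot>s e) s x" using B(4)[OF t] by (rule arg_cong)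
      then have "hh t s x = (\<Sum>e\<in>B. ip t e * hh e s x)" unfolding hh_comb .
      then have "cnj (hh t s x) = (\<Sum>e\<in>B. cnj (ip t e) * cnj (hh e s x))" by (simp add: cnj_sum)
      then show ?thesis by (simp only: hh_simps(5)[of s, symmetric])
    qed
    have "ip ?p t = ip ?p (\<Sum>e\<in>B. ip t e \<cdot>s e)" using B(4)[OF t] by (rule arg_cong)
    also have "\<dots> = (\<Sum>e\<in>B. cnj (ip t e) * ip ?p e)" by (rule ip_comb_right[OF B_H pH])
    also have "\<dots> = (\<Sum>e\<in>B. cnj (ip t e) * (LINT x|\<mu>. f x * hh s e x))" by (intro sum.cong refl) (simp only: pe)
    also have "\<dots> = (\<Sum>e\<in>B. (LINT x|\<mu>. cnj (ip t e) * (f x * hh s e x)))" by simp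
    also have "\<dots> = (LINT x|\<mu>. (\<Sum>e\<in>B. cnj (ip t e) * (f x * hh s e x)))"
      by (intro Bochner_Integration.integral_sum[symmetric] integrable_mult_right weighted_integrable f s B_H)
    also have "\<dots> = (LINT x|\<mu>. f x * hh s t x)"
      unfolding c by (intro Bochner_Integration.integral_cong refl) (simp add: sum_distrib_left mult_ac)
    finally show ?thesis .
  qed
  show ?thesis
    unfolding bergman_proj_def
  proof (rule the_equality)
    show "?p \<in> H \<and> (\<forall>t\<in>H. ip (?fs - ?p) t = 0)"
    proof (intro conjI ballI pH)
      fix t assume t: "t \<in> H"
      show "ip (?fs - ?p) t = 0" unfolding ipd[OF pH t] pt[OF t] by simp
    qed
    fix q assume q: "q \<in> H \<and> (\<forall>t\<in>H. ip (?fs - q) t = 0)"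
    show "q = ?p"
    proof (rule H_eqI[OF _ pH])
      show "q \<in> H" using q by blast
      fix e assume e: "e \<in> B"
      have "ip (?fs - q) e = 0" using q B_H[OF e] by blast
      then show "ip q e = ip ?p e" unfolding pe[OF e] using ipd[of q e] q B_H[OF e] by simp
    qed
  qed
qed

lemma toeplitz:
  assumes f: "continuous_on UNIV f"
  shows "toeplitz \<A> L m f \<in> EndoH"
    and "s \<in> H \<Longrightarrow> e \<in> B \<Longrightarrow> ip (toeplitz \<A> L m f s) e = (LINT x|\<mu>. f x * hh s e x)"
proof -
  have T: "toeplitz \<A> L m f = (\<lambda>s\<in>H. \<Sum>e\<in>B. (LINT x|\<mu>. f x * hh s e x) \<cdot>s e)"
    unfolding toeplitz_def by (intro restrict_ext) (rule bergman_proj_eq[OF f])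
  show "toeplitz \<A> L m f \<in> EndoH"
    unfolding T
  proof (rule matrix_Endo)
    fix e s t c assume e: "e \<in> B" and s: "s \<in> H"
    show "(LINT x|\<mu>. f x * hh (c \<cdot>s s) e x) = c * (LINT x|\<mu>. f x * hh s e x)"
      unfolding hh_simps(2) by (simp add: mult.left_commute)
    assume t: "t \<in> H"
    show "(LINT x|\<mu>. f x * hh (s + t) e x) = (LINT x|\<mu>. f x * hh s e x) + (LINT x|\<mu>. f x * hh t e x)"
      unfolding hh_simps(1) distrib_left
      by (intro Bochner_Integration.integral_add weighted_integrable f s t B_H e)
  qed (rule B_H)
  assume s: "s \<in> H" and e: "e \<in> B"
  have "ip (toeplitz \<A> L m f s) e = (\<Sum>e'\<in>B. (LINT x|\<mu>. f x * hh s e' x) * ip e' e)"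
    unfolding T restrict_apply'[OF s] by (rule ip_comb_left[OF B_H B_H[OF e]])
  also have "\<dots> = (\<Sum>e'\<in>B. if e' = e then (LINT x|\<mu>. f x * hh s e x) else 0)"
    by (intro sum.cong refl) (auto simp: B(3) e)
  finally show "ip (toeplitz \<A> L m f s) e = (LINT x|\<mu>. f x * hh s e x)" using B(1) e by simp
qed

text \<open>Moving the sum over the basis under the integral leaves the symbol of the adjoint, which
  is the conjugate symbol. This is the duality that characterises
  \<open>toeplitz_adj\<close>.\<close>

lemma tr_toeplitz:
  assumes f: "continuous_on UNIV f" and F: "F \<in> EndoH"
  shows "tr \<A> L m (toeplitz \<A> L m f \<circ> adjH F) = (LINT x|\<mu>. f x * cnj (symbol F x))"
proof -
  have AH: "adjH F e \<in> H" if "e \<in> B" for e by (rule Endo_D(2)[OF adj(1)[OF F] B_H[OF that]])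
  have "tr \<A> L m (toeplitz \<A> L m f \<circ> adjH F) = (\<Sum>e\<in>B. (LINT x|\<mu>. f x * hh (adjH F e) e x))"
    unfolding tr_def o_def by (intro sum.cong refl toeplitz(2)[OF f] AH)
  also have "\<dots> = (LINT x|\<mu>. (\<Sum>e\<in>B. f x * hh (adjH F e) e x))"
    by (intro Bochner_Integration.integral_sum[symmetric] weighted_integrable f AH B_H)
  also have "\<dots> = (LINT x|\<mu>. f x * symbol (adjH F) x)" by (simp add: symbol_def sum_distrib_left)
  finally show ?thesis unfolding symbol_adj[OF F] .
qed

lemma toeplitz_adj_eq:
  assumes F: "F \<in> EndoH"
  shows "toeplitz_adj \<A> L m F = symbol F"
  unfolding toeplitz_adj_def vol_eq
proof (rule the_equality)
  show "smooth_fun_on \<A> UNIV (symbol F) \<and> (\<forall>\<phi>. smooth_fun_on \<A> UNIV \<phi> \<longrightarrow>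
      tr \<A> L m (toeplitz \<A> L m \<phi> \<circ> adjH F) = (LINT x|\<mu>. \<phi> x * cnj (symbol F x)))"
    using symbol_smooth[OF F] tr_toeplitz[OF smooth_fun_continuous F] by blast
  fix f assume f: "smooth_fun_on \<A> UNIV f \<and> (\<forall>\<phi>. smooth_fun_on \<A> UNIV \<phi> \<longrightarrow>
      tr \<A> L m (toeplitz \<A> L m \<phi> \<circ> adjH F) = (LINT x|\<mu>. \<phi> x * cnj (f x)))"
  show "f = symbol F"
  proof (rule smooth_weak_unique)
    show "smooth_fun_on \<A> UNIV f" using f by blast
    show "smooth_fun_on \<A> UNIV (symbol F)" by (rule symbol_smooth[OF F])
    fix \<phi> :: "'a \<Rightarrow> complex" assume \<phi>: "smooth_fun_on \<A> UNIV \<phi>"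
    have "(LINT x|\<mu>. \<phi> x * cnj (f x)) = (LINT x|\<mu>. \<phi> x * cnj (symbol F x))"
      using f \<phi> tr_toeplitz[OF smooth_fun_continuous[OF \<phi>] F] by simp
    \<comment> \<open>\<open>toeplitz_adj\<close> pairs with the unknown function conjugated,
      \<open>smooth_weak_unique\<close> with the test function conjugated; conjugation of the
      integral passes from one to the other.\<close>
    then have "cnj (LINT x|\<mu>. \<phi> x * cnj (f x)) = cnj (LINT x|\<mu>. \<phi> x * cnj (symbol F x))" by (rule arg_cong)
    moreover have "(LINT x|\<mu>. cnj (h x)) = cnj (LINT x|\<mu>. h x)" for h :: "'a \<Rightarrow> complex"
      by (rule integral_bounded_linear'[OF bounded_linear_cnj bounded_linear_cnj]) simp
    ultimately have "(LINT x|\<mu>. cnj (\<phi> x * cnj (f x))) = (LINT x|\<mu>. cnj (\<phi> x * cnj (symbol F x)))"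
      by (simp only:)
    then show "(LINT x|\<mu>. f x * cnj (\<phi> x)) = (LINT x|\<mu>. symbol F x * cnj (\<phi> x))"
      by (simp add: mult.commute)
  qed
qed

lemma tr_determines:
  assumes D: "D \<in> EndoH" "D' \<in> EndoH"
    and eq: "\<And>G. G \<in> EndoH \<Longrightarrow> tr \<A> L m (D \<circ> adjH G) = tr \<A> L m (D' \<circ> adjH G)"
  shows "D = D'"
proof (rule Endo_eqI[OF D])
  fix a b assume ab: "a \<in> B" "b \<in> B"
  \<comment> \<open>The rank-one map s -> <s, a> b. Its adjoint is t -> <t, b> a, so the trace
    pairing with it reads off the matrix entry <D a, b>.\<close>
  define G where "G = (\<lambda>s\<in>H. \<Sum>e\<in>B. (if e = b then ip s a else 0) \<cdot>s e)"
  have G: "G \<in> EndoH" unfolding G_def by (rule matrix_Endo) (auto simp: B_H ip_add ip_scl ab)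
  have Gs: "G s = ip s a \<cdot>s b" if "s \<in> H" for s
  proof -
    have "(\<Sum>e\<in>B. (if e = b then ip s a else 0) \<cdot>s e) i x = (\<Sum>e\<in>B. if e = b then ip s a * b i x else 0)" for i x
      unfolding sum_sect_apply by (intro sum.cong) auto
    then have "(\<Sum>e\<in>B. (if e = b then ip s a else 0) \<cdot>s e) i x = ip s a * b i x" for i x
      using B(1) ab(2) by (simp only: sum.delta if_True)
    then show ?thesis unfolding G_def restrict_apply'[OF that] by (intro ext) (simp only: scl_apply)
  qed
  have adjG: "adjH G t = ip t b \<cdot>s a" if t: "t \<in> H" for t
  proof (rule H_eqI)
    show "adjH G t \<in> H" by (rule Endo_D(2)[OF adj(1)[OF G] t])
    show "ip t b \<cdot>s a \<in> H" by (rule H_scl[OF B_H[OF ab(1)]])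
    fix e assume e: "e \<in> B"
    have "ip e (adjH G t) = ip (G e) t" by (rule adj(2)[OF G B_H[OF e] t, symmetric])
    also have "\<dots> = ip e a * ip b t" unfolding Gs[OF B_H[OF e]] by (rule ip_scl)
    also have "\<dots> = ip e (ip t b \<cdot>s a)" unfolding ip_scl_right using ip_sym[of b t] by simp
    finally show "ip (adjH G t) e = ip (ip t b \<cdot>s a) e" using ip_sym[of _ e] by simp
  qed
  have tr: "tr \<A> L m (D \<circ> adjH G) = ip (D a) b" if D: "D \<in> EndoH" for D
  proof -
    have "tr \<A> L m (D \<circ> adjH G) = (\<Sum>e\<in>B. ip (ip e b \<cdot>s D a) e)"
      unfolding tr_def o_def by (intro sum.cong refl) (simp add: adjG B_H Endo_D(4)[OF D] ab)
    also have "\<dots> = (\<Sum>e\<in>B. ip (D a) e * ip e b)" by (simp add: ip_scl mult.commute)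
    also have "\<dots> = ip (D a) b" by (rule ip_expand[OF Endo_D(2)[OF D B_H[OF ab(1)]] B_H[OF ab(2)], symmetric])
    finally show ?thesis .
  qed
  show "ip (D a) b = ip (D' a) b" using eq[OF G] tr[OF D(1)] tr[OF D(2)] by simp
qed

end

section \<open>The Kodaira map and the Fubini-Study metric\<close>

lemma ln_quadratic_derivative:
  assumes "P > 0"
  shows "((\<lambda>t. complex_of_real (ln (P + 2 * t * r + t^2 * Q))) has_vector_derivative of_real (2 * r / P)) (at 0)"
proof (rule bounded_linear.has_vector_derivative[OF bounded_linear_of_real])
  have "((\<lambda>t. ln (P + 2 * t * r + t^2 * Q)) has_real_derivative 2 * r / P) (at 0)"
    using assms by (auto intro!: derivative_eq_intros)
  then show "((\<lambda>t. ln (P + 2 * t * r + t^2 * Q)) has_vector_derivative 2 * r / P) (at 0)"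
    by (simp only: has_real_derivative_iff_has_vector_derivative)
qed

text \<open>The argument of the logarithm is |p + w v|^2 along a complex line, with P = |p|^2, b =
  <v, p> and Q = |v|^2.\<close>

lemma dwbar_ln_quadratic:
  assumes "P > 0"
  shows "dwbar (\<lambda>w. of_real (ln (P + 2 * Re (w * b) + (cmod w)^2 * Q))) = cnj b / of_real P"
proof -
  have e: "P + 2 * Re (complex_of_real t * b) + (cmod (complex_of_real t))^2 * Q = P + 2 * t * Re b + t^2 * Q"
    "P + 2 * Re (\<i> * complex_of_real t * b) + (cmod (\<i> * complex_of_real t))^2 * Q = P + 2 * t * (- Im b) + t^2 * Q" for t
    by (simp_all add: norm_mult)
  show ?thesis
    unfolding dwbar_def e vector_derivative_at[OF ln_quadratic_derivative[OF assms]]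
    by (simp add: complex_eq_iff)
qed

text \<open>The function left after the conjugate derivative of log |z|^2 is a quotient of this
  form. Its formula is assumed only where the denominator is positive, an open condition that holds
  at 0 and so suffices for the derivative there.\<close>

lemma dw_quotient:
  assumes P: "P > 0"
    and F: "\<And>w. P + 2 * Re (w * b) + (cmod w)^2 * Q > 0 \<Longrightarrow>
      F w = (a0 + w * a1) / of_real (P + 2 * Re (w * b) + (cmod w)^2 * Q)"
  shows "dw F = a1 / of_real P - a0 * b / (of_real P)^2"
proof -
  have line: "vector_derivative (\<lambda>t. F (\<zeta> * of_real t)) (at 0) =
      \<zeta> * a1 / of_real P - a0 * of_real (2 * r) / (of_real P)^2"
    if q: "\<And>t. P + 2 * Re (\<zeta> * of_real t * b) + (cmod (\<zeta> * of_real t))^2 * Q = P + 2 * t * r + t^2 * Q" for \<zeta> r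
  proof -
    let ?q = "\<lambda>t. P + 2 * t * r + t^2 * Q"
    have "((\<lambda>t. inverse (?q t)) has_real_derivative - (2 * r) / P^2) (at 0)"
      using P by (auto intro!: derivative_eq_intros simp: power2_eq_square field_simps)
    then have 1: "((\<lambda>t. complex_of_real (inverse (?q t))) has_vector_derivative of_real (- (2 * r) / P^2)) (at 0)"
      unfolding has_real_derivative_iff_has_vector_derivative
      by (rule bounded_linear.has_vector_derivative[OF bounded_linear_of_real])
    have 2: "((\<lambda>t. a0 + \<zeta> * of_real t * a1) has_vector_derivative \<zeta> * a1) (at 0)"
      by (auto intro!: derivative_eq_intros)
    have 3: "((\<lambda>t. (a0 + \<zeta> * of_real t * a1) * complex_of_real (inverse (?q t))) has_vector_derivative
       ((a0 + \<zeta> * of_real 0 * a1) * of_real (- (2 * r) / P^2) + \<zeta> * a1 * complex_of_real (inverse (?q 0)))) (at 0)"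
      by (rule has_vector_derivative_mult[OF 2 1])
    have "((\<lambda>t. F (\<zeta> * of_real t)) has_vector_derivative
       ((a0 + \<zeta> * of_real 0 * a1) * of_real (- (2 * r) / P^2) + \<zeta> * a1 * complex_of_real (inverse (?q 0)))) (at 0)"
    proof (rule has_vector_derivative_transform_within_open[OF 3])
      show "open {t. 0 < ?q t}" by (intro open_Collect_less continuous_intros)
      show "0 \<in> {t. 0 < ?q t}" using P by simp
      fix t assume "t \<in> {t. 0 < ?q t}"
      then have "P + 2 * Re (\<zeta> * of_real t * b) + (cmod (\<zeta> * of_real t))^2 * Q > 0" unfolding q by simp
      from F[OF this] show "(a0 + \<zeta> * of_real t * a1) * complex_of_real (inverse (?q t)) = F (\<zeta> * of_real t)"
        unfolding q by (simp add: divide_inverse)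
    qed
    then show ?thesis
      by (rule vector_derivative_at[THEN trans]) (use P in \<open>simp add: field_simps power2_eq_square\<close>)
  qed
  have 1: "vector_derivative (\<lambda>t. F (1 * of_real t)) (at 0) = 1 * a1 / of_real P - a0 * of_real (2 * Re b) / (of_real P)^2"
    by (rule line) (simp add: norm_mult)
  have 2: "vector_derivative (\<lambda>t. F (\<i> * of_real t)) (at 0) = \<i> * a1 / of_real P - a0 * of_real (2 * (- Im b)) / (of_real P)^2"
    by (rule line) (simp add: norm_mult)
  have "b = of_real (Re b) + \<i> * of_real (Im b)" by (simp add: complex_eq_iff)
  then have "a0 * b / (of_real P)^2 = a0 * (of_real (Re b) + \<i> * of_real (Im b)) / (of_real P)^2" by (rule arg_cong)
  then have 3: "a0 * b / (of_real P)^2 = a0 * of_real (Re b) / (of_real P)^2 + \<i> * (a0 * of_real (Im b) / (of_real P)^2)"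
    by (simp add: distrib_left add_divide_distrib mult.left_commute)
  have alg: "((1 * A - 2 * R) - \<i> * (\<i> * A + 2 * I)) / 2 = A - (R + \<i> * I)" for A R I :: complex
    by (simp add: field_simps)
  have X1: "vector_derivative (\<lambda>t. F (of_real t)) (at 0) =
      1 * (a1 / of_real P) - 2 * (a0 * of_real (Re b) / (of_real P)^2)"
    using 1 by simp
  have X2: "vector_derivative (\<lambda>t. F (\<i> * of_real t)) (at 0) =
      \<i> * (a1 / of_real P) + 2 * (a0 * of_real (Im b) / (of_real P)^2)"
    using 2 by simp
  show ?thesis unfolding dw_def X1 X2 3 by (rule alg)
qed

context quantisation
begin

lemma norm_expand:
  assumes "p \<in> H" "v \<in> H"
  shows "Re (ip (p + w \<cdot>s v) (p + w \<cdot>s v)) = Re (ip p p) + 2 * Re (w * ip v p) + (cmod w)^2 * Re (ip v v)"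
proof -
  have "ip (p + w \<cdot>s v) (p + w \<cdot>s v) = ip p p + cnj w * ip p v + w * ip v p + w * (cnj w * ip v v)"
    using assms by (simp add: ip_add ip_add_right ip_scl ip_scl_right H_add H_scl algebra_simps)
  moreover have "cnj w * ip p v = cnj (w * ip v p)" using ip_sym[of p v] by simp
  moreover have "Re (w * (cnj w * ip v v)) = (cmod w)^2 * Re (ip v v)"
    unfolding mult.assoc[symmetric] complex_norm_square[symmetric] by (simp flip: of_real_power)
  ultimately show ?thesis by simp
qed

text \<open>The mixed Hessian of log |z|^2, complex linear in u and conjugate linear in v. It
  vanishes when u or v is a multiple of z, so it is defined on the projective space.\<close>

definition fs_hess :: "('i, 'a) sect \<Rightarrow> ('i, 'a) sect \<Rightarrow> ('i, 'a) sect \<Rightarrow> complex" where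
  "fs_hess z u v = ip u v / ip z z - ip z v * ip u z / (ip z z)^2"

lemma ip_self_real: "ip z z = of_real (Re (ip z z))"
  using ip_sym[of z z] by (simp add: complex_eq_iff)

lemma log_norm_hess:
  assumes H: "z \<in> H" "u \<in> H" "v \<in> H" and z: "z \<noteq> 0"
  shows "dw (\<lambda>w. dwbar (\<lambda>w'. log_norm2 \<A> L m (z + w \<cdot>s u + w' \<cdot>s v))) = fs_hess z u v"
proof -
  let ?P = "Re (ip z z)"
  have P: "?P > 0" by (rule ip_pos[OF H(1) z])
  have "dw (\<lambda>w. dwbar (\<lambda>w'. log_norm2 \<A> L m (z + w \<cdot>s u + w' \<cdot>s v))) =
      ip u v / of_real ?P - ip z v * ip u z / (of_real ?P)^2"
  proof (rule dw_quotient[OF P])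
    fix w assume q: "?P + 2 * Re (w * ip u z) + (cmod w)^2 * Re (ip u u) > 0"
    let ?p = "z + w \<cdot>s u"
    have p: "?p \<in> H" by (intro H_add H_scl H)
    have Pp: "Re (ip ?p ?p) = ?P + 2 * Re (w * ip u z) + (cmod w)^2 * Re (ip u u)"
      by (rule norm_expand[OF H(1,2)])
    have "dwbar (\<lambda>w'. log_norm2 \<A> L m (?p + w' \<cdot>s v)) = cnj (ip v ?p) / of_real (Re (ip ?p ?p))"
      unfolding log_norm2_def norm_expand[OF p H(3)] using q by (intro dwbar_ln_quadratic) (simp only: Pp)
    also have "cnj (ip v ?p) = ip z v + w * ip u v"
      unfolding ip_sym[of ?p v, symmetric] ip_add[OF H(1) H_scl[OF H(2)] H(3)] ip_scl ..
    finally show "dwbar (\<lambda>w'. log_norm2 \<A> L m (?p + w' \<cdot>s v)) =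
        (ip z v + w * ip u v) / of_real (?P + 2 * Re (w * ip u z) + (cmod w)^2 * Re (ip u u))"
      unfolding Pp .
  qed
  then show ?thesis unfolding fs_hess_def using ip_self_real[of z] by simp
qed

text \<open>With i v in the second slot, the antisymmetrised Hessian is -2i times its real part;
  against i/(2 pi) this leaves 1/pi.\<close>

lemma fs_metric_eq:
  assumes H: "z \<in> H" "u \<in> H" "v \<in> H" and z: "z \<noteq> 0"
  shows "fs_metric \<A> L m z u v = Re (fs_hess z u v) / pi"
proof -
  have sym: "fs_hess z v u = cnj (fs_hess z u v)"
    unfolding fs_hess_def using ip_sym[of v u] ip_sym[of v z] ip_sym[of z u] ip_sym[of z z]
    by (simp add: mult.commute)
  have r: "fs_hess z u (\<i> \<cdot>s v) = - \<i> * fs_hess z u v"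
    unfolding fs_hess_def ip_scl_right by (simp add: algebra_simps)
  have l: "fs_hess z (\<i> \<cdot>s v) u = \<i> * fs_hess z v u"
    unfolding fs_hess_def ip_scl by (simp add: algebra_simps)
  have "fs_metric \<A> L m z u v = Re (\<i> / (2 * of_real pi) * (fs_hess z u (\<i> \<cdot>s v) - fs_hess z (\<i> \<cdot>s v) u))"
    unfolding fs_metric_def fs_form_def log_norm_hess[OF H(1,2) H_scl[OF H(3)] z]
      log_norm_hess[OF H(1) H_scl[OF H(3)] H(2) z] ..
  also have "fs_hess z u (\<i> \<cdot>s v) - fs_hess z (\<i> \<cdot>s v) u = - 2 * \<i> * of_real (Re (fs_hess z u v))"
    unfolding r l sym by (simp add: complex_eq_iff)
  finally show ?thesis by simp
qed

section \<open>The Kodaira lift and its derivative\<close>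

definition lift :: "'a \<Rightarrow> ('i, 'a) sect" where
  "lift x = (\<Sum>e\<in>B. cnj (e (triv_at L x) x) \<cdot>s e)"

text \<open>The vector representing evaluation at \<open>x\<close>, written in an orthonormal basis.
  The conjugated coefficients make the lift antiholomorphic in \<open>x\<close>.\<close>

lemma kodaira_lift_eq: "kodaira_lift \<A> L m i x = (\<Sum>e\<in>B. cnj (e i x) \<cdot>s e)"
  unfolding kodaira_lift_def
proof (rule the_equality)
  let ?k = "\<Sum>e\<in>B. cnj (e i x) \<cdot>s e"
  have kH: "?k \<in> H" by (intro H_sum H_scl B_H)
  have k: "ip s ?k = s i x" if s: "s \<in> H" for s
  proof -
    have "ip s ?k = (\<Sum>e\<in>B. e i x * ip s e)" using ip_comb_right[OF B_H s, where a = "\<lambda>e. cnj (e i x)"] by simp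
    also have "\<dots> = (\<Sum>e\<in>B. ip s e \<cdot>s e) i x" by (simp add: sum_sect_apply mult.commute)
    also have "\<dots> = s i x" by (simp only: B(4)[OF s, symmetric])
    finally show ?thesis .
  qed
  then show "?k \<in> H \<and> (\<forall>s\<in>H. ip s ?k = s i x)" using kH by blast
  fix k' assume k': "k' \<in> H \<and> (\<forall>s\<in>H. ip s k' = s i x)"
  show "k' = ?k"
  proof (rule H_eqI[OF _ kH])
    fix e assume e: "e \<in> B"
    have "ip e k' = ip e ?k" using k' k[OF B_H[OF e]] B_H[OF e] by simp
    then show "ip k' e = ip ?k e" using ip_sym[of _ e] by simp
  qed (use k' in blast)
qed

lemma lift_at_eq: "lift_at \<A> L m x = lift x"
  unfolding lift_at_def kodaira_lift_eq lift_def ..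

lemma lift_H: "lift x \<in> H"
  unfolding lift_def by (intro H_sum H_scl B_H)

lemma ip_lift:
  assumes s: "s \<in> H"
  shows "ip s (lift x) = s (triv_at L x) x"
proof -
  have "ip s (lift x) = (\<Sum>e\<in>B. e (triv_at L x) x * ip s e)"
    unfolding lift_def using ip_comb_right[OF B_H s, where a = "\<lambda>e. cnj (e (triv_at L x) x)"] by simp
  also have "\<dots> = (\<Sum>e\<in>B. ip s e \<cdot>s e) (triv_at L x) x" by (simp add: sum_sect_apply mult.commute)
  also have "\<dots> = s (triv_at L x) x" by (simp only: B(4)[OF s, symmetric])
  finally show ?thesis .
qed

text \<open>\<open>x\<close> fixes the frame and the chart while \<open>z\<close> moves, so this is
  a holomorphic function near \<open>pt x\<close> that may be differentiated.\<close>

definition loc :: "'a \<Rightarrow> ('i, 'a) sect \<Rightarrow> complex^'n \<Rightarrow> complex" where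
  "loc x s z = s (triv_at L x) (cinv (chart_at \<A> x) z)"

abbreviation pt :: "'a \<Rightarrow> complex^'n" where "pt x \<equiv> snd (chart_at \<A> x) x"
abbreviation nb :: "'a \<Rightarrow> (complex^'n) set" where "nb x \<equiv> dom (chart_at \<A> x) (triv_at L x)"

lemma nb: "open (nb x)" "pt x \<in> nb x"
  using dom_open[OF chart_at(1)] chart_at(2) triv_at by auto

lemma loc_pt: "loc x s (pt x) = s (triv_at L x) x"
  unfolding loc_def cinv_chart[OF chart_at] ..

lemma loc_hol: "s \<in> H \<Longrightarrow> hol_on (nb x) (loc x s)"
  unfolding loc_def[abs_def] by (rule H_hol[OF _ chart_at(1)])

definition dloc :: "'a \<Rightarrow> ('i, 'a) sect \<Rightarrow> complex^'n \<Rightarrow> complex" where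
  "dloc x s = frechet_derivative (loc x s) (at (pt x))"

lemma loc_derivative: "s \<in> H \<Longrightarrow> (loc x s has_derivative dloc x s) (at (pt x))"
  unfolding dloc_def by (rule hol_on_has_derivative(1)[OF loc_hol nb(2)])

lemma kodaira_deriv_eq: "kodaira_deriv \<A> L m x v = (\<Sum>e\<in>B. cnj (dloc x e v) \<cdot>s e)"
proof (intro ext)
  fix j y
  have "((\<lambda>z. \<Sum>e\<in>B. cnj (loc x e z) * e j y) has_derivative (\<lambda>v. \<Sum>e\<in>B. cnj (dloc x e v) * e j y)) (at (pt x))"
    by (intro has_derivative_sum has_derivative_mult_left bounded_linear.has_derivative[OF bounded_linear_cnj]
        loc_derivative B_H)
  then have "frechet_derivative (\<lambda>z. \<Sum>e\<in>B. cnj (loc x e z) * e j y) (at (pt x)) = (\<lambda>v. \<Sum>e\<in>B. cnj (dloc x e v) * e j y)"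
    by (rule frechet_derivative_at[symmetric])
  moreover have "((\<lambda>x'. kodaira_lift \<A> L m (triv_at L x) x' j y) \<circ> cinv (chart_at \<A> x)) = (\<lambda>z. \<Sum>e\<in>B. cnj (loc x e z) * e j y)"
    by (rule ext) (simp add: kodaira_lift_eq sum_sect_apply loc_def)
  ultimately show "kodaira_deriv \<A> L m x v j y = (\<Sum>e\<in>B. cnj (dloc x e v) \<cdot>s e) j y"
    unfolding kodaira_deriv_def mderiv_def by (simp add: sum_sect_apply)
qed

lemma kodaira_deriv_H: "kodaira_deriv \<A> L m x v \<in> H"
  unfolding kodaira_deriv_eq by (intro H_sum H_scl B_H)

text \<open>Pairing with the lift is evaluation of the section, hence pairing with the derivative of
  the lift is differentiation of its component; the conjugations of the lift and of the second slot
  cancel.\<close>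

lemma ip_kodaira_deriv:
  assumes s: "s \<in> H"
  shows "ip s (kodaira_deriv \<A> L m x v) = dloc x s v"
proof -
  have "ip s (kodaira_deriv \<A> L m x v) = (\<Sum>e\<in>B. dloc x e v * ip s e)"
    unfolding kodaira_deriv_eq using ip_comb_right[OF B_H s, where a = "\<lambda>e. cnj (dloc x e v)"] by simp
  moreover have "(loc x s has_derivative (\<lambda>v. \<Sum>e\<in>B. ip s e * dloc x e v)) (at (pt x))"
  proof -
    have "loc x s = (\<lambda>z. \<Sum>e\<in>B. ip s e * loc x e z)"
    proof
      fix z
      have "s (triv_at L x) (cinv (chart_at \<A> x) z) = (\<Sum>e\<in>B. ip s e \<cdot>s e) (triv_at L x) (cinv (chart_at \<A> x) z)"
        by (simp only: B(4)[OF s, symmetric])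
      then show "loc x s z = (\<Sum>e\<in>B. ip s e * loc x e z)" by (simp add: loc_def sum_sect_apply)
    qed
    moreover have "((\<lambda>z. \<Sum>e\<in>B. ip s e * loc x e z) has_derivative (\<lambda>v. \<Sum>e\<in>B. ip s e * dloc x e v)) (at (pt x))"
      by (intro has_derivative_sum has_derivative_mult_right loc_derivative B_H)
    ultimately show ?thesis by simp
  qed
  then have "dloc x s = (\<lambda>v. \<Sum>e\<in>B. ip s e * dloc x e v)"
    unfolding dloc_def by (rule frechet_derivative_at[symmetric])
  ultimately show ?thesis by (simp add: mult.commute)
qed

lemma ip_lift_deriv: "ip (lift x) (kodaira_deriv \<A> L m x v) = (\<Sum>e\<in>B. cnj (loc x e (pt x)) * dloc x e v)"
  unfolding ip_kodaira_deriv[OF lift_H, symmetric] lift_def loc_pt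
  by (subst ip_comb_left[OF B_H kodaira_deriv_H]) (simp_all add: ip_kodaira_deriv B_H)

lemma ip_deriv_deriv: "ip (kodaira_deriv \<A> L m x u) (kodaira_deriv \<A> L m x v) = (\<Sum>e\<in>B. cnj (dloc x e u) * dloc x e v)"
  by (subst (1) kodaira_deriv_eq, subst ip_comb_left[OF B_H kodaira_deriv_H]) (simp_all add: ip_kodaira_deriv B_H)

lemma ip_lift_lift: "ip (lift x) (lift x) = of_real (\<Sum>e\<in>B. (cmod (loc x e (pt x)))^2)"
proof -
  have "ip (lift x) (lift x) = (\<Sum>e\<in>B. cnj (e (triv_at L x) x) * ip e (lift x))"
    unfolding lift_def[of x] by (rule ip_comb_left[OF B_H lift_H, unfolded lift_def])
  also have "\<dots> = (\<Sum>e\<in>B. cnj (e (triv_at L x) x) * e (triv_at L x) x)"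
    by (intro sum.cong refl) (simp only: ip_lift B_H)
  also have "\<dots> = of_real (\<Sum>e\<in>B. (cmod (loc x e (pt x)))^2)"
    unfolding loc_pt of_real_sum complex_norm_square by (simp add: mult.commute)
  finally show ?thesis .
qed

subsection \<open>The flow of an endomorphism\<close>

lemma Endo_power_H: "F \<in> EndoH \<Longrightarrow> z \<in> H \<Longrightarrow> (F ^^ k) z \<in> H"
  by (induction k) (auto intro: Endo_D(2))

text \<open>The sum \<open>M\<close> of the moduli of all matrix entries bounds the growth of the
  coordinate sum at each application of \<open>F\<close>. Geometric growth makes the exponential
  series converge pointwise.\<close>

lemma Endo_power_bound:
  assumes F: "F \<in> EndoH" and z: "z \<in> H"
  obtains C M where "C \<ge> 0" "M \<ge> 0" "\<And>k. cmod ((F ^^ k) z i x) \<le> C * M ^ k"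
proof -
  define S where "S k = (\<Sum>e\<in>B. cmod (ip ((F ^^ k) z) e))" for k
  define M where "M = (\<Sum>e\<in>B. \<Sum>f\<in>B. cmod (ip (F e) f))"
  define D where "D = (\<Sum>e\<in>B. cmod (e i x))"
  have M0: "M \<ge> 0" and D0: "D \<ge> 0" and S0: "S k \<ge> 0" for k by (simp_all add: M_def D_def S_def sum_nonneg)
  have step: "S (Suc k) \<le> S k * M" for k
  proof -
    let ?w = "(F ^^ k) z"
    have w: "?w \<in> H" by (rule Endo_power_H[OF F z])
    have Fw: "ip (F ?w) f = (\<Sum>e\<in>B. ip ?w e * ip (F e) f)" if "f \<in> B" for f
    proof -
      have "F ?w = F (\<Sum>e\<in>B. ip ?w e \<cdot>s e)" using B(4)[OF w] by (rule arg_cong)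
      also have "\<dots> = (\<Sum>e\<in>B. ip ?w e \<cdot>s F e)" by (rule Endo_sum[OF F B(1) B_H])
      finally have "ip (F ?w) f = ip (\<Sum>e\<in>B. ip ?w e \<cdot>s F e) f" by (rule arg_cong)
      then show ?thesis using ip_comb_left[OF Endo_D(2)[OF F B_H] B_H[OF that]] by simp
    qed
    have "S (Suc k) = (\<Sum>f\<in>B. cmod (ip (F ?w) f))" by (simp add: S_def)
    also have "\<dots> \<le> (\<Sum>f\<in>B. \<Sum>e\<in>B. cmod (ip ?w e) * cmod (ip (F e) f))"
      by (intro sum_mono) (simp only: Fw norm_mult[symmetric] norm_sum)
    also have "\<dots> = (\<Sum>e\<in>B. cmod (ip ?w e) * (\<Sum>f\<in>B. cmod (ip (F e) f)))"
      by (subst sum.swap) (simp add: sum_distrib_left)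
    also have "\<dots> \<le> (\<Sum>e\<in>B. cmod (ip ?w e) * M)"
      unfolding M_def
      by (intro sum_mono mult_left_mono member_le_sum[of _ B "\<lambda>e. \<Sum>f\<in>B. cmod (ip (F e) f)"] B(1)) (simp_all add: sum_nonneg)
    finally show ?thesis by (simp add: S_def sum_distrib_right)
  qed
  have pow: "S k \<le> S 0 * M ^ k" for k
  proof (induction k)
    case (Suc k)
    have "S (Suc k) \<le> S k * M" by (rule step)
    also have "\<dots> \<le> S 0 * M ^ k * M" using Suc M0 by (intro mult_right_mono)
    finally show ?case by (simp add: mult_ac)
  qed simp
  have "cmod ((F ^^ k) z i x) \<le> (S 0 * D) * M ^ k" for k
  proof -
    let ?w = "(F ^^ k) z"
    have "?w i x = (\<Sum>e\<in>B. ip ?w e \<cdot>s e) i x" by (simp only: B(4)[OF Endo_power_H[OF F z], symmetric])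
    then have "?w i x = (\<Sum>e\<in>B. ip ?w e * e i x)" by (simp add: sum_sect_apply)
    then have "cmod (?w i x) \<le> (\<Sum>e\<in>B. cmod (ip ?w e) * cmod (e i x))"
      by (simp only: norm_mult[symmetric] norm_sum)
    also have "\<dots> \<le> (\<Sum>e\<in>B. cmod (ip ?w e) * D)"
      unfolding D_def by (intro sum_mono mult_left_mono member_le_sum B(1)) simp_all
    also have "\<dots> = S k * D" by (simp add: S_def sum_distrib_right)
    also have "\<dots> \<le> S 0 * M ^ k * D" using pow D0 by (intro mult_right_mono)
    finally show ?thesis by (simp add: mult_ac)
  qed
  then show ?thesis using that[of "S 0 * D" M] S0 D0 M0 by simp
qed

text \<open>At a point of the manifold the flow is a power series in t, and its velocity at 0 is the
  linear coefficient, which carries the factor 2 pi.\<close>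

lemma nu_eq:
  assumes F: "F \<in> EndoH" and z: "z \<in> H"
  shows "nu F z = of_real (2 * pi) \<cdot>s F z"
proof (intro ext)
  fix i x
  obtain C M where CM: "C \<ge> 0" "M \<ge> 0" "\<And>k. cmod ((F ^^ k) z i x) \<le> C * M ^ k"
    using Endo_power_bound[OF F z] by blast
  define c where "c k = of_real ((2 * pi) ^ k / fact k) * (F ^^ k) z i x" for k
  \<comment> \<open>Convergence at the single point 1 already allows termwise differentiation at
    0.\<close>
  have sm: "summable (\<lambda>k. c k * 1 ^ k)"
  proof (rule summable_comparison_test')
    have "summable (\<lambda>k. C * ((2 * pi * M) ^ k /\<^sub>R fact k))" by (intro summable_mult summable_exp_generic)
    then show "summable (\<lambda>k. C * ((2 * pi * M) ^ k / fact k))" by (simp add: divide_inverse mult.commute)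
    fix k :: nat
    have "norm (c k * 1 ^ k) = (2 * pi) ^ k / fact k * cmod ((F ^^ k) z i x)"
      by (simp add: c_def norm_mult norm_divide norm_power)
    also have "\<dots> \<le> (2 * pi) ^ k / fact k * (C * M ^ k)" by (intro mult_left_mono CM(3)) simp
    finally show "norm (c k * 1 ^ k) \<le> C * ((2 * pi * M) ^ k / fact k)"
      by (simp add: power_mult_distrib mult_ac)
  qed
  have "((\<lambda>w. \<Sum>k. c k * w ^ k) has_field_derivative (\<Sum>k. diffs c k * 0 ^ k)) (at 0)"
    by (rule termdiffs_strong[OF sm]) simp
  then have "((\<lambda>w. \<Sum>k. c k * w ^ k) has_field_derivative c 1) (at (of_real 0))"
    by (simp add: diffs_def)
  then have "((\<lambda>t. \<Sum>k. c k * of_real t ^ k) has_vector_derivative c 1) (at 0)"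
    by (rule has_vector_derivative_real_field)
  moreover have "exp_flow F t z i x = (\<Sum>k. c k * of_real t ^ k)" for t
    unfolding exp_flow_def c_def by (intro suminf_cong) (simp add: power_mult_distrib mult_ac)
  ultimately have "vector_derivative (\<lambda>t. exp_flow F t z i x) (at 0) = c 1"
    by (simp add: vector_derivative_at)
  then show "nu F z i x = (of_real (2 * pi) \<cdot>s F z) i x" by (simp add: nu_def c_def)
qed

end

section \<open>Balanced metrics\<close>

lemma (in compact_complex_manifold) manifold_measure_scale:
  assumes \<delta>: "consistent \<delta>" and K: "K > 0"
  shows "manifold_measure \<A> (\<lambda>c x. K * \<delta> c x) = density_measure (manifold_measure \<A> \<delta>) (\<lambda>_. ennreal K)"
proof (rule is_mass_unique)
  have "consistent (\<lambda>c x. K * \<delta> c x)"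
    unfolding consistent_def
  proof (intro conjI ballI)
    show "K * \<delta> c x > 0" if "c \<in> \<A>" "x \<in> fst c" for c x using consistentD(1)[OF \<delta> that] K by simp
    show "continuous_on (im c) (\<lambda>z. K * \<delta> c (cinv c z))" if "c \<in> \<A>" for c
      by (rule continuous_on_mult_left[OF consistentD(2)[OF \<delta> that]])
    show "K * \<delta> c x = \<bar>det (jacobian (dtrans c d x))\<bar> * (K * \<delta> d x)"
      if "c \<in> \<A>" "d \<in> \<A>" "x \<in> fst c \<inter> fst d" for c d x
      using consistentD(3)[OF \<delta> that(1,2), of x] that(3) by simp
  qed
  then show "is_mass (\<lambda>c x. K * \<delta> c x) (manifold_measure \<A> (\<lambda>c x. K * \<delta> c x))"
    by (rule is_mass_manifold_measure)
  have M: "is_mass \<delta> (manifold_measure \<A> \<delta>)" by (rule is_mass_manifold_measure[OF \<delta>])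
  show "is_mass (\<lambda>c x. K * \<delta> c x) (density_measure (manifold_measure \<A> \<delta>) (\<lambda>_. ennreal K))"
    unfolding is_mass_def
  proof (intro conjI ballI impI)
    show "sets (density_measure (manifold_measure \<A> \<delta>) (\<lambda>_. ennreal K)) = sets borel"
      by (simp add: \<delta>)
    fix c B assume c: "c \<in> \<A>" and B: "B \<in> sets (borel :: 'a measure)" "B \<subseteq> fst c"
    have im: "snd c ` B \<in> sets borel" by (rule chart_image_borel[OF c B])
    have [measurable]: "dens \<delta> c \<in> borel_measurable borel" by (rule dens_measurable[OF \<delta> c])
    have d: "ennreal (\<delta> c (cinv c z)) * indicator (snd c ` B) z = ennreal (dens \<delta> c z) * indicator (snd c ` B) z"
      "ennreal (K * \<delta> c (cinv c z)) * indicator (snd c ` B) z = ennreal K * (ennreal (dens \<delta> c z) * indicator (snd c ` B) z)" for z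
      using B(2) K by (auto simp: indicator_def dens_def ennreal_mult')
    have "emeasure (density_measure (manifold_measure \<A> \<delta>) (\<lambda>_. ennreal K)) B = ennreal K * chart_mass \<delta> c B"
      using M c B by (simp add: emeasure_density_const is_mass_def \<delta>)
    also have "\<dots> = (\<integral>\<^sup>+z. ennreal K * (ennreal (dens \<delta> c z) * indicator (snd c ` B) z) \<partial>lborel)"
      unfolding chart_mass_def d(1) by (rule nn_integral_cmult[symmetric]) (use im in measurable)
    also have "\<dots> = chart_mass (\<lambda>c x. K * \<delta> c x) c B" unfolding chart_mass_def d(2) ..
    finally show "emeasure (density_measure (manifold_measure \<A> \<delta>) (\<lambda>_. ennreal K)) B = chart_mass (\<lambda>c x. K * \<delta> c x) c B" .
  qed
qed

lemma top_power_scale: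
  "top_power \<A> (\<lambda>x u v. K * \<omega> x u v) c x = K ^ CARD('n) * top_power \<A> \<omega> c (x :: 'a)"
  for \<A> :: "('a, 'n::finite) chart set"
  unfolding top_power_def
  by (simp add: prod.distrib sum_distrib_left sum_divide_distrib mult_ac)

locale balanced_quantisation = quantisation \<A> L m
  for \<A> :: "('a::t2_space, 'n::finite) chart set" and L :: "('i, 'a) herm_bundle" and m :: nat +
  assumes m_pos: "m > 0" and embedding: "kodaira_embedding \<A> L m" and bal: "balanced \<A> L m"
begin

text \<open>The density is constant by balancedness, so it may be evaluated at an arbitrary
  point.\<close>

definition \<rho> :: real where "\<rho> = Defs.density \<A> L m undefined"

lemma sum_n2: "(\<Sum>e\<in>B. n2 e x) = \<rho>"
proof -
  obtain C where C: "\<And>x. Defs.density \<A> L m x = C" using bal unfolding balanced_def by blast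
  have "(\<Sum>e\<in>B. n2 e x) = Defs.density \<A> L m x" by (simp add: density_def n2_def)
  then show ?thesis unfolding \<rho>_def C .
qed

text \<open>If the density vanished at a point, all basis sections and hence all sections would
  vanish there, but the Kodaira map has no base points.\<close>

lemma \<rho>_pos: "\<rho> > 0"
proof (rule ccontr)
  fix x :: 'a
  assume "\<not> \<rho> > 0"
  moreover have "(\<Sum>e\<in>B. n2 e x) \<ge> 0" by (intro sum_nonneg n2_nonneg B_H)
  ultimately have "(\<Sum>e\<in>B. n2 e x) = 0" using sum_n2[of x] by simp
  then have z: "n2 e x = 0" if "e \<in> B" for e
    using that sum_nonneg_eq_0_iff[OF B(1), of "\<lambda>e. n2 e x"] n2_nonneg B_H by simp
  have e0: "e (triv_at L x) x = 0" if "e \<in> B" for e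
    using z[OF that] n2_eq[OF B_H[OF that] triv_at] hmet_pos[OF triv_at, of x] by simp
  obtain s where s: "s \<in> H" "s (triv_at L x) x \<noteq> 0" using embedding unfolding kodaira_embedding_def by blast
  have "s (triv_at L x) x = (\<Sum>e\<in>B. ip s e \<cdot>s e) (triv_at L x) x" by (simp only: B(4)[OF s(1), symmetric])
  also have "\<dots> = 0" by (simp add: sum_sect_apply e0)
  finally show False using s(2) by simp
qed

lemma \<rho>_volume: "\<rho> * (LINT x|vol \<A> L. 1) = real (card B)"
proof -
  have int: "integrable \<mu> (n2 e)" if "e \<in> B" for e
    by (rule continuous_integrable[OF consistent_vden n2_continuous[OF B_H[OF that]]])
  have one: "(LINT x|\<mu>. n2 e x) = 1" if "e \<in> B" for e
  proof -
    have "complex_of_real (LINT x|\<mu>. n2 e x) = of_real 1"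
      unfolding ip_self[OF B_H[OF that], symmetric] B(3)[OF that that] by simp
    then show ?thesis by (rule of_real_eq_iff[THEN iffD1])
  qed
  have "\<rho> * (LINT x|vol \<A> L. 1) = (LINT x|\<mu>. \<rho>)" by (simp add: vol_eq)
  also have "\<dots> = (LINT x|\<mu>. (\<Sum>e\<in>B. n2 e x))" by (simp only: sum_n2)
  also have "\<dots> = (\<Sum>e\<in>B. (LINT x|\<mu>. n2 e x))" by (rule Bochner_Integration.integral_sum[OF int])
  also have "\<dots> = real (card B)" by (simp add: one)
  finally show ?thesis .
qed

section \<open>The induced metric of a balanced form\<close>

definition N :: "'a \<Rightarrow> complex^'n \<Rightarrow> real" where
  "N x z = (\<Sum>e\<in>B. (cmod (loc x e z))^2)"

text \<open>Balancedness in local form: log \<open>N\<close> and -m log h differ by a constant, and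
  h^m is \<open>\<rho>\<close> divided by \<open>N\<close>. The metric comparison uses the first
  consequence and the derivative of the symbol the second.\<close>

lemma N_hmet:
  assumes "z \<in> nb x"
  shows "hmet L (triv_at L x) (cinv (chart_at \<A> x) z) ^ m * N x z = \<rho>"
proof -
  let ?y = "cinv (chart_at \<A> x) z"
  have y: "?y \<in> patch L (triv_at L x)" by (rule dom_cinv(1)[OF chart_at(1) assms])
  have "\<rho> = (\<Sum>e\<in>B. n2 e ?y)" by (simp only: sum_n2)
  also have "\<dots> = (\<Sum>e\<in>B. hmet L (triv_at L x) ?y ^ m * (cmod (loc x e z))^2)"
    by (intro sum.cong refl) (simp only: n2_eq[OF B_H y] loc_def)
  finally show ?thesis by (simp add: N_def sum_distrib_left)
qed

lemma N_pos:
  assumes "z \<in> nb x"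
  shows "N x z > 0"
  using N_hmet[OF assms] \<rho>_pos hmet_pos[OF dom_cinv(1)[OF chart_at(1) assms]]
  by (metis zero_less_mult_pos zero_less_power)

lemma ip_lift_N: "ip (lift x) (lift x) = of_real (N x (pt x))"
  unfolding N_def by (rule ip_lift_lift)

lemma lift_nonzero: "lift x \<noteq> 0"
proof
  assume 0: "lift x = 0"
  have "0 = (0 \<cdot>s 0 :: ('i, 'a) sect)" by (simp add: fun_eq_iff)
  then have "ip (lift x) (lift x) = 0" unfolding 0 using ip_scl[of 0 0 0] by simp
  then show False using ip_lift_N[of x] N_pos[OF nb(2)[of x]] by simp
qed

text \<open>Both sides are 1/pi times the real part of the mixed Hessian of log \<open>N\<close>: on
  the right because \<open>N\<close> is a potential for m times the curvature, on the left by
  pulling back \<open>fs_hess\<close>. The lift is antiholomorphic, so the pull-back is the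
  conjugate expression, with the same real part.\<close>

lemma induced_metric_eq: "induced_metric \<A> L m x u v = real m * g x u v"
proof -
  let ?i = "triv_at L x" and ?c = "chart_at \<A> x"
  have hol: "hol_on (nb x) (loc x e)" if "e \<in> B" for e by (rule loc_hol[OF B_H[OF that]])
  have smN: "smooth_on (nb x) (\<lambda>z. ln (N x z))"
    unfolding N_def[abs_def] by (rule smooth_on_ln[OF smooth_on_sum_norm2[OF nb(1) hol] nb(1)]) (use N_pos N_def in auto)
  have lh: "lh ?i ?c z = (- 1 / real m) * ln (N x z) + ln \<rho> / real m" if z: "z \<in> nb x" for z
  proof -
    have h: "hmet L ?i (cinv ?c z) > 0" by (rule hmet_pos[OF dom_cinv(1)[OF chart_at(1) z]])
    have "ln \<rho> = real m * lh ?i ?c z + ln (N x z)"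
      unfolding lh_def N_hmet[OF z, symmetric] using h N_pos[OF z] by (simp add: ln_mult ln_realpow)
    then show ?thesis using m_pos by (simp add: field_simps)
  qed
  define A where "A w = (\<Sum>e\<in>B. cnj (loc x e (pt x)) * dloc x e w)" for w
  define E where "E = (\<Sum>e\<in>B. dloc x e u * cnj (dloc x e v))"
  define n where "n = N x (pt x)"
  have "levi (lh ?i ?c) (pt x) u v = levi (\<lambda>z. (- 1 / real m) * ln (N x z) + ln \<rho> / real m) (pt x) u v"
    by (rule levi_cong[OF nb lh])
  also have "\<dots> = levi (\<lambda>z. (- 1 / real m) * ln (N x z)) (pt x) u v + levi (\<lambda>z. ln \<rho> / real m) (pt x) u v"
    by (rule levi_add[OF smooth_on_mult[OF smooth_on_const smN] smooth_on_const nb(2,1)]) (rule nb(1))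
  also have "levi (\<lambda>z::complex^'n. ln \<rho> / real m) (pt x) u v = 0"
    by (simp add: levi_def D2_def)
  also have "levi (\<lambda>z. (- 1 / real m) * ln (N x z)) (pt x) u v = (- 1 / real m) * levi (\<lambda>z. ln (N x z)) (pt x) u v"
    by (rule levi_cmult[OF smN nb(2,1)])
  also have "levi (\<lambda>z. ln (N x z)) (pt x) u v = 4 * Re (E / n - A u * cnj (A v) / n^2)"
    unfolding N_def[abs_def] A_def E_def n_def dloc_def
    by (rule levi_ln_sum_norm2[OF nb hol]) (use N_pos N_def in auto)
  finally have lv: "real m * g x u v = Re (E / n - A u * cnj (A v) / n^2) / pi"
    unfolding metric_levi_at using m_pos by (simp add: field_simps)
  have "induced_metric \<A> L m x u v = Re (fs_hess (lift x) (kodaira_deriv \<A> L m x u) (kodaira_deriv \<A> L m x v)) / pi"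
    unfolding induced_metric_def lift_at_eq
    by (rule fs_metric_eq[OF lift_H kodaira_deriv_H kodaira_deriv_H lift_nonzero])
  also have "fs_hess (lift x) (kodaira_deriv \<A> L m x u) (kodaira_deriv \<A> L m x v) = cnj (E / n - A u * cnj (A v) / n^2)"
  proof -
    have 1: "ip (kodaira_deriv \<A> L m x u) (kodaira_deriv \<A> L m x v) = cnj E"
      by (simp add: ip_deriv_deriv E_def)
    have 2: "ip (lift x) (kodaira_deriv \<A> L m x v) = A v" by (simp add: ip_lift_deriv A_def)
    have 3: "ip (kodaira_deriv \<A> L m x u) (lift x) = cnj (A u)"
      using ip_sym[of "kodaira_deriv \<A> L m x u" "lift x"] by (simp add: ip_lift_deriv A_def)
    show ?thesis unfolding fs_hess_def 1 2 3 ip_lift_N n_def by (simp add: mult.commute)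
  qed
  finally show ?thesis unfolding lv by simp
qed

subsection \<open>The vector field of an endomorphism is a gradient\<close>

lemma loc_pairing_derivative:
  assumes "\<And>e. e \<in> B \<Longrightarrow> f e \<in> H"
  shows "((\<lambda>z. \<Sum>e\<in>B. loc x (f e) z * cnj (loc x e z)) has_derivative
    (\<lambda>\<xi>. \<Sum>e\<in>B. loc x (f e) (pt x) * cnj (dloc x e \<xi>) + dloc x (f e) \<xi> * cnj (loc x e (pt x)))) (at (pt x))"
  by (intro has_derivative_sum has_derivative_mult bounded_linear.has_derivative[OF bounded_linear_cnj]
      loc_derivative assms B_H)

text \<open>Collapses the basis sums occurring in a symbol and its derivative to a single product;
  the argument \<open>b\<close> is expanded because it enters through conjugates.\<close>

lemma Endo_pairing:
  assumes F: "F \<in> EndoH" and H: "a \<in> H" "b \<in> H"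
  shows "(\<Sum>e\<in>B. ip (F e) a * cnj (ip e b)) = ip (F b) a"
proof -
  have "F b = F (\<Sum>e\<in>B. ip b e \<cdot>s e)" using B(4)[OF H(2)] by (rule arg_cong)
  also have "\<dots> = (\<Sum>e\<in>B. ip b e \<cdot>s F e)" by (rule Endo_sum[OF F B(1) B_H])
  finally have "ip (F b) a = ip (\<Sum>e\<in>B. ip b e \<cdot>s F e) a" by (rule arg_cong)
  also have "\<dots> = (\<Sum>e\<in>B. ip b e * ip (F e) a)" by (rule ip_comb_left[OF Endo_D(2)[OF F B_H] H(1)])
  also have "\<dots> = (\<Sum>e\<in>B. ip (F e) a * cnj (ip e b))"
    by (intro sum.cong refl) (simp only: ip_sym[of b] mult.commute)
  finally show ?thesis by (rule sym)
qed

lemma lift_pairing: "loc x s (pt x) = ip s (lift x)" if "s \<in> H"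
  unfolding loc_pt ip_lift[OF that] ..

text \<open>Near \<open>x\<close> the symbol is \<open>\<rho>\<close> times the Rayleigh quotient <F
  z, z> / <z, z> along the lift. Self-adjointness makes the derivative of the numerator twice a real
  part, and this 2 is the quotient of the 2 pi in \<open>nu\<close> by the pi in
  \<open>fs_metric\<close>.\<close>

lemma mderiv_symbol:
  assumes F: "selfadjoint F"
  shows "mderiv \<A> (symbol F) x \<xi> = of_real (\<rho> * fs_metric \<A> L m (lift x) (nu F (lift x)) (kodaira_deriv \<A> L m x \<xi>))"
proof -
  have FE: "F \<in> EndoH" and sa: "\<And>s t. s \<in> H \<Longrightarrow> t \<in> H \<Longrightarrow> ip (F s) t = ip s (F t)"
    using F unfolding selfadjoint_def by blast+
  let ?kd = "kodaira_deriv \<A> L m x" and ?l = "lift x"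
  define n where "n = N x (pt x)"
  define Q where "Q z = (\<Sum>e\<in>B. loc x (F e) z * cnj (loc x e z))" for z
  define M where "M z = (\<Sum>e\<in>B. loc x e z * cnj (loc x e z))" for z
  have MN: "M z = of_real (N x z)" for z unfolding M_def N_def of_real_sum complex_norm_square ..
  have n0: "n > 0" unfolding n_def by (rule N_pos[OF nb(2)])
  have Fe: "F e \<in> H" if "e \<in> B" for e by (rule Endo_D(2)[OF FE B_H[OF that]])
  have Q0: "Q (pt x) = ip (F ?l) ?l"
    unfolding Q_def Endo_pairing[OF FE lift_H lift_H, symmetric]
    by (intro sum.cong refl) (simp only: lift_pairing Fe B_H)
  have Q0r: "Q (pt x) = of_real (Re (Q (pt x)))"
    using ip_sym[of "F ?l" ?l] sa[OF lift_H lift_H, of x x] unfolding Q0 by (simp add: complex_eq_iff)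
  have dQ: "(Q has_derivative (\<lambda>\<xi>. ip (F (?kd \<xi>)) ?l + ip (F ?l) (?kd \<xi>))) (at (pt x))"
  proof -
    have "(\<Sum>e\<in>B. loc x (F e) (pt x) * cnj (dloc x e \<xi>) + dloc x (F e) \<xi> * cnj (loc x e (pt x)))
        = ip (F (?kd \<xi>)) ?l + ip (F ?l) (?kd \<xi>)" for \<xi>
      unfolding Endo_pairing[OF FE lift_H kodaira_deriv_H, symmetric] Endo_pairing[OF FE kodaira_deriv_H lift_H, symmetric]
        sum.distrib[symmetric]
      by (intro sum.cong refl) (simp only: lift_pairing ip_kodaira_deriv Fe B_H)
    then show ?thesis using loc_pairing_derivative[of F x, OF Fe] unfolding Q_def[abs_def] by simp
  qed
  have dM: "(M has_derivative (\<lambda>\<xi>. ip (?kd \<xi>) ?l + ip ?l (?kd \<xi>))) (at (pt x))"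
  proof -
    have "(\<Sum>e\<in>B. loc x e (pt x) * cnj (dloc x e \<xi>) + dloc x e \<xi> * cnj (loc x e (pt x)))
        = ip (?kd \<xi>) ?l + ip ?l (?kd \<xi>)" for \<xi>
      unfolding ip_expand[OF lift_H kodaira_deriv_H] ip_expand[OF kodaira_deriv_H lift_H] sum.distrib[symmetric]
      by (intro sum.cong refl) (simp only: lift_pairing ip_kodaira_deriv B_H ip_sym[of "?kd \<xi>"] ip_sym[of ?l] mult.commute)
    then show ?thesis using loc_pairing_derivative[of "\<lambda>e. e" x, OF B_H] unfolding M_def[abs_def] by simp
  qed
  define P where "P = ip (F ?l) (?kd \<xi>)"
  define A where "A = ip ?l (?kd \<xi>)"
  have PP: "ip (F (?kd \<xi>)) ?l + ip (F ?l) (?kd \<xi>) = of_real (2 * Re P)"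
    unfolding sa[OF kodaira_deriv_H lift_H] ip_sym[of "?kd \<xi>" "F ?l"] P_def[symmetric] by (simp add: complex_eq_iff)
  have AA: "ip (?kd \<xi>) ?l + ip ?l (?kd \<xi>) = of_real (2 * Re A)"
    unfolding ip_sym[of "?kd \<xi>" ?l] A_def[symmetric] by (simp add: complex_eq_iff)
  have M0: "M (pt x) \<noteq> 0" unfolding MN using N_pos[OF nb(2)[of x]] by simp
  have "((\<lambda>z. of_real \<rho> * (Q z / M z)) has_derivative
      (\<lambda>\<xi>. of_real \<rho> * (((ip (F (?kd \<xi>)) ?l + ip (F ?l) (?kd \<xi>)) * M (pt x) - Q (pt x) * (ip (?kd \<xi>) ?l + ip ?l (?kd \<xi>)))
        / (M (pt x) * M (pt x))))) (at (pt x))"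
    by (intro has_derivative_mult_right has_derivative_divide'[OF dQ dM M0])
  then have "((symbol F \<circ> cinv (chart_at \<A> x)) has_derivative
      (\<lambda>\<xi>. of_real \<rho> * (((ip (F (?kd \<xi>)) ?l + ip (F ?l) (?kd \<xi>)) * M (pt x) - Q (pt x) * (ip (?kd \<xi>) ?l + ip ?l (?kd \<xi>)))
        / (M (pt x) * M (pt x))))) (at (pt x))"
  proof (rule has_derivative_transform_within_open[OF _ nb])
    fix z assume z: "z \<in> nb x"
    let ?y = "cinv (chart_at \<A> x) z"
    have y: "?y \<in> patch L (triv_at L x)" by (rule dom_cinv(1)[OF chart_at(1) z])
    have "symbol F ?y = (\<Sum>e\<in>B. of_real (hmet L (triv_at L x) ?y ^ m) * (loc x (F e) z * cnj (loc x e z)))"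
      unfolding symbol_def by (intro sum.cong refl) (simp only: hh_eq[OF Fe B_H y] loc_def mult.assoc)
    also have "\<dots> = of_real (hmet L (triv_at L x) ?y ^ m) * Q z" by (simp only: Q_def sum_distrib_left)
    \<comment> \<open>Here balancedness replaces the metric of the bundle by the norm of the lift;
      otherwise the derivative of the density would contribute.\<close>
    also have "hmet L (triv_at L x) ?y ^ m = \<rho> / N x z"
      using N_hmet[OF z] N_pos[OF z] by (simp add: field_simps)
    finally show "of_real \<rho> * (Q z / M z) = (symbol F \<circ> cinv (chart_at \<A> x)) z"
      unfolding MN by simp
  qed
  then have "mderiv \<A> (symbol F) x \<xi> = of_real \<rho> * (((ip (F (?kd \<xi>)) ?l + ip (F ?l) (?kd \<xi>)) * M (pt x) - Q (pt x) * (ip (?kd \<xi>) ?l + ip ?l (?kd \<xi>)))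
        / (M (pt x) * M (pt x)))"
    unfolding mderiv_def by (rule frechet_derivative_at[symmetric, THEN fun_cong])
  also have "\<dots> = of_real \<rho> * ((of_real (2 * Re P) * of_real n - of_real (Re (Q (pt x))) * of_real (2 * Re A)) / (of_real n * of_real n))"
    unfolding PP AA MN n_def Q0r[symmetric] ..
  also have "\<dots> = of_real (\<rho> * (2 * Re P / n - 2 * Re (Q (pt x)) * Re A / n^2))"
    using n0 by (simp add: field_simps power2_eq_square)
  also have "2 * Re P / n - 2 * Re (Q (pt x)) * Re A / n^2 = fs_metric \<A> L m ?l (nu F ?l) (?kd \<xi>)"
  proof -
    let ?t = "complex_of_real (2 * pi)"
    have "fs_metric \<A> L m ?l (nu F ?l) (?kd \<xi>) = Re (fs_hess ?l (?t \<cdot>s F ?l) (?kd \<xi>)) / pi"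
      unfolding nu_eq[OF FE lift_H]
      by (rule fs_metric_eq[OF lift_H H_scl[OF Endo_D(2)[OF FE lift_H]] kodaira_deriv_H lift_nonzero])
    also have "fs_hess ?l (?t \<cdot>s F ?l) (?kd \<xi>) = ?t * (P / of_real n - A * of_real (Re (Q (pt x))) / (of_real n)^2)"
      unfolding fs_hess_def ip_scl ip_lift_N n_def[symmetric] P_def[symmetric] A_def[symmetric] Q0[symmetric] Q0r[symmetric]
      by (simp add: algebra_simps)
    also have "Re \<dots> / pi = 2 * (Re P / n - Re A * Re (Q (pt x)) / n^2)"
      by (simp flip: of_real_power)
    finally show ?thesis by (simp add: right_diff_distrib mult_ac)
  qed
  finally show ?thesis .
qed

text \<open>Projecting to the tangent space of M does not change products with tangent vectors, so
  \<open>tangent_proj\<close> represents the functional of \<open>mderiv_symbol\<close> for the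
  induced metric. That metric is m g, whence the factor m beside \<open>\<rho>\<close>.\<close>

lemma tangent_proj_gradient:
  assumes F: "selfadjoint F"
  shows "mderiv \<A> (symbol F) x \<xi> =
    of_real (g x ((\<rho> * real m) *\<^sub>R tangent_proj \<A> L m x (nu F (lift_at \<A> L m x))) \<xi>)"
proof -
  note G = hermitian_metricD[OF hermitian_metric_g[of x]]
  have FE: "F \<in> EndoH" using F unfolding selfadjoint_def by blast
  let ?\<alpha> = "\<lambda>\<xi>. fs_metric \<A> L m (lift x) (nu F (lift x)) (kodaira_deriv \<A> L m x \<xi>)"
  let ?\<eta> = "tangent_proj \<A> L m x (nu F (lift x))"
  have lin: "linear ?\<alpha>"
  proof -
    have "?\<alpha> = (\<lambda>\<xi>. Re (mderiv \<A> (symbol F) x \<xi>) / \<rho>)" using \<rho>_pos by (simp add: mderiv_symbol[OF F])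
    moreover have "linear (\<lambda>\<xi>. Re (mderiv \<A> (symbol F) x \<xi>) / \<rho>)"
      using mderiv_linear[OF symbol_smooth[OF FE], of x] unfolding linear_iff by (simp add: add_divide_distrib)
    ultimately show ?thesis by simp
  qed
  have ex: "\<exists>!\<eta>. \<forall>\<xi>. ?\<alpha> \<xi> = real m * g x \<eta> \<xi>"
  proof (rule real_riesz[OF _ _ _ lin])
    show "linear (\<lambda>v. real m * g x u v)" for u using G(1)[of u] unfolding linear_iff by (simp add: algebra_simps)
    show "linear (\<lambda>v. real m * g x v u)" for u using G(2)[of u] unfolding linear_iff by (simp add: algebra_simps)
    show "real m * g x v v > 0" if "v \<noteq> 0" for v using G(5)[OF that] m_pos by simp
  qed
  have th: "?\<eta> = (THE \<eta>. \<forall>\<xi>. ?\<alpha> \<xi> = real m * g x \<eta> \<xi>)"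
    unfolding tangent_proj_def lift_at_eq induced_metric_eq[unfolded induced_metric_def lift_at_eq]
    by (intro arg_cong[where f = The] ext) (simp only: eq_commute)
  have "\<forall>\<xi>. ?\<alpha> \<xi> = real m * g x ?\<eta> \<xi>" unfolding th by (rule theI'[OF ex])
  then have "mderiv \<A> (symbol F) x \<xi> = of_real (\<rho> * (real m * g x ?\<eta> \<xi>))" by (simp only: mderiv_symbol[OF F])
  also have "\<rho> * (real m * g x ?\<eta> \<xi>) = g x ((\<rho> * real m) *\<^sub>R ?\<eta>) \<xi>"
    using linear_cmul[OF G(2)[of \<xi>], of "\<rho> * real m" ?\<eta>] by simp
  finally show ?thesis unfolding lift_at_eq .
qed

text \<open>The symbol is complex linear in \<open>F\<close>, so the gradients of the two
  self-adjoint parts, kept separately by \<open>e_op\<close>, combine to the complex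
  differential.\<close>

lemma symbol_gradient:
  assumes F: "F \<in> EndoH"
  shows "mderiv \<A> (symbol F) x \<xi> = Complex
    (g x ((\<rho> * real m) *\<^sub>R fst (e_op \<A> L m F x)) \<xi>) (g x ((\<rho> * real m) *\<^sub>R snd (e_op \<A> L m F x)) \<xi>)"
proof -
  let ?R = "re_part \<A> L m F" and ?I = "im_part \<A> L m F" and ?c = "chart_at \<A> x"
  note sa = re_im_part(1,2)[OF F]
  have "hh (F e) e y = hh (?R e) e y + \<i> * hh (?I e) e y" if "e \<in> B" for e y
  proof -
    have "hh (F e) e y = hh (?R e + \<i> \<cdot>s ?I e) e y" by (simp only: re_im_part(3)[OF F B_H[OF that], symmetric])
    then show ?thesis by (simp only: hh_simps(1,2))
  qed
  then have sym: "symbol F = (\<lambda>y. symbol ?R y + \<i> * symbol ?I y)"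
    by (intro ext) (simp add: symbol_def sum.distrib sum_distrib_left)
  have d: "((\<lambda>z. symbol G (cinv ?c z)) has_derivative mderiv \<A> (symbol G) x) (at (pt x))" if "selfadjoint G" for G
  proof -
    have "G \<in> EndoH" using that unfolding selfadjoint_def by blast
    from smooth_fun_chart[OF symbol_smooth[OF this] chart_at(1)]
    have "((\<lambda>z. symbol G (cinv ?c z)) has_derivative frechet_derivative (\<lambda>z. symbol G (cinv ?c z)) (at (pt x))) (at (pt x))"
      by (rule smooth_on_has_derivative) (use chart_at in blast)
    then show ?thesis unfolding mderiv_def[abs_def] comp_def .
  qed
  have "((\<lambda>z. symbol ?R (cinv ?c z) + \<i> * symbol ?I (cinv ?c z)) has_derivative
      (\<lambda>\<xi>. mderiv \<A> (symbol ?R) x \<xi> + \<i> * mderiv \<A> (symbol ?I) x \<xi>)) (at (pt x))"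
    by (intro has_derivative_add has_derivative_mult_right d sa)
  then have "mderiv \<A> (symbol F) x \<xi> = mderiv \<A> (symbol ?R) x \<xi> + \<i> * mderiv \<A> (symbol ?I) x \<xi>"
    unfolding mderiv_def sym comp_def by (rule frechet_derivative_at[symmetric, THEN fun_cong])
  then show ?thesis unfolding tangent_proj_gradient[OF sa(1)] tangent_proj_gradient[OF sa(2)]
    by (simp add: e_op_def complex_eq_iff)
qed

text \<open>The g-gradient of the symbol is \<open>\<rho> * m\<close> times \<open>e_op\<close>, so
  the energy is (rho m)^2 times the g-product of the fields, while \<open>herm_metric\<close> is m
  times that product. The quotient is 1/(rho^2 m).\<close>

lemma herm_metric_energy:
  assumes F: "F \<in> EndoH" and G: "G \<in> EndoH"
  shows "herm_metric \<A> L m x (e_op \<A> L m F x) (e_op \<A> L m G x) =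
    of_real (1 / (\<rho>^2 * real m)) * energy (symbol F) (symbol G) x"
proof -
  note gl = hermitian_metricD[OF hermitian_metric_g[of x]]
  let ?k = "\<rho> * real m"
  have s: "g x (?k *\<^sub>R a) (?k *\<^sub>R b) = ?k^2 * g x a b" for a b
    using linear_cmul[OF gl(2)[of "?k *\<^sub>R b"], of ?k a] linear_cmul[OF gl(1)[of a], of ?k b]
    by (simp add: power2_eq_square)
  have "energy (symbol F) (symbol G) x = of_real (\<rho>^2 * real m) * herm_metric \<A> L m x (e_op \<A> L m F x) (e_op \<A> L m G x)"
    unfolding energy_def cotangent_inner_riesz[of _ x, OF symbol_gradient[OF F] symbol_gradient[OF G]] s
      herm_metric_def induced_metric_eq
    by (simp add: complex_eq_iff power2_eq_square algebra_simps)
  moreover have "\<rho>^2 * real m \<noteq> 0" using \<rho>_pos m_pos by simp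
  ultimately show ?thesis by (simp add: field_simps)
qed

section \<open>The volume of the induced metric and the final constant\<close>

lemma induced_form_measure:
  "form_measure \<A> (kaehler_form_of (induced_metric \<A> L m)) = density_measure \<mu> (\<lambda>_. ennreal (real m ^ CARD('n)))"
proof -
  have "kaehler_form_of (induced_metric \<A> L m) = (\<lambda>x u v. real m * kaehler_form_of g x u v)"
    by (simp add: kaehler_form_of_def induced_metric_eq fun_eq_iff)
  then have "form_measure \<A> (kaehler_form_of (induced_metric \<A> L m)) =
      manifold_measure \<A> (\<lambda>c x. real m ^ CARD('n) * top_power \<A> (kaehler_form_of g) c x)"
    unfolding form_measure_def by (simp only: top_power_scale[abs_def])
  also have "\<dots> = manifold_measure \<A> (\<lambda>c x. real m ^ CARD('n) * vden c x)"
    by (rule manifold_measure_cong) (simp only: top_power_kaehler_form)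
  also have "\<dots> = density_measure \<mu> (\<lambda>_. ennreal (real m ^ CARD('n)))"
    by (rule manifold_measure_scale[OF consistent_vden]) (use m_pos in simp)
  finally show ?thesis .
qed

lemma field_inner_eq:
  assumes F: "F \<in> EndoH" and G: "G \<in> EndoH"
  shows "field_inner \<A> L m (e_op \<A> L m F) (e_op \<A> L m G) =
    of_real (real m ^ (CARD('n) - 1) / \<rho>^2) * (LINT x|\<mu>. energy (symbol F) (symbol G) x)"
proof -
  let ?E = "energy (symbol F) (symbol G)" and ?k = "1 / (\<rho>^2 * real m)" and ?K = "real m ^ CARD('n)"
  have E: "continuous_on UNIV ?E"
    by (rule smooth_fun_continuous[OF energy_smooth[OF symbol_smooth[OF F] symbol_smooth[OF G]]])
  have [measurable]: "?E \<in> borel_measurable borel" by (rule borel_measurable_continuous_onI[OF E])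
  have "field_inner \<A> L m (e_op \<A> L m F) (e_op \<A> L m G) =
      (LINT x|density_measure \<mu> (\<lambda>_. ennreal ?K). of_real ?k * ?E x)"
    unfolding field_inner_def induced_form_measure herm_metric_energy[OF F G] ..
  also have "\<dots> = (LINT x|\<mu>. ?K *\<^sub>R (of_real ?k * ?E x))"
    by (rule integral_density) (auto simp: measurable_cong_sets[OF sets_manifold_measure[OF consistent_vden] refl])
  also have "\<dots> = (LINT x|\<mu>. (of_real (?K * ?k)) * ?E x)" by (simp add: scaleR_conv_of_real mult.assoc)
  also have "\<dots> = of_real (?K * ?k) * (LINT x|\<mu>. ?E x)" by (rule integral_mult_right_zero)
  also have "?K * ?k = real m ^ (CARD('n) - 1) / \<rho>^2"
  proof -
    \<comment> \<open>Index types are nonempty, so the dimension is at least 1 and the subtraction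
      on natural numbers is not truncated.\<close>
    have "CARD('n) = Suc (CARD('n) - 1)" by simp
    then have "?K = real m * real m ^ (CARD('n) - 1)" by (metis power_Suc)
    then show ?thesis using m_pos \<rho>_pos by simp
  qed
  finally show ?thesis .
qed

lemma quantised_laplacian_eq:
  assumes F: "F \<in> EndoH"
  shows "quantised_laplacian \<A> L m F =
    escale \<A> L m (of_real (real m ^ (CARD('n) - 1) / \<rho>^2)) (toeplitz \<A> L m (laplacian \<A> g (symbol F)))"
proof -
  let ?C = "complex_of_real (real m ^ (CARD('n) - 1) / \<rho>^2)"
  let ?T = "toeplitz \<A> L m (laplacian \<A> g (symbol F))"
  have cont: "continuous_on UNIV (laplacian \<A> g (symbol F))"
    by (rule smooth_fun_continuous[OF laplacian(1)[OF symbol_smooth[OF F]]])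
  have T: "?T \<in> EndoH" by (rule toeplitz(1)[OF cont])
  have D: "escale \<A> L m ?C ?T \<in> EndoH"
    using comb_Endo[OF T T, of ?C 0] unfolding escale_def by (simp add: scl_def)
  have trD: "tr \<A> L m (escale \<A> L m ?C ?T \<circ> adjH G) = field_inner \<A> L m (e_op \<A> L m F) (e_op \<A> L m G)"
    if G: "G \<in> EndoH" for G
  proof -
    have "tr \<A> L m (escale \<A> L m ?C ?T \<circ> adjH G) = ?C * tr \<A> L m (?T \<circ> adjH G)"
      unfolding tr_def sum_distrib_left
    proof (rule sum.cong[OF refl])
      fix e assume e: "e \<in> B"
      have "adjH G e \<in> H" by (rule Endo_D(2)[OF adj(1)[OF G] B_H[OF e]])
      then show "ip ((escale \<A> L m ?C ?T \<circ> adjH G) e) e = ?C * ip ((?T \<circ> adjH G) e) e"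
        by (simp only: comp_def escale_def restrict_apply if_True ip_scl)
    qed
    also have "tr \<A> L m (?T \<circ> adjH G) = (LINT x|\<mu>. laplacian \<A> g (symbol F) x * cnj (symbol G x))"
      by (rule tr_toeplitz[OF cont G])
    also have "\<dots> = (LINT x|\<mu>. energy (symbol F) (symbol G) x)"
      by (rule laplacian(2)[OF symbol_smooth[OF F] symbol_smooth[OF G]])
    finally show ?thesis unfolding field_inner_eq[OF F G] .
  qed
  show ?thesis unfolding quantised_laplacian_def
  proof (rule the_equality)
    show "escale \<A> L m ?C ?T \<in> EndoH \<and> (\<forall>G\<in>EndoH. tr \<A> L m (escale \<A> L m ?C ?T \<circ> adjH G) =
        field_inner \<A> L m (e_op \<A> L m F) (e_op \<A> L m G))" using D trD by blast
    fix D' assume D': "D' \<in> EndoH \<and> (\<forall>G\<in>EndoH. tr \<A> L m (D' \<circ> adjH G) = field_inner \<A> L m (e_op \<A> L m F) (e_op \<A> L m G))"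
    show "D' = escale \<A> L m ?C ?T"
      by (rule tr_determines[OF _ D]) (use D' trD in simp_all)
  qed
qed

lemma constant_eq:
  "real m ^ (CARD('n) - 1) * (LINT x|vol \<A> L. 1)^2 / (real (vector_space.dim scl H))^2 = real m ^ (CARD('n) - 1) / \<rho>^2"
proof -
  let ?V = "LINT x|vol \<A> L. (1::real)"
  \<comment> \<open>The volume enters the constant as a factor to be cancelled; it is nonzero
    because its product with \<open>\<rho>\<close> is the size of the basis, and an empty basis
    would make \<open>\<rho>\<close> zero.\<close>
  have "card B \<noteq> 0"
  proof
    assume "card B = 0"
    then have "\<rho> = 0" using sum_n2[of undefined] B(1) by simp
    then show False using \<rho>_pos by simp
  qed
  then have V: "?V \<noteq> 0" using \<rho>_volume by auto
  have "real (vector_space.dim scl H) = \<rho> * ?V" by (simp only: dim_H \<rho>_volume)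
  then show ?thesis using V \<rho>_pos by (simp add: power_mult_distrib)
qed

end

theorem theorem1p2:
  fixes \<A> :: "('a::t2_space, 'n::finite) chart set"
    and L :: "('i, 'a) herm_bundle"
    and m :: nat
  assumes "complex_manifold \<A>"
    and "compact (UNIV :: 'a set)"
    and "connected (UNIV :: 'a set)"
    and "hermitian_line_bundle \<A> L"
    and "positive_form (curvature_form \<A> L)"
    and "m > 0"
    and "kodaira_embedding \<A> L m"
    and "balanced \<A> L m"
  shows "\<forall>A\<in>Endo \<A> L m.
    quantised_laplacian \<A> L m A =
      escale \<A> L m
        (of_real (real m ^ (CARD('n) - 1) * (LINT x|vol \<A> L. 1)\<^sup>2
           / (real (vector_space.dim scl (hol_sections \<A> L m)))\<^sup>2))
        (toeplitz \<A> L m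
           (laplacian \<A> (metric_of (curvature_form \<A> L)) (toeplitz_adj \<A> L m A)))"
proof
  interpret balanced_quantisation \<A> L m
    by (unfold_locales) (rule assms)+
  fix A assume A: "A \<in> Endo \<A> L m"
  show "quantised_laplacian \<A> L m A =
      escale \<A> L m
        (of_real (real m ^ (CARD('n) - 1) * (LINT x|vol \<A> L. 1)\<^sup>2
           / (real (vector_space.dim scl (hol_sections \<A> L m)))\<^sup>2))
        (toeplitz \<A> L m
           (laplacian \<A> (metric_of (curvature_form \<A> L)) (toeplitz_adj \<A> L m A)))"
    unfolding quantised_laplacian_eq[OF A] constant_eq toeplitz_adj_eq[OF A] ..
qed

end
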